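(* Let $m\geq 1$ and let $A$ be an $\mathcal R_m$-algebra. Let $t,q \geq 1$ be integers such that $q$ divides $t$. Then for all integers $p\geq 0$ the canonical inclusions of groups and rings $SG_q(A)\subset G_q(A) \subset \mathrm{Aff}_{p,q}^G(A)$ and $\mathbb Z \subset \Lambda_{m,t}$ induce maps of complexes $$\mathbb Z\stackrel{L}{\otimes}_{SG_q(A)}\mathbb Z \longrightarrow \Lambda_{m,t}\stackrel{L}{\otimes}_{G_q(A)}\mathbb Z \longrightarrow \Lambda_{m,t}\stackrel{L}{\otimes}_{\mathrm{Aff}_{p,q}^G(A)}\mathbb Z$$ which are isomorphisms on homology groups in degrees $r<mq/t$.
   Context: $\mathcal R_m=\mathbb Z[X_1,\dots,X_m][\Sigma^{-1}]$, where $\Sigma=\{X_J:\emptyset\neq J\subset\{1,\dots,m\}\}$ and $X_J=\sum_{j\in J}X_j$. An $\mathcal R_m$-algebra is a (not necessarily commutative) associative unital ring $A$ with a ring homomorphism from $\mathcal R_m$ to its center $Z(A)$. $\det:GL_q(A)\to K_1(A)=GL(A)^{ab}$ is the map induced by the inclusions $GL_q(A)\subset GL(A)$, $M\mapsto\begin{pmatrix} M & 0 \\ 0 & 1 \end{pmatrix}$. $\bar A^*\subset K_1(A)$ is the image of $Z(A)^*\subset GL_1(A)\to K_1(A)$. $G_q(A)=\{T\in GL_q(A):\det T\in\bar A^*\}$, $SG_q(A)=\ker(\det:GL_q(A)\to K_1(A))$, and $\mathrm{Aff}^{G}_{p,q}(A)=\begin{pmatrix} G_q(A) & 0 \\ M_{p,q}(A)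 & 1_p \end{pmatrix}\subset GL_{p+q}(A)$. The group $G_q(A)$ is embedded in $\mathrm{Aff}^G_{p,q}(A)$ by $M\mapsto\begin{pmatrix} M & 0 \\ 0 & 1_p \end{pmatrix}$. For $t\in\mathbb Z$, $s_{m,t}=-\sum_{\emptyset\ne J\subset\{1,\dots,m\}}(-1)^{|J|}\langle (X_J)^t\rangle\in\mathbb Z[\mathcal R_m^*]$, where $\langle g\rangle$ is the basis element of the group ring corresponding to $g$; its image in $\mathbb Z[\bar A^*]$ under $\mathcal R_m^*\to Z(A)^*\to\bar A^*$ is also denoted $s_{m,t}$. Set $\Lambda=\mathbb Z[\bar A^*]$ and $\Lambda_{m,t}=(s_{m,-t})^{-1}\Lambda$, a right module over $G_q(A)$ and $\mathrm{Aff}^G_{p,q}(A)$ via $\det$. $M\stackrel{L}{\otimes}_GN$ denotes the derived tensor product over $\mathbb Z[G]$. *)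

theory Defs
  imports
    "Jordan_Normal_Form.Matrix"
    "HOL-Library.Poly_Mapping"
    "HOL-Algebra.IntRing"
    "HOL-Algebra.Generated_Groups"
begin

section \<open>Localization of commutative rings\<close>

inductive_set mult_closure :: "('r, 'x) ring_scheme \<Rightarrow> 'r set \<Rightarrow> 'r set"
  for R :: "('r, 'x) ring_scheme" (structure) and \<Sigma> :: "'r set" where
  one: "\<one> \<in> mult_closure R \<Sigma>"
| mult: "s \<in> \<Sigma> \<Longrightarrow> u \<in> mult_closure R \<Sigma> \<Longrightarrow> s \<otimes> u \<in> mult_closure R \<Sigma>"

definition frac_rel :: "('r, 'x) ring_scheme \<Rightarrow> 'r set \<Rightarrow> (('r \<times> 'r) \<times> ('r \<times> 'r)) set" where
  "frac_rel R \<Sigma> = {((a, s), (b, u)).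
     a \<in> carrier R \<and> b \<in> carrier R \<and> s \<in> mult_closure R \<Sigma> \<and> u \<in> mult_closure R \<Sigma> \<and>
     (\<exists>v \<in> mult_closure R \<Sigma>. v \<otimes>\<^bsub>R\<^esub> (u \<otimes>\<^bsub>R\<^esub> a) = v \<otimes>\<^bsub>R\<^esub> (s \<otimes>\<^bsub>R\<^esub> b))}"

definition frac :: "('r, 'x) ring_scheme \<Rightarrow> 'r set \<Rightarrow> 'r \<Rightarrow> 'r \<Rightarrow> ('r \<times> 'r) set" where
  "frac R \<Sigma> a s = frac_rel R \<Sigma> `` {(a, s)}"

text \<open>The ring $R[\Sigma^{-1}]$. The set \<open>\<Sigma>\<close> need not be multiplicatively closed, and
  its elements may be zero divisors.\<close>

definition localization :: "('r, 'x) ring_scheme \<Rightarrow> 'r set \<Rightarrow> ('r \<times> 'r) set ring" where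
  "localization R \<Sigma> = \<lparr>
     carrier = {frac R \<Sigma> a s | a s. a \<in> carrier R \<and> s \<in> mult_closure R \<Sigma>},
     mult = (\<lambda>X Y. \<Union>(a, s)\<in>X. \<Union>(b, u)\<in>Y. frac R \<Sigma> (a \<otimes>\<^bsub>R\<^esub> b) (s \<otimes>\<^bsub>R\<^esub> u)),
     one = frac R \<Sigma> \<one>\<^bsub>R\<^esub> \<one>\<^bsub>R\<^esub>,
     zero = frac R \<Sigma> \<zero>\<^bsub>R\<^esub> \<one>\<^bsub>R\<^esub>,
     add = (\<lambda>X Y. \<Union>(a, s)\<in>X. \<Union>(b, u)\<in>Y.
              frac R \<Sigma> ((u \<otimes>\<^bsub>R\<^esub> a) \<oplus>\<^bsub>R\<^esub> (s \<otimes>\<^bsub>R\<^esub> b)) (s \<otimes>\<^bsub>R\<^esub> u))\<rparr>"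

section \<open>The ring $\mathcal{R}_m$ and its algebras\<close>

type_synonym int_mpoly = "(nat \<Rightarrow>\<^sub>0 nat) \<Rightarrow>\<^sub>0 int"
type_synonym Rm_elt = "(int_mpoly \<times> int_mpoly) set"

text \<open>$\mathbb{Z}[X_1,\dots,X_m]$, as the subring of the polynomials in countably many variables
  (finitely supported functions from monomials to coefficients) involving only
  $X_1,\dots,X_m$.\<close>

definition int_poly_ring :: "nat \<Rightarrow> int_mpoly ring" where
  "int_poly_ring m = \<lparr>
     carrier = {f. \<forall>\<mu> \<in> Poly_Mapping.keys f. Poly_Mapping.keys \<mu> \<subseteq> {1..m}},
     mult = (*), one = 1, zero = 0, add = (+)\<rparr>"

definition X_var :: "nat \<Rightarrow> int_mpoly" where
  "X_var j = Poly_Mapping.single (Poly_Mapping.single j 1) 1"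

definition X_sum :: "nat set \<Rightarrow> int_mpoly" where
  "X_sum J = (\<Sum>j\<in>J. X_var j)"

definition nonempty_subsets :: "nat \<Rightarrow> nat set set" where
  "nonempty_subsets m = {J. J \<noteq> {} \<and> J \<subseteq> {1..m}}"

definition R_ring :: "nat \<Rightarrow> Rm_elt ring" where
  "R_ring m = localization (int_poly_ring m) (X_sum ` nonempty_subsets m)"

definition R_X :: "nat \<Rightarrow> nat set \<Rightarrow> Rm_elt" where
  "R_X m J = frac (int_poly_ring m) (X_sum ` nonempty_subsets m) (X_sum J) 1"

text \<open>The ring \<open>A\<close> is a type of sort \<open>{ring, monoid_mult}\<close>, i.e. an associative unital
  ring. The class \<open>ring_1\<close> is not used, since it excludes the zero ring.\<close>

definition center_ring :: "'a::{ring,monoid_mult} ring" where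
  "center_ring = \<lparr>
     carrier = {a. \<forall>b. a * b = b * a}, mult = (*), one = 1, zero = 0, add = (+)\<rparr>"

text \<open>\<open>\<phi>\<close> is the structure map of an $\mathcal{R}_m$-algebra.\<close>

definition R_algebra :: "nat \<Rightarrow> (Rm_elt \<Rightarrow> 'a::{ring,monoid_mult}) \<Rightarrow> bool" where
  "R_algebra m \<phi> \<longleftrightarrow> \<phi> \<in> ring_hom (R_ring m) center_ring"

section \<open>General linear groups and $K_1$\<close>

definition GL :: "nat \<Rightarrow> 'a::{ring,monoid_mult} mat monoid" where
  "GL q = \<lparr>
     carrier = {M \<in> carrier_mat q q. \<exists>N \<in> carrier_mat q q. M * N = 1\<^sub>m q \<and> N * M = 1\<^sub>m q},
     mult = (*), one = 1\<^sub>m q\<rparr>"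

text \<open>$GL(A)=\bigcup_q GL_q(A)$ is realised by infinite matrices; a square matrix \<open>M\<close> is sent to
  the infinite block matrix with diagonal blocks \<open>M\<close> and the identity.\<close>

definition stab :: "'a::{zero,one} mat \<Rightarrow> nat \<Rightarrow> nat \<Rightarrow> 'a" where
  "stab M = (\<lambda>i j. if i < dim_row M \<and> j < dim_col M then M $$ (i, j)
                   else if i = j then 1 else 0)"

definition GL_inf :: "(nat \<Rightarrow> nat \<Rightarrow> 'a::{ring,monoid_mult}) monoid" where
  "GL_inf = \<lparr>
     carrier = (\<Union>q. stab ` carrier (GL q)),
     mult = (\<lambda>M N i j. \<Sum>k | M i k \<noteq> 0. M i k * N k j),
     one = (\<lambda>i j. if i = j then 1 else 0)\<rparr>"

type_synonym 'a K1_elt = "(nat \<Rightarrow> nat \<Rightarrow> 'a) set"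

definition K1 :: "'a::{ring,monoid_mult} K1_elt monoid" where
  "K1 = GL_inf Mod derived GL_inf (carrier GL_inf)"

definition K1_det :: "'a::{ring,monoid_mult} mat \<Rightarrow> 'a K1_elt" where
  "K1_det M = derived GL_inf (carrier GL_inf) #>\<^bsub>GL_inf\<^esub> stab M"

definition K1_unit :: "'a::{ring,monoid_mult} \<Rightarrow> 'a K1_elt" where
  "K1_unit a = K1_det (mat 1 1 (\<lambda>_. a))"

text \<open>$\bar A^*$\<close>

definition A_bar :: "'a::{ring,monoid_mult} K1_elt monoid" where
  "A_bar = K1\<lparr>carrier := K1_unit ` Units center_ring\<rparr>"

definition G_grp :: "nat \<Rightarrow> 'a::{ring,monoid_mult} mat monoid" where
  "G_grp q = (GL q)\<lparr>carrier := {T \<in> carrier (GL q). K1_det T \<in> carrier A_bar}\<rparr>"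

definition SG_grp :: "nat \<Rightarrow> 'a::{ring,monoid_mult} mat monoid" where
  "SG_grp q = (GL q)\<lparr>carrier := kernel (GL q) K1 K1_det\<rparr>"

definition Aff_grp :: "nat \<Rightarrow> nat \<Rightarrow> 'a::{ring,monoid_mult} mat monoid" where
  "Aff_grp p q = (GL (q + p))\<lparr>carrier :=
     {four_block_mat T (0\<^sub>m q p) M (1\<^sub>m p) | T M.
        T \<in> carrier (G_grp q) \<and> M \<in> carrier_mat p q}\<rparr>"

definition Aff_embed :: "nat \<Rightarrow> nat \<Rightarrow> 'a::{ring,monoid_mult} mat \<Rightarrow> 'a mat" where
  "Aff_embed p q T = four_block_mat T (0\<^sub>m q p) (0\<^sub>m p q) (1\<^sub>m p)"

section \<open>Group rings and the coefficient ring $\Lambda_{m,t}$\<close>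

text \<open>$\mathbb{Z}[G]$ consists of the finitely supported integer functions on \<open>G\<close>;
  \<open>frag_of g\<close> is the basis element $\langle g\rangle$, and \<open>frag_extend\<close> is linear
  extension from basis elements.\<close>

definition group_ring :: "('g, 'x) monoid_scheme \<Rightarrow> ('g \<Rightarrow>\<^sub>0 int) ring" where
  "group_ring G = \<lparr>
     carrier = {c. Poly_Mapping.keys c \<subseteq> carrier G},
     mult = (\<lambda>c d. frag_extend (\<lambda>g. frag_extend (\<lambda>h. frag_of (g \<otimes>\<^bsub>G\<^esub> h)) d) c),
     one = frag_of \<one>\<^bsub>G\<^esub>, zero = 0, add = (+)\<rparr>"

text \<open>$s_{m,t}\in\mathbb{Z}[\mathcal{R}_m^*]$ and its image in $\mathbb{Z}[\bar A^*]$\<close>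

definition s_elt :: "nat \<Rightarrow> int \<Rightarrow> Rm_elt \<Rightarrow>\<^sub>0 int" where
  "s_elt m t = - (\<Sum>J\<in>nonempty_subsets m.
     frag_cmul ((-1) ^ card J) (frag_of (R_X m J [^]\<^bsub>units_of (R_ring m)\<^esub> t)))"

definition s_bar :: "(Rm_elt \<Rightarrow> 'a::{ring,monoid_mult}) \<Rightarrow> nat \<Rightarrow> int \<Rightarrow> 'a K1_elt \<Rightarrow>\<^sub>0 int" where
  "s_bar \<phi> m t = frag_extend (\<lambda>u. frag_of (K1_unit (\<phi> u))) (s_elt m t)"

type_synonym 'a Lambda_elt = "(('a K1_elt \<Rightarrow>\<^sub>0 int) \<times> ('a K1_elt \<Rightarrow>\<^sub>0 int)) set"

text \<open>$\Lambda_{m,t}=(s_{m,-t})^{-1}\,\mathbb{Z}[\bar A^*]$\<close>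

definition Lambda ::
  "(Rm_elt \<Rightarrow> 'a::{ring,monoid_mult}) \<Rightarrow> nat \<Rightarrow> int \<Rightarrow> 'a Lambda_elt ring" where
  "Lambda \<phi> m t = localization (group_ring A_bar) {s_bar \<phi> m (- t)}"

text \<open>Right action of a matrix on $\Lambda_{m,t}$ via \<open>det\<close>\<close>

definition Lambda_act ::
  "(Rm_elt \<Rightarrow> 'a::{ring,monoid_mult}) \<Rightarrow> nat \<Rightarrow> int \<Rightarrow> 'a Lambda_elt \<Rightarrow> 'a mat \<Rightarrow> 'a Lambda_elt" where
  "Lambda_act \<phi> m t x T = x \<otimes>\<^bsub>Lambda \<phi> m t\<^esub>
     frac (group_ring A_bar) {s_bar \<phi> m (- t)} (frag_of (K1_det T)) (frag_of \<one>\<^bsub>A_bar\<^esub>)"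

definition int_to_Lambda ::
  "(Rm_elt \<Rightarrow> 'a::{ring,monoid_mult}) \<Rightarrow> nat \<Rightarrow> int \<Rightarrow> int \<Rightarrow> 'a Lambda_elt" where
  "int_to_Lambda \<phi> m t k = [k] \<cdot>\<^bsub>Lambda \<phi> m t\<^esub> \<one>\<^bsub>Lambda \<phi> m t\<^esub>"

section \<open>Chain complexes and their homology\<close>

text \<open>A non-negatively graded complex of (multiplicatively written) abelian groups: \<open>fst K n\<close> is
  the group in degree \<open>n\<close>, and \<open>snd K n\<close> the differential from degree \<open>n + 1\<close> to degree
  \<open>n\<close>. The homology in negative degrees vanishes.\<close>

type_synonym 'c complx = "(nat \<Rightarrow> 'c monoid) \<times> (nat \<Rightarrow> 'c \<Rightarrow> 'c)"

definition chain_complex :: "'c complx \<Rightarrow> bool" where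
  "chain_complex K \<longleftrightarrow>
     (\<forall>n. comm_group (fst K n)) \<and>
     (\<forall>n. snd K n \<in> hom (fst K (Suc n)) (fst K n)) \<and>
     (\<forall>n. \<forall>c \<in> carrier (fst K (Suc (Suc n))). snd K n (snd K (Suc n) c) = \<one>\<^bsub>fst K n\<^esub>)"

definition chain_map :: "'c complx \<Rightarrow> 'd complx \<Rightarrow> ('c \<Rightarrow> 'd) \<Rightarrow> bool" where
  "chain_map K L f \<longleftrightarrow>
     chain_complex K \<and> chain_complex L \<and>
     (\<forall>n. f \<in> hom (fst K n) (fst L n)) \<and>
     (\<forall>n. \<forall>c \<in> carrier (fst K (Suc n)). f (snd K n c) = snd L n (f c))"

definition cycles :: "'c complx \<Rightarrow> nat \<Rightarrow> 'c set" where
  "cycles K n = (case n of 0 \<Rightarrow> carrier (fst K 0)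
                 | Suc k \<Rightarrow> kernel (fst K (Suc k)) (fst K k) (snd K k))"

definition boundaries :: "'c complx \<Rightarrow> nat \<Rightarrow> 'c set" where
  "boundaries K n = snd K n ` carrier (fst K (Suc n))"

definition homology :: "'c complx \<Rightarrow> nat \<Rightarrow> 'c set monoid" where
  "homology K n = (fst K n)\<lparr>carrier := cycles K n\<rparr> Mod boundaries K n"

text \<open>The map on homology induced by a chain map \<open>f\<close> sends the class of a cycle \<open>z\<close> to the
  class of \<open>f z\<close>. All members of the union are equal to each other.\<close>

definition homology_map :: "'d complx \<Rightarrow> ('c \<Rightarrow> 'd) \<Rightarrow> nat \<Rightarrow> 'c set \<Rightarrow> 'd set" where
  "homology_map L f n \<xi> = (\<Union>z\<in>\<xi>. boundaries L n #>\<^bsub>fst L n\<^esub> f z)"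

definition homology_iso :: "'c complx \<Rightarrow> 'd complx \<Rightarrow> ('c \<Rightarrow> 'd) \<Rightarrow> nat \<Rightarrow> bool" where
  "homology_iso K L f n \<longleftrightarrow> homology_map L f n \<in> iso (homology K n) (homology L n)"

section \<open>The derived tensor product $M\otimes^L_G\mathbb{Z}$\<close>

text \<open>$M\otimes^L_G\mathbb{Z}$ is $M\otimes_{\mathbb{Z}[G]}B_\bullet(G)$ for the bar resolution
  $B_\bullet(G)\to\mathbb{Z}$. As $B_n(G)$ is the free left $\mathbb{Z}[G]$-module on the symbols
  $[g_1|\dots|g_n]$, the degree \<open>n\<close> part is the direct sum of copies of \<open>M\<close> indexed by
  $G^n$: a chain is a finitely supported function on lists of length \<open>n\<close>, standing for
  $\sum_x c(x)\otimes[x]$. Of the coefficient ring \<open>M\<close> only the additive group is used;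
  \<open>act\<close> is the right action of \<open>G\<close>.\<close>

definition bar_chains ::
  "('g, 'x) monoid_scheme \<Rightarrow> ('m, 'y) ring_scheme \<Rightarrow> nat \<Rightarrow> ('g list \<Rightarrow> 'm) monoid" where
  "bar_chains G M n = \<lparr>
     carrier = {c. (\<forall>x. c x \<in> carrier M) \<and> finite {x. c x \<noteq> \<zero>\<^bsub>M\<^esub>} \<and>
                   (\<forall>x. c x \<noteq> \<zero>\<^bsub>M\<^esub> \<longrightarrow> length x = n \<and> set x \<subseteq> carrier G)},
     mult = (\<lambda>c d x. c x \<oplus>\<^bsub>M\<^esub> d x),
     one = (\<lambda>x. \<zero>\<^bsub>M\<^esub>)\<rparr>"

text \<open>The image of a chain \<open>c\<close> under $a\otimes[x]\mapsto w(x,a)\otimes[f(x)]$\<close>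

definition push_chain ::
  "('m, 'y) ring_scheme \<Rightarrow> ('n, 'z) ring_scheme \<Rightarrow> ('g list \<Rightarrow> 'm \<Rightarrow> 'n) \<Rightarrow> ('g list \<Rightarrow> 'h list) \<Rightarrow>
   ('g list \<Rightarrow> 'm) \<Rightarrow> 'h list \<Rightarrow> 'n" where
  "push_chain M N w f c = (\<lambda>y. \<Oplus>\<^bsub>N\<^esub>x\<in>{x. c x \<noteq> \<zero>\<^bsub>M\<^esub> \<and> f x = y}. w x (c x))"

text \<open>The faces of $a\otimes[g_1|\dots|g_n]$ are $a g_1\otimes[g_2|\dots|g_n]$,
  $a\otimes[g_1|\dots|g_i g_{i+1}|\dots|g_n]$ for $0<i<n$, and
  $a\otimes[g_1|\dots|g_{n-1}]$; note that \<open>nth\<close> counts from zero.\<close>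

definition bar_face :: "('g, 'x) monoid_scheme \<Rightarrow> nat \<Rightarrow> 'g list \<Rightarrow> 'g list" where
  "bar_face G i x =
     (if i = 0 then tl x
      else if i = length x then butlast x
      else take (i - 1) x @ [(x ! (i - 1)) \<otimes>\<^bsub>G\<^esub> (x ! i)] @ drop (i + 1) x)"

definition bar_weight :: "('m \<Rightarrow> 'g \<Rightarrow> 'm) \<Rightarrow> nat \<Rightarrow> 'g list \<Rightarrow> 'm \<Rightarrow> 'm" where
  "bar_weight act i x a = (if i = 0 then act a (hd x) else a)"

definition bar_d ::
  "('g, 'x) monoid_scheme \<Rightarrow> ('m, 'y) ring_scheme \<Rightarrow> ('m \<Rightarrow> 'g \<Rightarrow> 'm) \<Rightarrow> nat \<Rightarrow>
   ('g list \<Rightarrow> 'm) \<Rightarrow> 'g list \<Rightarrow> 'm" where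
  "bar_d G M act n c = (\<lambda>y. \<Oplus>\<^bsub>M\<^esub>i\<in>{0..Suc n}.
     [((-1) ^ i :: int)] \<cdot>\<^bsub>M\<^esub> push_chain M M (bar_weight act i) (bar_face G i) c y)"

definition derived_tensor_Z ::
  "('m, 'y) ring_scheme \<Rightarrow> ('m \<Rightarrow> 'g \<Rightarrow> 'm) \<Rightarrow> ('g, 'x) monoid_scheme \<Rightarrow> ('g list \<Rightarrow> 'm) complx" where
  "derived_tensor_Z M act G = (bar_chains G M, bar_d G M act)"

text \<open>The map $a\otimes[g_1|\dots|g_n]\mapsto f(a)\otimes[h(g_1)|\dots|h(g_n)]$ induced by a group
  homomorphism \<open>h\<close> and an equivariant map of coefficients \<open>f\<close>\<close>

definition tensor_map ::
  "('m, 'y) ring_scheme \<Rightarrow> ('n, 'z) ring_scheme \<Rightarrow> ('m \<Rightarrow> 'n) \<Rightarrow> ('g \<Rightarrow> 'h) \<Rightarrow>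
   ('g list \<Rightarrow> 'm) \<Rightarrow> 'h list \<Rightarrow> 'n" where
  "tensor_map M N f h = push_chain M N (\<lambda>_. f) (map h)"

section \<open>The three complexes and the maps between them\<close>

definition cplx_SG :: "nat \<Rightarrow> ('a::{ring,monoid_mult} mat list \<Rightarrow> int) complx" where
  "cplx_SG q = derived_tensor_Z \<Z> (\<lambda>a _. a) (SG_grp q)"

definition cplx_G ::
  "(Rm_elt \<Rightarrow> 'a::{ring,monoid_mult}) \<Rightarrow> nat \<Rightarrow> int \<Rightarrow> nat \<Rightarrow>
   ('a mat list \<Rightarrow> 'a Lambda_elt) complx" where
  "cplx_G \<phi> m t q = derived_tensor_Z (Lambda \<phi> m t) (Lambda_act \<phi> m t) (G_grp q)"

definition cplx_Aff ::
  "(Rm_elt \<Rightarrow> 'a::{ring,monoid_mult}) \<Rightarrow> nat \<Rightarrow> int \<Rightarrow> nat \<Rightarrow> nat \<Rightarrow>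
   ('a mat list \<Rightarrow> 'a Lambda_elt) complx" where
  "cplx_Aff \<phi> m t p q = derived_tensor_Z (Lambda \<phi> m t) (Lambda_act \<phi> m t) (Aff_grp p q)"

definition SG_to_G ::
  "(Rm_elt \<Rightarrow> 'a::{ring,monoid_mult}) \<Rightarrow> nat \<Rightarrow> int \<Rightarrow>
   ('a mat list \<Rightarrow> int) \<Rightarrow> 'a mat list \<Rightarrow> 'a Lambda_elt" where
  "SG_to_G \<phi> m t = tensor_map \<Z> (Lambda \<phi> m t) (int_to_Lambda \<phi> m t) (\<lambda>T. T)"

definition G_to_Aff ::
  "(Rm_elt \<Rightarrow> 'a::{ring,monoid_mult}) \<Rightarrow> nat \<Rightarrow> int \<Rightarrow> nat \<Rightarrow> nat \<Rightarrow>
   ('a mat list \<Rightarrow> 'a Lambda_elt) \<Rightarrow> 'a mat list \<Rightarrow> 'a Lambda_elt" where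
  "G_to_Aff \<phi> m t p q =
     tensor_map (Lambda \<phi> m t) (Lambda \<phi> m t) (\<lambda>x. x) (Aff_embed p q)"

end

theory Submission
  imports Defs "HOL-Algebra.Free_Abelian_Groups" "HOL-Library.Function_Algebras"
begin

text \<open>Write \<open>\<Lambda> = \<int>[A\<^sup>*]\<close> for the group ring of the image of the central units and \<open>s\<close> for the image of
  the alternating sum, \<open>t = q d\<close>. A central unit \<open>c\<close> gives a scalar matrix in \<open>G_q\<close> of determinant
  class \<open>c^q\<close>, and conjugation acts on the homology of a group as the identity. Conjugation by a
  scalar matrix fixes \<open>G_q\<close>, so \<open>s\<close> acts on the homology of \<open>G_q\<close> with coefficients in \<open>\<Lambda>\<close> as
  the identity: inverting it changes nothing, and Shapiro's lemma for \<open>SG_q\<close> gives the first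
  isomorphism. On the affine group, conjugation by the scalars \<open>X_J^d\<close> multiplies the translation
  part by \<open>X_J^d\<close>, the sum of the monomials given by the words of length \<open>d\<close> in the letters of
  \<open>J\<close>. On \<open>r\<close>-chains the effect of such a sum on the translation part is polynomial of degree
  \<open>r\<close> up to homotopy, i.e. its cross effects of order \<open>r + 1\<close> vanish. A set of at most \<open>r\<close> words
  misses a letter as soon as \<open>r d < m\<close>, and then its contributions to the alternating sum over \<open>J\<close>
  cancel. What remains is the term of \<open>J = {}\<close>, the projection to \<open>G_q\<close> followed by the
  inclusion. Hence this composite agrees with \<open>s\<close> on homology, and since \<open>s\<close> is invertible
  on \<open>\<Lambda>[1/s]\<close> and acts as the identity on the homology of \<open>G_q\<close>, it is the identity.\<close>

section \<open>Homogeneous chains\<close>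

text \<open>Homotopies are built on homogeneous simplices, lists of vertices in the group, because
  there they are prisms between maps of vertices; an operator that respects left translation
  descends to the bar complex. With coefficients in \<Lambda> the chains are free on
  \<open>A_bar\<close> times bars, so Shapiro's lemma, conjugation and cross effects deal with
  generators only. After localization this freeness is lost, and s may be a zero divisor; cycles are
  therefore multiplied by denominators until they come from \<Lambda>, and the denominators, being
  powers of s, are removed afterwards. The exponent -t arises because conjugation by h on the group
  part amounts to multiplication by the inverse class of h on the coefficients, and the scalar X_J^d
  of size q has class X_J^(q d). The degree bound is a count of vertices: each index of a cross
  effect is spent on normalising one coordinate of the first vertex, which leaves a defect with one
  vertex less, and an r-simplex has r + 1 vertices. So more than r words give a null homotopic cross
  effect, and r d < m means r < m q / t.\<close>

lemma keys_frag_extend_subset: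
  assumes "Poly_Mapping.keys c \<subseteq> S" "\<And>x. x \<in> S \<Longrightarrow> Poly_Mapping.keys (f x) \<subseteq> S'"
  shows "Poly_Mapping.keys (frag_extend f c) \<subseteq> S'"
  using keys_frag_extend[of f c] assms by blast

lemma keys_diff_subset:
  assumes "Poly_Mapping.keys c \<subseteq> S" "Poly_Mapping.keys d \<subseteq> S"
  shows "Poly_Mapping.keys (c - d) \<subseteq> S"
  using keys_diff[of c d] assms by blast

lemma keys_add_subset:
  assumes "Poly_Mapping.keys c \<subseteq> S" "Poly_Mapping.keys d \<subseteq> S"
  shows "Poly_Mapping.keys (c + d) \<subseteq> S"
  using Poly_Mapping.keys_add[of c d] assms by blast

text \<open>Chain identities are checked on generators through this rule. It asks for compatibility
  with differences because that is the step of \<open>frag_induction\<close>; the value at 0 follows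
  from 0 - 0.\<close>

lemma frag_additive_eq:
  fixes f g :: "('a \<Rightarrow>\<^sub>0 int) \<Rightarrow> 'c::ab_group_add"
  assumes "Poly_Mapping.keys c \<subseteq> S"
    and "\<And>a b. f (a - b) = f a - f b" and "\<And>a b. g (a - b) = g a - g b"
    and "\<And>x. x \<in> S \<Longrightarrow> f (frag_of x) = g (frag_of x)"
  shows "f c = g c"
proof -
  have "f 0 = 0" "g 0 = 0"
    using assms(2)[of 0 0] assms(3)[of 0 0] by auto
  with assms(1) show ?thesis
    by (induction c rule: frag_induction) (auto simp: assms)
qed

lemma frag_extend_extend:
  "frag_extend f (frag_extend g c) = frag_extend (\<lambda>x. frag_extend f (g x)) c"
  by (rule frag_additive_eq[of c UNIV]) (auto simp: frag_extend_diff)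

text \<open>The boundary of an ordered simplex, in augmented form: a single vertex has boundary
  \<open>frag_of []\<close>. The recursion expresses that coning off from the first vertex is a
  contraction, and this is the form that the later inductions use.\<close>

fun hbd :: "'v list \<Rightarrow> ('v list \<Rightarrow>\<^sub>0 int)" where
  "hbd [] = 0"
| "hbd (v # vs) = frag_of vs - frag_extend (\<lambda>l. frag_of (v # l)) (hbd vs)"

abbreviation hBD :: "('v list \<Rightarrow>\<^sub>0 int) \<Rightarrow> ('v list \<Rightarrow>\<^sub>0 int)" where
  "hBD \<equiv> frag_extend hbd"

abbreviation cone :: "'v \<Rightarrow> ('v list \<Rightarrow>\<^sub>0 int) \<Rightarrow> ('v list \<Rightarrow>\<^sub>0 int)" where
  "cone v \<equiv> frag_extend (\<lambda>l. frag_of (v # l))"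

abbreviation mapc :: "('v \<Rightarrow> 'w) \<Rightarrow> ('v list \<Rightarrow>\<^sub>0 int) \<Rightarrow> ('w list \<Rightarrow>\<^sub>0 int)" where
  "mapc f \<equiv> frag_extend (\<lambda>l. frag_of (map f l))"

text \<open>The sum over i of (-1)^i times (f v_0, ..., f v_i, g v_i, ..., g v_n), the usual
  triangulation of a prism.\<close>

fun prism :: "('v \<Rightarrow> 'w) \<Rightarrow> ('v \<Rightarrow> 'w) \<Rightarrow> 'v list \<Rightarrow> ('w list \<Rightarrow>\<^sub>0 int)" where
  "prism f g [] = 0"
| "prism f g (v # vs) = frag_of (f v # map g (v # vs)) - cone (f v) (prism f g vs)"

abbreviation hPR :: "('v \<Rightarrow> 'w) \<Rightarrow> ('v \<Rightarrow> 'w) \<Rightarrow> ('v list \<Rightarrow>\<^sub>0 int) \<Rightarrow> ('w list \<Rightarrow>\<^sub>0 int)" where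
  "hPR f g \<equiv> frag_extend (prism f g)"

lemma hBD_cone: "hBD (cone v c) = c - cone v (hBD c)"
  by (rule frag_additive_eq[of c UNIV]) (auto simp: frag_extend_diff)

lemma hBD_hbd: "hBD (hbd l) = 0"
  by (induction l) (auto simp: frag_extend_diff hBD_cone)

lemma hBD_hBD: "hBD (hBD c) = 0"
  by (simp add: frag_extend_extend hBD_hbd frag_extend_eq_0)

lemma hbd_map: "hbd (map f l) = mapc f (hbd l)"
  by (induction l) (auto simp: frag_extend_diff frag_extend_extend)

lemma hBD_mapc: "hBD (mapc f c) = mapc f (hBD c)"
  by (simp add: frag_extend_extend hbd_map)

lemma mapc_mapc: "mapc f (mapc g c) = mapc (\<lambda>x. f (g x)) c"
  by (simp add: frag_extend_extend comp_def)

lemma mapc_id: "mapc (\<lambda>x. x) c = c"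
  using frag_expansion[of c] by simp

lemma hPR_cone: "hPR f g (cone v c) = cone (f v) (cone (g v) (mapc g c)) - cone (f v) (hPR f g c)"
  by (rule frag_additive_eq[of c UNIV]) (auto simp: frag_extend_diff)

lemma prism_homotopy:
  "hBD (prism f g l) + hPR f g (hbd l) = frag_of (map g l) - frag_of (map f l)"
proof (induction l)
  case Nil
  then show ?case by simp
next
  case (Cons v vs)
  have "cone (f v) (hBD (prism f g vs)) + cone (f v) (hPR f g (hbd vs)) =
    frag_of (f v # map g vs) - frag_of (f v # map f vs)"
    by (simp add: frag_extend_add[symmetric] Cons frag_extend_diff)
  then show ?case
    by (simp add: frag_extend_diff hBD_cone hPR_cone hbd_map algebra_simps)
qed

lemma hPR_homotopy: "hBD (hPR f g c) + hPR f g (hBD c) = mapc g c - mapc f c"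
  by (rule frag_additive_eq[of c UNIV])
    (auto simp: prism_homotopy frag_extend_diff algebra_simps)

text \<open>Naturality in the vertices. With left translations for \<open>h\<close> and
  \<open>k\<close> it makes prisms descend to the bar complex. The hypotheses are confined to the
  vertices of \<open>l\<close>, since the group laws hold in the carrier only.\<close>

lemma prism_map:
  assumes "\<And>v. v \<in> set l \<Longrightarrow> f' (h v) = k (f v)" "\<And>v. v \<in> set l \<Longrightarrow> g' (h v) = k (g v)"
  shows "prism f' g' (map h l) = mapc k (prism f g l)"
  using assms
proof (induction l)
  case (Cons v vs)
  then have "prism f' g' (map h vs) = mapc k (prism f g vs)" by auto
  moreover have "map (\<lambda>x. g' (h x)) vs = map (\<lambda>x. k (g x)) vs" using Cons.prems by auto
  ultimately show ?case
    using Cons.prems by (simp add: frag_extend_diff frag_extend_extend comp_def frag_of_eq)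
qed auto

lemma hPR_mapc:
  assumes "\<And>v. f (h v) = h (f v)" "\<And>v. g (h v) = h (g v)"
  shows "hPR f g (mapc h c) = mapc h (hPR f g c)"
  using assms by (simp add: frag_extend_extend prism_map[where f = f and g = g and k = h])

lemma keys_hbd: "Poly_Mapping.keys (hbd l) \<subseteq> {l'. Suc (length l') = length l \<and> set l' \<subseteq> set l}"
proof (induction l)
  case (Cons v vs)
  have "Poly_Mapping.keys (cone v (hbd vs))
      \<subseteq> {l'. Suc (length l') = length (v # vs) \<and> set l' \<subseteq> set (v # vs)}"
    by (rule keys_frag_extend_subset[OF Cons]) auto
  then show ?case unfolding hbd.simps by (intro keys_diff_subset) auto
qed auto

lemma keys_prism:
  "Poly_Mapping.keys (prism f g l)
     \<subseteq> {l'. length l' = Suc (length l) \<and> set l' \<subseteq> f ` set l \<union> g ` set l}"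
proof (induction l)
  case (Cons v vs)
  have "Poly_Mapping.keys (cone (f v) (prism f g vs))
      \<subseteq> {l'. length l' = Suc (length (v # vs)) \<and> set l' \<subseteq> f ` set (v # vs) \<union> g ` set (v # vs)}"
    by (rule keys_frag_extend_subset[OF Cons]) auto
  then show ?case unfolding prism.simps by (intro keys_diff_subset) auto
qed auto

section \<open>Vanishing of the cross effects\<close>

text \<open>A vertex carries a component in \<open>'b\<close> and one element of an abelian group
  for each index. The coordinates are kept apart, and added up only later by \<open>sumv\<close>, so
  that leaving an index out of the sum becomes the vertex map \<open>kill\<close>, to which prisms
  apply.\<close>

definition transl :: "'i \<Rightarrow> 'n::ab_group_add \<Rightarrow> 'b \<times> ('i \<Rightarrow> 'n) \<Rightarrow> 'b \<times> ('i \<Rightarrow> 'n)" where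
  "transl j a v = (fst v, (snd v)(j := a + snd v j))"

definition kill :: "'i \<Rightarrow> 'b \<times> ('i \<Rightarrow> 'n::ab_group_add) \<Rightarrow> 'b \<times> ('i \<Rightarrow> 'n)" where
  "kill j v = (fst v, (snd v)(j := 0))"

definition normal :: "'i \<Rightarrow> ('b \<times> ('i \<Rightarrow> 'n::ab_group_add)) list \<Rightarrow> ('b \<times> ('i \<Rightarrow> 'n)) list" where
  "normal j l = map (transl j (- snd (hd l) j)) l"

abbreviation hNR where
  "hNR j \<equiv> frag_extend (\<lambda>l. frag_of (normal j l))"

text \<open>The product of the operators 1 - \<open>kill j\<close> over j in T. Once the coordinates
  are added up it becomes the cross effect \<open>cross_diff_sum\<close>, see
  \<open>mapc_sumv_cross\<close>.\<close>

primrec cross :: "'i list \<Rightarrow> (('b \<times> ('i \<Rightarrow> 'n::ab_group_add)) list \<Rightarrow>\<^sub>0 int)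
    \<Rightarrow> (('b \<times> ('i \<Rightarrow> 'n)) list \<Rightarrow>\<^sub>0 int)" where
  "cross [] c = c"
| "cross (j # T) c = cross T c - mapc (kill j) (cross T c)"

text \<open>Modulo translations, \<open>htp T\<close> is a contracting homotopy of \<open>cross T\<close>. The normalisation
  makes \<open>v\<close> and \<open>kill j v\<close> agree for the first vertex \<open>v\<close>; it commutes with the boundary only up
  to a translation in the first face, and the second summand corrects this defect.\<close>

primrec htp :: "'i list \<Rightarrow> (('b \<times> ('i \<Rightarrow> 'n::ab_group_add)) list \<Rightarrow>\<^sub>0 int)
    \<Rightarrow> (('b \<times> ('i \<Rightarrow> 'n)) list \<Rightarrow>\<^sub>0 int)" where
  "htp [] c = 0"
| "htp (j # T) c =
     hPR (kill j) (\<lambda>v. v) (cross T (hNR j c) - htp T (hBD (hNR j c) - hNR j (hBD c)))"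

lemma cross_diff: "cross T (a - b) = cross T a - cross T b"
  by (induction T) (auto simp: frag_extend_diff)

lemma htp_diff:
  fixes a b :: "('b \<times> ('i \<Rightarrow> 'n::ab_group_add)) list \<Rightarrow>\<^sub>0 int"
  shows "htp T (a - b) = htp T a - htp T b"
proof (induction T arbitrary: a b)
  case (Cons j T)
  have *: "htp T ((a1 - b1) - (a2 - b2)) = htp T (a1 - a2) - htp T (b1 - b2)" 
    for a1 b1 a2 b2 :: "('b \<times> ('i \<Rightarrow> 'n)) list \<Rightarrow>\<^sub>0 int"
    unfolding Cons by simp
  show ?case
    by (simp add: frag_extend_diff cross_diff *)
qed auto

lemma htp_0: "htp T 0 = 0"
  using htp_diff[of T 0 0] by simp

lemma cross_Nil: "cross T (frag_of []) = (if T = [] then frag_of [] else 0)"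
  by (induction T) auto

text \<open>Operators that descend to the bar complex have to vanish on the empty simplex, see
  \<open>descent\<close>.\<close>

lemma htp_Nil:
  fixes T :: "'i list"
  shows "htp T (frag_of ([] :: ('b \<times> ('i \<Rightarrow> 'n::ab_group_add)) list)) = 0"
proof (cases T)
  case (Cons j T')
  have "normal j [] = ([] :: ('b \<times> ('i \<Rightarrow> 'n)) list)" by (simp add: normal_def)
  then show ?thesis unfolding Cons by (simp add: htp_0 cross_Nil)
qed simp

lemma kill_transl: "i \<noteq> j \<Longrightarrow> kill j (transl i a v) = transl i a (kill j v)"
  by (auto simp: kill_def transl_def fun_upd_twist)

lemma kill_transl_same: "kill j (transl j a v) = kill j v"
  by (auto simp: kill_def transl_def)

lemma cross_mapc:
  assumes "\<And>i v. i \<in> set T \<Longrightarrow> kill i (h v) = h (kill i v)"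
  shows "cross T (mapc h c) = mapc h (cross T c)"
  using assms by (induction T) (auto simp: frag_extend_diff mapc_mapc)

lemma normal_map:
  assumes "\<And>v w. transl j (- snd (h v) j) (h w) = h (transl j (- snd v j) w)"
  shows "normal j (map h l) = map h (normal j l)"
  using assms by (cases l) (auto simp: normal_def)

lemma hNR_mapc:
  assumes "\<And>v w. transl j (- snd (h v) j) (h w) = h (transl j (- snd v j) w)"
  shows "hNR j (mapc h c) = mapc h (hNR j c)"
  using normal_map[of j h, OF assms] by (simp add: frag_extend_extend)

text \<open>It serves for translations in an index outside T and for the linear maps
  \<open>lin g\<close>; the second hypothesis expresses that normalising commutes with
  \<open>h\<close>.\<close>

lemma htp_mapc:
  fixes h :: "'b \<times> ('i \<Rightarrow> 'n::ab_group_add) \<Rightarrow> 'b \<times> ('i \<Rightarrow> 'n)"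
  assumes "\<And>i v. i \<in> set T \<Longrightarrow> kill i (h v) = h (kill i v)"
    and "\<And>i v w. i \<in> set T \<Longrightarrow> transl i (- snd (h v) i) (h w) = h (transl i (- snd v i) w)"
  shows "htp T (mapc h c) = mapc h (htp T c)"
  using assms
proof (induction T arbitrary: c)
  case (Cons j T)
  have IH: "htp T (mapc h c) = mapc h (htp T c)" for c
    by (rule Cons.IH) (use Cons.prems in auto)
  have N: "hNR j (mapc h c) = mapc h (hNR j c)" for c
    by (rule hNR_mapc) (use Cons.prems in auto)
  have C: "cross T (mapc h c) = mapc h (cross T c)" for c
    by (rule cross_mapc) (use Cons.prems in auto)
  have P: "hPR (kill j) (\<lambda>v. v) (mapc h c) = mapc h (hPR (kill j) (\<lambda>v. v) c)" for c
    by (rule hPR_mapc) (use Cons.prems(1)[of j] in auto)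
  show ?case
    by (simp add: N C IH P hBD_mapc frag_extend_diff[symmetric])
qed auto

lemma htp_transl: "j \<notin> set T \<Longrightarrow> htp T (mapc (transl j a) c) = mapc (transl j a) (htp T c)"
  by (rule htp_mapc, metis kill_transl, auto simp: transl_def fun_upd_twist)

lemma hNR_transl: "i \<noteq> j \<Longrightarrow> hNR j (mapc (transl i a) c) = mapc (transl i a) (hNR j c)"
  by (rule hNR_mapc) (auto simp: transl_def fun_upd_twist)

lemma hNR_transl_same:
  fixes c :: "('b \<times> ('i \<Rightarrow> 'n::ab_group_add)) list \<Rightarrow>\<^sub>0 int"
  shows "hNR j (mapc (transl j a) c) = hNR j c"
proof -
  have "normal j (map (transl j a) l) = normal j l" for l :: "('b \<times> ('i \<Rightarrow> 'n)) list"
    by (cases l) (auto simp: normal_def transl_def)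
  then show ?thesis by (simp add: frag_extend_extend)
qed

lemma cross_transl: "j \<notin> set T \<Longrightarrow> cross T (mapc (transl j a) c) = mapc (transl j a) (cross T c)"
  by (rule cross_mapc, metis kill_transl)

lemma frag_of_normal: "frag_of (normal j l) = mapc (transl j (- snd (hd l) j)) (frag_of l)"
  by (simp add: normal_def)

text \<open>Normalising a simplex translates it by an amount that depends on the simplex.
  \<open>htp T\<close> commutes with translations in j, which is not in T, and \<psi> is invariant
  under them; so \<psi> after \<open>htp T\<close> does not notice whether normalisation takes place
  before the boundary, after it, or not at all.\<close>

lemma normal_defect:
  fixes \<psi> :: "(('b \<times> ('i \<Rightarrow> 'n::ab_group_add)) list \<Rightarrow>\<^sub>0 int) \<Rightarrow> 'c::ab_group_add"
  assumes \<psi>: "\<And>a b. \<psi> (a - b) = \<psi> a - \<psi> b" and inv: "\<And>a x. \<psi> (mapc (transl j a) x) = \<psi> x"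
    and "j \<notin> set T"
  shows "\<psi> (htp T (hBD (hNR j c) - hNR j (hBD c))) = 0"
proof -
  have nr: "\<psi> (htp T (hNR j x)) = \<psi> (htp T x)" for x
  proof (rule frag_additive_eq[of x UNIV])
    fix l :: "('b \<times> ('i \<Rightarrow> 'n)) list"
    have "\<psi> (htp T (mapc (transl j a) (frag_of l))) = \<psi> (htp T (frag_of l))" for a
      by (simp only: htp_transl[OF assms(3)] inv)
    then show "\<psi> (htp T (hNR j (frag_of l))) = \<psi> (htp T (frag_of l))"
      by (simp add: normal_def)
  qed (auto simp: htp_diff \<psi> frag_extend_diff)
  have bd: "\<psi> (htp T (hBD (hNR j x))) = \<psi> (htp T (hBD x))" for x
  proof (rule frag_additive_eq[of x UNIV])
    fix l :: "('b \<times> ('i \<Rightarrow> 'n)) list"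
    have "hBD (hNR j (frag_of l)) = mapc (transl j (- snd (hd l) j)) (hbd l)"
      by (simp add: normal_def hbd_map)
    then show "\<psi> (htp T (hBD (hNR j (frag_of l)))) = \<psi> (htp T (hBD (frag_of l)))"
      by (simp add: htp_transl[OF assms(3)] inv)
  qed (auto simp: htp_diff \<psi> frag_extend_diff)
  show ?thesis
    by (simp add: htp_diff \<psi> bd nr)
qed

text \<open>For the first index k of the list, \<open>kill k\<close> absorbs the translation in one
  term and \<phi> in the other. For a later index the induction hypothesis is used for \<phi> and
  for \<phi> after \<open>kill k\<close>; hence \<phi> varies in the induction.\<close>

lemma cross_invariant:
  fixes \<phi> :: "(('b \<times> ('i \<Rightarrow> 'n::ab_group_add)) list \<Rightarrow>\<^sub>0 int) \<Rightarrow> 'c::ab_group_add"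
  assumes "\<And>a b. \<phi> (a - b) = \<phi> a - \<phi> b" and "\<And>i a x. i \<in> set T \<Longrightarrow> \<phi> (mapc (transl i a) x) = \<phi> x"
    and "i \<in> set T" and "distinct T"
  shows "\<phi> (cross T (mapc (transl i a) c)) = \<phi> (cross T c)"
  using assms
proof (induction T arbitrary: \<phi>)
  case (Cons k T)
  note \<phi> = Cons.prems(1)
  show ?case
  proof (cases "i = k")
    case True
    then have "i \<notin> set T" using Cons.prems by auto
    then show ?thesis
      using Cons.prems(2)[of i] True
      by (simp add: cross_transl \<phi> mapc_mapc kill_transl_same)
  next
    case False
    then have i: "i \<in> set T" using Cons.prems by auto
    have 1: "\<phi> (cross T (mapc (transl i a) c)) = \<phi> (cross T c)"
      by (rule Cons.IH) (use Cons.prems i in auto)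
    have 2: "\<phi> (mapc (kill k) (cross T (mapc (transl i a) c))) = \<phi> (mapc (kill k) (cross T c))"
    proof (rule Cons.IH[where \<phi> = "\<lambda>x. \<phi> (mapc (kill k) x)"])
      fix i' a x assume "i' \<in> set T"
      then have "i' \<noteq> k" "i' \<in> set (k # T)" using Cons.prems by auto
      then show "\<phi> (mapc (kill k) (mapc (transl i' a) x)) = \<phi> (mapc (kill k) x)"
        using Cons.prems(2)[of i' a "mapc (kill k) x"] by (simp add: mapc_mapc kill_transl)
    qed (use Cons.prems i in \<open>auto simp: frag_extend_diff\<close>)
    show ?thesis by (simp add: \<phi> 1 2)
  qed
qed auto

text \<open>The prism from \<open>kill j\<close> to the identity commutes with translations in the
  other indices. Composing \<phi> with it gives a functional that is still invariant in the rest of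
  the list, as the inductions on T require.\<close>

lemma prism_kill_invariant:
  assumes "i \<noteq> j" "\<And>a x. \<phi> (mapc (transl i a) x) = \<phi> x"
  shows "\<phi> (hPR (kill j) (\<lambda>v. v) (mapc (transl i a) x)) = \<phi> (hPR (kill j) (\<lambda>v. v) x)"
  by (subst hPR_mapc) (use assms in \<open>auto simp: kill_transl\<close>)

lemma htp_invariant:
  fixes \<phi> :: "(('b \<times> ('i \<Rightarrow> 'n::ab_group_add)) list \<Rightarrow>\<^sub>0 int) \<Rightarrow> 'c::ab_group_add"
  assumes "\<And>a b. \<phi> (a - b) = \<phi> a - \<phi> b" and "\<And>i a x. i \<in> set T \<Longrightarrow> \<phi> (mapc (transl i a) x) = \<phi> x"
    and "i \<in> set T" and "distinct T"
  shows "\<phi> (htp T (mapc (transl i a) c)) = \<phi> (htp T c)"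
  using assms
proof (induction T arbitrary: \<phi> c)
  case (Cons j T)
  note \<phi> = Cons.prems(1)
  show ?case
  proof (cases "i = j")
    \<comment> \<open>The operator begins by normalising in j, which absorbs the
      translation.\<close>
    case True
    then show ?thesis
      by (simp add: hNR_transl_same hBD_mapc)
  next
    case False
    then have i: "i \<in> set T" using Cons.prems by auto
    define \<phi>' where "\<phi>' x = \<phi> (hPR (kill j) (\<lambda>v. v) x)" for x
    have \<phi>'1: "\<phi>' (a - b) = \<phi>' a - \<phi>' b" for a b
      by (simp add: \<phi>'_def frag_extend_diff \<phi>)
    have \<phi>'2: "\<phi>' (mapc (transl i a) x) = \<phi>' x" if "i \<in> set T" for i a x
      unfolding \<phi>'_def by (rule prism_kill_invariant) (use that Cons.prems in auto)
    have d: "distinct T" using Cons.prems by auto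
    have h: "\<phi>' (htp T (mapc (transl i a) y)) = \<phi>' (htp T y)" for y
      by (rule Cons.IH[OF \<phi>'1 \<phi>'2 i d])
    show ?thesis
      unfolding htp.simps \<phi>'_def[symmetric]
      by (simp add: hNR_transl[OF False] hBD_mapc \<phi>'1 frag_extend_diff[symmetric] h
          cross_invariant[OF \<phi>'1 \<phi>'2 i d])
  qed
qed auto

lemma keys_hBD:
  assumes "Poly_Mapping.keys c \<subseteq> {l. length l \<le> Suc n \<and> set l \<subseteq> A}"
  shows "Poly_Mapping.keys (hBD c) \<subseteq> {l. length l \<le> n \<and> set l \<subseteq> A}"
  by (rule keys_frag_extend_subset[OF assms]) (use keys_hbd in fastforce)

lemma keys_hNR_length:
  assumes "Poly_Mapping.keys c \<subseteq> {l. length l \<le> n}"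
  shows "Poly_Mapping.keys (hNR j c) \<subseteq> {l. length l \<le> n}"
  by (rule keys_frag_extend_subset[OF assms]) (auto simp: normal_def)

text \<open>Induction on T, where each index costs one vertex. The prism from \<open>kill j\<close>
  to the identity is a homotopy for 1 - \<open>kill j\<close>, but normalisation is not a chain map.
  Its defect \<zeta> has one vertex less than c, so that the induction hypothesis for the shorter
  list applies to \<zeta> and \<open>htp T\<close> corrects the defect. At the bottom only the empty
  simplex remains, which \<phi> kills.\<close>

theorem htp_homotopy:
  fixes \<phi> :: "(('b \<times> ('i \<Rightarrow> 'n::ab_group_add)) list \<Rightarrow>\<^sub>0 int) \<Rightarrow> 'c::ab_group_add"
  assumes "\<And>a b. \<phi> (a - b) = \<phi> a - \<phi> b" and "\<And>i a x. i \<in> set T \<Longrightarrow> \<phi> (mapc (transl i a) x) = \<phi> x"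
    and "\<phi> (frag_of []) = 0" and "distinct T"
    and "Poly_Mapping.keys c \<subseteq> {l. length l \<le> length T}"
  shows "\<phi> (hBD (htp T c)) + \<phi> (htp T (hBD c)) = \<phi> (cross T c)"
  using assms
proof (induction T arbitrary: \<phi> c)
  case Nil
  have \<phi>0: "\<phi> 0 = 0" using Nil.prems(1)[of 0 0] by simp
  have "\<phi> c = 0"
    by (rule frag_additive_eq[of c "{[]}" \<phi> "\<lambda>_. 0"]) (use Nil.prems in auto)
  then show ?case using \<phi>0 by simp
next
  case (Cons j T)
  note \<phi> = Cons.prems(1)
  have jT: "j \<notin> set T" and d: "distinct T" using Cons.prems by auto
  define \<zeta> where "\<zeta> = hBD (hNR j c) - hNR j (hBD c)"
  define u where "u = cross T (hNR j c) - htp T \<zeta>"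
  define P :: "(('b \<times> ('i \<Rightarrow> 'n)) list \<Rightarrow>\<^sub>0 int) \<Rightarrow> (('b \<times> ('i \<Rightarrow> 'n)) list \<Rightarrow>\<^sub>0 int)"
    where "P = hPR (kill j) (\<lambda>v. v)"
  have Pd: "P (a - b) = P a - P b" for a b by (simp add: P_def frag_extend_diff)
  have H: "htp (j # T) c = P u" by (simp add: P_def u_def \<zeta>_def)
  have HB: "htp (j # T) (hBD c) = P (cross T (hNR j (hBD c)) - htp T (hBD (hNR j (hBD c))))"
    by (simp add: P_def hBD_hBD)
  define \<phi>' where "\<phi>' x = \<phi> (P x)" for x
  have \<phi>'1: "\<phi>' (a - b) = \<phi>' a - \<phi>' b" for a b
    by (simp add: \<phi>'_def Pd \<phi>)
  have \<phi>'2: "\<phi>' (mapc (transl i a) x) = \<phi>' x" if "i \<in> set T" for i a x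
    unfolding \<phi>'_def P_def by (rule prism_kill_invariant) (use that Cons.prems in auto)
  have \<phi>0: "\<phi> 0 = 0" using \<phi>[of 0 0] by simp
  have \<phi>'3: "\<phi>' (frag_of []) = 0" by (simp add: \<phi>'_def P_def \<phi>0)
  have len: "Poly_Mapping.keys x \<subseteq> {l. length l \<le> Suc n} \<Longrightarrow>
      Poly_Mapping.keys (hBD x) \<subseteq> {l. length l \<le> n}"
    for x :: "('b \<times> ('i \<Rightarrow> 'n)) list \<Rightarrow>\<^sub>0 int" and n
    using keys_hBD[of x n UNIV] by auto
  have "Poly_Mapping.keys c \<subseteq> {l. length l \<le> Suc (length T)}" using Cons.prems by auto
  then have lz: "Poly_Mapping.keys \<zeta> \<subseteq> {l. length l \<le> length T}"
    unfolding \<zeta>_def by (intro keys_diff_subset len keys_hNR_length)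
  have IH: "\<phi>' (hBD (htp T \<zeta>)) + \<phi>' (htp T (hBD \<zeta>)) = \<phi>' (cross T \<zeta>)"
    by (rule Cons.IH[OF \<phi>'1 \<phi>'2 \<phi>'3 d lz])
  have inv: "\<phi> (mapc (transl j a) x) = \<phi> x" for a x using Cons.prems(2)[of j] by auto
  have z1: "\<phi> (htp T \<zeta>) = 0"
    unfolding \<zeta>_def by (rule normal_defect[OF \<phi> inv jT])
  have z2: "\<phi> (mapc (kill j) (htp T \<zeta>)) = 0"
    unfolding \<zeta>_def
    by (rule normal_defect[where \<psi> = "\<lambda>x. \<phi> (mapc (kill j) x)"])
      (auto simp: \<phi> frag_extend_diff mapc_mapc kill_transl_same jT)
  \<comment> \<open>On the full cross effect normalisation is invisible: it is a translation in j,
    absorbed by \<phi> or by \<open>kill j\<close>.\<close>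
  have k: "\<phi> (cross (j # T) (hNR j c)) = \<phi> (cross (j # T) c)"
  proof (rule frag_additive_eq[of c UNIV])
    fix l :: "('b \<times> ('i \<Rightarrow> 'n)) list"
    have "cross T (frag_of (normal j l)) = mapc (transl j (- snd (hd l) j)) (cross T (frag_of l))"
      by (simp only: frag_of_normal cross_transl[OF jT])
    then show "\<phi> (cross (j # T) (hNR j (frag_of l))) = \<phi> (cross (j # T) (frag_of l))"
      by (simp add: \<phi> inv mapc_mapc kill_transl_same)
  qed (auto simp: \<phi> frag_extend_diff cross_diff)
  have pr: "hBD (P u) = u - mapc (kill j) u - P (hBD u)"
    using hPR_homotopy[of "kill j" "\<lambda>v. v" u] mapc_id[of u]
    by (simp add: P_def algebra_simps)
  have u1: "\<phi> u - \<phi> (mapc (kill j) u) = \<phi> (cross (j # T) c)"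
    using k by (simp add: u_def \<phi> frag_extend_diff z1 z2)
  have crossB: "hBD (cross T x) = cross T (hBD x)" for x :: "('b \<times> ('i \<Rightarrow> 'n)) list \<Rightarrow>\<^sub>0 int"
    by (induction T) (auto simp: frag_extend_diff hBD_mapc)
  have bz: "hBD \<zeta> = 0 - hBD (hNR j (hBD c))"
    by (simp add: \<zeta>_def frag_extend_diff hBD_hBD)
  have "\<phi>' (hBD u) = \<phi>' (cross T (hBD (hNR j c))) - \<phi>' (hBD (htp T \<zeta>))"
    by (simp add: u_def frag_extend_diff \<phi>'1 crossB)
  \<comment> \<open>In what follows the terms with \<open>hBD (hNR j c)\<close> cancel; what
    survives is the homotopy applied to the boundary of c.\<close>
  also have "\<phi>' (hBD (htp T \<zeta>)) = \<phi>' (cross T \<zeta>) - \<phi>' (htp T (hBD \<zeta>))"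
    using IH by (simp add: algebra_simps)
  also have "\<phi>' (htp T (hBD \<zeta>)) = - \<phi>' (htp T (hBD (hNR j (hBD c))))"
    unfolding bz htp_diff \<phi>'1 htp_0 using \<phi>'1[of 0 0] by simp
  also have "\<phi>' (cross T \<zeta>) = \<phi>' (cross T (hBD (hNR j c))) - \<phi>' (cross T (hNR j (hBD c)))"
    by (simp add: \<zeta>_def cross_diff \<phi>'1)
  finally have "\<phi>' (hBD u) = \<phi> (htp (j # T) (hBD c))"
    unfolding HB \<phi>'_def[symmetric] \<phi>'1 by simp
  then show ?case
    unfolding H pr \<phi> u1[symmetric] \<phi>'_def by simp
qed

lemma keys_cross:
  assumes "Poly_Mapping.keys c \<subseteq> {l. length l = n \<and> fst ` set l \<subseteq> A}"
  shows "Poly_Mapping.keys (cross T c) \<subseteq> {l. length l = n \<and> fst ` set l \<subseteq> A}"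
proof (induction T)
  case (Cons j T)
  have "Poly_Mapping.keys (mapc (kill j) (cross T c)) \<subseteq> {l. length l = n \<and> fst ` set l \<subseteq> A}"
    by (rule keys_frag_extend_subset[OF Cons]) (auto simp: kill_def)
  with Cons show ?case unfolding cross.simps by (intro keys_diff_subset)
qed (use assms in auto)

lemma keys_hNR:
  assumes "Poly_Mapping.keys c \<subseteq> {l. length l = n \<and> fst ` set l \<subseteq> A}"
  shows "Poly_Mapping.keys (hNR j c) \<subseteq> {l. length l = n \<and> fst ` set l \<subseteq> A}"
  by (rule keys_frag_extend_subset[OF assms]) (auto simp: normal_def transl_def)

lemma keys_htp:
  fixes c :: "('b \<times> ('i \<Rightarrow> 'n::ab_group_add)) list \<Rightarrow>\<^sub>0 int"
  assumes "Poly_Mapping.keys c \<subseteq> {l. length l = n \<and> fst ` set l \<subseteq> A}"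
  shows "Poly_Mapping.keys (htp T c) \<subseteq> {l. length l = Suc n \<and> fst ` set l \<subseteq> A}"
  using assms
proof (induction T arbitrary: c n)
  case (Cons j T)
  have bd: "Poly_Mapping.keys (hBD x) \<subseteq> {l. Suc (length l) = n \<and> fst ` set l \<subseteq> A}"
    if "Poly_Mapping.keys x \<subseteq> {l. length l = n \<and> fst ` set l \<subseteq> A}"
    for x :: "('b \<times> ('i \<Rightarrow> 'n)) list \<Rightarrow>\<^sub>0 int"
    by (rule keys_frag_extend_subset[OF that]) (use keys_hbd in fastforce)
  have "Poly_Mapping.keys (htp T (hBD (hNR j c) - hNR j (hBD c)))
      \<subseteq> {l. length l = n \<and> fst ` set l \<subseteq> A}"
  proof (cases n)
    \<comment> \<open>A chain without vertices has no boundary, so the defect vanishes; there is no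
      smaller length to appeal to.\<close>
    case 0
    have z: "x = 0" if "Poly_Mapping.keys x \<subseteq> {}" for x :: "'z \<Rightarrow>\<^sub>0 int" using that by auto
    have "hBD c = 0" "hBD (hNR j c) = 0"
      using bd[OF Cons.prems] bd[OF keys_hNR[OF Cons.prems, of j]] 0 by auto
    then show ?thesis by (simp add: htp_0)
  next
    case (Suc k)
    then show ?thesis
      using bd[OF Cons.prems] bd[OF keys_hNR[OF Cons.prems, of j]]
      by (intro order.trans[OF Cons.IH[of _ k]] keys_diff_subset keys_hNR) auto
  qed
  moreover have "Poly_Mapping.keys (cross T (hNR j c)) \<subseteq> {l. length l = n \<and> fst ` set l \<subseteq> A}"
    by (intro keys_cross keys_hNR Cons.prems)
  ultimately have "Poly_Mapping.keys (cross T (hNR j c) - htp T (hBD (hNR j c) - hNR j (hBD c)))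
      \<subseteq> {l. length l = n \<and> fst ` set l \<subseteq> A}"
    by (intro keys_diff_subset)
  then show ?case
    unfolding htp.simps
  proof (rule keys_frag_extend_subset)
    fix l :: "('b \<times> ('i \<Rightarrow> 'n)) list" assume l: "l \<in> {l. length l = n \<and> fst ` set l \<subseteq> A}"
    have "Poly_Mapping.keys (prism (kill j) (\<lambda>v. v) l)
      \<subseteq> {l'. length l' = Suc (length l) \<and> set l' \<subseteq> kill j ` set l \<union> (\<lambda>v. v) ` set l}"
      by (rule keys_prism)
    also have "\<dots> \<subseteq> {l'. length l' = Suc n \<and> fst ` set l' \<subseteq> A}"
      using l by (fastforce simp: kill_def)
    finally show "Poly_Mapping.keys (prism (kill j) (\<lambda>v. v) l) \<subseteq> \<dots>" .
  qed
qed auto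

section \<open>The bar complex of a set with a group action\<close>

definition omit :: "nat \<Rightarrow> 'v list \<Rightarrow> 'v list" where
  "omit i l = take i l @ drop (Suc i) l"

text \<open>The link to the bar differential, which is an explicit alternating sum over
  faces.\<close>

lemma hbd_eq_sum: "hbd l = (\<Sum>i<length l. frag_cmul ((-1) ^ i) (frag_of (omit i l)))"
proof (induction l)
  case (Cons v vs)
  have "cone v (hbd vs) = (\<Sum>i<length vs. frag_cmul ((-1) ^ i) (frag_of (omit (Suc i) (v # vs))))"
    unfolding Cons by (simp add: frag_extend_sum frag_extend_cmul omit_def comp_def)
  moreover have "(\<Sum>i<length (v # vs). frag_cmul ((-1) ^ i) (frag_of (omit i (v # vs))))
    = frag_of vs + (\<Sum>i<length vs. - frag_cmul ((-1) ^ i) (frag_of (omit (Suc i) (v # vs))))"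
    by (simp add: sum.lessThan_Suc_shift omit_def del: sum.lessThan_Suc)
  ultimately show ?case
    unfolding sum_negf by simp
qed auto

lemma length_omit: "i < length l \<Longrightarrow> length (omit i l) = length l - 1"
  by (auto simp: omit_def)

lemma nth_omit: "i < length l \<Longrightarrow> k < length l - 1 \<Longrightarrow> omit i l ! k = (if k < i then l ! k else l ! Suc k)"
  by (auto simp: omit_def nth_append)

lemma hd_omit: "i < length l \<Longrightarrow> 2 \<le> length l \<Longrightarrow> hd (omit i l) = (if i = 0 then l ! 1 else hd l)"
  by (cases l rule: remdups_adj.cases; cases i) (auto simp: omit_def)

text \<open>Bar chains with coefficients in the permutation module Z[X] are free on X times the
  bars. This covers Z[\<open>A_bar\<close>], the trivial module (a point) and, through the free
  abelian group on its elements, any module.\<close>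

locale gset = group G for G (structure) +
  fixes X :: "'x set" and act :: "'x \<Rightarrow> 'a \<Rightarrow> 'x"
  assumes act_closed: "x \<in> X \<Longrightarrow> g \<in> carrier G \<Longrightarrow> act x g \<in> X"
    and act_one: "x \<in> X \<Longrightarrow> act x \<one> = x"
    and act_mult: "x \<in> X \<Longrightarrow> g \<in> carrier G \<Longrightarrow> h \<in> carrier G \<Longrightarrow> act x (g \<otimes> h) = act (act x g) h"
begin

definition bars :: "nat \<Rightarrow> ('x \<times> 'a list) set" where
  "bars n = X \<times> {gs. length gs = n \<and> set gs \<subseteq> carrier G}"

text \<open>Degree zero is set apart: \<open>hd []\<close> has no meaning, and the bar complex is
  not augmented.\<close>

definition dgen :: "'x \<times> 'a list \<Rightarrow> (('x \<times> 'a list) \<Rightarrow>\<^sub>0 int)" where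
  "dgen b = (if snd b = [] then 0 else
     (\<Sum>i\<in>{0..length (snd b)}. frag_cmul ((-1) ^ i)
       (frag_of (if i = 0 then act (fst b) (hd (snd b)) else fst b, bar_face G i (snd b)))))"

abbreviation dB where "dB \<equiv> frag_extend dgen"

definition quots :: "'a list \<Rightarrow> 'a list" where
  "quots l = map (\<lambda>k. inv (l ! k) \<otimes> l ! Suc k) [0..<length l - 1]"

text \<open>The class of x tensor (v_0, ..., v_n) over the group, in inhomogeneous coordinates: v_0
  moves into the coefficient. The empty simplex goes to 0, which drops the augmentation;
  \<open>lift \<one>\<close> provides a section.\<close>

definition EVl :: "'x \<Rightarrow> 'a list \<Rightarrow> (('x \<times> 'a list) \<Rightarrow>\<^sub>0 int)" where
  "EVl x l = (if l = [] then 0 else frag_of (act x (hd l), quots l))"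

abbreviation EV where "EV x \<equiv> frag_extend (EVl x)"

primrec lift :: "'a \<Rightarrow> 'a list \<Rightarrow> 'a list" where
  "lift v [] = [v]"
| "lift v (g # gs) = v # lift (v \<otimes> g) gs"

lemma nth_quots: "Suc k < length l \<Longrightarrow> quots l ! k = inv (l ! k) \<otimes> l ! Suc k"
  by (simp add: quots_def less_diff_conv)

lemma quots_Cons: "quots (v # w # l) = (inv v \<otimes> w) # quots (w # l)"
proof (rule nth_equalityI)
  fix k assume "k < length (quots (v # w # l))"
  then show "quots (v # w # l) ! k = ((inv v \<otimes> w) # quots (w # l)) ! k"
    by (cases k) (simp_all add: quots_def del: upt_Suc)
qed (simp add: quots_def)

lemma lift_nonempty: "lift v gs \<noteq> []"
  by (cases gs) auto

lemma hd_lift: "hd (lift v gs) = v"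
  by (cases gs) auto

lemma length_lift: "length (lift v gs) = Suc (length gs)"
  by (induction gs arbitrary: v) auto

lemma set_lift: "v \<in> carrier G \<Longrightarrow> set gs \<subseteq> carrier G \<Longrightarrow> set (lift v gs) \<subseteq> carrier G"
  by (induction gs arbitrary: v) auto

lemma quots_lift: "v \<in> carrier G \<Longrightarrow> set gs \<subseteq> carrier G \<Longrightarrow> quots (lift v gs) = gs"
proof (induction gs arbitrary: v)
  case Nil
  then show ?case by (simp add: quots_def)
next
  case (Cons g gs)
  have "lift v (g # gs) = v # (v \<otimes> g) # tl (lift (v \<otimes> g) gs)"
    by (cases gs) auto
  moreover have "(v \<otimes> g) # tl (lift (v \<otimes> g) gs) = lift (v \<otimes> g) gs"
    by (cases gs) auto
  moreover have "inv v \<otimes> (v \<otimes> g) = g" using Cons by (simp add: m_assoc[symmetric])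
  moreover have "quots (lift (v \<otimes> g) gs) = gs" using Cons by simp
  ultimately show ?case by (metis quots_Cons)
qed

lemma EVl_lift: "x \<in> X \<Longrightarrow> set gs \<subseteq> carrier G \<Longrightarrow> EVl x (lift \<one> gs) = frag_of (x, gs)"
  by (simp add: EVl_def lift_nonempty hd_lift quots_lift act_one)

lemma lift_quots:
  assumes "l \<noteq> []" "set l \<subseteq> carrier G"
  shows "lift (hd l) (quots l) = l"
  using assms
proof (induction l rule: induct_list012)
  case (3 v w l)
  then have "v \<otimes> (inv v \<otimes> w) = w" by (simp add: m_assoc[symmetric])
  with 3 show ?case by (simp add: quots_Cons)
qed (auto simp: quots_def)

lemma map_lift: "g \<in> carrier G \<Longrightarrow> v \<in> carrier G \<Longrightarrow> set gs \<subseteq> carrier G \<Longrightarrow>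
    map ((\<otimes>) g) (lift v gs) = lift (g \<otimes> v) gs"
  by (induction gs arbitrary: v) (auto simp: m_assoc)

lemma quots_closed: "set l \<subseteq> carrier G \<Longrightarrow> set (quots l) \<subseteq> carrier G"
  by (fastforce simp: quots_def subset_iff)

lemma length_quots: "length (quots l) = length l - 1"
  by (simp add: quots_def)

lemma quots_map_left:
  assumes "g \<in> carrier G" "set l \<subseteq> carrier G"
  shows "quots (map ((\<otimes>) g) l) = quots l"
proof (rule nth_equalityI)
  fix k assume "k < length (quots (map ((\<otimes>) g) l))"
  then have k: "Suc k < length l" by (simp add: length_quots)
  then have "l ! k \<in> carrier G" "l ! Suc k \<in> carrier G" using assms(2) by (auto simp: subset_iff)
  then have "inv (g \<otimes> l ! k) \<otimes> (g \<otimes> l ! Suc k) = inv (l ! k) \<otimes> l ! Suc k"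
    using assms(1) by (simp add: inv_mult_group m_assoc) (simp add: m_assoc[symmetric])
  with k show "quots (map ((\<otimes>) g) l) ! k = quots l ! k" by (simp add: nth_quots)
qed (simp add: length_quots)

text \<open>The relation x tensor g l = x g tensor l of the tensor product: quotients do not change
  under left translation, and only the first vertex feels g.\<close>

lemma EVl_map_left:
  assumes "x \<in> X" "g \<in> carrier G" "set l \<subseteq> carrier G"
  shows "EVl x (map ((\<otimes>) g) l) = EVl (act x g) l"
proof (cases l)
  case (Cons v vs)
  with assms show ?thesis
    unfolding EVl_def quots_map_left[OF assms(2,3)] by (simp add: act_mult)
qed (simp add: EVl_def)

text \<open>At an inner vertex w the quotients on both sides multiply, (v^-1 w)(w^-1 u) = v^-1 u; at
  either end one quotient disappears.\<close>

lemma quots_omit: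
  assumes l: "set l \<subseteq> carrier G" and "2 \<le> length l" "i < length l"
  shows "quots (omit i l) = bar_face G i (quots l)"
proof (rule nth_equalityI)
  have len: "length (quots l) = length l - 1" by (rule length_quots)
  have "quots l \<noteq> []" using len assms(2) by auto
  then have lenf: "length (bar_face G i (quots l)) = length l - 2"
    using assms(2,3) len by (auto simp: bar_face_def)
  then show "length (quots (omit i l)) = length (bar_face G i (quots l))"
    using assms by (simp add: length_quots length_omit)
  fix k assume "k < length (quots (omit i l))"
  then have k: "Suc (Suc k) < length l" using assms by (simp add: length_quots length_omit)
  have c: "l ! j \<in> carrier G" if "j < length l" for j using that l by (auto simp: subset_iff)
  have nq: "quots (omit i l) ! k = inv (omit i l ! k) \<otimes> omit i l ! Suc k"
    using k assms by (simp add: nth_quots length_omit)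
  have q: "quots l ! j = inv (l ! j) \<otimes> l ! Suc j" if "Suc j < length l" for j
    using that by (rule nth_quots)
  have m: "(inv (l ! k) \<otimes> l ! Suc k) \<otimes> (inv (l ! Suc k) \<otimes> l ! Suc (Suc k))
      = inv (l ! k) \<otimes> l ! Suc (Suc k)"
  proof -
    have "l ! Suc k \<otimes> (inv (l ! Suc k) \<otimes> l ! Suc (Suc k)) = l ! Suc (Suc k)"
      using k c by (simp add: m_assoc[symmetric])
    then show ?thesis using k c by (simp add: m_assoc)
  qed
  show "quots (omit i l) ! k = bar_face G i (quots l) ! k"
  proof (cases "i = 0 \<or> i = length l - 1")
    case True
    then show ?thesis
    proof
      assume "i = 0"
      then show ?thesis unfolding nq using k assms(2,3) len
        by (simp add: nth_omit bar_face_def q nth_tl)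
    next
      assume i: "i = length l - 1"
      have "Suc k < length l - Suc 0" using k by linarith
      with i show ?thesis unfolding nq using k assms(2,3) len
        by (simp add: nth_omit bar_face_def q nth_butlast)
    qed
  next
    case False
    then have f: "bar_face G i (quots l) =
      take (i - 1) (quots l) @ [quots l ! (i - 1) \<otimes> quots l ! i] @ drop (i + 1) (quots l)"
      using len by (simp add: bar_face_def)
    consider "Suc k < i" | "Suc k = i" | "i \<le> k" by linarith
    then show ?thesis
    proof cases
      case 1
      then have "k < i - 1" by linarith
      then have "bar_face G i (quots l) ! k = quots l ! k"
        unfolding f using k len False assms(3) by (simp add: nth_append)
      then show ?thesis using k 1 assms(3)
        unfolding nq by (simp add: nth_omit q)
    next
      case 2
      then have "k = i - 1" by linarith
      then have "bar_face G i (quots l) ! k = quots l ! k \<otimes> quots l ! Suc k"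
        unfolding f using k len False assms(3) by (auto simp: nth_append)
      then show ?thesis using k 2 assms(3) m
        unfolding nq by (simp add: nth_omit q)
    next
      case 3
      then have "k - (i - 1) = Suc (k - i)" using False by auto
      then have "bar_face G i (quots l) ! k = quots l ! Suc k"
        unfolding f using 3 k len False assms(3) by (auto simp: nth_append nth_Cons')
      then show ?thesis using k 3 assms(3)
        unfolding nq by (simp add: nth_omit q)
    qed
  qed
qed

text \<open>Omitting v_0 changes the coefficient from x v_0 to x v_1 = (x v_0)(v_0^-1 v_1), which is
  exactly the action in face zero of the bar differential.\<close>

lemma dgen_EVl:
  assumes "x \<in> X" "set l \<subseteq> carrier G"
  shows "dB (EVl x l) = EV x (hbd l)"
proof (cases "length l < 2")
  case True
  then consider "l = []" | v where "l = [v]" by (cases l rule: remdups_adj.cases) auto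
  then show ?thesis by cases (auto simp: EVl_def dgen_def quots_def)
next
  case False
  then have len: "2 \<le> length l" and ne: "l \<noteq> []" by auto
  then have q: "quots l \<noteq> []" using length_quots[of l] by auto
  have r: "{0..length (quots l)} = {..<length l}"
    using len by (auto simp: length_quots)
  have "l ! 0 \<in> set l" "l ! 1 \<in> set l" using len by (auto intro!: nth_mem)
  then have l01: "l ! 0 \<in> carrier G" "l ! 1 \<in> carrier G" using assms(2) by blast+
  have "hd (quots l) = inv (l ! 0) \<otimes> l ! 1" using q len by (simp add: hd_conv_nth quots_def)
  then have "act (act x (hd l)) (hd (quots l)) = act x (l ! 1)"
    using l01 ne assms(1)
    by (simp add: hd_conv_nth act_mult[symmetric]) (simp add: m_assoc[symmetric])
  then have h: "act x (hd (omit i l)) =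
      (if i = 0 then act (act x (hd l)) (hd (quots l)) else act x (hd l))" if "i < length l" for i
    using hd_omit[OF that len] by simp
  have e: "EVl x (omit i l) = frag_of (if i = 0 then act (act x (hd l)) (hd (quots l)) else act x (hd l),
     bar_face G i (quots l))" if "i < length l" for i
  proof -
    have "omit i l \<noteq> []" using length_omit[OF that] len by auto
    then show ?thesis
      unfolding EVl_def h[OF that] quots_omit[OF assms(2) len that] by simp
  qed
  have "dB (EVl x l) = (\<Sum>i<length l. frag_cmul ((-1) ^ i) (EVl x (omit i l)))"
    using q by (simp add: EVl_def[of x l] ne dgen_def r e cong: if_cong)
  also have "\<dots> = EV x (hbd l)"
    by (simp add: hbd_eq_sum frag_extend_sum comp_def frag_extend_cmul)
  finally show ?thesis .
qed

lemma dB_EV: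
  assumes "x \<in> X" "Poly_Mapping.keys c \<subseteq> lists (carrier G)"
  shows "dB (EV x c) = EV x (hBD c)"
  by (rule frag_additive_eq[OF assms(2)]) (auto simp: frag_extend_diff dgen_EVl assms(1) lists_eq_set)

lemma keys_EVl:
  assumes "x \<in> X" "set l \<subseteq> carrier G" "length l = Suc n"
  shows "Poly_Mapping.keys (EVl x l) \<subseteq> bars n"
proof -
  have "hd l \<in> carrier G" using assms(2,3) by (cases l) auto
  then show ?thesis
    using assms quots_closed[OF assms(2)]
    by (auto simp: EVl_def bars_def act_closed length_quots)
qed

lemma keys_EV:
  assumes "x \<in> X" "Poly_Mapping.keys c \<subseteq> {l. length l = Suc n \<and> set l \<subseteq> carrier G}"
  shows "Poly_Mapping.keys (EV x c) \<subseteq> bars n"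
  by (rule keys_frag_extend_subset[OF assms(2)]) (use assms(1) keys_EVl in auto)

lemma EV_mapc_left:
  assumes "x \<in> X" "g \<in> carrier G" "Poly_Mapping.keys c \<subseteq> lists (carrier G)"
  shows "EV x (mapc ((\<otimes>) g) c) = EV (act x g) c"
  by (rule frag_additive_eq[OF assms(3)]) (auto simp: frag_extend_diff EVl_map_left assms lists_eq_set)

lemma keys_hbd_carrier:
  assumes "set l \<subseteq> carrier G"
  shows "Poly_Mapping.keys (hbd l) \<subseteq> lists (carrier G)"
  using keys_hbd[of l] assms by (auto simp: lists_eq_set)

text \<open>An operator \<open>q\<close> on homogeneous chains that is invariant under left translations induces an
  operator on the bar complex.\<close>

lemma descent:
  fixes q :: "'x \<Rightarrow> 'a list \<Rightarrow> ('c \<Rightarrow>\<^sub>0 int)"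
  assumes q0: "\<And>x. x \<in> X \<Longrightarrow> q x [] = 0"
    and inv: "\<And>x g l. x \<in> X \<Longrightarrow> g \<in> carrier G \<Longrightarrow> set l \<subseteq> carrier G \<Longrightarrow> q x (map ((\<otimes>) g) l) = q (act x g) l"
    and "x \<in> X" "set gs \<subseteq> carrier G"
  shows "frag_extend (\<lambda>b. q (fst b) (lift \<one> (snd b))) (dgen (x, gs)) = frag_extend (q x) (hbd (lift \<one> gs))"
proof -
  \<comment> \<open>Translating a simplex so that it starts at the unit moves its first vertex into
    the coefficient; by invariance \<open>q\<close> takes the same value there.\<close>
  have e: "frag_extend (\<lambda>b. q (fst b) (lift \<one> (snd b))) (EVl x l) = q x l"
    if l: "set l \<subseteq> carrier G" for l
  proof (cases "l = []")
    case False
    then have h: "hd l \<in> carrier G" using l by (cases l) auto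
    have "q x l = q x (map ((\<otimes>) (hd l)) (lift \<one> (quots l)))"
      using h l False by (simp add: map_lift quots_closed lift_quots)
    also have "\<dots> = q (act x (hd l)) (lift \<one> (quots l))"
      by (rule inv) (use assms h l set_lift quots_closed in auto)
    finally show ?thesis using False by (simp add: EVl_def)
  qed (simp add: EVl_def q0 assms)
  have s: "set (lift \<one> gs) \<subseteq> carrier G" using assms(4) by (simp add: set_lift)
  have "frag_extend (\<lambda>b. q (fst b) (lift \<one> (snd b))) (dgen (x, gs))
      = frag_extend (\<lambda>b. q (fst b) (lift \<one> (snd b))) (EV x (hbd (lift \<one> gs)))"
    using dgen_EVl[OF assms(3) s] EVl_lift[OF assms(3,4)] by simp
  also have "\<dots> = frag_extend (q x) (hbd (lift \<one> gs))"
    by (rule frag_additive_eq[OF keys_hbd_carrier[OF s]]) (auto simp: frag_extend_diff e lists_eq_set)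
  finally show ?thesis .
qed

lemma bars_EV:
  assumes "b \<in> bars n"
  obtains x gs where "b = (x, gs)" "x \<in> X" "set gs \<subseteq> carrier G" "length gs = n"
    "frag_of b = EVl x (lift \<one> gs)" "set (lift \<one> gs) \<subseteq> carrier G" "length (lift \<one> gs) = Suc n"
  using assms EVl_lift by (cases b) (auto simp: bars_def set_lift length_lift)

lemma keys_dgen:
  assumes "b \<in> bars (Suc n)"
  shows "Poly_Mapping.keys (dgen b) \<subseteq> bars n"
proof -
  obtain x gs where b: "b = (x, gs)" "x \<in> X" "set gs \<subseteq> carrier G" "frag_of b = EVl x (lift \<one> gs)"
    "set (lift \<one> gs) \<subseteq> carrier G" "length (lift \<one> gs) = Suc (Suc n)"
    using bars_EV[OF assms] by metis
  have "dgen b = EV x (hbd (lift \<one> gs))"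
    using dgen_EVl[OF b(2,5)] b(4)[symmetric] by simp
  moreover have "Poly_Mapping.keys (hbd (lift \<one> gs)) \<subseteq> {l. length l = Suc n \<and> set l \<subseteq> carrier G}"
    using keys_hbd[of "lift \<one> gs"] b(5,6) by auto
  ultimately show ?thesis using keys_EV[OF b(2)] by simp
qed

lemma dB_dgen:
  assumes "b \<in> bars n"
  shows "dB (dgen b) = 0"
proof -
  obtain x gs where b: "b = (x, gs)" "x \<in> X" "frag_of b = EVl x (lift \<one> gs)"
    "set (lift \<one> gs) \<subseteq> carrier G"
    using bars_EV[OF assms] by metis
  have "dgen b = EV x (hbd (lift \<one> gs))"
    using dgen_EVl[OF b(2,4)] b(3)[symmetric] by simp
  then show ?thesis
    using dB_EV[OF b(2) keys_hbd_carrier[OF b(4)]] by (simp add: hBD_hbd)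
qed

lemma keys_dB: "Poly_Mapping.keys c \<subseteq> bars (Suc n) \<Longrightarrow> Poly_Mapping.keys (dB c) \<subseteq> bars n"
  by (erule keys_frag_extend_subset) (rule keys_dgen)

lemma dB_dB: "Poly_Mapping.keys c \<subseteq> bars n \<Longrightarrow> dB (dB c) = 0"
  by (rule frag_additive_eq[where g = "\<lambda>_. 0"]) (auto simp: frag_extend_diff dB_dgen)

definition Z :: "nat \<Rightarrow> (('x \<times> 'a list) \<Rightarrow>\<^sub>0 int) set" where
  "Z n = {c. Poly_Mapping.keys c \<subseteq> bars n \<and> dB c = 0}"

definition Bd :: "nat \<Rightarrow> (('x \<times> 'a list) \<Rightarrow>\<^sub>0 int) set" where
  "Bd n = dB ` {b. Poly_Mapping.keys b \<subseteq> bars (Suc n)}"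

lemma Bd_0: "0 \<in> Bd n"
  by (auto simp: Bd_def intro!: image_eqI[of _ _ 0])

lemma Bd_diff: "a \<in> Bd n \<Longrightarrow> b \<in> Bd n \<Longrightarrow> a - b \<in> Bd n"
proof (unfold Bd_def, elim imageE, goal_cases)
  case (1 u v)
  then show ?case
    by (intro image_eqI[of _ _ "u - v"]) (auto simp: frag_extend_diff intro: keys_diff_subset[THEN subsetD])
qed

lemma Bd_uminus: "a \<in> Bd n \<Longrightarrow> - a \<in> Bd n"
  using Bd_diff[OF Bd_0] by force

lemma Bd_add: "a \<in> Bd n \<Longrightarrow> b \<in> Bd n \<Longrightarrow> a + b \<in> Bd n"
  using Bd_diff[OF _ Bd_uminus] by force

lemma chain_homotopy:
  fixes h f g
  assumes "\<And>b. b \<in> bars n \<Longrightarrow> Poly_Mapping.keys (h b) \<subseteq> bars (Suc n)"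
    and "\<And>b. b \<in> bars n \<Longrightarrow> dB (h b) + frag_extend h (dgen b) = f b - g b"
    and "z \<in> Z n"
  shows "frag_extend f z - frag_extend g z \<in> Bd n"
proof -
  have k: "Poly_Mapping.keys z \<subseteq> bars n" and d: "dB z = 0" using assms(3) by (auto simp: Z_def)
  have "dB (frag_extend h z) + frag_extend h (dB z) = frag_extend f z - frag_extend g z"
    by (rule frag_additive_eq[OF k]) (auto simp: frag_extend_diff assms(2))
  then have "dB (frag_extend h z) = frag_extend f z - frag_extend g z" by (simp add: d)
  moreover have "Poly_Mapping.keys (frag_extend h z) \<subseteq> bars (Suc n)"
    by (rule keys_frag_extend_subset[OF k]) (rule assms(1))
  ultimately show ?thesis unfolding Bd_def by (metis (mono_tags) imageI mem_Collect_eq)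
qed

section \<open>Conjugation acts as the identity on homology\<close>

definition conj :: "'a \<Rightarrow> 'x \<times> 'a list \<Rightarrow> 'x \<times> 'a list" where
  "conj s b = (act (fst b) s, map (\<lambda>g. inv s \<otimes> g \<otimes> s) (snd b))"

lemma EVl_map_right:
  assumes "x \<in> X" "s \<in> carrier G" "set gs \<subseteq> carrier G"
  shows "EVl x (map (\<lambda>v. v \<otimes> s) (lift \<one> gs)) = frag_of (conj s (x, gs))"
proof -
  let ?l = "lift \<one> gs"
  have l: "set ?l \<subseteq> carrier G" using assms by (simp add: set_lift)
  have "quots (map (\<lambda>v. v \<otimes> s) ?l) = map (\<lambda>g. inv s \<otimes> g \<otimes> s) (quots ?l)"
  proof (rule nth_equalityI)
    fix k assume "k < length (quots (map (\<lambda>v. v \<otimes> s) ?l))"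
    then have k: "Suc k < length ?l" by (simp add: length_quots)
    then have "?l ! k \<in> carrier G" "?l ! Suc k \<in> carrier G" using l by (auto simp: subset_iff)
    then have "inv (?l ! k \<otimes> s) \<otimes> (?l ! Suc k \<otimes> s) = inv s \<otimes> (inv (?l ! k) \<otimes> ?l ! Suc k) \<otimes> s"
      using assms(2) by (simp add: inv_mult_group m_assoc)
    with k show "quots (map (\<lambda>v. v \<otimes> s) ?l) ! k = map (\<lambda>g. inv s \<otimes> g \<otimes> s) (quots ?l) ! k"
      using nth_quots[OF k] by (simp add: nth_quots length_quots)
  qed (simp add: length_quots)
  moreover have "hd (map (\<lambda>v. v \<otimes> s) ?l) = s"
    using assms by (simp add: hd_map lift_nonempty hd_lift)
  ultimately show ?thesis
    using assms by (simp add: EVl_def conj_def lift_nonempty quots_lift)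
qed

text \<open>Right translation of all vertices by s commutes with left translation and becomes
  \<open>conj s\<close> on bars, so the prism between the identity and it descends.\<close>

lemma conj_homologous:
  assumes s: "s \<in> carrier G" and z: "z \<in> Z n"
  shows "frag_extend (\<lambda>b. frag_of (conj s b)) z - z \<in> Bd n"
proof -
  let ?P = "prism (\<lambda>v. v) (\<lambda>v. v \<otimes> s)"
  have kp: "Poly_Mapping.keys (?P l) \<subseteq> {l'. length l' = Suc (length l) \<and> set l' \<subseteq> carrier G}"
    if "set l \<subseteq> carrier G" for l
    using keys_prism[of "\<lambda>v. v" "\<lambda>v. v \<otimes> s" l] that s by (fastforce simp: image_iff)
  define q where "q x l = EV x (?P l)" for x l
  define h where "h b = q (fst b) (lift \<one> (snd b))" for b
  have inv: "q x (map ((\<otimes>) g) l) = q (act x g) l"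
    if "x \<in> X" "g \<in> carrier G" "set l \<subseteq> carrier G" for x g l
  proof -
    have "?P (map ((\<otimes>) g) l) = mapc ((\<otimes>) g) (?P l)"
      by (rule prism_map) (use that s in \<open>auto simp: m_assoc\<close>)
    then show ?thesis
      unfolding q_def using that kp[OF that(3)] by (subst EV_mapc_left[symmetric]) (auto simp: lists_eq_set)
  qed
  have "frag_extend (\<lambda>b. frag_of (conj s b)) z - frag_extend frag_of z \<in> Bd n"
  proof (rule chain_homotopy[where h = h])
    fix b assume "b \<in> bars n"
    then obtain x gs where b: "b = (x, gs)" "x \<in> X" "set gs \<subseteq> carrier G"
      "frag_of b = EVl x (lift \<one> gs)" "set (lift \<one> gs) \<subseteq> carrier G" "length (lift \<one> gs) = Suc n"
      using bars_EV by metis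
    have h: "h b = EV x (?P (lift \<one> gs))" by (simp add: h_def q_def b(1))
    show "Poly_Mapping.keys (h b) \<subseteq> bars (Suc n)"
      unfolding h by (rule keys_EV[OF b(2)]) (use kp[OF b(5)] b(6) in auto)
    have 1: "dB (h b) = EV x (hBD (?P (lift \<one> gs)))"
      unfolding h by (rule dB_EV[OF b(2)]) (use kp[OF b(5)] in \<open>auto simp: lists_eq_set\<close>)
    have "frag_extend h (dgen b) = frag_extend (q x) (hbd (lift \<one> gs))"
      unfolding h_def b(1)
      by (rule descent[where q = q]) (use inv b in \<open>auto simp: q_def\<close>)
    also have "\<dots> = EV x (hPR (\<lambda>v. v) (\<lambda>v. v \<otimes> s) (hbd (lift \<one> gs)))"
      by (simp add: q_def[abs_def] frag_extend_extend)
    finally have "dB (h b) + frag_extend h (dgen b) =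
      EV x (frag_of (map (\<lambda>v. v \<otimes> s) (lift \<one> gs)) - frag_of (map (\<lambda>v. v) (lift \<one> gs)))"
      using 1 by (simp only: frag_extend_add[symmetric] prism_homotopy)
    then show "dB (h b) + frag_extend h (dgen b) = frag_of (conj s b) - frag_of b"
      using b EVl_map_right[OF b(2) s b(3)] by (simp add: frag_extend_diff)
  qed (rule z)
  then show ?thesis by (simp add: frag_expansion[symmetric])
qed

end

section \<open>Functoriality of the bar complex in the group and the set\<close>

lemma bar_map_dgen:
  assumes "gset G X act" "gset H Y act'" and \<beta>: "\<beta> \<in> hom G H"
    and \<alpha>: "\<And>x g. x \<in> X \<Longrightarrow> g \<in> carrier G \<Longrightarrow> \<alpha> (act x g) = act' (\<alpha> x) (\<beta> g)"
    and b: "b \<in> gset.bars G X n"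
  shows "frag_extend (\<lambda>b. frag_of (map_prod \<alpha> (map \<beta>) b)) (gset.dgen G act b)
    = gset.dgen H act' (map_prod \<alpha> (map \<beta>) b)"
proof -
  interpret G: gset G X act by fact
  interpret H: gset H Y act' by fact
  obtain x gs where x: "b = (x, gs)" "x \<in> X" "set gs \<subseteq> carrier G"
    using b by (cases b) (auto simp: G.bars_def)
  have f: "map \<beta> (bar_face G i gs) = bar_face H i (map \<beta> gs)" if "i \<le> length gs" "gs \<noteq> []" for i
  proof -
    have "gs ! j \<in> carrier G" if "j < length gs" for j using x(3) that by (auto simp: subset_iff)
    then have "\<beta> (gs ! (i - 1) \<otimes>\<^bsub>G\<^esub> gs ! i) = \<beta> (gs ! (i - 1)) \<otimes>\<^bsub>H\<^esub> \<beta> (gs ! i)"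
      if "0 < i" "i < length gs"
      using that \<beta> by (auto simp: hom_def)
    then show ?thesis
      using that by (auto simp: bar_face_def map_tl map_butlast take_map drop_map)
  qed
  have h: "\<alpha> (act x (hd gs)) = act' (\<alpha> x) (\<beta> (hd gs))" if "gs \<noteq> []"
    using that x \<alpha> by (cases gs) auto
  show ?thesis
    unfolding x(1) G.dgen_def H.dgen_def
    by (auto simp: frag_extend_sum frag_extend_cmul h hd_map f intro!: sum.cong)
qed

lemma bar_map_dB:
  assumes "gset G X act" "gset H Y act'" and "\<beta> \<in> hom G H"
    and "\<And>x g. x \<in> X \<Longrightarrow> g \<in> carrier G \<Longrightarrow> \<alpha> (act x g) = act' (\<alpha> x) (\<beta> g)"
    and "Poly_Mapping.keys c \<subseteq> gset.bars G X n"
  shows "frag_extend (\<lambda>b. frag_of (map_prod \<alpha> (map \<beta>) b)) (frag_extend (gset.dgen G act) c)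
    = frag_extend (gset.dgen H act') (frag_extend (\<lambda>b. frag_of (map_prod \<alpha> (map \<beta>) b)) c)"
proof -
  let ?F = "frag_extend (\<lambda>b. frag_of (map_prod \<alpha> (map \<beta>) b))"
  have "?F (gset.dgen G act b) = frag_extend (gset.dgen H act') (frag_of (map_prod \<alpha> (map \<beta>) b))"
    if "b \<in> gset.bars G X n" for b
    unfolding frag_extend_of by (rule bar_map_dgen[where \<alpha> = \<alpha> and \<beta> = \<beta>, OF assms(1-4) that])
  then show ?thesis
    unfolding frag_extend_extend using subsetD[OF assms(5)] by (intro frag_extend_eq) simp
qed

section \<open>Alternating sums over subsets\<close>

lemma sum_Pow_insert:
  fixes f :: "'i set \<Rightarrow> 'c::comm_monoid_add"
  assumes "finite A" "j \<notin> A"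
  shows "(\<Sum>S\<in>Pow (insert j A). f S) = (\<Sum>S\<in>Pow A. f S) + (\<Sum>S\<in>Pow A. f (insert j S))"
proof -
  have "inj_on (insert j) (Pow A)" using assms(2) by (intro inj_onI) (metis PowD insert_ident subsetD)
  moreover have "Pow A \<inter> insert j ` Pow A = {}" using assms(2) by blast
  ultimately show ?thesis
    using assms(1) by (simp add: Pow_insert sum.union_disjoint sum.reindex)
qed

lemma frag_cmul_diff_right: "frag_cmul k (a - b) = frag_cmul k a - frag_cmul k b"
  by (rule poly_mapping_eqI) (simp add: lookup_minus right_diff_distrib)

definition cross_diff_sum :: "('i set \<Rightarrow> ('c \<Rightarrow>\<^sub>0 int)) \<Rightarrow> 'i set \<Rightarrow> ('c \<Rightarrow>\<^sub>0 int)" where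
  "cross_diff_sum f T = (\<Sum>S\<in>Pow T. frag_cmul ((-1) ^ card S) (f (T - S)))"

text \<open>Moebius inversion on the subsets of U. For a subset containing the new element j the
  cross effect is one of the difference function \<open>f'\<close>; the induction hypothesis applies
  to it because f varies.\<close>

lemma sum_cross_diff_sum:
  "finite U \<Longrightarrow> (\<Sum>T\<in>Pow U. cross_diff_sum f T) = f U"
proof (induction U arbitrary: f rule: finite_induct)
  case empty
  then show ?case by (simp add: cross_diff_sum_def)
next
  case (insert j U)
  define f' where "f' S = f (insert j S) - f S" for S
  have "cross_diff_sum f (insert j T) = cross_diff_sum f' T" if "T \<in> Pow U" for T
  proof -
    have T: "finite T" "j \<notin> T" using that insert finite_subset by auto
    have 1: "insert j T - S = insert j (T - S)" if "S \<in> Pow T" for S using that T by auto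
    have 2: "insert j T - insert j S = T - S" if "S \<in> Pow T" for S using that T by auto
    have 3: "card (insert j S) = Suc (card S)" if "S \<in> Pow T" for S
      using that T finite_subset by (subst card_insert_disjoint) auto
    have "cross_diff_sum f (insert j T) = (\<Sum>S\<in>Pow T. frag_cmul ((-1) ^ card S) (f (insert j (T - S))))
        + (\<Sum>S\<in>Pow T. frag_cmul ((-1) ^ Suc (card S)) (f (T - S)))"
      unfolding cross_diff_sum_def sum_Pow_insert[OF T]
      by (intro arg_cong2[of _ _ _ _ "(+)"] sum.cong refl) (simp_all only: 1 2 3)
    also have "\<dots> = cross_diff_sum f' T"
      unfolding cross_diff_sum_def f'_def sum.distrib[symmetric]
      by (intro sum.cong refl)
        (simp only: power_Suc mult_minus1 minus_frag_cmul[symmetric] frag_cmul_diff_right add_uminus_conv_diff)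
    finally show ?thesis .
  qed
  then have "(\<Sum>T\<in>Pow (insert j U). cross_diff_sum f T)
      = (\<Sum>T\<in>Pow U. cross_diff_sum f T) + (\<Sum>T\<in>Pow U. cross_diff_sum f' T)"
    using insert by (simp add: sum_Pow_insert)
  then show ?case by (simp add: insert.IH f'_def)
qed

lemma alternating_sum_Pow:
  assumes "finite N" "N \<noteq> {}"
  shows "(\<Sum>K\<in>Pow N. (-1::int) ^ card K) = 0"
proof -
  obtain j N' where N: "N = insert j N'" "j \<notin> N'" using assms(2) by (metis equals0I insert_Diff Diff_iff singletonI)
  have f: "finite N'" using N assms by simp
  have "card (insert j S) = Suc (card S)" if "S \<in> Pow N'" for S
    using that N f finite_subset by (subst card_insert_disjoint) auto
  then show ?thesis unfolding N sum_Pow_insert[OF f N(2)] by (simp add: sum_negf)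
qed

lemma alternating_sum_supersets:
  assumes "finite M" "A \<subset> M"
  shows "(\<Sum>J | A \<subseteq> J \<and> J \<subseteq> M. (-1::int) ^ card J) = 0"
proof -
  have A: "finite A" using assms finite_subset by blast
  have "bij_betw (\<lambda>K. A \<union> K) (Pow (M - A)) {J. A \<subseteq> J \<and> J \<subseteq> M}"
    by (rule bij_betwI[where g = "\<lambda>J. J - A"]) (use assms in auto)
  then have "(\<Sum>J | A \<subseteq> J \<and> J \<subseteq> M. (-1::int) ^ card J) = (\<Sum>K\<in>Pow (M - A). (-1) ^ card (A \<union> K))"
    by (rule sum.reindex_bij_betw[symmetric])
  also have "\<dots> = (\<Sum>K\<in>Pow (M - A). (-1) ^ card A * (-1) ^ card K)"
  proof (rule sum.cong[OF refl])
    fix K assume K: "K \<in> Pow (M - A)"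
    then have "card (A \<union> K) = card A + card K"
      using A assms finite_subset[of K M] by (intro card_Un_disjoint) auto
    then show "(-1::int) ^ card (A \<union> K) = (-1) ^ card A * (-1) ^ card K"
      by (simp add: power_add)
  qed
  also have "\<dots> = 0"
    using alternating_sum_Pow[of "M - A"] assms by (simp add: sum_distrib_left[symmetric])
  finally show ?thesis .
qed

section \<open>Words in a set of letters and the cancellation of signs\<close>

definition words :: "nat \<Rightarrow> nat set \<Rightarrow> nat list set" where
  "words d J = {w. length w = d \<and> set w \<subseteq> J}"

lemma finite_words: "finite J \<Longrightarrow> finite (words d J)"
  using finite_lists_length_eq[of J d] by (simp add: words_def conj_commute)

text \<open>A set of at most \<open>r\<close> words of length \<open>d\<close> involves at most \<open>r d < m\<close> letters, so that the
  alternating sum over the sets of letters annihilates all cross effects of order at most \<open>r\<close>.\<close>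

lemma alternating_sum_words:
  fixes f :: "nat list set \<Rightarrow> ('c \<Rightarrow>\<^sub>0 int)"
  assumes B0: "0 \<in> B" and Badd: "\<And>a b. a \<in> B \<Longrightarrow> b \<in> B \<Longrightarrow> a + b \<in> B" and Bneg: "\<And>a. a \<in> B \<Longrightarrow> - a \<in> B"
    and cr: "\<And>T. finite T \<Longrightarrow> r < card T \<Longrightarrow> cross_diff_sum f T \<in> B"
    and rd: "r * d < m"
  shows "(\<Sum>J\<in>Pow {1..m}. frag_cmul ((-1) ^ card J) (f (words d J))) \<in> B"
proof -
  let ?M = "{1..m}"
  have sumB: "(\<Sum>i\<in>A. g i) \<in> B" if "\<And>i. i \<in> A \<Longrightarrow> g i \<in> B" for A :: "'z set" and g
    using that by (induction A rule: infinite_finite_induct) (auto simp: B0 Badd)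
  have cmulB: "frag_cmul k a \<in> B" if "a \<in> B" for k a
    using frag_closure_minus_cmul[of "\<lambda>a. a \<in> B" a k] Badd[OF _ Bneg] B0 that by force
  define sp where "sp T = (\<Union>w\<in>T. set w)" for T :: "nat list set"
  have iff: "T \<in> Pow (words d J) \<longleftrightarrow> T \<in> Pow (words d ?M) \<and> sp T \<subseteq> J" if "J \<in> Pow ?M" for T J
    using that by (fastforce simp: words_def sp_def)
  \<comment> \<open>Moebius inversion in each term, with the inner sum extended by zeros to a range
    independent of J, so that the two sums can be exchanged.\<close>
  have "(\<Sum>J\<in>Pow ?M. frag_cmul ((-1) ^ card J) (f (words d J)))
      = (\<Sum>J\<in>Pow ?M. \<Sum>T\<in>Pow (words d ?M).
          if sp T \<subseteq> J then frag_cmul ((-1) ^ card J) (cross_diff_sum f T) else 0)"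
  proof (rule sum.cong[OF refl])
    fix J assume J: "J \<in> Pow ?M"
    then have fJ: "finite (words d J)" by (intro finite_words) (auto intro: finite_subset)
    have "frag_cmul ((-1) ^ card J) (f (words d J))
        = (\<Sum>T\<in>Pow (words d J). frag_cmul ((-1) ^ card J) (cross_diff_sum f T))"
      by (simp add: sum_cross_diff_sum[OF fJ, symmetric] frag_cmul_sum)
    also have "\<dots> = (\<Sum>T | T \<in> Pow (words d ?M) \<and> sp T \<subseteq> J. frag_cmul ((-1) ^ card J) (cross_diff_sum f T))"
      by (rule sum.cong) (use iff[OF J] in auto)
    also have "\<dots> = (\<Sum>T\<in>Pow (words d ?M).
          if sp T \<subseteq> J then frag_cmul ((-1) ^ card J) (cross_diff_sum f T) else 0)"
      by (rule sum.inter_filter) (simp add: finite_words)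
    finally show "frag_cmul ((-1) ^ card J) (f (words d J)) = \<dots>" .
  qed
  also have "\<dots> = (\<Sum>T\<in>Pow (words d ?M). \<Sum>J\<in>Pow ?M.
          if sp T \<subseteq> J then frag_cmul ((-1) ^ card J) (cross_diff_sum f T) else 0)"
    by (rule sum.swap)
  also have "\<dots> \<in> B"
  proof (rule sumB)
    fix T assume T: "T \<in> Pow (words d ?M)"
    then have fT: "finite T" using finite_words[of ?M d] finite_subset by auto
    have "(\<Sum>J\<in>Pow ?M. if sp T \<subseteq> J then frag_cmul ((-1) ^ card J) (cross_diff_sum f T) else 0)
        = (\<Sum>J | J \<in> Pow ?M \<and> sp T \<subseteq> J. frag_cmul ((-1) ^ card J) (cross_diff_sum f T))"
      by (rule sum.inter_filter[symmetric]) simp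
    also have "\<dots> = frag_cmul (\<Sum>J | J \<in> Pow ?M \<and> sp T \<subseteq> J. (-1) ^ card J) (cross_diff_sum f T)"
    proof -
      have "frag_cmul (sum k A) x = (\<Sum>i\<in>A. frag_cmul (k i) x)" for k :: "nat set \<Rightarrow> int" and A and x :: "'c \<Rightarrow>\<^sub>0 int"
        by (induction A rule: infinite_finite_induct) (auto simp: frag_cmul_distrib)
      then show ?thesis by simp
    qed
    also have "\<dots> \<in> B"
    proof (cases "r < card T")
      case True
      then show ?thesis by (intro cmulB cr fT)
    next
      case False
      have "card (sp T) \<le> (\<Sum>w\<in>T. card (set w))"
        unfolding sp_def by (rule card_UN_le[OF fT])
      also have "\<dots> \<le> (\<Sum>w\<in>T. d)"
        by (rule sum_mono) (use T card_length in \<open>fastforce simp: words_def\<close>)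
      also have "\<dots> \<le> r * d" using False by simp
      finally have "card (sp T) < card ?M" using rd by simp
      moreover have "sp T \<subseteq> ?M" using T by (fastforce simp: words_def sp_def)
      ultimately have "sp T \<subset> ?M" by auto
      then have "(\<Sum>J | sp T \<subseteq> J \<and> J \<subseteq> ?M. (-1::int) ^ card J) = 0"
        by (intro alternating_sum_supersets) auto
      moreover have "{J. J \<in> Pow ?M \<and> sp T \<subseteq> J} = {J. sp T \<subseteq> J \<and> J \<subseteq> ?M}" by auto
      ultimately show ?thesis by (simp only: frag_cmul_zero B0)
    qed
    finally show "(\<Sum>J\<in>Pow ?M. if sp T \<subseteq> J then frag_cmul ((-1) ^ card J) (cross_diff_sum f T) else 0) \<in> B" .
  qed
  finally show ?thesis .
qed

section \<open>Extensions by an abelian group with commuting endomorphisms\<close>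

text \<open>The group is a semidirect product: \<open>e = \<mu> (\<nu> e) \<otimes> \<pi> e\<close> with \<open>\<mu>\<close> the inclusion of the abelian
  normal subgroup, on which \<open>e\<close> acts by \<open>L e\<close>, and \<open>\<pi>\<close> the projection to the complement. The
  endomorphisms \<open>sc i\<close> of the normal subgroup commute with this action.\<close>

locale affine_ext = gset G X act for G (structure) and X :: "'x set" and act :: "'x \<Rightarrow> 'a \<Rightarrow> 'x" +
  fixes \<pi> :: "'a \<Rightarrow> 'a" and \<mu> :: "'n::ab_group_add \<Rightarrow> 'a" and \<nu> :: "'a \<Rightarrow> 'n" and L :: "'a \<Rightarrow> 'n \<Rightarrow> 'n"
    and sc :: "'i \<Rightarrow> 'n \<Rightarrow> 'n"
  assumes pi_hom: "\<pi> \<in> hom G G"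
    and decomp: "e \<in> carrier G \<Longrightarrow> \<mu> (\<nu> e) \<otimes> \<pi> e = e"
    and mu_closed: "\<mu> n \<in> carrier G"
    and mu_add: "\<mu> (a + b) = \<mu> a \<otimes> \<mu> b"
    and nu_mult: "e \<in> carrier G \<Longrightarrow> f \<in> carrier G \<Longrightarrow> \<nu> (e \<otimes> f) = \<nu> e + L e (\<nu> f)"
    and L_add: "e \<in> carrier G \<Longrightarrow> L e (a + b) = L e a + L e b"
    and pi_mu: "e \<in> carrier G \<Longrightarrow> \<pi> e \<otimes> \<mu> n = \<mu> (L e n) \<otimes> \<pi> e"
    and act_mu: "x \<in> X \<Longrightarrow> act x (\<mu> n) = x"
    and sc_add: "sc i (a + b) = sc i a + sc i b"
    and L_sc: "e \<in> carrier G \<Longrightarrow> L e (sc i a) = sc i (L e a)"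
begin

lemma pi_closed: "e \<in> carrier G \<Longrightarrow> \<pi> e \<in> carrier G"
  using pi_hom by (auto simp: hom_def)

lemma pi_mult: "e \<in> carrier G \<Longrightarrow> f \<in> carrier G \<Longrightarrow> \<pi> (e \<otimes> f) = \<pi> e \<otimes> \<pi> f"
  using pi_hom by (auto simp: hom_def)

lemma L_0: "e \<in> carrier G \<Longrightarrow> L e 0 = 0"
  using L_add[of e 0 0] by simp

lemma L_uminus: "e \<in> carrier G \<Longrightarrow> L e (- a) = - L e a"
  using L_add[of e a "- a"] by (simp add: L_0 eq_neg_iff_add_eq_0 add.commute)

lemma L_sum: "e \<in> carrier G \<Longrightarrow> L e (sum h S) = (\<Sum>i\<in>S. L e (h i))"
  by (induction S rule: infinite_finite_induct) (auto simp: L_0 L_add)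

text \<open>For the words of length d in J this will be conjugation by X_J^d, see
  \<open>sigma_inner\<close>; for the empty set it is \<pi>.\<close>

definition \<sigma> :: "'i set \<Rightarrow> 'a \<Rightarrow> 'a" where
  "\<sigma> S e = \<mu> (\<Sum>i\<in>S. sc i (\<nu> e)) \<otimes> \<pi> e"

lemma sigma_closed: "e \<in> carrier G \<Longrightarrow> \<sigma> S e \<in> carrier G"
  by (simp add: \<sigma>_def mu_closed pi_closed)

text \<open>\<nu> is a crossed homomorphism for the action L, and it stays one after an endomorphism
  that commutes with L, such as a sum of the \<open>sc i\<close>.\<close>

lemma sigma_hom: "\<sigma> S \<in> hom G G"
proof (rule homI)
  fix e f assume e: "e \<in> carrier G" "f \<in> carrier G"
  define a where "a = (\<Sum>i\<in>S. sc i (\<nu> e))"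
  define b where "b = (\<Sum>i\<in>S. sc i (\<nu> f))"
  have "(\<Sum>i\<in>S. sc i (\<nu> (e \<otimes> f))) = a + L e b"
    by (simp add: a_def b_def nu_mult e sc_add sum.distrib L_sum L_sc)
  then have "\<sigma> S (e \<otimes> f) = \<mu> a \<otimes> (\<mu> (L e b) \<otimes> \<pi> e) \<otimes> \<pi> f"
    using e by (simp add: \<sigma>_def mu_add pi_mult m_assoc mu_closed pi_closed)
  also have "\<dots> = \<sigma> S e \<otimes> \<sigma> S f"
    using e by (simp add: \<sigma>_def a_def b_def m_assoc mu_closed pi_closed pi_mu[symmetric])
  finally show "\<sigma> S (e \<otimes> f) = \<sigma> S e \<otimes> \<sigma> S f" .
qed (rule sigma_closed)

lemma EVl_sigma:
  assumes "x \<in> X" "set gs \<subseteq> carrier G"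
  shows "EVl x (map (\<sigma> S) (lift \<one> gs)) = frag_of (x, map (\<sigma> S) gs)"
proof -
  have "map (\<sigma> S) (lift v gs) = lift (\<sigma> S v) (map (\<sigma> S) gs)" if "v \<in> carrier G" for v
    using that assms(2) sigma_hom[of S] by (induction gs arbitrary: v) (auto simp: hom_mult)
  moreover have "\<sigma> S \<one> = \<one>"
    using hom_one[OF sigma_hom] is_group by auto
  moreover have "set (map (\<sigma> S) gs) \<subseteq> carrier G" using assms(2) by (auto simp: sigma_closed)
  ultimately show ?thesis using EVl_lift[OF assms(1)] by simp
qed

text \<open>\<open>sumv S (vert U e)\<close> is \<open>\<sigma> S e\<close> for every S contained in
  U: all these endomorphisms are read off from a single vertex.\<close>

definition sumv :: "'i set \<Rightarrow> 'a \<times> ('i \<Rightarrow> 'n) \<Rightarrow> 'a" where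
  "sumv U v = \<mu> (\<Sum>i\<in>U. snd v i) \<otimes> fst v"

text \<open>Killing coordinate j and then summing over U is summing over U without j. In the inner
  claim U is independent of T, since the induction hypothesis is used for U and for U without j with
  the same T.\<close>

lemma mapc_sumv_cross:
  assumes "distinct T"
  shows "mapc (sumv (set T)) (cross T c) = cross_diff_sum (\<lambda>S. mapc (sumv S) c) (set T)"
proof -
  have "mapc (sumv U) (cross T c) = (\<Sum>S\<in>Pow (set T). frag_cmul ((-1) ^ card S) (mapc (sumv (U - S)) c))"
    if "finite U" for U
    using assms that
  proof (induction T arbitrary: U)
    case (Cons j T)
    have k: "sumv U (kill j v) = sumv (U - {j}) v" for v
    proof -
      have "(\<Sum>i\<in>U. ((snd v)(j := 0)) i) = (\<Sum>i\<in>U - {j}. snd v i)"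
        using Cons.prems by (intro sum.mono_neutral_cong_right) auto
      then show ?thesis by (simp add: sumv_def kill_def)
    qed
    have c: "card (insert j S) = Suc (card S)" if "S \<in> Pow (set T)" for S
      using that Cons.prems finite_subset by (subst card_insert_disjoint) auto
    have d: "U - insert j S = U - {j} - S" for S by auto
    have "mapc (sumv U) (cross (j # T) c) = mapc (sumv U) (cross T c) - mapc (sumv (U - {j})) (cross T c)"
      by (simp add: frag_extend_diff mapc_mapc k)
    also have "\<dots> = (\<Sum>S\<in>Pow (set T). frag_cmul ((-1) ^ card S) (mapc (sumv (U - S)) c)) +
        (\<Sum>S\<in>Pow (set T). - frag_cmul ((-1) ^ card S) (mapc (sumv (U - {j} - S)) c))"
      using Cons by (simp add: sum_negf del: minus_frag_cmul)
    also have "\<dots> = (\<Sum>S\<in>Pow (set (j # T)). frag_cmul ((-1) ^ card S) (mapc (sumv (U - S)) c))"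
    proof -
      have j: "j \<notin> set T" using Cons.prems by simp
      have "- frag_cmul ((-1) ^ card S) (mapc (sumv (U - {j} - S)) c)
          = frag_cmul ((-1) ^ card (insert j S)) (mapc (sumv (U - insert j S)) c)"
        if "S \<in> Pow (set T)" for S
        unfolding c[OF that] d[symmetric] by simp
      then show ?thesis
        unfolding list.set sum_Pow_insert[OF finite_set j] by (simp only: cong: sum.cong)
    qed
    finally show ?case .
  qed simp
  then show ?thesis by (simp add: cross_diff_sum_def)
qed

definition goods :: "('a \<times> ('i \<Rightarrow> 'n)) list set" where
  "goods = {l. fst ` set l \<subseteq> carrier G}"

text \<open>Chains with vertices outside the group are sent to zero, so that invariance under
  translations holds for all chains.\<close>

definition EVv :: "'x \<Rightarrow> 'i set \<Rightarrow> ('a \<times> ('i \<Rightarrow> 'n)) list \<Rightarrow> (('x \<times> 'a list) \<Rightarrow>\<^sub>0 int)" where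
  "EVv x U l = (if l \<in> goods then EVl x (map (sumv U) l) else 0)"

lemma sumv_closed: "fst v \<in> carrier G \<Longrightarrow> sumv U v \<in> carrier G"
  by (simp add: sumv_def mu_closed)

lemma set_map_sumv: "l \<in> goods \<Longrightarrow> set (map (sumv U) l) \<subseteq> carrier G"
  by (auto simp: goods_def sumv_closed)

lemma EVv_goods:
  assumes "Poly_Mapping.keys c \<subseteq> goods"
  shows "frag_extend (EVv x U) c = EV x (mapc (sumv U) c)"
  unfolding frag_extend_extend using assms by (intro frag_extend_eq) (auto simp: EVv_def)

lemma keys_mapc_sumv:
  assumes "Poly_Mapping.keys c \<subseteq> goods"
  shows "Poly_Mapping.keys (mapc (sumv U) c) \<subseteq> lists (carrier G)"
  by (rule keys_frag_extend_subset[OF assms]) (use set_map_sumv in \<open>auto simp: lists_eq_set\<close>)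

lemma goods_transl: "map (transl i a) l \<in> goods \<longleftrightarrow> l \<in> goods"
  by (simp add: goods_def transl_def image_image)

lemma sumv_transl:
  assumes "finite U" "i \<in> U" "fst v \<in> carrier G"
  shows "sumv U (transl i a v) = \<mu> a \<otimes> sumv U v"
proof -
  have "(\<Sum>k\<in>U. ((snd v)(i := a + snd v i)) k) = a + (\<Sum>k\<in>U. snd v k)"
    using assms(1,2) by (simp add: sum.remove[of U i] add.assoc)
  then show ?thesis using assms(3)
    by (simp add: sumv_def transl_def mu_add m_assoc mu_closed)
qed

text \<open>Translating one coordinate multiplies every vertex on the left by
  \<open>\<mu> a\<close>; this moves into the coefficient, where it acts trivially. It is the
  invariance that \<open>htp_homotopy\<close> asks of its functional.\<close>

lemma EVv_transl:
  assumes "finite U" "i \<in> U" "x \<in> X"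
  shows "frag_extend (EVv x U) (mapc (transl i a) c) = frag_extend (EVv x U) c"
proof -
  have "EVv x U (map (transl i a) l) = EVv x U l" for l
  proof (cases "l \<in> goods")
    case True
    then have "map (sumv U) (map (transl i a) l) = map ((\<otimes>) (\<mu> a)) (map (sumv U) l)"
      using assms by (auto simp: goods_def sumv_transl)
    then show ?thesis
      using True EVl_map_left[OF assms(3) mu_closed set_map_sumv[OF True]] act_mu[OF assms(3)]
      by (simp add: EVv_def goods_transl del: map_map)
  qed (simp add: EVv_def goods_transl)
  then show ?thesis by (simp add: frag_extend_extend)
qed

lemma act_pi: "x \<in> X \<Longrightarrow> g \<in> carrier G \<Longrightarrow> act x (\<pi> g) = act x g"
  using act_mult[of x "\<mu> (\<nu> g)" "\<pi> g"] by (simp add: decomp act_mu mu_closed pi_closed)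

text \<open>Left multiplication by g without its translation part; \<open>vert_mult\<close> recovers
  the full left multiplication as \<open>lin g\<close> followed by translations in each
  index.\<close>

definition lin :: "'a \<Rightarrow> 'a \<times> ('i \<Rightarrow> 'n) \<Rightarrow> 'a \<times> ('i \<Rightarrow> 'n)" where
  "lin g v = (\<pi> g \<otimes> fst v, \<lambda>i. L g (snd v i))"

lemma sumv_lin:
  assumes "g \<in> carrier G" "fst v \<in> carrier G"
  shows "sumv U (lin g v) = \<pi> g \<otimes> sumv U v"
proof -
  have "sumv U (lin g v) = (\<mu> (L g (\<Sum>i\<in>U. snd v i)) \<otimes> \<pi> g) \<otimes> fst v"
    using assms by (simp add: sumv_def lin_def L_sum m_assoc mu_closed pi_closed)
  also have "\<dots> = \<pi> g \<otimes> sumv U v"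
    using assms by (simp add: sumv_def pi_mu[symmetric] m_assoc mu_closed pi_closed)
  finally show ?thesis .
qed

lemma EVv_lin:
  assumes "g \<in> carrier G" "x \<in> X" "Poly_Mapping.keys c \<subseteq> goods"
  shows "frag_extend (EVv x U) (mapc (lin g) c) = frag_extend (EVv (act x g) U) c"
proof -
  have "EVv x U (map (lin g) l) = EVv (act x g) U l" if l: "l \<in> goods" for l
  proof -
    have "map (sumv U) (map (lin g) l) = map ((\<otimes>) (\<pi> g)) (map (sumv U) l)"
      using assms l by (auto simp: goods_def sumv_lin)
    moreover have "map (lin g) l \<in> goods"
      using l assms by (auto simp: goods_def lin_def pi_closed)
    ultimately show ?thesis
      using l EVl_map_left[OF assms(2) pi_closed[OF assms(1)] set_map_sumv[OF l]] act_pi[OF assms(2,1)]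
      by (simp add: EVv_def del: map_map)
  qed
  then show ?thesis
    unfolding frag_extend_extend using assms(3) by (intro frag_extend_eq) auto
qed

lemma htp_lin:
  assumes "g \<in> carrier G"
  shows "htp T (mapc (lin g) c) = mapc (lin g) (htp T c)"
  by (rule htp_mapc)
    (auto simp: kill_def lin_def transl_def L_0[OF assms] fun_eq_iff
      L_add[OF assms, symmetric] L_uminus[OF assms, symmetric])

definition vert :: "'i set \<Rightarrow> 'a \<Rightarrow> 'a \<times> ('i \<Rightarrow> 'n)" where
  "vert U e = (\<pi> e, \<lambda>i. if i \<in> U then sc i (\<nu> e) else 0)"

lemma foldr_transl:
  "distinct T \<Longrightarrow> foldr (\<lambda>i. transl i (t i)) T v = (fst v, \<lambda>i. if i \<in> set T then t i + snd v i else snd v i)"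
  by (induction T) (auto simp: transl_def fun_eq_iff)

lemma vert_mult:
  assumes "g \<in> carrier G" "e \<in> carrier G" "distinct T"
  shows "vert (set T) (g \<otimes> e) = foldr (\<lambda>i. transl i (sc i (\<nu> g))) T (lin g (vert (set T) e))"
  unfolding foldr_transl[OF assms(3)]
  using assms by (auto simp: vert_def lin_def pi_mult nu_mult sc_add L_sc L_0 fun_eq_iff)

lemma htp_foldr_transl:
  assumes "\<And>a b. \<phi> (a - b) = \<phi> a - \<phi> b" and "\<And>i a x. i \<in> set T \<Longrightarrow> \<phi> (mapc (transl i a) x) = \<phi> x"
    and "distinct T" and "set T' \<subseteq> set T"
  shows "\<phi> (htp T (mapc (foldr (\<lambda>i. transl i (t i)) T') c)) = (\<phi> (htp T c) :: 'z::ab_group_add)"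
  using assms(4)
proof (induction T')
  case Nil
  then show ?case using mapc_id[of c] by (simp add: id_def)
next
  case (Cons i T')
  have "mapc (foldr (\<lambda>i. transl i (t i)) (i # T')) c
      = mapc (transl i (t i)) (mapc (foldr (\<lambda>i. transl i (t i)) T') c)"
    by (simp only: mapc_mapc) (simp add: comp_def)
  moreover have "\<phi> (htp T (mapc (transl i a) c')) = \<phi> (htp T c')" for a c'
    by (rule htp_invariant[where \<phi> = \<phi>, OF assms(1,2) _ assms(3)]) (use Cons in auto)
  ultimately show ?case
    using Cons by (simp del: foldr.simps)
qed

text \<open>The null homotopy is \<open>htp\<close>, applied to the simplices with separate
  coordinates \<open>vert\<close> and followed by adding the coordinates. An r-simplex has r + 1
  vertices, no more than there are indices in T.\<close>

theorem cross_effect_homologous_zero: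
  assumes z: "z \<in> Z r" and T: "finite T" "r < card T"
  shows "cross_diff_sum (\<lambda>S. frag_extend (\<lambda>b. frag_of (map_prod (\<lambda>x. x) (map (\<sigma> S)) b)) z) T \<in> Bd r"
proof -
  obtain ts where ts: "T = set ts" "distinct ts" using finite_distinct_list[OF T(1)] by blast
  then have lts: "r < length ts" using T(2) distinct_card by metis
  define \<phi> where "\<phi> x = frag_extend (EVv x (set ts))" for x
  have \<phi>d: "\<phi> x (a - b) = \<phi> x a - \<phi> x b" for x a b by (simp add: \<phi>_def frag_extend_diff)
  have \<phi>t: "\<phi> x (mapc (transl i a) c) = \<phi> x c" if "x \<in> X" "i \<in> set ts" for x i a c
    unfolding \<phi>_def by (rule EVv_transl) (use that in auto)
  define D where "D = vert (set ts)"
  define q where "q x l = \<phi> x (htp ts (frag_of (map D l)))" for x l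
  define h where "h b = q (fst b) (lift \<one> (snd b))" for b
  have gD: "map D l \<in> {l'. length l' = length l \<and> fst ` set l' \<subseteq> carrier G}" if "set l \<subseteq> carrier G" for l
    using that by (auto simp: D_def vert_def pi_closed)
  have gH: "Poly_Mapping.keys (htp ts (frag_of (map D l)))
      \<subseteq> {l'. length l' = Suc (length l) \<and> fst ` set l' \<subseteq> carrier G}" if "set l \<subseteq> carrier G" for l
    by (rule keys_htp) (use gD[OF that] in simp)
  \<comment> \<open>Invariance for \<open>descent\<close>: left translation by g is
    \<open>lin g\<close> up to translations; these are absorbed, and \<open>lin g\<close> commutes
    with \<open>htp\<close> and moves into the coefficient.\<close>
  have qinv: "q x (map ((\<otimes>) g) l) = q (act x g) l"
    if x: "x \<in> X" and g: "g \<in> carrier G" and l: "set l \<subseteq> carrier G" for x g l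
  proof -
    have "map D (map ((\<otimes>) g) l) = map (foldr (\<lambda>i. transl i (sc i (\<nu> g))) ts) (map (lin g) (map D l))"
      using l g ts by (auto simp: D_def vert_mult)
    then have "frag_of (map D (map ((\<otimes>) g) l))
        = mapc (foldr (\<lambda>i. transl i (sc i (\<nu> g))) ts) (mapc (lin g) (frag_of (map D l)))"
      by (simp del: map_map)
    then have "q x (map ((\<otimes>) g) l) = \<phi> x (htp ts (mapc (lin g) (frag_of (map D l))))"
      unfolding q_def using htp_foldr_transl[OF \<phi>d \<phi>t[OF x] ts(2)] by (simp del: map_map frag_extend_of)
    also have "\<dots> = \<phi> x (mapc (lin g) (htp ts (frag_of (map D l))))"
      by (simp only: htp_lin[OF g])
    also have "\<dots> = q (act x g) l"
      unfolding q_def \<phi>_def by (rule EVv_lin[OF g x]) (use gH[OF l] in \<open>auto simp: goods_def\<close>)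
    finally show ?thesis .
  qed
  define F where "F S b = frag_of (map_prod (\<lambda>x. x) (map (\<sigma> S)) b)" for S and b :: "'x \<times> 'a list"
  have "frag_extend (\<lambda>b. cross_diff_sum (\<lambda>S. F S b) T) z - frag_extend (\<lambda>_. 0) z \<in> Bd r"
  proof (rule chain_homotopy[where h = h])
    fix b assume "b \<in> bars r"
    then obtain x gs where b: "b = (x, gs)" "x \<in> X" "set gs \<subseteq> carrier G"
      "set (lift \<one> gs) \<subseteq> carrier G" "length (lift \<one> gs) = Suc r"
      using bars_EV by metis
    let ?l = "lift \<one> gs" and ?c = "frag_of (map D (lift \<one> gs))"
    have h: "h b = \<phi> x (htp ts ?c)" by (simp add: h_def q_def b(1))
    have good: "Poly_Mapping.keys (htp ts ?c) \<subseteq> goods" using gH[OF b(4)] by (auto simp: goods_def)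
    have kl: "Poly_Mapping.keys (mapc (sumv (set ts)) (htp ts ?c)) \<subseteq> {l. length l = Suc (Suc r) \<and> set l \<subseteq> carrier G}"
      by (rule keys_frag_extend_subset[OF gH[OF b(4)]]) (use b(5) in \<open>auto simp: sumv_closed\<close>)
    have h2: "h b = EV x (mapc (sumv (set ts)) (htp ts ?c))"
      unfolding h \<phi>_def by (rule EVv_goods[OF good])
    show "Poly_Mapping.keys (h b) \<subseteq> bars (Suc r)"
      unfolding h2 by (rule keys_EV[OF b(2) kl])
    have good': "Poly_Mapping.keys (hBD (htp ts ?c)) \<subseteq> goods"
      by (rule keys_frag_extend_subset[OF good]) (use keys_hbd in \<open>fastforce simp: goods_def\<close>)
    have 1: "dB (h b) = \<phi> x (hBD (htp ts ?c))"
      unfolding h2 \<phi>_def EVv_goods[OF good'] hBD_mapc[symmetric]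
      by (rule dB_EV[OF b(2) keys_mapc_sumv[OF good]])
    have "frag_extend h (dgen b) = frag_extend (q x) (hbd ?l)"
      unfolding h_def b(1)
    proof (rule descent)
      fix x show "q x [] = 0"
        using \<phi>d[of x 0 0] by (simp add: q_def htp_Nil)
    qed (use qinv b in auto)
    also have "\<dots> = \<phi> x (htp ts (mapc D (hbd ?l)))"
      by (rule frag_additive_eq[OF subset_UNIV]) (auto simp: frag_extend_diff q_def \<phi>d htp_diff)
    also have "mapc D (hbd ?l) = hBD ?c" by (simp add: hbd_map)
    finally have 2: "frag_extend h (dgen b) = \<phi> x (htp ts (hBD ?c))" .
    have "dB (h b) + frag_extend h (dgen b) = \<phi> x (cross ts ?c)"
      unfolding 1 2
      by (rule htp_homotopy[OF \<phi>d \<phi>t[OF b(2)] _ ts(2)])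
        (use b(5) lts in \<open>auto simp: \<phi>_def EVv_def goods_def EVl_def\<close>)
    also have "\<dots> = EV x (mapc (sumv (set ts)) (cross ts ?c))"
      unfolding \<phi>_def
    proof (rule EVv_goods)
      show "Poly_Mapping.keys (cross ts ?c) \<subseteq> goods"
        using keys_cross[of ?c "Suc r" "carrier G" ts] gD[OF b(4)] b(5) by (auto simp: goods_def)
    qed
    also have "\<dots> = cross_diff_sum (\<lambda>S. EV x (mapc (sumv S) ?c)) (set ts)"
      unfolding mapc_sumv_cross[OF ts(2)]
      by (simp add: cross_diff_sum_def frag_extend_sum frag_extend_cmul comp_def)
    also have "\<dots> = cross_diff_sum (\<lambda>S. F S b) T"
      unfolding cross_diff_sum_def ts(1)
    proof (intro sum.cong refl arg_cong[of _ _ "frag_cmul _"])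
      fix S assume "S \<in> Pow (set ts)"
      have "sumv (set ts - S) (D e) = \<sigma> (set ts - S) e" for e
        unfolding sumv_def D_def vert_def \<sigma>_def snd_conv fst_conv
        by (intro arg_cong2[of _ _ _ _ "(\<otimes>)"] arg_cong[of _ _ \<mu>] sum.cong refl) simp
      then have "map (sumv (set ts - S)) (map D ?l) = map (\<sigma> (set ts - S)) ?l" by simp
      then show "EV x (mapc (sumv (set ts - S)) ?c) = F (set ts - S) b"
        using EVl_sigma[OF b(2,3), of "set ts - S"] by (simp add: F_def b(1) del: map_map)
    qed
    finally show "dB (h b) + frag_extend h (dgen b) = cross_diff_sum (\<lambda>S. F S b) T - 0" by simp
  qed (rule z)
  moreover have "frag_extend (\<lambda>b. cross_diff_sum (\<lambda>S. F S b) T) z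
      = cross_diff_sum (\<lambda>S. frag_extend (F S) z) T"
    by (rule frag_additive_eq[OF subset_UNIV])
      (auto simp: frag_extend_diff cross_diff_sum_def frag_cmul_diff_right sum_subtractf)
  ultimately show ?thesis
    by (simp add: frag_extend_eq_0 F_def[abs_def])
qed

end

section \<open>Shapiro's lemma\<close>

text \<open>X is the orbit of x0, K its stabiliser, and s chooses coset representatives. The
  normalisation of s at x0 makes \<open>retr\<close> the identity on K, and hence
  \<open>rgen\<close> an exact left inverse of \<open>incl\<close>.\<close>

locale shapiro = gset G X act for G (structure) and X :: "'x set" and act :: "'x \<Rightarrow> 'a \<Rightarrow> 'x" +
  fixes K :: "'a set" and x0 :: 'x and s :: "'x \<Rightarrow> 'a"
  assumes K_subgroup: "subgroup K G" and x0: "x0 \<in> X"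
    and stabilizer: "g \<in> carrier G \<Longrightarrow> act x0 g = x0 \<longleftrightarrow> g \<in> K"
    and s_closed: "x \<in> X \<Longrightarrow> s x \<in> carrier G" and act_s: "x \<in> X \<Longrightarrow> act x0 (s x) = x"
    and s_x0: "s x0 = \<one>"
begin

abbreviation "GK \<equiv> G\<lparr>carrier := K\<rparr>"

lemma gset_K: "gset GK {()} (\<lambda>_ _. ())"
  by (simp add: gset_def gset_axioms_def subgroup_imp_group[OF K_subgroup])

sublocale K: gset "G\<lparr>carrier := K\<rparr>" "{()}" "\<lambda>_ _. ()"
  by (rule gset_K)

lemma K_sub: "k \<in> K \<Longrightarrow> k \<in> carrier G"
  using subgroup.subset[OF K_subgroup] by auto

text \<open>The element v divided by the representative of its coset K v: a retraction of the group
  onto K that commutes with left multiplication by K.\<close>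

definition retr :: "'a \<Rightarrow> 'a" where
  "retr v = v \<otimes> inv s (act x0 v)"

lemma retr_closed:
  assumes "v \<in> carrier G"
  shows "retr v \<in> K"
proof -
  let ?y = "act x0 v"
  have y: "?y \<in> X" using act_closed[OF x0 assms] .
  have "act x0 (retr v) = act ?y (inv s ?y)"
    unfolding retr_def using assms y by (simp add: act_mult x0 s_closed)
  also have "\<dots> = act (act x0 (s ?y)) (inv s ?y)" by (simp add: act_s y)
  also have "\<dots> = x0" using y by (simp add: act_mult[symmetric] x0 s_closed act_one)
  finally show ?thesis using stabilizer[of "retr v"] assms y by (simp add: retr_def s_closed)
qed

lemma retr_mult:
  assumes "k \<in> K" "v \<in> carrier G"
  shows "retr (k \<otimes> v) = k \<otimes> retr v"
proof -
  have "act x0 k = x0" using stabilizer[of k] K_sub assms(1) by simp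
  then have "act x0 (k \<otimes> v) = act x0 v"
    using assms K_sub x0 by (simp add: act_mult)
  then show ?thesis
    using assms K_sub act_closed[OF x0 assms(2)] by (simp add: retr_def m_assoc s_closed)
qed

lemma retr_K: "k \<in> K \<Longrightarrow> retr k = k"
  using stabilizer[of k] K_sub by (simp add: retr_def s_x0)

lemma s_mult:
  assumes "x \<in> X" "g \<in> carrier G"
  obtains k where "k \<in> K" "s x \<otimes> g = k \<otimes> s (act x g)"
proof
  have "act x0 (s x \<otimes> g) = act x g" using assms by (simp add: act_mult x0 s_closed act_s)
  then show "s x \<otimes> g = retr (s x \<otimes> g) \<otimes> s (act x g)"
    using assms by (simp add: retr_def m_assoc s_closed act_closed)
  show "retr (s x \<otimes> g) \<in> K" using assms by (simp add: retr_closed s_closed)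
qed

lemma map_s_translate:
  assumes "x \<in> X" "g \<in> carrier G"
  obtains k where "k \<in> K" "\<And>l. set l \<subseteq> carrier G \<Longrightarrow>
     map ((\<otimes>) (s x)) (map ((\<otimes>) g) l) = map ((\<otimes>) k) (map ((\<otimes>) (s (act x g))) l)"
proof -
  obtain k where k: "k \<in> K" "s x \<otimes> g = k \<otimes> s (act x g)" using s_mult[OF assms] .
  have "s x \<otimes> (g \<otimes> v) = k \<otimes> (s (act x g) \<otimes> v)" if "v \<in> carrier G" for v
    using that assms k K_sub by (simp add: m_assoc[symmetric] s_closed act_closed)
  then show ?thesis by (intro that[OF k(1)]) auto
qed

lemma K_quots: "set l \<subseteq> K \<Longrightarrow> K.quots l = quots l"
proof (rule nth_equalityI)
  fix k assume l: "set l \<subseteq> K" "k < length (K.quots l)"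
  then have k: "Suc k < length l" by (simp add: K.length_quots)
  then have "l ! k \<in> K" using l by (auto simp: subset_iff)
  then show "K.quots l ! k = quots l ! k"
    using k by (simp add: nth_quots K.nth_quots m_inv_consistent[OF K_subgroup])
qed (simp add: K.length_quots length_quots)

definition incl :: "unit \<times> 'a list \<Rightarrow> 'x \<times> 'a list" where
  "incl b = (x0, snd b)"

abbreviation Incl where "Incl \<equiv> frag_extend (\<lambda>b. frag_of (incl b))"

lemma incl_eq: "incl = map_prod (\<lambda>_. x0) (map (\<lambda>g. g))"
  by (auto simp: incl_def fun_eq_iff)

lemma incl_bars: "b \<in> K.bars n \<Longrightarrow> incl b \<in> bars n"
  using K_sub x0 by (auto simp: K.bars_def bars_def incl_def)

lemma keys_Incl: "Poly_Mapping.keys c \<subseteq> K.bars n \<Longrightarrow> Poly_Mapping.keys (Incl c) \<subseteq> bars n"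
  by (erule keys_frag_extend_subset) (use incl_bars in auto)

lemma Incl_EVl:
  assumes "set l \<subseteq> K"
  shows "Incl (K.EVl () l) = EVl x0 l"
proof (cases l)
  case (Cons v vs)
  then have "act x0 v = x0" using assms stabilizer[of v] K_sub by simp
  then show ?thesis using K_quots[OF assms] Cons by (simp add: K.EVl_def EVl_def incl_def)
qed (simp add: K.EVl_def EVl_def)

lemma dB_Incl:
  assumes "Poly_Mapping.keys c \<subseteq> K.bars n"
  shows "dB (Incl c) = Incl (K.dB c)"
proof -
  have i: "(\<lambda>g. g) \<in> hom GK G"
    using K_sub by (auto simp: hom_def)
  have a: "act x0 g = x0" if "g \<in> K" for g
    using stabilizer[of g] K_sub that by simp
  show ?thesis
    unfolding incl_eq
    by (rule bar_map_dB[where \<alpha> = "\<lambda>_. x0" and \<beta> = "\<lambda>g. g", OF gset_K gset_axioms i _ assms, symmetric])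
      (simp add: a)
qed

text \<open>In the tensor product x tensor l equals x0 tensor (s x) l. Over the base point only the
  stabiliser K has to be respected, and so the vertices may be retracted to K.\<close>

definition ret :: "'x \<Rightarrow> 'a list \<Rightarrow> ((unit \<times> 'a list) \<Rightarrow>\<^sub>0 int)" where
  "ret x l = K.EVl () (map retr (map ((\<otimes>) (s x)) l))"

definition rgen :: "'x \<times> 'a list \<Rightarrow> ((unit \<times> 'a list) \<Rightarrow>\<^sub>0 int)" where
  "rgen b = ret (fst b) (lift \<one> (snd b))"

lemma set_map_s: "x \<in> X \<Longrightarrow> set l \<subseteq> carrier G \<Longrightarrow> set (map ((\<otimes>) (s x)) l) \<subseteq> carrier G"
  by (auto simp: s_closed)

lemma set_map_retr: "set l \<subseteq> carrier G \<Longrightarrow> set (map retr l) \<subseteq> K"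
  by (auto simp: retr_closed)

lemma ret_invariant:
  assumes "x \<in> X" "g \<in> carrier G" "set l \<subseteq> carrier G"
  shows "ret x (map ((\<otimes>) g) l) = ret (act x g) l"
proof -
  obtain k where k: "k \<in> K" "map ((\<otimes>) (s x)) (map ((\<otimes>) g) l) = map ((\<otimes>) k) (map ((\<otimes>) (s (act x g))) l)"
    using map_s_translate[OF assms(1,2)] assms(3) by metis
  let ?l = "map ((\<otimes>) (s (act x g))) l"
  have l: "set ?l \<subseteq> carrier G" using assms by (intro set_map_s) (auto simp: act_closed)
  then have "map retr (map ((\<otimes>) k) ?l) = map ((\<otimes>) k) (map retr ?l)"
    using k by (auto simp: retr_mult)
  then show ?thesis
    unfolding ret_def k(2) using K.EVl_map_left[of "()" k "map retr ?l"] k(1) set_map_retr[OF l]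
    by (simp del: map_map)
qed

lemma K_dB_rgen:
  assumes "b \<in> bars n"
  shows "K.dB (rgen b) = frag_extend rgen (dgen b)"
proof -
  obtain x gs where b: "b = (x, gs)" "x \<in> X" "set gs \<subseteq> carrier G" "set (lift \<one> gs) \<subseteq> carrier G"
    using bars_EV[OF assms] by metis
  let ?l = "map retr (map ((\<otimes>) (s x)) (lift \<one> gs))"
  have "frag_extend rgen (dgen b) = frag_extend (ret x) (hbd (lift \<one> gs))"
    unfolding rgen_def b(1)
    by (rule descent) (use b ret_invariant in \<open>auto simp: ret_def K.EVl_def\<close>)
  also have "\<dots> = K.EV () (hbd ?l)"
    by (simp only: hbd_map frag_extend_extend frag_extend_of ret_def[abs_def])
  also have "\<dots> = K.dB (K.EVl () ?l)"
    by (rule K.dgen_EVl[symmetric]) (use set_map_retr[OF set_map_s[OF b(2,4)]] in auto)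
  finally show ?thesis by (simp add: rgen_def ret_def b(1))
qed

lemma keys_rgen: "b \<in> bars n \<Longrightarrow> Poly_Mapping.keys (rgen b) \<subseteq> K.bars n"
  unfolding rgen_def ret_def
  by (elim bars_EV, rule K.keys_EVl) (use set_map_retr[OF set_map_s] in auto)

lemma K_lift: "K.lift v gs = lift v gs"
  by (induction gs arbitrary: v) auto

lemma rgen_incl:
  assumes "b \<in> K.bars n"
  shows "rgen (incl b) = frag_of b"
proof -
  obtain gs where b: "b = ((), gs)" "set gs \<subseteq> K" using assms by (cases b) (auto simp: K.bars_def)
  have c: "set (lift \<one> gs) \<subseteq> K"
    using K.set_lift[of \<one> gs] b(2) subgroup.one_closed[OF K_subgroup]
    by (simp add: K_lift)
  have "map retr (map ((\<otimes>) (s x0)) (lift \<one> gs)) = lift \<one> gs"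
    unfolding map_map by (rule map_idI) (use c K_sub in \<open>auto simp: s_x0 retr_K subset_iff\<close>)
  then show ?thesis
    using K.EVl_lift[of "()" gs] b by (simp add: rgen_def ret_def incl_def K_lift del: map_map)
qed

text \<open>The prism between the identity and \<open>retr\<close> commutes with left translation by
  K. Read off over x0 this gives invariance under the whole group, because
  \<open>map_s_translate\<close> turns a translation by g into one by an element of K.\<close>

lemma incl_rgen_homologous:
  assumes z: "z \<in> Z n"
  shows "Incl (frag_extend rgen z) - z \<in> Bd n"
proof -
  let ?P = "prism (\<lambda>v. v) retr"
  have kp: "Poly_Mapping.keys (?P l) \<subseteq> {l'. length l' = Suc (length l) \<and> set l' \<subseteq> carrier G}"
    if "set l \<subseteq> carrier G" for l
  proof -
    have "(\<lambda>v. v) ` set l \<union> retr ` set l \<subseteq> carrier G"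
      using that by (auto intro!: K_sub[OF retr_closed])
    then show ?thesis using keys_prism[of "\<lambda>v. v" retr l] by blast
  qed
  define q where "q x l = EV x0 (?P (map ((\<otimes>) (s x)) l))" for x l
  define h where "h b = q (fst b) (lift \<one> (snd b))" for b
  have inv: "q x (map ((\<otimes>) g) l) = q (act x g) l"
    if x: "x \<in> X" "g \<in> carrier G" "set l \<subseteq> carrier G" for x g l
  proof -
    obtain k where k: "k \<in> K" "map ((\<otimes>) (s x)) (map ((\<otimes>) g) l) = map ((\<otimes>) k) (map ((\<otimes>) (s (act x g))) l)"
      using map_s_translate[OF x(1,2)] x(3) by metis
    let ?l = "map ((\<otimes>) (s (act x g))) l"
    have l: "set ?l \<subseteq> carrier G" using x by (intro set_map_s) (auto simp: act_closed)
    have "?P (map ((\<otimes>) k) ?l) = mapc ((\<otimes>) k) (?P ?l)"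
      by (rule prism_map) (use l k(1) retr_mult in auto)
    moreover have "EV x0 (mapc ((\<otimes>) k) (?P ?l)) = EV (act x0 k) (?P ?l)"
      by (rule EV_mapc_left) (use x0 k(1) K_sub kp[OF l] in \<open>auto simp: lists_eq_set\<close>)
    moreover have "act x0 k = x0" using stabilizer[of k] K_sub k(1) by simp
    ultimately show ?thesis unfolding q_def k(2) by (simp only:)
  qed
  have "frag_extend (\<lambda>b. Incl (rgen b)) z - frag_extend frag_of z \<in> Bd n"
  proof (rule chain_homotopy[where h = h])
    fix b assume "b \<in> bars n"
    then obtain x gs where b: "b = (x, gs)" "x \<in> X" "set gs \<subseteq> carrier G"
      "frag_of b = EVl x (lift \<one> gs)" "set (lift \<one> gs) \<subseteq> carrier G" "length (lift \<one> gs) = Suc n"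
      using bars_EV by metis
    let ?l = "map ((\<otimes>) (s x)) (lift \<one> gs)"
    have l: "set ?l \<subseteq> carrier G" by (rule set_map_s[OF b(2,5)])
    have h: "h b = EV x0 (?P ?l)" by (simp add: h_def q_def b(1))
    show "Poly_Mapping.keys (h b) \<subseteq> bars (Suc n)"
      unfolding h by (rule keys_EV[OF x0]) (use kp[OF l] b(6) in auto)
    have 1: "dB (h b) = EV x0 (hBD (?P ?l))"
      unfolding h by (rule dB_EV[OF x0]) (use kp[OF l] in \<open>auto simp: lists_eq_set\<close>)
    have "frag_extend h (dgen b) = frag_extend (q x) (hbd (lift \<one> gs))"
      unfolding h_def b(1)
      by (rule descent[where q = q]) (use inv b in \<open>auto simp: q_def\<close>)
    also have "\<dots> = EV x0 (hPR (\<lambda>v. v) retr (hbd ?l))"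
      by (simp only: q_def[abs_def] hbd_map frag_extend_extend frag_extend_of)
    finally have "dB (h b) + frag_extend h (dgen b) =
      EV x0 (frag_of (map retr ?l) - frag_of (map (\<lambda>v. v) ?l))"
      using 1 by (simp only: frag_extend_add[symmetric] prism_homotopy)
    also have "\<dots> = EVl x0 (map retr ?l) - EVl x0 ?l"
      by (simp add: frag_extend_diff del: map_map)
    also have "EVl x0 ?l = frag_of b"
      using EVl_map_left[OF x0 s_closed[OF b(2)] b(5)] act_s[OF b(2)] b(4) by simp
    also have "EVl x0 (map retr ?l) = Incl (rgen b)"
      using Incl_EVl[OF set_map_retr[OF l]] by (simp add: rgen_def ret_def b(1))
    finally show "dB (h b) + frag_extend h (dgen b) = Incl (rgen b) - frag_of b" .
  qed (rule z)
  then show ?thesis by (simp add: frag_expansion[symmetric] frag_extend_extend)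
qed

lemma keys_frag_extend_rgen:
  "Poly_Mapping.keys c \<subseteq> bars n \<Longrightarrow> Poly_Mapping.keys (frag_extend rgen c) \<subseteq> K.bars n"
  by (erule keys_frag_extend_subset) (rule keys_rgen)

lemma K_dB_frag_extend_rgen:
  assumes "Poly_Mapping.keys c \<subseteq> bars n"
  shows "K.dB (frag_extend rgen c) = frag_extend rgen (dB c)"
  unfolding frag_extend_extend using assms K_dB_rgen by (intro frag_extend_eq) auto

theorem shapiro_surj:
  assumes "z \<in> Z n"
  obtains u where "u \<in> K.Z n" "Incl u - z \<in> Bd n"
proof
  show "frag_extend rgen z \<in> K.Z n"
    using assms keys_frag_extend_rgen K_dB_frag_extend_rgen by (auto simp: Z_def K.Z_def)
qed (rule incl_rgen_homologous[OF assms])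

theorem shapiro_inj:
  assumes "Poly_Mapping.keys u \<subseteq> K.bars n" "Incl u \<in> Bd n"
  shows "u \<in> K.Bd n"
proof -
  obtain b where b: "Poly_Mapping.keys b \<subseteq> bars (Suc n)" "Incl u = dB b"
    using assms(2) by (auto simp: Bd_def)
  have "u = frag_extend rgen (Incl u)"
    unfolding frag_extend_extend frag_extend_of
    by (subst frag_expansion, rule frag_extend_eq) (use assms(1) rgen_incl in auto)
  also have "\<dots> = K.dB (frag_extend rgen b)"
    unfolding b(2) by (rule K_dB_frag_extend_rgen[OF b(1), symmetric])
  finally show ?thesis
    using keys_frag_extend_rgen[OF b(1)] by (auto simp: K.Bd_def)
qed

end

section \<open>Isomorphisms on homology\<close>

lemma chain_complex_group_hom:
  assumes "chain_complex K"
  shows "group_hom (fst K (Suc n)) (fst K n) (snd K n)"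
  using assms unfolding chain_complex_def group_hom_def group_hom_axioms_def
  by (meson comm_group.axioms(2))

lemma subgroup_cycles:
  assumes "chain_complex K"
  shows "subgroup (cycles K n) (fst K n)"
proof (cases n)
  case 0
  have "group (fst K 0)" using assms unfolding chain_complex_def by (meson comm_group.axioms(2))
  then show ?thesis using 0 by (simp add: cycles_def group.subgroup_self)
next
  case (Suc k)
  then show ?thesis
    using group_hom.subgroup_kernel[OF chain_complex_group_hom[OF assms, of k]] by (simp add: cycles_def)
qed

lemma subgroup_boundaries:
  assumes "chain_complex K"
  shows "subgroup (boundaries K n) (fst K n)"
  unfolding boundaries_def by (rule group_hom.img_is_subgroup[OF chain_complex_group_hom[OF assms]])

lemma boundaries_cycles:
  assumes "chain_complex K"
  shows "boundaries K n \<subseteq> cycles K n"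
proof (cases n)
  case 0
  then show ?thesis
    using subgroup.subset[OF subgroup_boundaries[OF assms, of 0]] by (simp add: cycles_def)
next
  case (Suc k)
  show ?thesis
  proof
    fix b assume b: "b \<in> boundaries K n"
    then have "b \<in> carrier (fst K (Suc k))"
      using subgroup.subset[OF subgroup_boundaries[OF assms, of n]] Suc by auto
    moreover obtain c where "c \<in> carrier (fst K (Suc (Suc k)))" "b = snd K (Suc k) c"
      using b Suc by (auto simp: boundaries_def)
    ultimately show "b \<in> cycles K n"
      using assms Suc by (simp add: cycles_def kernel_def chain_complex_def)
  qed
qed

lemma chain_map_cycles:
  assumes "chain_map K L f" "z \<in> cycles K n"
  shows "f z \<in> cycles L n"
proof (cases n)
  case 0
  have "f \<in> hom (fst K 0) (fst L 0)" using assms(1) by (simp add: chain_map_def)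
  then show ?thesis using assms(2) 0 by (simp add: cycles_def hom_in_carrier)
next
  case (Suc k)
  have K: "chain_complex K" and L: "chain_complex L" and f: "f \<in> hom (fst K i) (fst L i)" for i
    using assms(1) by (simp_all add: chain_map_def)
  have z: "z \<in> carrier (fst K (Suc k))" "snd K k z = \<one>\<^bsub>fst K k\<^esub>"
    using assms(2) Suc by (simp_all add: cycles_def kernel_def)
  have "f \<one>\<^bsub>fst K k\<^esub> = \<one>\<^bsub>fst L k\<^esub>"
    using f chain_complex_group_hom[OF K, of k] chain_complex_group_hom[OF L, of k]
    by (intro hom_one) (simp_all add: group_hom_def)
  moreover have "snd L k (f z) = f (snd K k z)" using assms(1) z(1) unfolding chain_map_def by metis
  ultimately show ?thesis using z Suc hom_in_carrier[OF f z(1)]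
    by (simp add: cycles_def kernel_def)
qed

lemma chain_map_boundaries:
  assumes "chain_map K L f" "b \<in> boundaries K n"
  shows "f b \<in> boundaries L n"
proof -
  obtain c where c: "c \<in> carrier (fst K (Suc n))" "b = snd K n c"
    using assms(2) by (auto simp: boundaries_def)
  have "f \<in> hom (fst K (Suc n)) (fst L (Suc n))" using assms(1) by (simp add: chain_map_def)
  then have "f c \<in> carrier (fst L (Suc n))" using c(1) by (rule hom_in_carrier)
  moreover have "f b = snd L n (f c)" using assms(1) c unfolding chain_map_def by metis
  ultimately show ?thesis by (auto simp: boundaries_def)
qed

text \<open>The first isomorphism theorem for the map from the cycles of K to the homology of L: the
  hypotheses say that its kernel consists of the boundaries and that it is onto.\<close>

lemma homology_isoI:
  assumes cm: "chain_map K L f"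
    and inj: "\<And>z. z \<in> cycles K n \<Longrightarrow> f z \<in> boundaries L n \<Longrightarrow> z \<in> boundaries K n"
    and surj: "\<And>z. z \<in> cycles L n \<Longrightarrow> \<exists>u \<in> cycles K n. \<exists>b \<in> boundaries L n. z = b \<otimes>\<^bsub>fst L n\<^esub> f u"
  shows "homology_iso K L f n"
proof -
  have K: "chain_complex K" and L: "chain_complex L" using cm by (auto simp: chain_map_def)
  define A where "A = (fst K n)\<lparr>carrier := cycles K n\<rparr>"
  define B where "B = (fst L n)\<lparr>carrier := cycles L n\<rparr>"
  define C where "C = homology L n"
  have gK: "comm_group (fst K n)" and gL: "comm_group (fst L n)" using K L by (auto simp: chain_complex_def)
  interpret gK: comm_group "fst K n" by (rule gK)
  interpret gL: comm_group "fst L n" by (rule gL)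
  have gA: "group A" unfolding A_def by (rule gK.subgroup_imp_group[OF subgroup_cycles[OF K]])
  have gB: "comm_group B" unfolding B_def
    using gL.subgroup_imp_group[OF subgroup_cycles[OF L]] subgroup.subset[OF subgroup_cycles[OF L]]
    by (intro group.group_comm_groupI) (auto simp: subset_iff gL.m_comm)
  interpret B: comm_group B by (rule gB)
  have sB: "subgroup (boundaries L n) B"
    unfolding B_def by (rule gL.subgroup_incl[OF subgroup_boundaries[OF L] subgroup_cycles[OF L] boundaries_cycles[OF L]])
  have nB: "boundaries L n \<lhd> B" using sB by (simp add: B.normal_iff_subgroup)
  have C: "C = B Mod boundaries L n" by (simp add: C_def homology_def B_def)
  have gC: "group C" unfolding C by (rule normal.factorgroup_is_group[OF nB])
  define h where "h z = boundaries L n #>\<^bsub>B\<^esub> f z" for z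
  have fB: "f z \<in> carrier B" if "z \<in> carrier A" for z
    using chain_map_cycles[OF cm] that by (simp add: A_def B_def)
  have "h \<in> hom A C"
  proof (rule homI)
    fix x assume x: "x \<in> carrier A"
    show "h x \<in> carrier C"
      using fB[OF x] by (auto simp: h_def C FactGroup_def RCOSETS_def)
    fix y assume y: "y \<in> carrier A"
    have "x \<in> carrier (fst K n)" "y \<in> carrier (fst K n)"
      using x y subgroup.subset[OF subgroup_cycles[OF K]] by (auto simp: A_def)
    then have "f (x \<otimes>\<^bsub>A\<^esub> y) = f x \<otimes>\<^bsub>B\<^esub> f y"
      using cm by (simp add: A_def B_def chain_map_def hom_def)
    then show "h (x \<otimes>\<^bsub>A\<^esub> y) = h x \<otimes>\<^bsub>C\<^esub> h y"
      using normal.rcos_sum[OF nB fB[OF x] fB[OF y]] by (simp add: h_def C FactGroup_def)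
  qed
  then interpret h: group_hom A C h
    using gA gC by (simp add: group_hom_def group_hom_axioms_def)
  have h1: "h z = boundaries L n \<longleftrightarrow> f z \<in> boundaries L n" if "z \<in> carrier A" for z
    unfolding h_def using B.coset_join1[OF _ fB[OF that] sB] B.coset_join2[OF fB[OF that] sB] by auto
  have ker: "kernel A C h = boundaries K n"
  proof -
    have "\<one>\<^bsub>C\<^esub> = boundaries L n" by (simp add: C FactGroup_def)
    then have "z \<in> kernel A C h \<longleftrightarrow> z \<in> carrier A \<and> f z \<in> boundaries L n" for z
      using h1[of z] by (auto simp: kernel_def)
    moreover have "z \<in> boundaries K n \<longleftrightarrow> z \<in> carrier A \<and> f z \<in> boundaries L n" for z
      using inj[of z] chain_map_boundaries[OF cm, of z n] subsetD[OF boundaries_cycles[OF K, of n], of z]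
      by (auto simp: A_def)
    ultimately show ?thesis by blast
  qed
  have im: "h ` carrier A = carrier C"
  proof
    show "carrier C \<subseteq> h ` carrier A"
    proof
      fix y assume "y \<in> carrier C"
      then obtain z where z: "z \<in> carrier B" "y = boundaries L n #>\<^bsub>B\<^esub> z"
        by (auto simp: C FactGroup_def RCOSETS_def)
      then obtain u b where ub: "u \<in> cycles K n" "b \<in> boundaries L n" "z = b \<otimes>\<^bsub>B\<^esub> f u"
        using surj[of z] by (auto simp: B_def)
      have u: "u \<in> carrier A" using ub by (simp add: A_def)
      have "z \<in> boundaries L n #>\<^bsub>B\<^esub> f u"
        using ub by (auto simp: r_coset_def)
      then have "y = h u"
        unfolding z(2) h_def using B.repr_independence[OF _ fB[OF u] sB] by auto
      then show "y \<in> h ` carrier A" using u by auto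
    qed
  qed (use h.hom_closed in auto)
  have iso: "(\<lambda>X. the_elem (h ` X)) \<in> iso (homology K n) C"
    using h.FactGroup_iso_set[OF im] unfolding ker unfolding A_def homology_def .
  have HA: "homology K n = A Mod boundaries K n" by (simp add: homology_def A_def)
  have eq: "homology_map L f n X = the_elem (h ` X)" if X: "X \<in> carrier (homology K n)" for X
  proof -
    obtain z where z: "z \<in> carrier A" "X = boundaries K n #>\<^bsub>A\<^esub> z"
      using X unfolding HA by (auto simp: FactGroup_def RCOSETS_def)
    \<comment> \<open>The union in \<open>homology_map\<close> runs over equal cosets, so it is the
      element that \<open>the_elem\<close> picks.\<close>
    have const: "h z' = h z" if z': "z' \<in> X" for z'
    proof -
      obtain b where b: "b \<in> boundaries K n" "z' = b \<otimes>\<^bsub>A\<^esub> z" using z' z by (auto simp: r_coset_def)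
      have bA: "b \<in> kernel A C h" using b ker by simp
      then have "b \<in> carrier A" "h b = \<one>\<^bsub>C\<^esub>" by (auto simp: kernel_def)
      then show ?thesis using b(2) z(1) by simp
    qed
    have "z \<in> X"
    proof -
      have "\<one>\<^bsub>A\<^esub> \<in> boundaries K n"
        using subgroup.one_closed[OF subgroup_boundaries[OF K]] by (simp add: A_def)
      moreover have "z = \<one>\<^bsub>A\<^esub> \<otimes>\<^bsub>A\<^esub> z" using z(1) by simp
      ultimately show ?thesis unfolding z(2) r_coset_def by blast
    qed
    then have im: "h ` X = {h z}" using const by blast
    have "homology_map L f n X = \<Union> (h ` X)"
      unfolding homology_map_def h_def r_coset_def B_def by simp
    then show ?thesis by (simp add: im)
  qed
  have "homology_map L f n \<in> hom (homology K n) C"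
  proof (rule homI)
    have gH: "group (homology K n)"
    proof -
      have "boundaries K n \<lhd> A" using h.normal_kernel by (simp add: ker)
      then show ?thesis unfolding homology_def A_def[symmetric] by (rule normal.factorgroup_is_group)
    qed
    interpret H: group "homology K n" by (rule gH)
    fix X Y assume X: "X \<in> carrier (homology K n)" and Y: "Y \<in> carrier (homology K n)"
    show "homology_map L f n X \<in> carrier C" using iso X by (auto simp: eq iso_def hom_def)
    show "homology_map L f n (X \<otimes>\<^bsub>homology K n\<^esub> Y) = homology_map L f n X \<otimes>\<^bsub>C\<^esub> homology_map L f n Y"
      using iso X Y by (auto simp: eq iso_def hom_def)
  qed
  moreover have "bij_betw (homology_map L f n) (carrier (homology K n)) (carrier C)"
    using iso eq by (auto simp: iso_def cong: bij_betw_cong)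
  ultimately show ?thesis by (simp add: homology_iso_def iso_def C_def)
qed

section \<open>Bar chains with coefficients in a module\<close>

text \<open>The analogue of \<open>frag_additive_eq\<close> for targets given by a carrier. The
  homomorphisms are known to respect sums, so the step for a - b cancels b from (a - b) + b.\<close>

lemma free_Abelian_hom_eq:
  assumes f: "f \<in> hom (free_Abelian_group S) H" and g: "g \<in> hom (free_Abelian_group S) H"
    and "group H" and eq: "\<And>x. x \<in> S \<Longrightarrow> f (frag_of x) = g (frag_of x)"
    and "Poly_Mapping.keys c \<subseteq> S"
  shows "f c = g c"
proof -
  interpret H: group H by fact
  interpret f: group_hom "free_Abelian_group S" H f
    by (simp add: group_hom_def group_hom_axioms_def f assms(3))
  interpret g: group_hom "free_Abelian_group S" H g
    by (simp add: group_hom_def group_hom_axioms_def g assms(3))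
  have "Poly_Mapping.keys c \<subseteq> S \<and> f c = g c"
    using assms(5)
  proof (induction c rule: frag_induction)
    case zero
    then show ?case using f.hom_one g.hom_one by simp
  next
    case (one x)
    then show ?case using eq by simp
  next
    case (diff a b)
    then have k: "Poly_Mapping.keys (a - b) \<subseteq> S" by (intro keys_diff_subset) auto
    have "f (a - b) \<otimes>\<^bsub>H\<^esub> f b = f a" "g (a - b) \<otimes>\<^bsub>H\<^esub> g b = g a"
      using k diff f.hom_mult[of "a - b" b] g.hom_mult[of "a - b" b] by auto
    then have "f (a - b) \<otimes>\<^bsub>H\<^esub> f b = g (a - b) \<otimes>\<^bsub>H\<^esub> f b" using diff by simp
    moreover have "f (a - b) \<in> carrier H" "g (a - b) \<in> carrier H" "f b \<in> carrier H"
      using k diff f.hom_closed g.hom_closed by auto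
    ultimately show ?case using k by simp
  qed
  then show ?thesis by simp
qed

section \<open>Integral combinations in an abelian group\<close>

context abelian_group
begin

definition zext :: "('k \<Rightarrow> 'a) \<Rightarrow> ('k \<Rightarrow>\<^sub>0 int) \<Rightarrow> 'a" where
  "zext h w = (\<Oplus>k\<in>Poly_Mapping.keys w. [Poly_Mapping.lookup w k] \<cdot> h k)"

lemma zext_superset:
  assumes "\<And>k. h k \<in> carrier G" "finite S" "Poly_Mapping.keys w \<subseteq> S"
  shows "zext h w = (\<Oplus>k\<in>S. [Poly_Mapping.lookup w k] \<cdot> h k)"
  unfolding zext_def
  by (rule add.finprod_mono_neutral_cong_left[OF assms(2,3)])
    (use assms(1) in \<open>auto simp: in_keys_iff add_pow_def intro!: add.int_pow_closed[unfolded add_pow_def]\<close>)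

lemma zext_closed: "(\<And>k. h k \<in> carrier G) \<Longrightarrow> zext h w \<in> carrier G"
  unfolding zext_def by (intro finsum_closed) (auto intro!: add.int_pow_closed)

lemma zext_0: "zext h 0 = \<zero>"
  by (simp add: zext_def)

lemma zext_of: "(\<And>k. h k \<in> carrier G) \<Longrightarrow> zext h (frag_of k) = h k"
  using add.int_pow_1[of "h k"] by (simp add: zext_def)

lemma zext_add:
  assumes "\<And>k. h k \<in> carrier G"
  shows "zext h (v + w) = zext h v \<oplus> zext h w"
proof -
  let ?S = "Poly_Mapping.keys v \<union> Poly_Mapping.keys w"
  have s: "zext h u = (\<Oplus>k\<in>?S. [Poly_Mapping.lookup u k] \<cdot> h k)" if "Poly_Mapping.keys u \<subseteq> ?S" for u
    by (rule zext_superset) (use assms that in auto)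
  have "zext h (v + w) = (\<Oplus>k\<in>?S. [Poly_Mapping.lookup v k] \<cdot> h k \<oplus> [Poly_Mapping.lookup w k] \<cdot> h k)"
    using s[OF Poly_Mapping.keys_add] assms by (simp add: lookup_add add.int_pow_mult)
  then show ?thesis
    using assms by (simp add: s finsum_addf Pi_def add.int_pow_closed)
qed

lemma zext_minus:
  assumes "\<And>k. h k \<in> carrier G"
  shows "zext h (- w) = \<ominus> zext h w"
proof -
  have "zext h (- w) \<oplus> zext h w = \<zero>"
    using zext_add[of h "- w" w, OF assms] by (simp add: zext_0)
  then show ?thesis
    by (intro minus_equality[symmetric] zext_closed assms)
qed

lemma zext_cmul_sign:
  assumes "\<And>k. h k \<in> carrier G"
  shows "zext h (frag_cmul ((-1) ^ i) w) = [((-1) ^ i :: int)] \<cdot> zext h w"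
proof -
  have c: "zext h w \<in> carrier G" by (rule zext_closed) (rule assms)
  have "[((-1) :: int)] \<cdot> zext h w = \<ominus> zext h w" "[(1 :: int)] \<cdot> zext h w = zext h w"
    using add.int_pow_neg[OF c, of 1] add.int_pow_1[OF c] by (simp_all add: a_inv_def add_pow_def)
  then show ?thesis
    by (cases "even i") (simp_all add: zext_minus[OF assms])
qed

lemma zext_sum:
  assumes "\<And>k. h k \<in> carrier G"
  shows "finite I \<Longrightarrow> zext h (\<Sum>i\<in>I. g i) = (\<Oplus>i\<in>I. zext h (g i))"
  by (induction I rule: finite_induct) (auto simp: zext_0 zext_add[OF assms] zext_closed[OF assms])

end

lemma (in abelian_group) add_pow_add_distrib:
  "a \<in> carrier G \<Longrightarrow> b \<in> carrier G \<Longrightarrow> [(k::int)] \<cdot> (a \<oplus> b) = [k] \<cdot> a \<oplus> [k] \<cdot> b"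
  using add.int_pow_distrib[of a b k] by simp

section \<open>The groups of bar chains and maps between them\<close>

lemma comm_group_bar_chains:
  assumes "abelian_group M"
  shows "comm_group (bar_chains G M n)"
proof -
  interpret M: abelian_group M by fact
  show ?thesis
  proof (rule comm_groupI)
    fix c d assume c: "c \<in> carrier (bar_chains G M n)" "d \<in> carrier (bar_chains G M n)"
    have nz: "c x \<noteq> \<zero>\<^bsub>M\<^esub> \<or> d x \<noteq> \<zero>\<^bsub>M\<^esub>" if "c x \<oplus>\<^bsub>M\<^esub> d x \<noteq> \<zero>\<^bsub>M\<^esub>" for x
      using that by auto
    then have "{x. c x \<oplus>\<^bsub>M\<^esub> d x \<noteq> \<zero>\<^bsub>M\<^esub>} \<subseteq> {x. c x \<noteq> \<zero>\<^bsub>M\<^esub>} \<union> {x. d x \<noteq> \<zero>\<^bsub>M\<^esub>}" by blast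
    then have "finite {x. c x \<oplus>\<^bsub>M\<^esub> d x \<noteq> \<zero>\<^bsub>M\<^esub>}"
      using c by (auto simp: bar_chains_def intro: finite_subset)
    then show "c \<otimes>\<^bsub>bar_chains G M n\<^esub> d \<in> carrier (bar_chains G M n)"
      using c nz by (fastforce simp: bar_chains_def)
  next
    fix c assume c: "c \<in> carrier (bar_chains G M n)"
    have z: "\<ominus>\<^bsub>M\<^esub> c x \<noteq> \<zero>\<^bsub>M\<^esub> \<longleftrightarrow> c x \<noteq> \<zero>\<^bsub>M\<^esub>" for x
      using c M.minus_minus[of "c x"] by (auto simp: bar_chains_def)
    show "\<exists>d\<in>carrier (bar_chains G M n). d \<otimes>\<^bsub>bar_chains G M n\<^esub> c = \<one>\<^bsub>bar_chains G M n\<^esub>"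
    proof (rule bexI[of _ "\<lambda>x. \<ominus>\<^bsub>M\<^esub> c x"])
      show "(\<lambda>x. \<ominus>\<^bsub>M\<^esub> c x) \<in> carrier (bar_chains G M n)"
        using c unfolding bar_chains_def partial_object.simps mem_Collect_eq z by auto
    qed (use c in \<open>auto simp: bar_chains_def M.l_neg\<close>)
  qed (auto simp: bar_chains_def fun_eq_iff intro: M.a_assoc M.a_comm)
qed

definition single_chain :: "('m, 'y) ring_scheme \<Rightarrow> 'm \<Rightarrow> 'g list \<Rightarrow> 'g list \<Rightarrow> 'm" where
  "single_chain M a l = (\<lambda>y. if y = l then a else \<zero>\<^bsub>M\<^esub>)"

text \<open>The set L confines additivity of the weight to lists of the right length over the group,
  since \<open>bar_weight\<close> is known to be additive only where a group element acts.\<close>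

locale push = M: abelian_group M + N: abelian_group N
  for M :: "('m, 'y) ring_scheme" and N :: "('n, 'z) ring_scheme" +
  fixes w :: "'g list \<Rightarrow> 'm \<Rightarrow> 'n" and L :: "'g list set"
  assumes w_closed: "x \<in> L \<Longrightarrow> a \<in> carrier M \<Longrightarrow> w x a \<in> carrier N"
    and w_add: "x \<in> L \<Longrightarrow> a \<in> carrier M \<Longrightarrow> b \<in> carrier M \<Longrightarrow> w x (a \<oplus>\<^bsub>M\<^esub> b) = w x a \<oplus>\<^bsub>N\<^esub> w x b"
begin

lemma w_0:
  assumes "x \<in> L"
  shows "w x \<zero>\<^bsub>M\<^esub> = \<zero>\<^bsub>N\<^esub>"
proof -
  have "w x \<zero>\<^bsub>M\<^esub> \<oplus>\<^bsub>N\<^esub> w x \<zero>\<^bsub>M\<^esub> = w x \<zero>\<^bsub>M\<^esub>"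
    using w_add[of x "\<zero>\<^bsub>M\<^esub>" "\<zero>\<^bsub>M\<^esub>"] assms by simp
  then show ?thesis
    using w_closed[of x "\<zero>\<^bsub>M\<^esub>"] assms N.add.r_cancel_one by simp
qed

lemma push_chain_superset:
  assumes "\<And>x. c x \<in> carrier M" "{x. c x \<noteq> \<zero>\<^bsub>M\<^esub>} \<subseteq> S" "finite S" "S \<subseteq> L"
  shows "push_chain M N w f c y = (\<Oplus>\<^bsub>N\<^esub>x\<in>S. if f x = y then w x (c x) else \<zero>\<^bsub>N\<^esub>)"
proof -
  have "(\<Oplus>\<^bsub>N\<^esub>x\<in>{x. c x \<noteq> \<zero>\<^bsub>M\<^esub> \<and> f x = y}. w x (c x))
      = (\<Oplus>\<^bsub>N\<^esub>x\<in>S. if f x = y then w x (c x) else \<zero>\<^bsub>N\<^esub>)"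
    by (rule N.add.finprod_mono_neutral_cong_left)
      (use assms w_closed w_0 in \<open>auto simp: subset_iff\<close>)
  then show ?thesis by (simp add: push_chain_def)
qed

lemma push_chain_closed:
  assumes "\<And>x. c x \<in> carrier M" "{x. c x \<noteq> \<zero>\<^bsub>M\<^esub>} \<subseteq> L"
  shows "push_chain M N w f c y \<in> carrier N"
  unfolding push_chain_def by (rule N.finsum_closed) (use assms w_closed in auto)

lemma push_chain_add:
  assumes "\<And>x. c x \<in> carrier M" "finite {x. c x \<noteq> \<zero>\<^bsub>M\<^esub>}" "{x. c x \<noteq> \<zero>\<^bsub>M\<^esub>} \<subseteq> L"
    and "\<And>x. d x \<in> carrier M" "finite {x. d x \<noteq> \<zero>\<^bsub>M\<^esub>}" "{x. d x \<noteq> \<zero>\<^bsub>M\<^esub>} \<subseteq> L"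
  shows "push_chain M N w f (\<lambda>x. c x \<oplus>\<^bsub>M\<^esub> d x) y = push_chain M N w f c y \<oplus>\<^bsub>N\<^esub> push_chain M N w f d y"
proof -
  let ?S = "{x. c x \<noteq> \<zero>\<^bsub>M\<^esub>} \<union> {x. d x \<noteq> \<zero>\<^bsub>M\<^esub>}"
  have S: "finite ?S" "?S \<subseteq> L" using assms by auto
  have cd: "{x. c x \<oplus>\<^bsub>M\<^esub> d x \<noteq> \<zero>\<^bsub>M\<^esub>} \<subseteq> ?S" by auto
  have "push_chain M N w f (\<lambda>x. c x \<oplus>\<^bsub>M\<^esub> d x) y
      = (\<Oplus>\<^bsub>N\<^esub>x\<in>?S. if f x = y then w x (c x \<oplus>\<^bsub>M\<^esub> d x) else \<zero>\<^bsub>N\<^esub>)"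
    by (rule push_chain_superset[OF _ cd S]) (simp add: assms)
  also have "\<dots> = (\<Oplus>\<^bsub>N\<^esub>x\<in>?S. (if f x = y then w x (c x) else \<zero>\<^bsub>N\<^esub>) \<oplus>\<^bsub>N\<^esub> (if f x = y then w x (d x) else \<zero>\<^bsub>N\<^esub>))"
    by (rule N.add.finprod_cong') (use assms S w_add w_closed in \<open>auto simp: subset_iff\<close>)
  also have "\<dots> = (\<Oplus>\<^bsub>N\<^esub>x\<in>?S. if f x = y then w x (c x) else \<zero>\<^bsub>N\<^esub>)
      \<oplus>\<^bsub>N\<^esub> (\<Oplus>\<^bsub>N\<^esub>x\<in>?S. if f x = y then w x (d x) else \<zero>\<^bsub>N\<^esub>)"
    by (rule N.finsum_addf) (use assms S w_closed in \<open>auto simp: subset_iff\<close>)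
  also have "\<dots> = push_chain M N w f c y \<oplus>\<^bsub>N\<^esub> push_chain M N w f d y"
    using push_chain_superset[of c ?S f y] push_chain_superset[of d ?S f y] assms S by simp
  finally show ?thesis .
qed

lemma push_chain_single:
  assumes "a \<in> carrier M" "l \<in> L"
  shows "push_chain M N w f (single_chain M a l) = single_chain N (w l a) (f l)"
proof
  fix y
  have "push_chain M N w f (single_chain M a l) y
      = (\<Oplus>\<^bsub>N\<^esub>x\<in>{l}. if f x = y then w x (single_chain M a l x) else \<zero>\<^bsub>N\<^esub>)"
    by (rule push_chain_superset) (use assms in \<open>auto simp: single_chain_def\<close>)
  also have "\<dots> = single_chain N (w l a) (f l) y"
    using assms w_closed by (auto simp: single_chain_def)
  finally show "push_chain M N w f (single_chain M a l) y = single_chain N (w l a) (f l) y" .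
qed

lemma push_chain_nonzero:
  assumes "push_chain M N w f c y \<noteq> \<zero>\<^bsub>N\<^esub>"
  obtains x where "c x \<noteq> \<zero>\<^bsub>M\<^esub>" "f x = y"
proof -
  have "{x. c x \<noteq> \<zero>\<^bsub>M\<^esub> \<and> f x = y} \<noteq> {}"
  proof
    assume "{x. c x \<noteq> \<zero>\<^bsub>M\<^esub> \<and> f x = y} = {}"
    then have "push_chain M N w f c y = \<zero>\<^bsub>N\<^esub>"
      unfolding push_chain_def by (simp only: N.finsum_empty)
    with assms show False by simp
  qed
  then show ?thesis using that by blast
qed

lemma push_chain_hom:
  assumes "L = {l. length l = n \<and> set l \<subseteq> carrier G}"
    and "\<And>l. l \<in> L \<Longrightarrow> length (f l) = n' \<and> set (f l) \<subseteq> carrier H"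
  shows "push_chain M N w f \<in> hom (bar_chains G M n) (bar_chains H N n')"
proof (rule homI)
  fix c assume c: "c \<in> carrier (bar_chains G M n)"
  have c': "\<And>x. c x \<in> carrier M" "finite {x. c x \<noteq> \<zero>\<^bsub>M\<^esub>}" "{x. c x \<noteq> \<zero>\<^bsub>M\<^esub>} \<subseteq> L"
    using c by (auto simp: bar_chains_def assms(1))
  have "{y. push_chain M N w f c y \<noteq> \<zero>\<^bsub>N\<^esub>} \<subseteq> f ` {x. c x \<noteq> \<zero>\<^bsub>M\<^esub>}"
    by (auto elim!: push_chain_nonzero)
  then have "finite {y. push_chain M N w f c y \<noteq> \<zero>\<^bsub>N\<^esub>}"
    using c'(2) by (rule finite_surj[rotated])
  moreover have "length y = n' \<and> set y \<subseteq> carrier H" if "push_chain M N w f c y \<noteq> \<zero>\<^bsub>N\<^esub>" for y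
    using that c'(3) assms(2) by (elim push_chain_nonzero) blast
  ultimately show "push_chain M N w f c \<in> carrier (bar_chains H N n')"
    by (simp add: bar_chains_def push_chain_closed[OF c'(1,3)])
  fix d assume d: "d \<in> carrier (bar_chains G M n)"
  have d': "\<And>x. d x \<in> carrier M" "finite {x. d x \<noteq> \<zero>\<^bsub>M\<^esub>}" "{x. d x \<noteq> \<zero>\<^bsub>M\<^esub>} \<subseteq> L"
    using d by (auto simp: bar_chains_def assms(1))
  show "push_chain M N w f (c \<otimes>\<^bsub>bar_chains G M n\<^esub> d)
      = push_chain M N w f c \<otimes>\<^bsub>bar_chains H N n'\<^esub> push_chain M N w f d"
    by (simp add: bar_chains_def fun_eq_iff push_chain_add[OF c' d'])
qed

end

locale bar_module = group G + M: abelian_group M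
  for G (structure) and M :: "('m, 'y) ring_scheme" +
  fixes act :: "'m \<Rightarrow> 'a \<Rightarrow> 'm"
  assumes mact_closed: "a \<in> carrier M \<Longrightarrow> g \<in> carrier G \<Longrightarrow> act a g \<in> carrier M"
    and mact_one: "a \<in> carrier M \<Longrightarrow> act a \<one> = a"
    and mact_mult: "a \<in> carrier M \<Longrightarrow> g \<in> carrier G \<Longrightarrow> h \<in> carrier G \<Longrightarrow> act a (g \<otimes> h) = act (act a g) h"
    and mact_add: "a \<in> carrier M \<Longrightarrow> b \<in> carrier M \<Longrightarrow> g \<in> carrier G \<Longrightarrow>
      act (a \<oplus>\<^bsub>M\<^esub> b) g = act a g \<oplus>\<^bsub>M\<^esub> act b g"
begin

sublocale gset G "carrier M" act
  by unfold_locales (auto simp: mact_closed mact_one mact_mult)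

abbreviation "C n \<equiv> bar_chains G M n"

lemma C_group: "comm_group (C n)"
  by (rule comm_group_bar_chains) (rule M.abelian_group_axioms)

text \<open>The value zero off the carrier makes every coefficient an element of M, as the lemmas on
  \<open>zext\<close> demand for all indices.\<close>

definition coeff_at :: "'a list \<Rightarrow> 'm \<times> 'a list \<Rightarrow> 'm" where
  "coeff_at y k = (if snd k = y \<and> fst k \<in> carrier M then fst k else \<zero>\<^bsub>M\<^esub>)"

text \<open>The surjection from the bar complex of the set \<open>carrier M\<close> onto that of the
  module M, induced by the map from the free abelian group on M to M. It lets identities for
  \<open>bar_d\<close> and \<open>tensor_map\<close> be checked on generators.\<close>

definition \<Theta> :: "('m \<times> 'a list \<Rightarrow>\<^sub>0 int) \<Rightarrow> 'a list \<Rightarrow> 'm" where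
  "\<Theta> w = (\<lambda>y. M.zext (coeff_at y) w)"

lemma coeff_at_closed: "coeff_at y k \<in> carrier M"
  by (auto simp: coeff_at_def)

lemma Theta_of: "a \<in> carrier M \<Longrightarrow> \<Theta> (frag_of (a, l)) = single_chain M a l"
  by (auto simp: \<Theta>_def M.zext_of coeff_at_closed fun_eq_iff single_chain_def) (auto simp: coeff_at_def)

lemma Theta_add: "\<Theta> (v + w) = (\<lambda>y. \<Theta> v y \<oplus>\<^bsub>M\<^esub> \<Theta> w y)"
  by (simp add: \<Theta>_def M.zext_add coeff_at_closed)

lemma Theta_closed:
  assumes "Poly_Mapping.keys w \<subseteq> bars n"
  shows "\<Theta> w \<in> carrier (C n)"
proof -
  have nz: "y \<in> snd ` Poly_Mapping.keys w" if "\<Theta> w y \<noteq> \<zero>\<^bsub>M\<^esub>" for y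
  proof (rule ccontr)
    assume "y \<notin> snd ` Poly_Mapping.keys w"
    then have "\<Theta> w y = (\<Oplus>\<^bsub>M\<^esub>k\<in>Poly_Mapping.keys w. \<zero>\<^bsub>M\<^esub>)"
      unfolding \<Theta>_def M.zext_def
      by (intro M.add.finprod_cong') (auto simp: coeff_at_def image_iff M.add.int_pow_one)
    with that show False by simp
  qed
  then have "{y. \<Theta> w y \<noteq> \<zero>\<^bsub>M\<^esub>} \<subseteq> snd ` Poly_Mapping.keys w" by auto
  then have "finite {y. \<Theta> w y \<noteq> \<zero>\<^bsub>M\<^esub>}" by (rule finite_subset) simp
  moreover have "length y = n \<and> set y \<subseteq> carrier G" if "\<Theta> w y \<noteq> \<zero>\<^bsub>M\<^esub>" for y
    using nz[OF that] assms by (auto simp: bars_def)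
  moreover have "\<Theta> w y \<in> carrier M" for y
    unfolding \<Theta>_def by (rule M.zext_closed) (rule coeff_at_closed)
  ultimately show ?thesis by (simp add: bar_chains_def)
qed

lemma Theta_hom: "\<Theta> \<in> hom (free_Abelian_group (bars n)) (C n)"
proof (rule homI)
  fix v w
  show "\<Theta> (v \<otimes>\<^bsub>free_Abelian_group (bars n)\<^esub> w) = \<Theta> v \<otimes>\<^bsub>C n\<^esub> \<Theta> w"
    by (simp add: free_Abelian_group_def Theta_add bar_chains_def)
qed (simp add: free_Abelian_group_def Theta_closed)

lemma Theta_surj:
  assumes "c \<in> carrier (C n)"
  obtains w where "Poly_Mapping.keys w \<subseteq> bars n" "\<Theta> w = c"
proof
  let ?S = "{y. c y \<noteq> \<zero>\<^bsub>M\<^esub>}"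
  have S: "finite ?S" and cM: "c y \<in> carrier M" for y using assms by (auto simp: bar_chains_def)
  define w where "w = (\<Sum>l\<in>?S. frag_of (c l, l))"
  show "Poly_Mapping.keys w \<subseteq> bars n"
    unfolding w_def using assms
    by (intro order.trans[OF Poly_Mapping.keys_sum]) (auto simp: bars_def bar_chains_def)
  show "\<Theta> w = c"
  proof
    fix y
    have "\<Theta> w y = (\<Oplus>\<^bsub>M\<^esub>l\<in>?S. \<Theta> (frag_of (c l, l)) y)"
      unfolding \<Theta>_def w_def by (rule M.zext_sum) (auto simp: coeff_at_closed S)
    also have "\<dots> = (\<Oplus>\<^bsub>M\<^esub>l\<in>?S. if y = l then c l else \<zero>\<^bsub>M\<^esub>)"
      by (rule M.add.finprod_cong') (auto simp: Theta_of cM single_chain_def)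
    also have "\<dots> = c y"
    proof (cases "y \<in> ?S")
      case True
      then show ?thesis using M.add.finprod_singleton[OF True S, of c] cM by auto
    next
      case False
      then have "(\<Oplus>\<^bsub>M\<^esub>l\<in>?S. if y = l then c l else \<zero>\<^bsub>M\<^esub>) = (\<Oplus>\<^bsub>M\<^esub>l\<in>?S. \<zero>\<^bsub>M\<^esub>)"
        by (intro M.add.finprod_cong') auto
      with False show ?thesis by simp
    qed
    finally show "\<Theta> w y = c y" .
  qed
qed

lemma push_face:
  assumes "i \<le> Suc n"
  shows "push M M (bar_weight act i) {l. length l = Suc n \<and> set l \<subseteq> carrier G}"
proof -
  have "hd l \<in> carrier G" if "length l = Suc n" "set l \<subseteq> carrier G" for l :: "'a list"
    using that by (cases l) auto
  then show ?thesis
    by unfold_locales (auto simp: bar_weight_def mact_closed mact_add)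
qed

lemma length_bar_face:
  assumes "length l = Suc n" "set l \<subseteq> carrier G" "i \<le> Suc n"
  shows "length (bar_face G i l) = n \<and> set (bar_face G i l) \<subseteq> carrier G"
proof -
  have "l ! j \<in> carrier G" if "j < Suc n" for j using that assms by (auto simp: subset_iff)
  then show ?thesis
    using assms by (auto simp: bar_face_def subset_iff dest: in_set_takeD in_set_dropD in_set_butlastD list.set_sel(2)[rotated])
qed

lemma bar_d_hom: "bar_d G M act n \<in> hom (C (Suc n)) (C n)"
proof (rule homI)
  let ?P = "\<lambda>i. push_chain M M (bar_weight act i) (bar_face G i)"
  have P: "?P i \<in> hom (C (Suc n)) (C n)" if "i \<le> Suc n" for i
    by (rule push.push_chain_hom[OF push_face[OF that] refl]) (use length_bar_face that in auto)
  fix c assume c: "c \<in> carrier (C (Suc n))"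
  have Pc: "?P i c \<in> carrier (C n)" if "i \<le> Suc n" for i using hom_in_carrier[OF P[OF that] c] .
  have PM: "?P i c y \<in> carrier M" if "i \<le> Suc n" for i y using Pc[OF that] by (simp add: bar_chains_def)
  have nz: "\<exists>i\<le>Suc n. ?P i c y \<noteq> \<zero>\<^bsub>M\<^esub>" if "bar_d G M act n c y \<noteq> \<zero>\<^bsub>M\<^esub>" for y
  proof (rule ccontr)
    assume "\<not> ?thesis"
    then have "bar_d G M act n c y = (\<Oplus>\<^bsub>M\<^esub>i\<in>{0..Suc n}. \<zero>\<^bsub>M\<^esub>)"
      unfolding bar_d_def by (intro M.add.finprod_cong') (auto simp: M.add.int_pow_one)
    with that show False by simp
  qed
  then have "{y. bar_d G M act n c y \<noteq> \<zero>\<^bsub>M\<^esub>} \<subseteq> (\<Union>i\<in>{..Suc n}. {y. ?P i c y \<noteq> \<zero>\<^bsub>M\<^esub>})" by auto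
  moreover have "finite (\<Union>i\<in>{..Suc n}. {y. ?P i c y \<noteq> \<zero>\<^bsub>M\<^esub>})" using Pc by (auto simp: bar_chains_def)
  ultimately have "finite {y. bar_d G M act n c y \<noteq> \<zero>\<^bsub>M\<^esub>}" by (rule finite_subset)
  moreover have "length y = n \<and> set y \<subseteq> carrier G" if y: "bar_d G M act n c y \<noteq> \<zero>\<^bsub>M\<^esub>" for y
  proof -
    obtain i where "i \<le> Suc n" "?P i c y \<noteq> \<zero>\<^bsub>M\<^esub>" using nz[OF y] by auto
    then show ?thesis using Pc[of i] by (simp add: bar_chains_def)
  qed
  moreover have "bar_d G M act n c y \<in> carrier M" for y
    unfolding bar_d_def by (rule M.finsum_closed) (auto intro!: M.add.int_pow_closed PM)
  ultimately show "bar_d G M act n c \<in> carrier (C n)" by (simp add: bar_chains_def)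
  fix d assume d: "d \<in> carrier (C (Suc n))"
  have PMd: "?P i d y \<in> carrier M" if "i \<le> Suc n" for i y
    using hom_in_carrier[OF P[OF that] d] by (simp add: bar_chains_def)
  have "?P i (c \<otimes>\<^bsub>C (Suc n)\<^esub> d) y = ?P i c y \<oplus>\<^bsub>M\<^esub> ?P i d y" if "i \<le> Suc n" for i y
    using hom_mult[OF P[OF that] c d] by (simp add: bar_chains_def)
  then have "bar_d G M act n (c \<otimes>\<^bsub>C (Suc n)\<^esub> d) y
     = (\<Oplus>\<^bsub>M\<^esub>i\<in>{0..Suc n}. [((-1) ^ i :: int)] \<cdot>\<^bsub>M\<^esub> ?P i c y \<oplus>\<^bsub>M\<^esub> [((-1) ^ i :: int)] \<cdot>\<^bsub>M\<^esub> ?P i d y)" for y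
    unfolding bar_d_def
    by (intro M.add.finprod_cong') (auto simp: M.add_pow_add_distrib PM PMd intro!: M.add.int_pow_closed)
  also have "\<dots> y = bar_d G M act n c y \<oplus>\<^bsub>M\<^esub> bar_d G M act n d y" for y
    unfolding bar_d_def
    by (rule M.finsum_addf) (auto intro!: M.add.int_pow_closed PM PMd)
  finally show "bar_d G M act n (c \<otimes>\<^bsub>C (Suc n)\<^esub> d) = bar_d G M act n c \<otimes>\<^bsub>C n\<^esub> bar_d G M act n d"
    by (auto simp: bar_chains_def)
qed

lemma bar_d_single:
  assumes "(a, l) \<in> bars (Suc n)"
  shows "bar_d G M act n (single_chain M a l) = \<Theta> (dgen (a, l))"
proof
  fix y
  have l: "a \<in> carrier M" "length l = Suc n" "set l \<subseteq> carrier G" "l \<noteq> []"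
    using assms by (auto simp: bars_def)
  have hl: "hd l \<in> carrier G" using l by (cases l) auto
  have "bar_d G M act n (single_chain M a l) y = (\<Oplus>\<^bsub>M\<^esub>i\<in>{0..Suc n}. [((-1) ^ i :: int)] \<cdot>\<^bsub>M\<^esub>
      \<Theta> (frag_of (if i = 0 then act a (hd l) else a, bar_face G i l)) y)"
    unfolding bar_d_def
  proof (rule M.add.finprod_cong'[OF refl])
    fix i assume "i \<in> {0..Suc n}"
    then have i: "i \<le> Suc n" by simp
    show "[((-1) ^ i :: int)] \<cdot>\<^bsub>M\<^esub> push_chain M M (bar_weight act i) (bar_face G i) (single_chain M a l) y
       = [((-1) ^ i :: int)] \<cdot>\<^bsub>M\<^esub> \<Theta> (frag_of (if i = 0 then act a (hd l) else a, bar_face G i l)) y"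
      using push.push_chain_single[OF push_face[OF i] l(1), of l "bar_face G i"] l hl
      by (auto simp: bar_weight_def Theta_of mact_closed)
  qed (use l hl in \<open>auto intro!: M.add.int_pow_closed simp: Theta_of mact_closed single_chain_def\<close>)
  also have "\<dots> = \<Theta> (dgen (a, l)) y"
  proof -
    have d: "dgen (a, l) = (\<Sum>i\<in>{0..Suc n}. frag_cmul ((-1) ^ i)
       (frag_of (if i = 0 then act a (hd l) else a, bar_face G i l)))"
      unfolding dgen_def fst_conv snd_conv l(2) using l(4) by (simp only: if_False)
    show ?thesis
      unfolding \<Theta>_def d
      by (simp only: M.zext_sum[OF coeff_at_closed finite_atLeastAtMost] M.zext_cmul_sign[OF coeff_at_closed])
  qed
  finally show "bar_d G M act n (single_chain M a l) y = \<Theta> (dgen (a, l)) y" .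
qed

lemma dB_hom: "dB \<in> hom (free_Abelian_group (bars (Suc n))) (free_Abelian_group (bars n))"
  by (rule homI) (use keys_dB in \<open>auto simp: free_Abelian_group_def frag_extend_add\<close>)

lemma Theta_dB:
  assumes "Poly_Mapping.keys w \<subseteq> bars (Suc n)"
  shows "\<Theta> (dB w) = bar_d G M act n (\<Theta> w)"
proof -
  have "(\<Theta> \<circ> dB) w = (bar_d G M act n \<circ> \<Theta>) w"
  proof (rule free_Abelian_hom_eq[OF Group.hom_compose[OF dB_hom Theta_hom] Group.hom_compose[OF Theta_hom bar_d_hom] _ _ assms])
    fix b assume b: "b \<in> bars (Suc n)"
    then show "(\<Theta> \<circ> dB) (frag_of b) = (bar_d G M act n \<circ> \<Theta>) (frag_of b)"
      by (cases b) (auto simp: bar_d_single Theta_of bars_def)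
  qed (rule comm_group.axioms(2)[OF C_group])
  then show ?thesis by simp
qed

text \<open>Every chain lifts along \<Theta> to the free complex, where the differential is known to
  square to zero.\<close>

lemma chain_complex_bar: "chain_complex (derived_tensor_Z M act G)"
  unfolding chain_complex_def derived_tensor_Z_def fst_conv snd_conv
proof (intro conjI allI ballI C_group bar_d_hom)
  fix n c assume "c \<in> carrier (C (Suc (Suc n)))"
  then obtain w where w: "Poly_Mapping.keys w \<subseteq> bars (Suc (Suc n))" "\<Theta> w = c" by (rule Theta_surj)
  have "bar_d G M act n (bar_d G M act (Suc n) c) = \<Theta> (dB (dB w))"
    using Theta_dB[OF w(1)] Theta_dB[OF keys_dB[OF w(1)]] w(2) by simp
  also have "\<dots> = \<one>\<^bsub>C n\<^esub>"
    by (simp add: dB_dB[OF w(1)] \<Theta>_def M.zext_0 bar_chains_def)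
  finally show "bar_d G M act n (bar_d G M act (Suc n) c) = \<one>\<^bsub>C n\<^esub>" .
qed

end

locale bar_module_map = A: bar_module G M act + B: bar_module H N act'
  for G :: "('g, 'x) monoid_scheme" and M :: "('m, 'y) ring_scheme" and act
    and H :: "('h, 'u) monoid_scheme" and N :: "('n, 'v) ring_scheme" and act' +
  fixes f :: "'m \<Rightarrow> 'n" and \<beta> :: "'g \<Rightarrow> 'h"
  assumes f_closed: "a \<in> carrier M \<Longrightarrow> f a \<in> carrier N"
    and f_add: "a \<in> carrier M \<Longrightarrow> b \<in> carrier M \<Longrightarrow> f (a \<oplus>\<^bsub>M\<^esub> b) = f a \<oplus>\<^bsub>N\<^esub> f b"
    and \<beta>_hom: "\<beta> \<in> hom G H"
    and f_act: "a \<in> carrier M \<Longrightarrow> g \<in> carrier G \<Longrightarrow> f (act a g) = act' (f a) (\<beta> g)"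
begin

abbreviation Map where "Map \<equiv> frag_extend (\<lambda>b. frag_of (map_prod f (map \<beta>) b))"

lemma push_map: "push M N (\<lambda>_. f) {l. length l = n \<and> set l \<subseteq> carrier G}"
  by unfold_locales (auto simp: f_closed f_add)

lemma tensor_map_hom: "tensor_map M N f \<beta> \<in> hom (bar_chains G M n) (bar_chains H N n)"
  unfolding tensor_map_def
  by (rule push.push_chain_hom[OF push_map refl]) (use \<beta>_hom in \<open>auto simp: hom_def\<close>)

lemma Map_bars: "b \<in> A.bars n \<Longrightarrow> map_prod f (map \<beta>) b \<in> B.bars n"
  using hom_in_carrier[OF \<beta>_hom] by (auto simp: A.bars_def B.bars_def f_closed subset_iff)

lemma keys_Map: "Poly_Mapping.keys w \<subseteq> A.bars n \<Longrightarrow> Poly_Mapping.keys (Map w) \<subseteq> B.bars n"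
  by (erule keys_frag_extend_subset) (use Map_bars in auto)

lemma Map_hom: "Map \<in> hom (free_Abelian_group (A.bars n)) (free_Abelian_group (B.bars n))"
  by (rule homI) (use keys_Map in \<open>auto simp: free_Abelian_group_def frag_extend_add\<close>)

lemma tensor_map_Theta:
  assumes "Poly_Mapping.keys w \<subseteq> A.bars n"
  shows "tensor_map M N f \<beta> (A.\<Theta> w) = B.\<Theta> (Map w)"
proof -
  have "(tensor_map M N f \<beta> \<circ> A.\<Theta>) w = (B.\<Theta> \<circ> Map) w"
  proof (rule free_Abelian_hom_eq[OF Group.hom_compose[OF A.Theta_hom tensor_map_hom] Group.hom_compose[OF Map_hom B.Theta_hom] _ _ assms])
    fix b assume b: "b \<in> A.bars n"
    then obtain a l where al: "b = (a, l)" "a \<in> carrier M" "length l = n" "set l \<subseteq> carrier G"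
      by (cases b) (auto simp: A.bars_def)
    then show "(tensor_map M N f \<beta> \<circ> A.\<Theta>) (frag_of b) = (B.\<Theta> \<circ> Map) (frag_of b)"
      using push.push_chain_single[OF push_map[of n] al(2), of l]
      by (simp add: A.Theta_of B.Theta_of f_closed tensor_map_def)
  qed (rule comm_group.axioms(2)[OF B.C_group])
  then show ?thesis by simp
qed

lemma dB_Map:
  assumes "Poly_Mapping.keys w \<subseteq> A.bars n"
  shows "Map (A.dB w) = B.dB (Map w)"
  by (rule bar_map_dB[where \<alpha> = f and \<beta> = \<beta>, OF A.gset_axioms B.gset_axioms \<beta>_hom f_act assms])

lemma chain_map_bar:
  "chain_map (derived_tensor_Z M act G) (derived_tensor_Z N act' H) (tensor_map M N f \<beta>)"
  unfolding chain_map_def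
proof (intro conjI allI ballI A.chain_complex_bar B.chain_complex_bar)
  fix n
  show "tensor_map M N f \<beta> \<in> hom (fst (derived_tensor_Z M act G) n) (fst (derived_tensor_Z N act' H) n)"
    unfolding derived_tensor_Z_def fst_conv by (rule tensor_map_hom)
  fix c assume "c \<in> carrier (fst (derived_tensor_Z M act G) (Suc n))"
  then have "c \<in> carrier (bar_chains G M (Suc n))" by (simp add: derived_tensor_Z_def)
  then obtain w where w: "Poly_Mapping.keys w \<subseteq> A.bars (Suc n)" "A.\<Theta> w = c" by (rule A.Theta_surj)
  show "tensor_map M N f \<beta> (snd (derived_tensor_Z M act G) n c)
      = snd (derived_tensor_Z N act' H) n (tensor_map M N f \<beta> c)"
    unfolding derived_tensor_Z_def snd_conv w(2)[symmetric] A.Theta_dB[OF w(1), symmetric]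
      tensor_map_Theta[OF w(1)] tensor_map_Theta[OF A.keys_dB[OF w(1)]] dB_Map[OF w(1)]
      B.Theta_dB[OF keys_Map[OF w(1)]] by (rule refl)
qed

end

section \<open>Localizations and group rings\<close>

locale localized = cring R for R (structure) +
  fixes \<Sigma> :: "'a set"
  assumes Sigma_carrier: "\<Sigma> \<subseteq> carrier R"
begin

abbreviation "S \<equiv> mult_closure R \<Sigma>"
abbreviation "fr \<equiv> frac R \<Sigma>"
abbreviation "LR \<equiv> localization R \<Sigma>"

lemma S_carrier: "s \<in> S \<Longrightarrow> s \<in> carrier R"
  by (induction rule: mult_closure.induct) (use Sigma_carrier in auto)

lemma S_one: "\<one> \<in> S"
  by (rule mult_closure.one)

lemma S_mult: "s \<in> S \<Longrightarrow> u \<in> S \<Longrightarrow> s \<otimes> u \<in> S"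
proof (induction rule: mult_closure.induct)
  case (mult s u')
  then have "s \<otimes> u' \<otimes> u = s \<otimes> (u' \<otimes> u)"
    using Sigma_carrier S_carrier by (simp add: m_assoc subset_iff)
  then show ?case using mult mult_closure.mult by metis
qed (simp add: S_carrier)

lemma Sigma_S: "s \<in> \<Sigma> \<Longrightarrow> s \<in> S"
  using mult_closure.mult[where R = R and \<Sigma> = \<Sigma> and s = s and u = "\<one>"] S_one Sigma_carrier by (auto simp: subset_iff)

lemma mem_fr:
  assumes "a \<in> carrier R" "s \<in> S"
  shows "(b, u) \<in> fr a s \<longleftrightarrow> b \<in> carrier R \<and> u \<in> S \<and> (\<exists>v\<in>S. v \<otimes> (u \<otimes> a) = v \<otimes> (s \<otimes> b))"
  using assms by (auto simp: frac_def frac_rel_def)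

text \<open>The middle denominator u cannot be cancelled, so it joins v and v' in the new
  witness.\<close>

lemma rel_trans:
  assumes "a \<in> carrier R" "b \<in> carrier R" "c \<in> carrier R" "s \<in> S" "u \<in> S" "w \<in> S" "v \<in> S" "v' \<in> S"
    and 1: "v \<otimes> (u \<otimes> a) = v \<otimes> (s \<otimes> b)" and 2: "v' \<otimes> (w \<otimes> b) = v' \<otimes> (u \<otimes> c)"
  shows "(v \<otimes> v' \<otimes> u) \<otimes> (w \<otimes> a) = (v \<otimes> v' \<otimes> u) \<otimes> (s \<otimes> c)"
proof -
  note cl = assms(1-3) assms(4-8)[THEN S_carrier]
  have "(v \<otimes> v' \<otimes> u) \<otimes> (w \<otimes> a) = (v' \<otimes> w) \<otimes> (v \<otimes> (u \<otimes> a))" using cl by (simp add: m_ac)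
  also have "\<dots> = (v \<otimes> s) \<otimes> (v' \<otimes> (w \<otimes> b))" unfolding 1 using cl by (simp add: m_ac)
  also have "\<dots> = (v \<otimes> v' \<otimes> u) \<otimes> (s \<otimes> c)" unfolding 2 using cl by (simp add: m_ac)
  finally show ?thesis .
qed

lemma fr_eq_iff:
  assumes "a \<in> carrier R" "s \<in> S" "b \<in> carrier R" "u \<in> S"
  shows "fr a s = fr b u \<longleftrightarrow> (\<exists>v\<in>S. v \<otimes> (u \<otimes> a) = v \<otimes> (s \<otimes> b))"
proof
  assume "fr a s = fr b u"
  moreover have "(b, u) \<in> fr b u" using assms S_one by (auto simp: mem_fr)
  ultimately show "\<exists>v\<in>S. v \<otimes> (u \<otimes> a) = v \<otimes> (s \<otimes> b)"
    using assms by (metis mem_fr)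
next
  assume "\<exists>v\<in>S. v \<otimes> (u \<otimes> a) = v \<otimes> (s \<otimes> b)"
  then obtain v where v: "v \<in> S" "v \<otimes> (u \<otimes> a) = v \<otimes> (s \<otimes> b)" by blast
  have "(c, w) \<in> fr a s \<longleftrightarrow> (c, w) \<in> fr b u" for c w
  proof
    assume "(c, w) \<in> fr b u"
    then obtain v' where v': "c \<in> carrier R" "w \<in> S" "v' \<in> S" "v' \<otimes> (w \<otimes> b) = v' \<otimes> (u \<otimes> c)"
      using assms by (auto simp: mem_fr)
    have "v \<otimes> v' \<otimes> u \<in> S" using v v' assms by (intro S_mult)
    then show "(c, w) \<in> fr a s"
      using rel_trans[OF assms(1,3) v'(1) assms(2,4) v'(2) v(1) v'(3) v(2) v'(4)] v' assms
      by (auto simp: mem_fr)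
  next
    assume "(c, w) \<in> fr a s"
    then obtain v' where v': "c \<in> carrier R" "w \<in> S" "v' \<in> S" "v' \<otimes> (w \<otimes> a) = v' \<otimes> (s \<otimes> c)"
      using assms by (auto simp: mem_fr)
    have "v \<otimes> v' \<otimes> s \<in> S" using v v' assms by (intro S_mult)
    then show "(c, w) \<in> fr b u"
      using rel_trans[OF assms(3,1) v'(1) assms(4,2) v'(2) v(1) v'(3) v(2)[symmetric] v'(4)] v' assms
      by (auto simp: mem_fr)
  qed
  then show "fr a s = fr b u" by auto
qed

lemma fr_self: "a \<in> carrier R \<Longrightarrow> s \<in> S \<Longrightarrow> (a, s) \<in> fr a s"
  using S_one by (auto simp: mem_fr)

text \<open>The operations of \<open>localization\<close> are unions over all representatives. If
  all of them give the same class, the nonempty union is that class.\<close>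

lemma UN_fr:
  assumes "a \<in> carrier R" "s \<in> S" "b \<in> carrier R" "u \<in> S"
    and "\<And>a' s' b' u'. (a', s') \<in> fr a s \<Longrightarrow> (b', u') \<in> fr b u \<Longrightarrow> F a' s' b' u' = F a s b u"
  shows "(\<Union>(a', s')\<in>fr a s. \<Union>(b', u')\<in>fr b u. F a' s' b' u') = (F a s b u :: 'z set)"
proof -
  have "F a' s' b' u' = F a s b u" if "(a', s') \<in> fr a s" "(b', u') \<in> fr b u" for a' s' b' u'
    by (rule assms(5)[OF that])
  then show ?thesis using fr_self[OF assms(1,2)] fr_self[OF assms(3,4)] by fast
qed

lemma fr_mult:
  assumes "a \<in> carrier R" "s \<in> S" "b \<in> carrier R" "u \<in> S"
  shows "fr a s \<otimes>\<^bsub>LR\<^esub> fr b u = fr (a \<otimes> b) (s \<otimes> u)"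
  unfolding localization_def monoid.simps
proof (rule UN_fr[OF assms])
  fix a' s' b' u' assume 1: "(a', s') \<in> fr a s" and 2: "(b', u') \<in> fr b u"
  obtain v where v: "a' \<in> carrier R" "s' \<in> S" "v \<in> S" "v \<otimes> (s' \<otimes> a) = v \<otimes> (s \<otimes> a')"
    using 1 assms by (auto simp: mem_fr)
  obtain w where w: "b' \<in> carrier R" "u' \<in> S" "w \<in> S" "w \<otimes> (u' \<otimes> b) = w \<otimes> (u \<otimes> b')"
    using 2 assms by (auto simp: mem_fr)
  note cl = assms(1,3) assms(2,4)[THEN S_carrier] v(1) v(2,3)[THEN S_carrier] w(1) w(2,3)[THEN S_carrier]
  have "(v \<otimes> w) \<otimes> ((s \<otimes> u) \<otimes> (a' \<otimes> b')) = (v \<otimes> (s \<otimes> a')) \<otimes> (w \<otimes> (u \<otimes> b'))"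
    using cl by (simp add: m_ac)
  also have "\<dots> = (v \<otimes> w) \<otimes> ((s' \<otimes> u') \<otimes> (a \<otimes> b))"
    unfolding v(4)[symmetric] w(4)[symmetric] using cl by (simp add: m_ac)
  finally show "fr (a' \<otimes> b') (s' \<otimes> u') = fr (a \<otimes> b) (s \<otimes> u)"
    using cl v w assms S_mult by (subst fr_eq_iff) auto
qed

lemma fr_add:
  assumes "a \<in> carrier R" "s \<in> S" "b \<in> carrier R" "u \<in> S"
  shows "fr a s \<oplus>\<^bsub>LR\<^esub> fr b u = fr ((u \<otimes> a) \<oplus> (s \<otimes> b)) (s \<otimes> u)"
  unfolding localization_def ring_record_simps
proof (rule UN_fr[OF assms])
  fix a' s' b' u' assume 1: "(a', s') \<in> fr a s" and 2: "(b', u') \<in> fr b u"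
  obtain v where v: "a' \<in> carrier R" "s' \<in> S" "v \<in> S" "v \<otimes> (s' \<otimes> a) = v \<otimes> (s \<otimes> a')"
    using 1 assms by (auto simp: mem_fr)
  obtain w where w: "b' \<in> carrier R" "u' \<in> S" "w \<in> S" "w \<otimes> (u' \<otimes> b) = w \<otimes> (u \<otimes> b')"
    using 2 assms by (auto simp: mem_fr)
  note cl = assms(1,3) assms(2,4)[THEN S_carrier] v(1) v(2,3)[THEN S_carrier] w(1) w(2,3)[THEN S_carrier]
  have "(v \<otimes> w) \<otimes> ((s \<otimes> u) \<otimes> ((u' \<otimes> a') \<oplus> (s' \<otimes> b')))
      = (w \<otimes> u \<otimes> u') \<otimes> (v \<otimes> (s \<otimes> a')) \<oplus> (v \<otimes> s \<otimes> s') \<otimes> (w \<otimes> (u \<otimes> b'))"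
    using cl by (simp add: m_ac r_distr)
  also have "\<dots> = (v \<otimes> w) \<otimes> ((s' \<otimes> u') \<otimes> ((u \<otimes> a) \<oplus> (s \<otimes> b)))"
    unfolding v(4)[symmetric] w(4)[symmetric] using cl by (simp add: m_ac r_distr)
  finally show "fr ((u' \<otimes> a') \<oplus> (s' \<otimes> b')) (s' \<otimes> u') = fr ((u \<otimes> a) \<oplus> (s \<otimes> b)) (s \<otimes> u)"
    using cl v w assms S_mult by (subst fr_eq_iff) auto
qed

lemma fr_cancel:
  assumes "a \<in> carrier R" "s \<in> S" "u \<in> S"
  shows "fr (u \<otimes> a) (u \<otimes> s) = fr a s"
  using assms S_one S_mult S_carrier by (subst fr_eq_iff) (auto simp: m_ac intro!: bexI[of _ \<one>])

lemma fr_closed: "a \<in> carrier R \<Longrightarrow> s \<in> S \<Longrightarrow> fr a s \<in> carrier LR"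
  by (auto simp: localization_def)

lemma LR_cases:
  assumes "X \<in> carrier LR"
  obtains a s where "X = fr a s" "a \<in> carrier R" "s \<in> S"
  using assms by (auto simp: localization_def)

lemma LR_one: "\<one>\<^bsub>LR\<^esub> = fr \<one> \<one>" and LR_zero: "\<zero>\<^bsub>LR\<^esub> = fr \<zero> \<one>"
  by (simp_all add: localization_def)

lemma fr_add_same:
  assumes "a \<in> carrier R" "b \<in> carrier R" "s \<in> S"
  shows "fr a s \<oplus>\<^bsub>LR\<^esub> fr b s = fr (a \<oplus> b) s"
proof -
  have "(s \<otimes> a) \<oplus> (s \<otimes> b) = s \<otimes> (a \<oplus> b)" using assms S_carrier by (simp add: r_distr)
  then show ?thesis using assms by (simp add: fr_add fr_cancel)
qed

lemma localization_cring: "cring LR"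
proof (rule cringI)
  \<comment> \<open>Over a common denominator the additive laws reduce to those of the numerators,
    by \<open>fr_add_same\<close>.\<close>
  have common: "\<exists>a b s. X = fr a s \<and> Y = fr b s \<and> a \<in> carrier R \<and> b \<in> carrier R \<and> s \<in> S"
    if XY: "X \<in> carrier LR" "Y \<in> carrier LR" for X Y
  proof -
    obtain a s where a: "X = fr a s" "a \<in> carrier R" "s \<in> S" using XY(1) by (rule LR_cases)
    obtain b u where b: "Y = fr b u" "b \<in> carrier R" "u \<in> S" using XY(2) by (rule LR_cases)
    have "X = fr (u \<otimes> a) (u \<otimes> s)" "Y = fr (s \<otimes> b) (u \<otimes> s)"
      using a b S_carrier fr_cancel[OF a(2,3) b(3)] fr_cancel[OF b(2,3) a(3)] by (simp_all add: m_comm)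
    then show ?thesis using a b S_carrier S_mult by blast
  qed
  show "abelian_group LR"
  proof (rule abelian_groupI)
    fix X Y assume XY: "X \<in> carrier LR" "Y \<in> carrier LR"
    obtain a b s where a: "X = fr a s" "Y = fr b s" "a \<in> carrier R" "b \<in> carrier R" "s \<in> S"
      using common[OF XY] by blast
    show "X \<oplus>\<^bsub>LR\<^esub> Y \<in> carrier LR" using a by (simp add: fr_add_same fr_closed)
    show "X \<oplus>\<^bsub>LR\<^esub> Y = Y \<oplus>\<^bsub>LR\<^esub> X" using a by (simp add: fr_add_same a_comm)
    fix W assume "W \<in> carrier LR"
    then obtain c w where c: "W = fr c w" "c \<in> carrier R" "w \<in> S" by (rule LR_cases)
    show "X \<oplus>\<^bsub>LR\<^esub> Y \<oplus>\<^bsub>LR\<^esub> W = X \<oplus>\<^bsub>LR\<^esub> (Y \<oplus>\<^bsub>LR\<^esub> W)"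
    proof -
      have "X = fr (w \<otimes> a) (w \<otimes> s)" "Y = fr (w \<otimes> b) (w \<otimes> s)" "W = fr (s \<otimes> c) (w \<otimes> s)"
        using a c S_carrier fr_cancel[OF a(3,5) c(3)] fr_cancel[OF a(4,5) c(3)] fr_cancel[OF c(2,3) a(5)]
          m_comm[of w s] by simp_all
      then show ?thesis using a c S_mult S_carrier by (simp add: fr_add_same a_assoc)
    qed
  next
    show "\<zero>\<^bsub>LR\<^esub> \<in> carrier LR" by (simp add: LR_zero fr_closed S_one)
  next
    fix X assume "X \<in> carrier LR"
    then obtain a s where a: "X = fr a s" "a \<in> carrier R" "s \<in> S" by (rule LR_cases)
    have z: "\<zero>\<^bsub>LR\<^esub> = fr \<zero> s"
      using fr_cancel[of \<zero> \<one> s] a S_one S_carrier by (simp add: LR_zero)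
    show "\<zero>\<^bsub>LR\<^esub> \<oplus>\<^bsub>LR\<^esub> X = X" unfolding z using a by (simp add: fr_add_same)
    show "\<exists>Y\<in>carrier LR. Y \<oplus>\<^bsub>LR\<^esub> X = \<zero>\<^bsub>LR\<^esub>"
      unfolding z by (rule bexI[of _ "fr (\<ominus> a) s"]) (use a in \<open>simp_all add: fr_add_same fr_closed l_neg\<close>)
  qed
  show "comm_monoid LR"
  proof (rule comm_monoidI)
    fix X Y assume XY: "X \<in> carrier LR" "Y \<in> carrier LR"
    obtain a s where a: "X = fr a s" "a \<in> carrier R" "s \<in> S" using XY(1) by (rule LR_cases)
    obtain b u where b: "Y = fr b u" "b \<in> carrier R" "u \<in> S" using XY(2) by (rule LR_cases)
    show "X \<otimes>\<^bsub>LR\<^esub> Y \<in> carrier LR" using a b by (simp add: fr_mult fr_closed S_mult)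
    show "X \<otimes>\<^bsub>LR\<^esub> Y = Y \<otimes>\<^bsub>LR\<^esub> X" using a b S_carrier by (simp add: fr_mult m_comm)
    fix W assume "W \<in> carrier LR"
    then obtain c w where c: "W = fr c w" "c \<in> carrier R" "w \<in> S" by (rule LR_cases)
    show "X \<otimes>\<^bsub>LR\<^esub> Y \<otimes>\<^bsub>LR\<^esub> W = X \<otimes>\<^bsub>LR\<^esub> (Y \<otimes>\<^bsub>LR\<^esub> W)"
      using a b c S_mult S_carrier by (simp add: fr_mult m_assoc)
  next
    show "\<one>\<^bsub>LR\<^esub> \<in> carrier LR" by (simp add: LR_one fr_closed S_one)
  next
    fix X assume "X \<in> carrier LR"
    then obtain a s where a: "X = fr a s" "a \<in> carrier R" "s \<in> S" by (rule LR_cases)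
    then show "\<one>\<^bsub>LR\<^esub> \<otimes>\<^bsub>LR\<^esub> X = X" using S_carrier by (simp add: LR_one fr_mult S_one)
  qed
  fix X Y W assume XY: "X \<in> carrier LR" "Y \<in> carrier LR" and "W \<in> carrier LR"
  then obtain c w where c: "W = fr c w" "c \<in> carrier R" "w \<in> S" by (rule_tac LR_cases)
  obtain a b s where a: "X = fr a s" "Y = fr b s" "a \<in> carrier R" "b \<in> carrier R" "s \<in> S"
    using common[OF XY] by blast
  show "(X \<oplus>\<^bsub>LR\<^esub> Y) \<otimes>\<^bsub>LR\<^esub> W = X \<otimes>\<^bsub>LR\<^esub> W \<oplus>\<^bsub>LR\<^esub> Y \<otimes>\<^bsub>LR\<^esub> W"
    using a c S_mult by (simp add: fr_mult fr_add_same l_distr)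
qed

lemma fr_one_eq_zero:
  assumes "a \<in> carrier R" "fr a \<one> = \<zero>\<^bsub>LR\<^esub>"
  obtains v where "v \<in> S" "v \<otimes> a = \<zero>"
  using assms fr_eq_iff[of a \<one> \<zero> \<one>] S_one S_carrier by (auto simp: LR_zero)

lemma fr_inverse: "s \<in> S \<Longrightarrow> fr s \<one> \<otimes>\<^bsub>LR\<^esub> fr \<one> s = \<one>\<^bsub>LR\<^esub>"
  using fr_cancel[of \<one> \<one> s] S_carrier S_one by (simp add: fr_mult LR_one)

end

section \<open>Group rings and polynomial rings\<close>

lemma group_ring_cring:
  assumes "comm_group G"
  shows "cring (group_ring G)"
proof -
  interpret comm_group G by fact
  define m where "m c d = frag_extend (\<lambda>g. frag_extend (\<lambda>h. frag_of (g \<otimes>\<^bsub>G\<^esub> h)) d) c" for c d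
  have R: "carrier (group_ring G) = {c. Poly_Mapping.keys c \<subseteq> carrier G}"
    "a \<otimes>\<^bsub>group_ring G\<^esub> b = m a b" "\<one>\<^bsub>group_ring G\<^esub> = frag_of \<one>\<^bsub>G\<^esub>"
    "\<zero>\<^bsub>group_ring G\<^esub> = 0" "a \<oplus>\<^bsub>group_ring G\<^esub> b = a + b" for a b
    by (simp_all add: group_ring_def m_def)
  have keys_m: "Poly_Mapping.keys (m c d) \<subseteq> carrier G"
    if "Poly_Mapping.keys c \<subseteq> carrier G" "Poly_Mapping.keys d \<subseteq> carrier G" for c d
    unfolding m_def by (intro keys_frag_extend_subset[OF that(1)] keys_frag_extend_subset[OF that(2)]) auto
  have ml: "m (a - b) d = m a d - m b d" for a b d by (simp add: m_def frag_extend_diff)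
  have mr: "m d (a - b) = m d a - m d b" for a b d
    by (simp add: m_def frag_extend_def[of _ d] frag_extend_diff frag_cmul_diff_right sum_subtractf)
  have mm: "m (frag_of g) (frag_of h) = frag_of (g \<otimes>\<^bsub>G\<^esub> h)" for g h by (simp add: m_def)
  show ?thesis
  proof (rule cringI)
    show "abelian_group (group_ring G)"
    proof (rule abelian_groupI)
      fix c assume "c \<in> carrier (group_ring G)"
      then show "\<exists>d\<in>carrier (group_ring G). d \<oplus>\<^bsub>group_ring G\<^esub> c = \<zero>\<^bsub>group_ring G\<^esub>"
        by (intro bexI[of _ "- c"]) (auto simp: R)
    qed (auto simp: R intro!: keys_add_subset add.assoc add.commute dest: keys_add_subset[THEN subsetD])
    show "comm_monoid (group_ring G)"
    proof (rule comm_monoidI)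
      fix a b assume ab: "a \<in> carrier (group_ring G)" "b \<in> carrier (group_ring G)"
      then show "a \<otimes>\<^bsub>group_ring G\<^esub> b \<in> carrier (group_ring G)" by (simp add: R keys_m)
      have ka: "Poly_Mapping.keys a \<subseteq> carrier G" and kb: "Poly_Mapping.keys b \<subseteq> carrier G"
        using ab by (simp_all add: R)
      show "a \<otimes>\<^bsub>group_ring G\<^esub> b = b \<otimes>\<^bsub>group_ring G\<^esub> a"
        unfolding R
      proof (rule frag_additive_eq[OF ka])
        fix g assume g: "g \<in> carrier G"
        show "m (frag_of g) b = m b (frag_of g)"
          by (rule frag_additive_eq[OF kb]) (auto simp: ml mr mm g m_comm)
      qed (auto simp: ml mr)
      fix c assume "c \<in> carrier (group_ring G)"
      then have kc: "Poly_Mapping.keys c \<subseteq> carrier G" by (simp add: R)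
      show "a \<otimes>\<^bsub>group_ring G\<^esub> b \<otimes>\<^bsub>group_ring G\<^esub> c = a \<otimes>\<^bsub>group_ring G\<^esub> (b \<otimes>\<^bsub>group_ring G\<^esub> c)"
        unfolding R
      proof (rule frag_additive_eq[OF ka])
        fix g assume g: "g \<in> carrier G"
        show "m (m (frag_of g) b) c = m (frag_of g) (m b c)"
        proof (rule frag_additive_eq[OF kb])
          fix h assume h: "h \<in> carrier G"
          show "m (m (frag_of g) (frag_of h)) c = m (frag_of g) (m (frag_of h) c)"
            by (rule frag_additive_eq[OF kc]) (auto simp: ml mr mm g h m_assoc)
        qed (auto simp: ml mr)
      qed (auto simp: ml mr)
    next
      fix a assume "a \<in> carrier (group_ring G)"
      then have ka: "Poly_Mapping.keys a \<subseteq> carrier G" by (simp add: R)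
      show "\<one>\<^bsub>group_ring G\<^esub> \<otimes>\<^bsub>group_ring G\<^esub> a = a"
        unfolding R by (rule frag_additive_eq[OF ka]) (auto simp: mr mm)
    qed (auto simp: R)
    fix a b c
    show "(a \<oplus>\<^bsub>group_ring G\<^esub> b) \<otimes>\<^bsub>group_ring G\<^esub> c
        = a \<otimes>\<^bsub>group_ring G\<^esub> c \<oplus>\<^bsub>group_ring G\<^esub> b \<otimes>\<^bsub>group_ring G\<^esub> c"
      by (simp add: R m_def frag_extend_add)
  qed
qed

lemma int_poly_ring_cring: "cring (int_poly_ring m)"
proof (rule cringI)
  have k: "Poly_Mapping.keys \<rho> \<subseteq> {1..m}"
    if fg: "\<rho> \<in> Poly_Mapping.keys (f * g)" "f \<in> carrier (int_poly_ring m)" "g \<in> carrier (int_poly_ring m)" for f g \<rho>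
  proof -
    obtain \<mu> \<nu> where "\<rho> = \<mu> + \<nu>" "\<mu> \<in> Poly_Mapping.keys f" "\<nu> \<in> Poly_Mapping.keys g"
      using fg(1) keys_mult[of f g] by blast
    then show ?thesis using fg(2,3) Poly_Mapping.keys_add[of \<mu> \<nu>] by (fastforce simp: int_poly_ring_def)
  qed
  show "abelian_group (int_poly_ring m)"
  proof (rule abelian_groupI)
    fix c assume "c \<in> carrier (int_poly_ring m)"
    then show "\<exists>d\<in>carrier (int_poly_ring m). d \<oplus>\<^bsub>int_poly_ring m\<^esub> c = \<zero>\<^bsub>int_poly_ring m\<^esub>"
      by (intro bexI[of _ "- c"]) (auto simp: int_poly_ring_def)
  qed (use Poly_Mapping.keys_add in \<open>fastforce simp: int_poly_ring_def add_ac\<close>)+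
  show "comm_monoid (int_poly_ring m)"
    by (rule comm_monoidI) (use k in \<open>auto simp: int_poly_ring_def mult_ac\<close>)
qed (auto simp: int_poly_ring_def algebra_simps)

section \<open>Matrices over a ring and $K_1$\<close>

text \<open>The library proves the unit laws for matrices only over rings with \<open>0 \<noteq> 1\<close>.\<close>

lemma one_mat_mult:
  fixes A :: "'a::{ring,monoid_mult} mat"
  assumes "A \<in> carrier_mat n k"
  shows "1\<^sub>m n * A = A" "A * 1\<^sub>m k = A"
proof -
  have d: "(if i = j then 1 else 0) * (x::'a) = (if i = j then x else 0)"
    "x * (if i = j then 1 else 0) = (if i = j then x else 0)" for i j :: nat and x :: 'a
    by auto
  show "1\<^sub>m n * A = A" "A * 1\<^sub>m k = A"
    using assms by (auto intro!: eq_matI simp: scalar_prod_def d)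
qed

lemma GL_group: "group (GL n :: 'a::{ring,monoid_mult} mat monoid)"
proof (rule groupI)
  fix A B :: "'a mat" assume A: "A \<in> carrier (GL n)" and B: "B \<in> carrier (GL n)"
  obtain A' where A': "A' \<in> carrier_mat n n" "A * A' = 1\<^sub>m n" "A' * A = 1\<^sub>m n" using A by (auto simp: GL_def)
  obtain B' where B': "B' \<in> carrier_mat n n" "B * B' = 1\<^sub>m n" "B' * B = 1\<^sub>m n" using B by (auto simp: GL_def)
  have c: "A \<in> carrier_mat n n" "B \<in> carrier_mat n n" using A B by (auto simp: GL_def)
  have "(A * B) * (B' * A') = A * (B * B') * A'" "(B' * A') * (A * B) = B' * (A' * A) * B"
    using c A'(1) B'(1) by (simp_all add: assoc_mult_mat[of _ n n _ n _ n])
  then have "(A * B) * (B' * A') = 1\<^sub>m n" "(B' * A') * (A * B) = 1\<^sub>m n"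
    using c A' B' by (simp_all add: one_mat_mult[of _ n n])
  moreover have "A * B \<in> carrier_mat n n" "B' * A' \<in> carrier_mat n n" using c A' B' by auto
  ultimately show "A \<otimes>\<^bsub>GL n\<^esub> B \<in> carrier (GL n)"
    unfolding GL_def by auto
  fix C :: "'a mat" assume "C \<in> carrier (GL n)"
  then show "A \<otimes>\<^bsub>GL n\<^esub> B \<otimes>\<^bsub>GL n\<^esub> C = A \<otimes>\<^bsub>GL n\<^esub> (B \<otimes>\<^bsub>GL n\<^esub> C)"
    using c by (auto simp: GL_def assoc_mult_mat[of _ n n _ n _ n])
next
  show "\<one>\<^bsub>GL n\<^esub> \<in> carrier (GL n)"
    by (auto simp: GL_def one_mat_mult[of _ n n] intro!: bexI[of _ "1\<^sub>m n"])
next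
  fix A :: "'a mat" assume A: "A \<in> carrier (GL n)"
  then show "\<one>\<^bsub>GL n\<^esub> \<otimes>\<^bsub>GL n\<^esub> A = A" by (auto simp: GL_def one_mat_mult[of _ n n])
  show "\<exists>B\<in>carrier (GL n). B \<otimes>\<^bsub>GL n\<^esub> A = \<one>\<^bsub>GL n\<^esub>"
    using A by (auto simp: GL_def)
qed

lemma GL_carrier_mat: "A \<in> carrier (GL n) \<Longrightarrow> A \<in> carrier_mat n n"
  by (simp add: GL_def)

lemma GL_simps: "A \<otimes>\<^bsub>GL n\<^esub> B = A * B" "\<one>\<^bsub>GL n\<^esub> = 1\<^sub>m n"
  by (simp_all add: GL_def)

lemma one_GL: "(1\<^sub>m n :: 'a::{ring,monoid_mult} mat) \<in> carrier (GL n)"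
  using monoid.one_closed[OF group.is_monoid[OF GL_group], of n] by (simp add: GL_simps)

lemma GL_I: "A \<in> carrier_mat n n \<Longrightarrow> B \<in> carrier_mat n n \<Longrightarrow> A * B = 1\<^sub>m n \<Longrightarrow> B * A = 1\<^sub>m n \<Longrightarrow> A \<in> carrier (GL n)"
  by (auto simp: GL_def)

abbreviation blocks :: "nat \<Rightarrow> nat \<Rightarrow> 'a::{ring,monoid_mult} mat \<Rightarrow> 'a mat \<Rightarrow> 'a mat \<Rightarrow> 'a mat" where
  "blocks n k A C D \<equiv> four_block_mat A (0\<^sub>m n k) C D"

lemma blocks_mult:
  fixes A :: "'a::{ring,monoid_mult} mat"
  assumes "A \<in> carrier_mat n n" "C \<in> carrier_mat k n" "D \<in> carrier_mat k k"
    and "A' \<in> carrier_mat n n" "C' \<in> carrier_mat k n" "D' \<in> carrier_mat k k"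
  shows "blocks n k A C D * blocks n k A' C' D' = blocks n k (A * A') (C * A' + D * C') (D * D')"
proof -
  have "A * A' + 0\<^sub>m n k * C' = A * A'" "A * 0\<^sub>m n k + 0\<^sub>m n k * D' = 0\<^sub>m n k"
    "C * 0\<^sub>m n k + D * D' = D * D'"
    using assms by (auto simp: left_mult_zero_mat[of _ k] right_mult_zero_mat[of _ _ n])
  then show ?thesis
    using mult_four_block_mat[OF assms(1) zero_carrier_mat assms(2,3,4) zero_carrier_mat assms(5,6)] by simp
qed

lemma blocks_GL:
  fixes A :: "'a::{ring,monoid_mult} mat"
  assumes "A \<in> carrier (GL n)" "D \<in> carrier (GL k)" "C \<in> carrier_mat k n"
  shows "blocks n k A C D \<in> carrier (GL (n + k))"
proof -
  obtain A' where A': "A' \<in> carrier_mat n n" "A * A' = 1\<^sub>m n" "A' * A = 1\<^sub>m n" using assms by (auto simp: GL_def)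
  obtain D' where D': "D' \<in> carrier_mat k k" "D * D' = 1\<^sub>m k" "D' * D = 1\<^sub>m k" using assms by (auto simp: GL_def)
  have c: "A \<in> carrier_mat n n" "D \<in> carrier_mat k k" using assms by (auto simp: GL_def)
  \<comment> \<open>The lower left block of the inverse of a lower triangular block matrix.\<close>
  define C' where "C' = - (D' * (C * A'))"
  have C': "C' \<in> carrier_mat k n" "D' * (C * A') \<in> carrier_mat k n" using assms A' D' by (auto simp: C'_def)
  have "D * C' = - (D * (D' * (C * A')))" unfolding C'_def
    using uminus_mult_right_mat[of D "D' * (C * A')"] c C' by auto
  also have "D * (D' * (C * A')) = C * A'"
    using c D' A' assms by (simp add: assoc_mult_mat[of _ k k _ k _ n, symmetric] one_mat_mult[of _ k n])
  finally have 1: "C * A' + D * C' = 0\<^sub>m k n"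
    using assms A' by (auto intro!: eq_matI)
  have "C' * A = - (D' * (C * A') * A)" unfolding C'_def
    using uminus_mult_left_mat[of "D' * (C * A')" A] c C' by auto
  also have "D' * (C * A') * A = D' * (C * (A' * A))"
    using c D' A' assms
    by (simp add: assoc_mult_mat[of _ k k _ n _ n] assoc_mult_mat[of _ k n _ n _ n])
  also have "\<dots> = D' * C" using A' assms by (simp add: one_mat_mult[of _ k n])
  finally have 2: "C' * A + D' * C = 0\<^sub>m k n"
    using assms D' by (auto intro!: eq_matI)
  show ?thesis
  proof (rule GL_I[of _ _ "blocks n k A' C' D'"])
    show "blocks n k A C D * blocks n k A' C' D' = 1\<^sub>m (n + k)"
      by (subst blocks_mult) (use c A' D' C' assms 1 in simp_all)
    show "blocks n k A' C' D' * blocks n k A C D = 1\<^sub>m (n + k)"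
      by (subst blocks_mult) (use c A' D' C' assms 2 in simp_all)
  qed (use c A' D' in auto)
qed

section \<open>The stable general linear group\<close>

lemma stab_mult:
  fixes A B :: "'a::{ring,monoid_mult} mat"
  assumes A: "A \<in> carrier_mat n n" and B: "B \<in> carrier_mat n n"
  shows "stab A \<otimes>\<^bsub>GL_inf\<^esub> stab B = stab (A * B)"
proof (intro ext)
  fix i j
  have "(stab A \<otimes>\<^bsub>GL_inf\<^esub> stab B) i j = (\<Sum>k | stab A i k \<noteq> 0. stab A i k * stab B k j)"
    by (simp add: GL_inf_def)
  also have "\<dots> = stab (A * B) i j"
  proof (cases "i < n")
    case True
    have "(\<Sum>k | stab A i k \<noteq> 0. stab A i k * stab B k j) = (\<Sum>k\<in>{0..<n}. A $$ (i, k) * stab B k j)"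
      using True A by (intro sum.mono_neutral_cong_left) (auto simp: stab_def split: if_splits)
    also have "\<dots> = stab (A * B) i j"
    proof (cases "j < n")
      case j: True
      then show ?thesis using True A B by (simp add: stab_def scalar_prod_def)
    next
      case False
      then have "(\<Sum>k\<in>{0..<n}. A $$ (i, k) * stab B k j) = 0"
        using B by (intro sum.neutral) (auto simp: stab_def)
      then show ?thesis using True False A B by (simp add: stab_def)
    qed
    finally show ?thesis .
  next
    case False
    have "(\<Sum>k | stab A i k \<noteq> 0. stab A i k * stab B k j) = (\<Sum>k\<in>{i}. stab B k j)"
    \<comment> \<open>In the zero ring no entry is nonzero and the index set is empty; otherwise row
      i of the stabilised matrix has its only nonzero entry on the diagonal.\<close>
    proof (cases "(1::'a) = 0")
      case True
      then have "x = 0" for x :: 'a by (metis mult_1_right mult_zero_right)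
      then show ?thesis by metis
    next
      case one: False
      show ?thesis
        using False A one by (intro sum.mono_neutral_cong_left) (auto simp: stab_def split: if_splits)
    qed
    then show ?thesis using False A B by (simp add: stab_def)
  qed
  finally show "(stab A \<otimes>\<^bsub>GL_inf\<^esub> stab B) i j = stab (A * B) i j" .
qed

lemma stab_blocks:
  assumes "A \<in> carrier_mat n n"
  shows "stab (blocks n k A (0\<^sub>m k n) (1\<^sub>m k)) = stab A"
  using assms by (intro ext) (auto simp: stab_def)

lemma stab_one: "stab (1\<^sub>m n) = \<one>\<^bsub>GL_inf\<^esub>"
  by (intro ext) (auto simp: stab_def GL_inf_def)

text \<open>Each group axiom concerns at most three elements; represented by matrices of one common
  size, they can be multiplied as matrices.\<close>

lemma GL_inf_common:
  assumes "finite X" "X \<subseteq> carrier (GL_inf :: (nat \<Rightarrow> nat \<Rightarrow> 'a::{ring,monoid_mult}) monoid)"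
  obtains n where "X \<subseteq> stab ` carrier (GL n)"
proof -
  have mono: "stab ` carrier (GL n) \<subseteq> stab ` (carrier (GL n') :: 'a mat set)" if "n \<le> n'" for n n'
  proof
    fix x assume "x \<in> stab ` (carrier (GL n) :: 'a mat set)"
    then obtain A :: "'a mat" where A: "A \<in> carrier (GL n)" "x = stab A" by auto
    have "blocks n (n' - n) A (0\<^sub>m (n' - n) n) (1\<^sub>m (n' - n)) \<in> carrier (GL (n + (n' - n)))"
      using A by (intro blocks_GL one_GL) auto
    then show "x \<in> stab ` carrier (GL n')"
      using A that stab_blocks[OF GL_carrier_mat[OF A(1)], of "n' - n"] by (intro image_eqI) auto
  qed
  have "\<exists>n. X \<subseteq> stab ` carrier (GL n)" using assms
  proof (induction X rule: finite_induct)
    case (insert x X)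
    then obtain n where n: "X \<subseteq> stab ` carrier (GL n)" by auto
    obtain n' where n': "x \<in> stab ` carrier (GL n')" using insert by (auto simp: GL_inf_def)
    show ?case using n n' mono[of n "max n n'"] mono[of n' "max n n'"] by (intro exI[of _ "max n n'"]) auto
  qed auto
  then show ?thesis using that by blast
qed

lemma stab_GL: "A \<in> carrier (GL n) \<Longrightarrow> stab A \<in> carrier GL_inf"
  by (auto simp: GL_inf_def)

lemma GL_inf_group: "group (GL_inf :: (nat \<Rightarrow> nat \<Rightarrow> 'a::{ring,monoid_mult}) monoid)"
proof (rule groupI)
  fix x y :: "nat \<Rightarrow> nat \<Rightarrow> 'a" assume xy: "x \<in> carrier GL_inf" "y \<in> carrier GL_inf"
  obtain n where "{x, y} \<subseteq> stab ` carrier (GL n)" by (rule GL_inf_common[of "{x, y}"]) (use xy in auto)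
  then obtain A B where AB: "A \<in> carrier (GL n)" "B \<in> carrier (GL n)" "x = stab A" "y = stab B" by auto
  have "A * B \<in> carrier (GL n)"
    using monoid.m_closed[OF group.is_monoid[OF GL_group] AB(1,2)] by (simp add: GL_simps)
  then show "x \<otimes>\<^bsub>GL_inf\<^esub> y \<in> carrier GL_inf"
    unfolding AB(3,4) stab_mult[OF AB(1,2)[THEN GL_carrier_mat]] by (rule stab_GL)
next
  fix x y z :: "nat \<Rightarrow> nat \<Rightarrow> 'a"
  assume xyz: "x \<in> carrier GL_inf" "y \<in> carrier GL_inf" "z \<in> carrier GL_inf"
  obtain n where "{x, y, z} \<subseteq> stab ` carrier (GL n)" by (rule GL_inf_common[of "{x, y, z}"]) (use xyz in auto)
  then obtain A B C where g: "A \<in> carrier (GL n)" "B \<in> carrier (GL n)" "C \<in> carrier (GL n)"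
    and x: "x = stab A" "y = stab B" "z = stab C" by auto
  note A = g[THEN GL_carrier_mat] x
  then have "A * B \<in> carrier_mat n n" "B * C \<in> carrier_mat n n" by auto
  then show "x \<otimes>\<^bsub>GL_inf\<^esub> y \<otimes>\<^bsub>GL_inf\<^esub> z = x \<otimes>\<^bsub>GL_inf\<^esub> (y \<otimes>\<^bsub>GL_inf\<^esub> z)"
    using A by (simp add: stab_mult[of _ n] assoc_mult_mat[of _ n n _ n _ n])
next
  show "\<one>\<^bsub>GL_inf\<^esub> \<in> (carrier GL_inf :: (nat \<Rightarrow> nat \<Rightarrow> 'a) set)"
    using stab_GL[OF one_GL[of 0]] unfolding stab_one .
next
  fix x :: "nat \<Rightarrow> nat \<Rightarrow> 'a" assume x: "x \<in> carrier GL_inf"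
  then obtain n A where A: "A \<in> carrier (GL n)" "x = stab A" by (auto simp: GL_inf_def)
  then have c: "A \<in> carrier_mat n n" by (simp add: GL_carrier_mat)
  show "\<one>\<^bsub>GL_inf\<^esub> \<otimes>\<^bsub>GL_inf\<^esub> x = x"
    unfolding stab_one[of n, symmetric] A(2) stab_mult[OF one_carrier_mat c] one_mat_mult(1)[OF c] by (rule refl)
  obtain B where B: "B \<in> carrier (GL n)" "B * A = 1\<^sub>m n"
    using group.l_inv_ex[OF GL_group A(1)] by (auto simp: GL_simps)
  then show "\<exists>y\<in>carrier GL_inf. y \<otimes>\<^bsub>GL_inf\<^esub> x = \<one>\<^bsub>GL_inf\<^esub>"
    unfolding A(2) using stab_mult[OF GL_carrier_mat[OF B(1)] c] stab_GL[OF B(1)] B(2) stab_one[of n]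
    by (intro bexI[of _ "stab B"]) simp_all
qed

lemma K1_comm_group: "comm_group (K1 :: 'a::{ring,monoid_mult} K1_elt monoid)"
  unfolding K1_def by (rule group.derived_quot_is_comm_group[OF GL_inf_group])

lemma K1_det_hom: "K1_det \<in> hom (GL n) (K1 :: 'a::{ring,monoid_mult} K1_elt monoid)"
proof -
  let ?D = "derived GL_inf (carrier (GL_inf :: (nat \<Rightarrow> nat \<Rightarrow> 'a) monoid))"
  have N: "?D \<lhd> (GL_inf :: (nat \<Rightarrow> nat \<Rightarrow> 'a) monoid)"
    by (rule group.derived_self_is_normal[OF GL_inf_group])
  have "(\<lambda>x. ?D #>\<^bsub>GL_inf\<^esub> x) \<in> hom GL_inf (GL_inf Mod ?D)"
    by (rule normal.r_coset_hom_Mod[OF N])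
  moreover have "stab \<in> hom (GL n) (GL_inf :: (nat \<Rightarrow> nat \<Rightarrow> 'a) monoid)"
  proof (rule homI)
    fix A B :: "'a mat" assume "A \<in> carrier (GL n)" "B \<in> carrier (GL n)"
    then show "stab (A \<otimes>\<^bsub>GL n\<^esub> B) = stab A \<otimes>\<^bsub>GL_inf\<^esub> stab B"
      by (simp add: GL_simps stab_mult[OF GL_carrier_mat GL_carrier_mat])
  qed (rule stab_GL)
  ultimately have "(\<lambda>x. ?D #>\<^bsub>GL_inf\<^esub> x) \<circ> stab \<in> hom (GL n) (GL_inf Mod ?D)"
    by (rule Group.hom_compose[rotated])
  then show ?thesis by (simp add: K1_def K1_det_def[abs_def] comp_def)
qed

lemma K1_det_mult:
  fixes A :: "'a::{ring,monoid_mult} mat"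
  shows "A \<in> carrier (GL n) \<Longrightarrow> B \<in> carrier (GL n) \<Longrightarrow> K1_det (A * B) = K1_det A \<otimes>\<^bsub>K1\<^esub> K1_det B"
  using hom_mult[OF K1_det_hom] by (simp add: GL_simps)

lemma K1_det_closed: "A \<in> carrier (GL n) \<Longrightarrow> K1_det A \<in> carrier K1"
  using hom_in_carrier[OF K1_det_hom] .

lemma K1_det_one: "K1_det (1\<^sub>m n) = \<one>\<^bsub>K1\<^esub>"
  using hom_one[OF K1_det_hom GL_group comm_group.axioms(2)[OF K1_comm_group]] by (simp add: GL_simps)

lemma K1_det_blocks_one: "A \<in> carrier_mat n n \<Longrightarrow> K1_det (blocks n k A (0\<^sub>m k n) (1\<^sub>m k)) = K1_det A"
  by (simp add: K1_det_def stab_blocks)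

text \<open>With an auxiliary third block row and column, the unipotent matrix \<open>1 + C D\<close> becomes a
  commutator of two unipotent matrices with off-diagonal blocks \<open>C\<close> and \<open>D\<close>.\<close>

lemma K1_det_unipotent:
  fixes M :: "'a::{ring,monoid_mult} mat"
  assumes M: "M \<in> carrier_mat p q"
  shows "K1_det (blocks q p (1\<^sub>m q) M (1\<^sub>m p)) = \<one>\<^bsub>K1\<^esub>"
proof -
  interpret K: comm_group "K1 :: 'a K1_elt monoid" by (rule K1_comm_group)
  let ?n = "q + p"
  \<comment> \<open>C is the inclusion of the last p coordinates and D is the row (M 0): thus C D
    has M as its lower left block and D C = 0.\<close>
  define C :: "'a mat" where "C = mat ?n p (\<lambda>(i, j). if i = q + j then 1 else 0)"
  define D :: "'a mat" where "D = mat p ?n (\<lambda>(i, j). if j < q then M $$ (i, j) else 0)"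
  have C: "C \<in> carrier_mat ?n p" and D: "D \<in> carrier_mat p ?n" by (auto simp: C_def D_def)
  define U where "U = blocks q p (1\<^sub>m q) M (1\<^sub>m p)"
  have U: "U \<in> carrier_mat ?n ?n" by (auto simp: U_def)
  have UG: "U \<in> carrier (GL ?n)" unfolding U_def by (intro blocks_GL one_GL M)
  have DC: "D * C = 0\<^sub>m p p"
    by (intro eq_matI) (auto simp: C_def D_def scalar_prod_def intro!: sum.neutral)
  have CD: "U = 1\<^sub>m ?n + C * D"
  proof (rule eq_matI)
    fix i j assume ij: "i < dim_row (1\<^sub>m ?n + C * D)" "j < dim_col (1\<^sub>m ?n + C * D)"
    have "(C * D) $$ (i, j) = (\<Sum>k = 0..<p. (if i = q + k then 1 else 0) * D $$ (k, j))"
      using ij C D by (simp add: scalar_prod_def) (simp add: C_def)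
    also have "\<dots> = (if q \<le> i then D $$ (i - q, j) else 0)"
    proof (cases "q \<le> i")
      case True
      then have "(\<Sum>k = 0..<p. (if i = q + k then 1 else 0) * D $$ (k, j)) = (\<Sum>k\<in>{i - q}. D $$ (k, j))"
        using ij C by (intro sum.mono_neutral_cong_right) auto
      with True show ?thesis by simp
    qed (auto intro!: sum.neutral)
    finally have "(C * D) $$ (i, j) = (if q \<le> i then D $$ (i - q, j) else 0)" .
    then show "U $$ (i, j) = (1\<^sub>m ?n + C * D) $$ (i, j)"
      using ij C D M by (auto simp: U_def D_def)
  qed (use C D U in auto)
  define a where "a = four_block_mat (1\<^sub>m ?n) C (0\<^sub>m p ?n) (1\<^sub>m p)"
  define b where "b = blocks ?n p (1\<^sub>m ?n) D (1\<^sub>m p)"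
  define u where "u = blocks ?n p U (0\<^sub>m p ?n) (1\<^sub>m p)"
  have b: "b \<in> carrier (GL (?n + p))" unfolding b_def by (intro blocks_GL one_GL D)
  have u: "u \<in> carrier (GL (?n + p))" unfolding u_def by (intro blocks_GL one_GL UG) auto
  have a: "a \<in> carrier (GL (?n + p))"
  proof (rule GL_I)
    let ?a' = "four_block_mat (1\<^sub>m ?n) (- C) (0\<^sub>m p ?n) (1\<^sub>m p)"
    have m: "four_block_mat (1\<^sub>m ?n) C' (0\<^sub>m p ?n) (1\<^sub>m p) * four_block_mat (1\<^sub>m ?n) C'' (0\<^sub>m p ?n) (1\<^sub>m p)
      = four_block_mat (1\<^sub>m ?n) (C'' + C') (0\<^sub>m p ?n) (1\<^sub>m p)"
      if "C' \<in> carrier_mat ?n p" "C'' \<in> carrier_mat ?n p" for C' C'' :: "'a mat"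
      using that by (subst mult_four_block_mat[of _ ?n ?n _ p _ p _ _ ?n _ p])
        (auto simp: one_mat_mult[of _ ?n ?n] one_mat_mult[of _ ?n p] one_mat_mult[of _ p p])
    have "- C + C = 0\<^sub>m ?n p" "C + - C = 0\<^sub>m ?n p" using C by (auto intro!: eq_matI)
    then show "a * ?a' = 1\<^sub>m (?n + p)" "?a' * a = 1\<^sub>m (?n + p)"
      using C unfolding a_def by (simp_all add: m)
  qed (use C in \<open>auto simp: a_def\<close>)
  have ba: "b * a = four_block_mat (1\<^sub>m ?n) C D (1\<^sub>m p)"
    unfolding a_def b_def using C D DC
    by (subst mult_four_block_mat[of _ ?n ?n _ p _ p _ _ ?n _ p])
      (auto simp: one_mat_mult[of _ ?n ?n] one_mat_mult[of _ ?n p] one_mat_mult[of _ p p] one_mat_mult[of _ p ?n])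
  have UC: "U * C = C"
  proof -
    have "U * C = 1\<^sub>m ?n * C + C * D * C"
      unfolding CD using C D by (intro add_mult_distrib_mat[of _ ?n ?n _ _ p]) auto
    also have "C * D * C = C * (D * C)" using C D by (intro assoc_mult_mat[of _ ?n p _ ?n _ p]) auto
    finally show ?thesis using C DC by (simp add: one_mat_mult[of _ ?n p])
  qed
  have uba: "u * (b * a) = four_block_mat U C D (1\<^sub>m p)"
    unfolding ba u_def using C D U
    by (subst mult_four_block_mat[of _ ?n ?n _ p _ p _ _ ?n _ p])
      (auto simp: UC one_mat_mult[of _ ?n ?n] one_mat_mult[of _ ?n p] one_mat_mult[of _ p p] one_mat_mult[of _ p ?n])
  have ab: "a * b = four_block_mat U C D (1\<^sub>m p)"
    unfolding a_def b_def CD using C D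
    by (subst mult_four_block_mat[of _ ?n ?n _ p _ p _ _ ?n _ p])
      (auto simp: one_mat_mult[of _ ?n ?n] one_mat_mult[of _ ?n p] one_mat_mult[of _ p p] one_mat_mult[of _ p ?n])
  have bag: "b * a \<in> carrier (GL (?n + p))"
    using monoid.m_closed[OF group.is_monoid[OF GL_group] b a] by (simp add: GL_simps)
  \<comment> \<open>Now a b = u b a, and in the commutative group K1 the classes of a and b
    cancel.\<close>
  have "K1_det u \<otimes>\<^bsub>K1\<^esub> (K1_det b \<otimes>\<^bsub>K1\<^esub> K1_det a) = K1_det a \<otimes>\<^bsub>K1\<^esub> K1_det b"
    using uba ab K1_det_mult[OF u bag] K1_det_mult[OF b a] K1_det_mult[OF a b] by simp
  then have "K1_det u = \<one>\<^bsub>K1\<^esub>"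
    using K1_det_closed[OF a] K1_det_closed[OF b] K1_det_closed[OF u] by (simp add: K.m_comm)
  then show ?thesis
    using K1_det_blocks_one[OF U, of p] by (simp add: u_def U_def)
qed

text \<open>Splitting off the diagonal matrix with blocks A and 1 on the right leaves a unipotent
  factor with lower left block M A^-1.\<close>

lemma K1_det_blocks:
  fixes A :: "'a::{ring,monoid_mult} mat"
  assumes A: "A \<in> carrier (GL q)" and M: "M \<in> carrier_mat p q"
  shows "K1_det (blocks q p A M (1\<^sub>m p)) = K1_det A"
proof -
  interpret K: comm_group "K1 :: 'a K1_elt monoid" by (rule K1_comm_group)
  obtain A' where A': "A' \<in> carrier_mat q q" "A' * A = 1\<^sub>m q" using A by (auto simp: GL_def)
  have c: "A \<in> carrier_mat q q" by (rule GL_carrier_mat[OF A])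
  let ?u = "blocks q p (1\<^sub>m q) (M * A') (1\<^sub>m p)" and ?a = "blocks q p A (0\<^sub>m p q) (1\<^sub>m p)"
  have MA: "M * A' \<in> carrier_mat p q" using M A' by auto
  have "M * A' * A = M" using M A' c by (simp add: assoc_mult_mat[of _ p q _ q _ q] one_mat_mult[of _ p q])
  then have "?u * ?a = blocks q p A M (1\<^sub>m p)"
    using c MA M by (subst blocks_mult) (auto simp: one_mat_mult[of _ q q] one_mat_mult[of _ p p])
  then have "K1_det (blocks q p A M (1\<^sub>m p)) = K1_det ?u \<otimes>\<^bsub>K1\<^esub> K1_det ?a"
    using K1_det_mult[of ?u "q + p" ?a] blocks_GL[OF one_GL one_GL MA] blocks_GL[OF A one_GL, of "0\<^sub>m p q" p] by simp
  then show ?thesis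
    using K1_det_unipotent[OF MA] K1_det_blocks_one[OF c, of p] K1_det_closed[OF A] by simp
qed

text \<open>A block permutation P satisfies diag(1, D) P = P diag(D, 1), and K1 is
  commutative.\<close>

lemma K1_det_swap_blocks:
  fixes D :: "'a::{ring,monoid_mult} mat"
  assumes D: "D \<in> carrier (GL k)"
  shows "K1_det (blocks n k (1\<^sub>m n) (0\<^sub>m k n) D) = K1_det D"
proof -
  interpret K: comm_group "K1 :: 'a K1_elt monoid" by (rule K1_comm_group)
  have c: "D \<in> carrier_mat k k" by (rule GL_carrier_mat[OF D])
  define P :: "'a mat" where "P = four_block_mat (0\<^sub>m n k) (1\<^sub>m n) (1\<^sub>m k) (0\<^sub>m k n)"
  define P' :: "'a mat" where "P' = four_block_mat (0\<^sub>m k n) (1\<^sub>m k) (1\<^sub>m n) (0\<^sub>m n k)"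
  note om = one_mat_mult[of _ n n] one_mat_mult[of _ n k] one_mat_mult[of _ k k] one_mat_mult[of _ k n]
  have "P * P' = 1\<^sub>m (n + k)" unfolding P_def P'_def
    by (subst mult_four_block_mat[of _ n k _ n _ k _ _ n _ k]) (auto simp: om)
  moreover have "P' * P = 1\<^sub>m (k + n)" unfolding P_def P'_def
    by (subst mult_four_block_mat[of _ k n _ k _ n _ _ k _ n]) (auto simp: om)
  moreover have "P \<in> carrier_mat (n + k) (k + n)" "P' \<in> carrier_mat (k + n) (n + k)"
    by (auto simp: P_def P'_def)
  ultimately have P: "P \<in> carrier (GL (n + k))"
    by (intro GL_I[of _ _ P']) (auto simp: add.commute)
  let ?d = "blocks n k (1\<^sub>m n) (0\<^sub>m k n) D" and ?e = "blocks k n D (0\<^sub>m n k) (1\<^sub>m n)"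
  have "?d * P = four_block_mat (0\<^sub>m n k) (1\<^sub>m n) D (0\<^sub>m k n)" unfolding P_def using c
    by (subst mult_four_block_mat[of _ n n _ k _ k _ _ k _ n]) (auto simp: om)
  moreover have "P * ?e = four_block_mat (0\<^sub>m n k) (1\<^sub>m n) D (0\<^sub>m k n)" unfolding P_def using c
    by (subst mult_four_block_mat[of _ n k _ n _ k _ _ k _ n]) (auto simp: om)
  ultimately have e: "?d * P = P * ?e" by simp
  have d: "?d \<in> carrier (GL (n + k))" by (intro blocks_GL one_GL D) auto
  have "?e \<in> carrier (GL (k + n))" by (intro blocks_GL one_GL D) auto
  then have e': "?e \<in> carrier (GL (n + k))" by (simp add: add.commute)
  have "K1_det ?d \<otimes>\<^bsub>K1\<^esub> K1_det P = K1_det P \<otimes>\<^bsub>K1\<^esub> K1_det ?e"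
    using K1_det_mult[OF d P] K1_det_mult[OF P e'] e by simp
  then have "K1_det ?d = K1_det ?e"
    using K1_det_closed[OF d] K1_det_closed[OF P] K1_det_closed[OF e'] by (simp add: K.m_comm)
  then show ?thesis using K1_det_blocks_one[OF c, of n] by simp
qed

section \<open>Scalar matrices and their classes in K1\<close>

definition scal :: "nat \<Rightarrow> 'a::{ring,monoid_mult} \<Rightarrow> 'a mat" where
  "scal n x = mat n n (\<lambda>(i, j). if i = j then x else 0)"

lemma scal_carrier: "scal n x \<in> carrier_mat n n"
  by (simp add: scal_def)

lemma scal_mult_left:
  assumes "A \<in> carrier_mat n k"
  shows "scal n x * A = mat n k (\<lambda>(i, j). x * A $$ (i, j))"
proof -
  have d: "(if i = j then x else 0) * y = (if i = j then x * y else 0)" for i j :: nat and y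
    by auto
  show ?thesis using assms by (auto intro!: eq_matI simp: scal_def scalar_prod_def d)
qed

lemma scal_mult_right:
  assumes "A \<in> carrier_mat k n"
  shows "A * scal n x = mat k n (\<lambda>(i, j). A $$ (i, j) * x)"
proof -
  have d: "y * (if i = j then x else 0) = (if i = j then y * x else 0)" for i j :: nat and y
    by auto
  show ?thesis using assms by (auto intro!: eq_matI simp: scal_def scalar_prod_def d)
qed

lemma scal_scal: "scal n x * scal n y = scal n (x * y)"
  by (subst scal_mult_left[OF scal_carrier]) (auto intro!: eq_matI simp: scal_def)

lemma scal_one: "scal n 1 = 1\<^sub>m n"
  by (auto intro!: eq_matI simp: scal_def)

lemma scal_GL: "x * y = 1 \<Longrightarrow> y * x = 1 \<Longrightarrow> scal n x \<in> carrier (GL n)"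
  by (rule GL_I[OF scal_carrier scal_carrier[of n y]]) (simp_all add: scal_scal scal_one)

lemma K1_unit_scal: "K1_unit x = K1_det (scal 1 x)"
proof -
  have "mat 1 1 (\<lambda>_. x) = scal 1 x" by (auto intro!: eq_matI simp: scal_def)
  then show ?thesis by (simp add: K1_unit_def)
qed

text \<open>One diagonal entry is split off at a time. The exponent n = q is the source of the
  factor q in t = q d.\<close>

lemma K1_det_scal:
  fixes x :: "'a::{ring,monoid_mult}"
  assumes "x * y = 1" "y * x = 1"
  shows "K1_det (scal n x) = K1_unit x [^]\<^bsub>K1\<^esub> n"
proof (induction n)
  case 0
  have "scal 0 x = 1\<^sub>m 0" by (auto intro!: eq_matI simp: scal_def)
  then show ?case by (simp add: K1_det_one)
next
  case (Suc n)
  let ?a = "blocks n 1 (scal n x) (0\<^sub>m 1 n) (1\<^sub>m 1)" and ?b = "blocks n 1 (1\<^sub>m n) (0\<^sub>m 1 n) (scal 1 x)"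
  note g = scal_GL[OF assms]
  have ab: "?a \<in> carrier (GL (n + 1))" "?b \<in> carrier (GL (n + 1))"
    by (intro blocks_GL g one_GL zero_carrier_mat)+
  have "?a * ?b = blocks n 1 (scal n x) (0\<^sub>m 1 n) (scal 1 x)"
    by (subst blocks_mult) (auto simp: scal_carrier one_mat_mult[of _ n n] one_mat_mult[of _ "Suc 0" "Suc 0"])
  also have "\<dots> = scal (Suc n) x"
    by (rule eq_matI) (auto simp: scal_def)
  finally have "K1_det (scal (Suc n) x) = K1_det ?a \<otimes>\<^bsub>K1\<^esub> K1_det ?b"
    using K1_det_mult[OF ab] by simp
  then show ?case
    using Suc K1_det_swap_blocks[OF g[of 1], of n] K1_det_blocks_one[OF scal_carrier, of n x 1]
    by (simp add: K1_unit_scal)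
qed

section \<open>Chains with coefficients in a localized group ring\<close>

lemma group_ring_simps:
  "carrier (group_ring U) = {c. Poly_Mapping.keys c \<subseteq> carrier U}"
  "\<one>\<^bsub>group_ring U\<^esub> = frag_of \<one>\<^bsub>U\<^esub>" "\<zero>\<^bsub>group_ring U\<^esub> = 0" "a \<oplus>\<^bsub>group_ring U\<^esub> b = a + b"
  "a \<otimes>\<^bsub>group_ring U\<^esub> b = frag_extend (\<lambda>g. frag_extend (\<lambda>h. frag_of (g \<otimes>\<^bsub>U\<^esub> h)) b) a"
  by (simp_all add: group_ring_def)

lemma group_ring_mult_diff_right:
  "c \<otimes>\<^bsub>group_ring U\<^esub> (a - b) = c \<otimes>\<^bsub>group_ring U\<^esub> a - c \<otimes>\<^bsub>group_ring U\<^esub> b"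
  by (simp add: group_ring_simps frag_extend_def[of _ c] frag_extend_diff frag_cmul_diff_right sum_subtractf)

lemma tensor_map_scale:
  assumes "abelian_group N" "f \<zero>\<^bsub>M\<^esub> = \<zero>\<^bsub>N\<^esub>" "f (c y) \<in> carrier N"
  shows "tensor_map M N f (\<lambda>g. g) c y = f (c y)"
proof -
  interpret N: abelian_group N by fact
  have e: "{x. c x \<noteq> \<zero>\<^bsub>M\<^esub> \<and> map (\<lambda>g. g) x = y} = (if c y = \<zero>\<^bsub>M\<^esub> then {} else {y})" by auto
  show ?thesis using assms unfolding tensor_map_def push_chain_def e by auto
qed

text \<open>It will be applied to G_q and to the affine group, with \<open>A_bar\<close> for U.
  Below, \<open>F\<close> stands for bars over the set U, that is coefficients in Z[U], and
  \<open>B\<close> for bars over the module \<open>Lam\<close>; \<Psi> leads from the first to the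
  second.\<close>

locale det_group = group H + U: comm_group U
  for H :: "('h, 'x) monoid_scheme" (structure) and U :: "('u, 'y) monoid_scheme" +
  fixes \<delta> :: "'h \<Rightarrow> 'u" and s :: "'u \<Rightarrow>\<^sub>0 int"
  assumes det_hom: "\<delta> \<in> hom H U" and s_carrier: "s \<in> carrier (group_ring U)"
begin

abbreviation "R \<equiv> group_ring U"
abbreviation "Lam \<equiv> localization R {s}"

sublocale L: localized "group_ring U" "{s}"
  using group_ring_cring[OF U.comm_group_axioms] s_carrier
  by (simp add: localized_def localized_axioms_def)

sublocale Lam: cring "localization (group_ring U) {s}"
  by (rule L.localization_cring)

definition lact :: "(('u \<Rightarrow>\<^sub>0 int) \<times> ('u \<Rightarrow>\<^sub>0 int)) set \<Rightarrow> 'h \<Rightarrow> (('u \<Rightarrow>\<^sub>0 int) \<times> ('u \<Rightarrow>\<^sub>0 int)) set" where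
  "lact x T = x \<otimes>\<^bsub>Lam\<^esub> frac R {s} (frag_of (\<delta> T)) (frag_of \<one>\<^bsub>U\<^esub>)"

definition uact :: "'u \<Rightarrow> 'h \<Rightarrow> 'u" where
  "uact x T = x \<otimes>\<^bsub>U\<^esub> \<delta> T"

definition \<beta> :: "'u \<Rightarrow> (('u \<Rightarrow>\<^sub>0 int) \<times> ('u \<Rightarrow>\<^sub>0 int)) set" where
  "\<beta> x = frac R {s} (frag_of x) (frag_of \<one>\<^bsub>U\<^esub>)"

lemma one_S: "frag_of \<one>\<^bsub>U\<^esub> \<in> L.S"
  using L.S_one by (simp add: group_ring_simps)

lemma frag_of_R: "x \<in> carrier U \<Longrightarrow> frag_of x \<in> carrier R"
  by (simp add: group_ring_simps)

lemma det_closed: "T \<in> carrier H \<Longrightarrow> \<delta> T \<in> carrier U"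
  using hom_in_carrier[OF det_hom] .

lemma beta_closed: "x \<in> carrier U \<Longrightarrow> \<beta> x \<in> carrier Lam"
  by (simp add: \<beta>_def L.fr_closed frag_of_R one_S)

lemma beta_mult: "x \<in> carrier U \<Longrightarrow> y \<in> carrier U \<Longrightarrow> \<beta> (x \<otimes>\<^bsub>U\<^esub> y) = \<beta> x \<otimes>\<^bsub>Lam\<^esub> \<beta> y"
  by (simp add: \<beta>_def L.fr_mult frag_of_R one_S) (simp add: group_ring_simps)

lemma beta_one: "\<beta> \<one>\<^bsub>U\<^esub> = \<one>\<^bsub>Lam\<^esub>"
  by (simp add: \<beta>_def L.LR_one) (simp add: group_ring_simps)

lemma lact_beta: "lact x T = x \<otimes>\<^bsub>Lam\<^esub> \<beta> (\<delta> T)"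
  by (simp add: lact_def \<beta>_def)

lemma det_mult: "g \<in> carrier H \<Longrightarrow> h \<in> carrier H \<Longrightarrow> \<delta> (g \<otimes> h) = \<delta> g \<otimes>\<^bsub>U\<^esub> \<delta> h"
  using hom_mult[OF det_hom] .

lemma det_one: "\<delta> \<one> = \<one>\<^bsub>U\<^esub>"
  using hom_one[OF det_hom] is_group U.is_group by simp

sublocale B: bar_module H Lam lact
  by unfold_locales
    (auto simp: lact_beta det_closed beta_closed det_one beta_one det_mult beta_mult Lam.m_assoc Lam.l_distr)

sublocale F: gset H "carrier U" uact
  by unfold_locales (auto simp: uact_def det_closed det_one det_mult U.m_assoc)

text \<open>Z[U] acts on the coefficients from the left, which commutes with the right action by
  determinants. The identity on the group part is spelled out so that \<open>bar_map_dB\<close>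
  applies to each basis element.\<close>

definition smul :: "('u \<Rightarrow>\<^sub>0 int) \<Rightarrow> ('u \<times> 'h list \<Rightarrow>\<^sub>0 int) \<Rightarrow> ('u \<times> 'h list \<Rightarrow>\<^sub>0 int)" where
  "smul c w = frag_extend (\<lambda>u. frag_extend (\<lambda>b. frag_of (map_prod (\<lambda>x. u \<otimes>\<^bsub>U\<^esub> x) (map (\<lambda>g. g)) b)) w) c"

text \<open>The coefficient of [y], an element of Z[U]. By \<open>lookup_cf\<close> these
  coefficients determine the chain, so that identities for \<open>smul\<close> come from the ring
  axioms of Z[U].\<close>

definition cf :: "'h list \<Rightarrow> ('u \<times> 'h list \<Rightarrow>\<^sub>0 int) \<Rightarrow> ('u \<Rightarrow>\<^sub>0 int)" where
  "cf y w = frag_extend (\<lambda>b. if snd b = y then frag_of (fst b) else 0) w"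

lemma smul_diff: "smul c (a - b) = smul c a - smul c b"
  by (simp add: smul_def frag_extend_def[of _ c] frag_extend_diff frag_cmul_diff_right sum_subtractf)

lemma keys_smul:
  assumes "c \<in> carrier R" "Poly_Mapping.keys w \<subseteq> F.bars n"
  shows "Poly_Mapping.keys (smul c w) \<subseteq> F.bars n"
proof -
  have "Poly_Mapping.keys c \<subseteq> carrier U" using assms(1) by (simp add: group_ring_simps)
  then show ?thesis
    unfolding smul_def
    by (rule keys_frag_extend_subset) (rule keys_frag_extend_subset[OF assms(2)], auto simp: F.bars_def)
qed

lemma cf_smul: "cf y (smul c w) = c \<otimes>\<^bsub>R\<^esub> cf y w"
proof (rule frag_additive_eq[of w UNIV])
  fix b :: "'u \<times> 'h list"
  show "cf y (smul c (frag_of b)) = c \<otimes>\<^bsub>R\<^esub> cf y (frag_of b)"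
    by (cases "snd b = y")
      (auto simp: cf_def smul_def frag_extend_extend group_ring_simps frag_extend_eq_0)
qed (auto simp: smul_diff cf_def frag_extend_diff group_ring_mult_diff_right)

lemma lookup_cf: "Poly_Mapping.lookup (cf y w) x = Poly_Mapping.lookup w (x, y)"
  by (rule frag_additive_eq[of w UNIV])
    (auto simp: cf_def frag_extend_diff lookup_minus)

lemma cf_carrier: "Poly_Mapping.keys w \<subseteq> F.bars n \<Longrightarrow> cf y w \<in> carrier R"
  unfolding group_ring_simps cf_def mem_Collect_eq
  by (erule keys_frag_extend_subset) (auto simp: F.bars_def)

lemma smul_mult:
  assumes "c \<in> carrier R" "d \<in> carrier R" "Poly_Mapping.keys w \<subseteq> F.bars n"
  shows "smul (c \<otimes>\<^bsub>R\<^esub> d) w = smul c (smul d w)"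
proof (rule poly_mapping_eqI)
  fix b :: "'u \<times> 'h list"
  have "cf (snd b) (smul (c \<otimes>\<^bsub>R\<^esub> d) w) = cf (snd b) (smul c (smul d w))"
    using assms cf_carrier[OF assms(3)] by (simp add: cf_smul L.m_assoc)
  then show "Poly_Mapping.lookup (smul (c \<otimes>\<^bsub>R\<^esub> d) w) b = Poly_Mapping.lookup (smul c (smul d w)) b"
    using lookup_cf[of "snd b" _ "fst b"] by (metis prod.collapse)
qed

lemma smul_one: "Poly_Mapping.keys w \<subseteq> F.bars n \<Longrightarrow> smul \<one>\<^bsub>R\<^esub> w = w"
proof (rule poly_mapping_eqI)
  fix b :: "'u \<times> 'h list" assume "Poly_Mapping.keys w \<subseteq> F.bars n"
  then have "cf (snd b) (smul \<one>\<^bsub>R\<^esub> w) = cf (snd b) w" using cf_carrier by (simp add: cf_smul)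
  then show "Poly_Mapping.lookup (smul \<one>\<^bsub>R\<^esub> w) b = Poly_Mapping.lookup w b"
    using lookup_cf[of "snd b" _ "fst b"] by (metis prod.collapse)
qed

lemma dB_smul:
  assumes c: "c \<in> carrier R" and w: "Poly_Mapping.keys w \<subseteq> F.bars n"
  shows "F.dB (smul c w) = smul c (F.dB w)"
proof -
  have id: "(\<lambda>g. g) \<in> hom H H" by (rule homI) auto
  have "F.dB (smul c w) = frag_extend (\<lambda>u. F.dB (frag_extend (\<lambda>b. frag_of (map_prod (\<lambda>x. u \<otimes>\<^bsub>U\<^esub> x) (map (\<lambda>g. g)) b)) w)) c"
    by (simp add: smul_def frag_extend_extend)
  also have "\<dots> = smul c (F.dB w)"
    unfolding smul_def
  proof (rule frag_extend_eq)
    fix u assume "u \<in> Poly_Mapping.keys c"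
    then have u: "u \<in> carrier U" using c by (auto simp: group_ring_simps)
    show "F.dB (frag_extend (\<lambda>b. frag_of (map_prod (\<lambda>x. u \<otimes>\<^bsub>U\<^esub> x) (map (\<lambda>g. g)) b)) w)
       = frag_extend (\<lambda>b. frag_of (map_prod (\<lambda>x. u \<otimes>\<^bsub>U\<^esub> x) (map (\<lambda>g. g)) b)) (F.dB w)"
      by (rule bar_map_dB[where \<alpha> = "\<lambda>x. u \<otimes>\<^bsub>U\<^esub> x" and \<beta> = "\<lambda>g. g", OF F.gset_axioms F.gset_axioms id _ w, symmetric])
        (simp add: uact_def U.m_assoc u det_closed)
  qed
  finally show ?thesis .
qed

section \<open>From the group ring to its localization\<close>

abbreviation "Beta \<equiv> frag_extend (\<lambda>b. frag_of (map_prod \<beta> (map (\<lambda>g. g)) b))"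

definition \<Psi> :: "('u \<times> 'h list \<Rightarrow>\<^sub>0 int) \<Rightarrow> 'h list \<Rightarrow> (('u \<Rightarrow>\<^sub>0 int) \<times> ('u \<Rightarrow>\<^sub>0 int)) set" where
  "\<Psi> w = B.\<Theta> (Beta w)"

lemma keys_Beta: "Poly_Mapping.keys w \<subseteq> F.bars n \<Longrightarrow> Poly_Mapping.keys (Beta w) \<subseteq> B.bars n"
  by (erule keys_frag_extend_subset) (auto simp: F.bars_def B.bars_def beta_closed)

lemma Psi_closed: "Poly_Mapping.keys w \<subseteq> F.bars n \<Longrightarrow> \<Psi> w \<in> carrier (bar_chains H Lam n)"
  unfolding \<Psi>_def by (intro B.Theta_closed keys_Beta)

lemma Psi_dB:
  assumes "Poly_Mapping.keys w \<subseteq> F.bars (Suc n)"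
  shows "\<Psi> (F.dB w) = bar_d H Lam lact n (\<Psi> w)"
proof -
  have id: "(\<lambda>g. g) \<in> hom H H" by (rule homI) auto
  have "Beta (F.dB w) = B.dB (Beta w)"
    by (rule bar_map_dB[where \<alpha> = \<beta> and \<beta> = "\<lambda>g. g", OF F.gset_axioms B.gset_axioms id _ assms])
      (simp add: uact_def lact_beta beta_mult det_closed)
  then show ?thesis unfolding \<Psi>_def by (simp only: B.Theta_dB[OF keys_Beta[OF assms]])
qed

lemma Psi_at:
  assumes "Poly_Mapping.keys w \<subseteq> F.bars n"
  shows "\<Psi> w y = L.fr (cf y w) \<one>\<^bsub>R\<^esub>"
proof -
  have "(\<lambda>w. \<Psi> w y) w = (\<lambda>w. L.fr (cf y w) \<one>\<^bsub>R\<^esub>) w"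
  proof (rule free_Abelian_hom_eq[OF _ _ _ _ assms])
    show "(\<lambda>w. \<Psi> w y) \<in> hom (free_Abelian_group (F.bars n)) (add_monoid Lam)"
    proof (rule homI)
      fix v assume "v \<in> carrier (free_Abelian_group (F.bars n))"
      then show "\<Psi> v y \<in> carrier (add_monoid Lam)"
        using Psi_closed[of v n] by (simp add: free_Abelian_group_def bar_chains_def)
    qed (simp add: free_Abelian_group_def \<Psi>_def frag_extend_add B.Theta_add)
    show "(\<lambda>w. L.fr (cf y w) \<one>\<^bsub>R\<^esub>) \<in> hom (free_Abelian_group (F.bars n)) (add_monoid Lam)"
    proof (rule homI)
      fix v w assume "v \<in> carrier (free_Abelian_group (F.bars n))"
        and "w \<in> carrier (free_Abelian_group (F.bars n))"
      then have v: "cf y v \<in> carrier R" "cf y w \<in> carrier R"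
        using cf_carrier by (auto simp: free_Abelian_group_def)
      have "cf y (v + w) = cf y v \<oplus>\<^bsub>R\<^esub> cf y w"
        by (simp add: cf_def frag_extend_add group_ring_simps)
      then show "L.fr (cf y (v \<otimes>\<^bsub>free_Abelian_group (F.bars n)\<^esub> w)) \<one>\<^bsub>R\<^esub>
        = L.fr (cf y v) \<one>\<^bsub>R\<^esub> \<otimes>\<^bsub>add_monoid Lam\<^esub> L.fr (cf y w) \<one>\<^bsub>R\<^esub>"
        using L.fr_add_same[OF v L.S_one] by (simp add: free_Abelian_group_def)
    qed (auto simp: free_Abelian_group_def intro!: L.fr_closed cf_carrier L.S_one)
    show "group (add_monoid Lam)" by (rule Lam.a_group)
    fix b assume "b \<in> F.bars n"
    then obtain x l where b: "b = (x, l)" "x \<in> carrier U" by (cases b) (auto simp: F.bars_def)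
    have "\<Psi> (frag_of b) = single_chain Lam (\<beta> x) l"
      using B.Theta_of[OF beta_closed[OF b(2)], of l] by (simp add: \<Psi>_def b(1))
    then show "\<Psi> (frag_of b) y = L.fr (cf y (frag_of b)) \<one>\<^bsub>R\<^esub>"
      by (simp add: single_chain_def cf_def b(1) L.LR_zero \<beta>_def group_ring_simps)
  qed
  then show ?thesis .
qed

lemma Psi_smul:
  assumes "c \<in> carrier R" "Poly_Mapping.keys w \<subseteq> F.bars n"
  shows "\<Psi> (smul c w) y = L.fr c \<one>\<^bsub>R\<^esub> \<otimes>\<^bsub>Lam\<^esub> \<Psi> w y"
  using assms cf_carrier[OF assms(2), of y] L.S_one
  by (simp add: Psi_at[OF keys_smul[OF assms]] Psi_at[OF assms(2)] cf_smul L.fr_mult)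

text \<open>A numerator over 1 vanishes in the localization when some denominator annihilates it.
  Only finitely many coefficients are nonzero, and the product of their annihilators kills the whole
  chain.\<close>

lemma Psi_eq_zero:
  assumes w: "Poly_Mapping.keys w \<subseteq> F.bars n" and z: "\<And>y. \<Psi> w y = \<zero>\<^bsub>Lam\<^esub>"
  obtains \<sigma> where "\<sigma> \<in> L.S" "smul \<sigma> w = 0"
proof -
  have ann: "\<exists>v\<in>L.S. v \<otimes>\<^bsub>R\<^esub> cf y w = \<zero>\<^bsub>R\<^esub>" for y
    using z[of y] Psi_at[OF w, of y] L.fr_one_eq_zero[OF cf_carrier[OF w, of y]] by metis
  have "\<exists>\<sigma>\<in>L.S. \<forall>y\<in>Y. \<sigma> \<otimes>\<^bsub>R\<^esub> cf y w = \<zero>\<^bsub>R\<^esub>" if "finite Y" for Y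
    using that
  proof (induction Y rule: finite_induct)
    case empty
    then show ?case using L.S_one by auto
  next
    case (insert y Y)
    obtain \<sigma> where \<sigma>: "\<sigma> \<in> L.S" "\<And>y. y \<in> Y \<Longrightarrow> \<sigma> \<otimes>\<^bsub>R\<^esub> cf y w = \<zero>\<^bsub>R\<^esub>" using insert by auto
    obtain v where v: "v \<in> L.S" "v \<otimes>\<^bsub>R\<^esub> cf y w = \<zero>\<^bsub>R\<^esub>" using ann by auto
    note cl = L.S_carrier[OF \<sigma>(1)] L.S_carrier[OF v(1)] cf_carrier[OF w]
    have "(\<sigma> \<otimes>\<^bsub>R\<^esub> v) \<otimes>\<^bsub>R\<^esub> cf y' w = \<zero>\<^bsub>R\<^esub>" if "y' \<in> insert y Y" for y'
    proof (cases "y' = y")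
      case True
      then show ?thesis using cl v by (simp add: L.m_assoc)
    next
      case False
      then have "v \<otimes>\<^bsub>R\<^esub> (\<sigma> \<otimes>\<^bsub>R\<^esub> cf y' w) = \<zero>\<^bsub>R\<^esub>" using that \<sigma> cl by simp
      then show ?thesis using cl by (simp add: L.m_ac)
    qed
    then show ?case using L.S_mult[OF \<sigma>(1) v(1)] by blast
  qed
  then obtain \<sigma> where \<sigma>: "\<sigma> \<in> L.S" "\<forall>y\<in>snd ` Poly_Mapping.keys w. \<sigma> \<otimes>\<^bsub>R\<^esub> cf y w = \<zero>\<^bsub>R\<^esub>"
    by (metis finite_imageI finite_keys)
  have "Poly_Mapping.lookup (smul \<sigma> w) (x, y) = 0" for x y
  proof (cases "y \<in> snd ` Poly_Mapping.keys w")
    case True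
    then have "cf y (smul \<sigma> w) = 0" using \<sigma>(2) unfolding cf_smul group_ring_simps(3) by blast
    then show ?thesis by (simp add: lookup_cf[symmetric])
  next
    case False
    then have "cf y w = 0" unfolding cf_def by (intro frag_extend_eq_0) auto
    then have "cf y (smul \<sigma> w) = 0"
      using group_ring_mult_diff_right[where c = \<sigma> and U = U and a = 0 and b = 0] by (simp add: cf_smul)
    then show ?thesis by (simp add: lookup_cf[symmetric])
  qed
  then have "smul \<sigma> w = 0" by (intro poly_mapping_eqI) auto
  then show ?thesis using that \<sigma>(1) by blast
qed

section \<open>Multiplication of chains by elements of the localized ring\<close>

definition scale :: "(('u \<Rightarrow>\<^sub>0 int) \<times> ('u \<Rightarrow>\<^sub>0 int)) set \<Rightarrow> ('h list \<Rightarrow> (('u \<Rightarrow>\<^sub>0 int) \<times> ('u \<Rightarrow>\<^sub>0 int)) set)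
    \<Rightarrow> 'h list \<Rightarrow> (('u \<Rightarrow>\<^sub>0 int) \<times> ('u \<Rightarrow>\<^sub>0 int)) set" where
  "scale a c = (\<lambda>y. a \<otimes>\<^bsub>Lam\<^esub> c y)"

lemma scale_module_map:
  assumes "a \<in> carrier Lam"
  shows "bar_module_map H Lam lact H Lam lact (\<lambda>x. a \<otimes>\<^bsub>Lam\<^esub> x) (\<lambda>g. g)"
  by unfold_locales
    (use assms in \<open>auto simp: Lam.r_distr lact_beta Lam.m_assoc beta_closed det_closed hom_def\<close>)

lemma scale_tensor_map:
  assumes "a \<in> carrier Lam" "c \<in> carrier (bar_chains H Lam n)"
  shows "tensor_map Lam Lam (\<lambda>x. a \<otimes>\<^bsub>Lam\<^esub> x) (\<lambda>g. g) c = scale a c"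
proof
  fix y
  have "c y \<in> carrier Lam" using assms(2) by (simp add: bar_chains_def)
  then show "tensor_map Lam Lam (\<lambda>x. a \<otimes>\<^bsub>Lam\<^esub> x) (\<lambda>g. g) c y = scale a c y"
    unfolding scale_def using assms(1)
    by (intro tensor_map_scale Lam.abelian_group_axioms) auto
qed

lemma scale_hom: "a \<in> carrier Lam \<Longrightarrow> scale a \<in> hom (bar_chains H Lam n) (bar_chains H Lam n)"
  using bar_module_map.tensor_map_hom[OF scale_module_map, of a n] scale_tensor_map[of a _ n]
    group.is_monoid[OF comm_group.axioms(2)[OF B.C_group[of n]]]
  by (auto simp: hom_def Pi_iff monoid.m_closed)

lemma scale_bar_d:
  assumes a: "a \<in> carrier Lam" and c: "c \<in> carrier (bar_chains H Lam (Suc n))"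
  shows "bar_d H Lam lact n (scale a c) = scale a (bar_d H Lam lact n c)"
proof -
  have "bar_d H Lam lact n c \<in> carrier (bar_chains H Lam n)"
    using hom_in_carrier[OF B.bar_d_hom c] .
  then show ?thesis
    using bar_module_map.chain_map_bar[OF scale_module_map[OF a]] c
      scale_tensor_map[OF a c] scale_tensor_map[OF a, of "bar_d H Lam lact n c" n]
    by (simp add: chain_map_def derived_tensor_Z_def)
qed

lemma scale_scale:
  assumes "a \<in> carrier Lam" "b \<in> carrier Lam" "c \<in> carrier (bar_chains H Lam n)"
  shows "scale a (scale b c) = scale (a \<otimes>\<^bsub>Lam\<^esub> b) c"
  using assms by (auto simp: scale_def bar_chains_def Lam.m_assoc)

lemma scale_one: "c \<in> carrier (bar_chains H Lam n) \<Longrightarrow> scale \<one>\<^bsub>Lam\<^esub> c = c"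
  by (auto simp: scale_def bar_chains_def)

abbreviation inc :: "('u \<Rightarrow>\<^sub>0 int) \<Rightarrow> (('u \<Rightarrow>\<^sub>0 int) \<times> ('u \<Rightarrow>\<^sub>0 int)) set" where
  "inc c \<equiv> L.fr c \<one>\<^bsub>R\<^esub>"

lemma inc_closed: "c \<in> carrier R \<Longrightarrow> inc c \<in> carrier Lam"
  by (rule L.fr_closed[OF _ L.S_one])

lemma inc_mult: "c \<in> carrier R \<Longrightarrow> d \<in> carrier R \<Longrightarrow> inc (c \<otimes>\<^bsub>R\<^esub> d) = inc c \<otimes>\<^bsub>Lam\<^esub> inc d"
  by (simp add: L.fr_mult L.S_one)

lemma Psi_smul_scale:
  assumes "c \<in> carrier R" "Poly_Mapping.keys w \<subseteq> F.bars n"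
  shows "\<Psi> (smul c w) = scale (inc c) (\<Psi> w)"
  using Psi_smul[OF assms] by (auto simp: scale_def)

text \<open>Induction over a preimage under \<Theta>: a generator with coefficient a/\<sigma> is
  cleared by \<sigma>, and for a difference the two denominators are multiplied.\<close>

lemma clear_denominators:
  assumes "c \<in> carrier (bar_chains H Lam n)"
  obtains \<sigma> w where "\<sigma> \<in> L.S" "Poly_Mapping.keys w \<subseteq> F.bars n" "\<Psi> w = scale (inc \<sigma>) c"
proof -
  let ?P = "\<lambda>c. \<exists>\<sigma>\<in>L.S. \<exists>w. Poly_Mapping.keys w \<subseteq> F.bars n \<and> (\<forall>y. \<Psi> w y = inc \<sigma> \<otimes>\<^bsub>Lam\<^esub> c y)"
  obtain v where v: "Poly_Mapping.keys v \<subseteq> B.bars n" "B.\<Theta> v = c" using assms by (rule B.Theta_surj)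
  have Psi_minus: "\<Psi> (a - b) y = \<Psi> a y \<ominus>\<^bsub>Lam\<^esub> \<Psi> b y"
    if a: "Poly_Mapping.keys a \<subseteq> F.bars n" and b: "Poly_Mapping.keys b \<subseteq> F.bars n" for a b y
  proof -
    have cl: "\<Psi> (a - b) y \<in> carrier Lam" "\<Psi> b y \<in> carrier Lam"
      using Psi_closed[OF keys_diff_subset[OF a b]] Psi_closed[OF b] by (auto simp: bar_chains_def)
    have "\<Psi> a y = \<Psi> (a - b) y \<oplus>\<^bsub>Lam\<^esub> \<Psi> b y"
      using B.Theta_add[of "Beta (a - b)" "Beta b"] by (simp add: \<Psi>_def frag_extend_diff)
    then show ?thesis using cl by (simp add: Lam.minus_eq Lam.a_assoc Lam.r_neg)
  qed
  have Theta_minus: "B.\<Theta> (a - b) y = B.\<Theta> a y \<ominus>\<^bsub>Lam\<^esub> B.\<Theta> b y"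
    if a: "Poly_Mapping.keys a \<subseteq> B.bars n" and b: "Poly_Mapping.keys b \<subseteq> B.bars n" for a b y
  proof -
    have cl: "B.\<Theta> (a - b) y \<in> carrier Lam" "B.\<Theta> b y \<in> carrier Lam"
      using B.Theta_closed[OF keys_diff_subset[OF a b]] B.Theta_closed[OF b] by (auto simp: bar_chains_def)
    have "B.\<Theta> a y = B.\<Theta> (a - b) y \<oplus>\<^bsub>Lam\<^esub> B.\<Theta> b y"
      using B.Theta_add[of "a - b" b] by simp
    then show ?thesis using cl by (simp add: Lam.minus_eq Lam.a_assoc Lam.r_neg)
  qed
  have "Poly_Mapping.keys v \<subseteq> B.bars n \<and> ?P (B.\<Theta> v)"
    using v(1)
  proof (induction v rule: frag_induction)
    case zero
    have "\<Psi> 0 y = inc \<one>\<^bsub>R\<^esub> \<otimes>\<^bsub>Lam\<^esub> B.\<Theta> 0 y" for y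
      using inc_closed[of "\<one>\<^bsub>R\<^esub>"] by (simp add: \<Psi>_def B.\<Theta>_def Lam.zext_0)
    then show ?case using L.S_one by (intro conjI bexI[of _ "\<one>\<^bsub>R\<^esub>"] exI[of _ 0]) auto
  next
    case (one b)
    then obtain x l where b: "b = (x, l)" "x \<in> carrier Lam" "length l = n" "set l \<subseteq> carrier H"
      by (cases b) (auto simp: B.bars_def)
    obtain a \<sigma> where a: "x = L.fr a \<sigma>" "a \<in> carrier R" "\<sigma> \<in> L.S" using b(2) by (rule L.LR_cases)
    define w where "w = frag_extend (\<lambda>u. frag_of (u, l)) a"
    have w: "Poly_Mapping.keys w \<subseteq> F.bars n"
      unfolding w_def using a(2) b
      by (intro keys_frag_extend_subset[of a "carrier U"]) (auto simp: group_ring_simps F.bars_def)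
    have "cf y w = (if y = l then a else 0)" for y
    proof -
      have "cf y w = frag_extend (\<lambda>u. if l = y then frag_of u else 0) a"
        by (simp add: cf_def w_def frag_extend_extend cong: if_cong)
      then show ?thesis by (auto simp: frag_expansion[symmetric] frag_extend_eq_0)
    qed
    then have "\<Psi> w y = (if y = l then inc a else \<zero>\<^bsub>Lam\<^esub>)" for y
      by (simp add: Psi_at[OF w] L.LR_zero group_ring_simps)
    moreover have "inc \<sigma> \<otimes>\<^bsub>Lam\<^esub> x = inc a"
      using a L.S_carrier[OF a(3)] L.fr_cancel[of a "\<one>\<^bsub>R\<^esub>" \<sigma>] L.S_one by (simp add: L.fr_mult)
    ultimately have "\<Psi> w y = inc \<sigma> \<otimes>\<^bsub>Lam\<^esub> B.\<Theta> (frag_of b) y" for y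
      using inc_closed[OF L.S_carrier[OF a(3)]]
      by (simp add: b(1) B.Theta_of[OF b(2)] single_chain_def)
    then show ?case using w a(3) one by auto
  next
    case (diff v1 v2)
    obtain \<sigma>1 w1 where 1: "\<sigma>1 \<in> L.S" "Poly_Mapping.keys w1 \<subseteq> F.bars n"
      "\<And>y. \<Psi> w1 y = inc \<sigma>1 \<otimes>\<^bsub>Lam\<^esub> B.\<Theta> v1 y" using diff by blast
    obtain \<sigma>2 w2 where 2: "\<sigma>2 \<in> L.S" "Poly_Mapping.keys w2 \<subseteq> F.bars n"
      "\<And>y. \<Psi> w2 y = inc \<sigma>2 \<otimes>\<^bsub>Lam\<^esub> B.\<Theta> v2 y" using diff by blast
    note S = L.S_carrier[OF 1(1)] L.S_carrier[OF 2(1)]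
    note I = inc_closed[OF S(1)] inc_closed[OF S(2)]
    let ?w = "smul \<sigma>2 w1 - smul \<sigma>1 w2"
    have k: "Poly_Mapping.keys (smul \<sigma>2 w1) \<subseteq> F.bars n" "Poly_Mapping.keys (smul \<sigma>1 w2) \<subseteq> F.bars n"
      using keys_smul 1 2 S by auto
    have "\<Psi> ?w y = inc (\<sigma>1 \<otimes>\<^bsub>R\<^esub> \<sigma>2) \<otimes>\<^bsub>Lam\<^esub> B.\<Theta> (v1 - v2) y" for y
    proof -
      have cl: "B.\<Theta> v1 y \<in> carrier Lam" "B.\<Theta> v2 y \<in> carrier Lam"
        using B.Theta_closed[of v1 n] B.Theta_closed[of v2 n] diff by (auto simp: bar_chains_def)
      have "\<Psi> ?w y = inc \<sigma>2 \<otimes>\<^bsub>Lam\<^esub> (inc \<sigma>1 \<otimes>\<^bsub>Lam\<^esub> B.\<Theta> v1 y) \<ominus>\<^bsub>Lam\<^esub> inc \<sigma>1 \<otimes>\<^bsub>Lam\<^esub> (inc \<sigma>2 \<otimes>\<^bsub>Lam\<^esub> B.\<Theta> v2 y)"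
        by (simp only: Psi_minus[OF k] Psi_smul[OF S(2) 1(2)] Psi_smul[OF S(1) 2(2)] 1(3) 2(3))
      also have "\<dots> = (inc \<sigma>1 \<otimes>\<^bsub>Lam\<^esub> inc \<sigma>2) \<otimes>\<^bsub>Lam\<^esub> (B.\<Theta> v1 y \<ominus>\<^bsub>Lam\<^esub> B.\<Theta> v2 y)"
        using cl I by (simp add: Lam.minus_eq Lam.r_distr Lam.r_minus Lam.m_ac)
      finally show ?thesis using S diff by (simp add: inc_mult Theta_minus)
    qed
    moreover have "Poly_Mapping.keys ?w \<subseteq> F.bars n" by (intro keys_diff_subset k)
    moreover have "\<sigma>1 \<otimes>\<^bsub>R\<^esub> \<sigma>2 \<in> L.S" by (rule L.S_mult[OF 1(1) 2(1)])
    ultimately show ?case using diff keys_diff_subset[of v1 _ v2] by blast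
  qed
  then obtain \<sigma> w where "\<sigma> \<in> L.S" "Poly_Mapping.keys w \<subseteq> F.bars n" "\<And>y. \<Psi> w y = inc \<sigma> \<otimes>\<^bsub>Lam\<^esub> c y"
    using v(2) by blast
  then show ?thesis by (intro that[of \<sigma> w]) (auto simp: scale_def)
qed

definition unscale :: "('u \<Rightarrow>\<^sub>0 int) \<Rightarrow> (('u \<Rightarrow>\<^sub>0 int) \<times> ('u \<Rightarrow>\<^sub>0 int)) set" where
  "unscale \<sigma> = L.fr \<one>\<^bsub>R\<^esub> \<sigma>"

lemma unscale_closed: "\<sigma> \<in> L.S \<Longrightarrow> unscale \<sigma> \<in> carrier Lam"
  by (simp add: unscale_def L.fr_closed)

lemma unscale_inc: "\<sigma> \<in> L.S \<Longrightarrow> unscale \<sigma> \<otimes>\<^bsub>Lam\<^esub> inc \<sigma> = \<one>\<^bsub>Lam\<^esub>"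
  using L.fr_inverse[of \<sigma>] inc_closed[OF L.S_carrier] unscale_closed Lam.m_comm unscale_def by metis

lemma scale_unscale:
  assumes "\<sigma> \<in> L.S" "c \<in> carrier (bar_chains H Lam n)"
  shows "scale (unscale \<sigma>) (scale (inc \<sigma>) c) = c"
  using assms scale_scale[OF unscale_closed inc_closed[OF L.S_carrier], of \<sigma> \<sigma> c n]
  by (simp add: unscale_inc scale_one)

section \<open>Cycles and boundaries over the localization\<close>

abbreviation "Cpx \<equiv> derived_tensor_Z Lam lact H"

lemma scale_cycles:
  assumes a: "a \<in> carrier Lam" and z: "z \<in> cycles Cpx n"
  shows "scale a z \<in> cycles Cpx n"
  using chain_map_cycles[OF bar_module_map.chain_map_bar[OF scale_module_map[OF a]] z]
    scale_tensor_map[OF a, of z n] z subgroup.subset[OF subgroup_cycles[OF B.chain_complex_bar, of n]]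
  by (auto simp: derived_tensor_Z_def)

lemma scale_boundaries:
  assumes a: "a \<in> carrier Lam" and z: "z \<in> boundaries Cpx n"
  shows "scale a z \<in> boundaries Cpx n"
  using chain_map_boundaries[OF bar_module_map.chain_map_bar[OF scale_module_map[OF a]] z]
    scale_tensor_map[OF a, of z n] z subgroup.subset[OF subgroup_boundaries[OF B.chain_complex_bar, of n]]
  by (auto simp: derived_tensor_Z_def)

lemma Psi_cycle:
  assumes "w \<in> F.Z n"
  shows "\<Psi> w \<in> cycles Cpx n"
proof (cases n)
  case 0
  then show ?thesis using assms Psi_closed[of w 0] by (simp add: cycles_def F.Z_def derived_tensor_Z_def)
next
  case (Suc k)
  have w: "Poly_Mapping.keys w \<subseteq> F.bars (Suc k)" "F.dB w = 0" using assms Suc by (auto simp: F.Z_def)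
  have "\<Psi> 0 = \<one>\<^bsub>bar_chains H Lam k\<^esub>"
    by (simp add: \<Psi>_def B.\<Theta>_def Lam.zext_0 bar_chains_def)
  then show ?thesis
    using Psi_closed[OF w(1)] Psi_dB[OF w(1)] w(2) Suc by (simp add: cycles_def kernel_def derived_tensor_Z_def)
qed

lemma Psi_boundary:
  assumes "w \<in> F.Bd n"
  shows "\<Psi> w \<in> boundaries Cpx n"
proof -
  obtain b where b: "Poly_Mapping.keys b \<subseteq> F.bars (Suc n)" "w = F.dB b" using assms by (auto simp: F.Bd_def)
  show ?thesis unfolding b(2) Psi_dB[OF b(1)] boundaries_def
    using Psi_closed[OF b(1)] by (auto simp: derived_tensor_Z_def)
qed

lemma Psi_add: "\<Psi> (v + w) = \<Psi> v \<otimes>\<^bsub>bar_chains H Lam n\<^esub> \<Psi> w"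
  by (simp add: \<Psi>_def frag_extend_add B.Theta_add bar_chains_def)

text \<open>Two denominators enter. After the first, the chain comes from some w over Z[U], but the
  boundary of w is only known to vanish in the localization; the second denominator annihilates this
  boundary.\<close>

lemma cycle_clear_denominators:
  assumes z: "z \<in> cycles Cpx n"
  obtains \<sigma> w where "\<sigma> \<in> L.S" "w \<in> F.Z n" "\<Psi> w = scale (inc \<sigma>) z"
proof -
  have zc: "z \<in> carrier (bar_chains H Lam n)"
    using z subgroup.subset[OF subgroup_cycles[OF B.chain_complex_bar, of n]] by (auto simp: derived_tensor_Z_def)
  obtain \<sigma> w where w: "\<sigma> \<in> L.S" "Poly_Mapping.keys w \<subseteq> F.bars n" "\<Psi> w = scale (inc \<sigma>) z"
    using clear_denominators[OF zc] .
  have "\<exists>\<sigma>'\<in>L.S. smul \<sigma>' (F.dB w) = 0"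
  proof (cases n)
    case 0
    have "F.dB w = 0"
      by (rule frag_extend_eq_0) (use w(2) 0 in \<open>auto simp: F.bars_def F.dgen_def\<close>)
    then show ?thesis using L.S_one by (auto simp: smul_def frag_extend_eq_0)
  next
    case (Suc k)
    have wk: "Poly_Mapping.keys w \<subseteq> F.bars (Suc k)" using w Suc by simp
    have "scale (inc \<sigma>) z \<in> cycles Cpx n"
      by (rule scale_cycles[OF inc_closed[OF L.S_carrier[OF w(1)]] z])
    then have "bar_d H Lam lact k (\<Psi> w) = \<one>\<^bsub>bar_chains H Lam k\<^esub>"
      using Suc w(3) by (simp add: cycles_def kernel_def derived_tensor_Z_def)
    then have "\<Psi> (F.dB w) y = \<zero>\<^bsub>Lam\<^esub>" for y
      by (simp add: Psi_dB[OF wk] bar_chains_def)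
    then show ?thesis using Psi_eq_zero[OF F.keys_dB[OF wk]] by metis
  qed
  then obtain \<sigma>' where s': "\<sigma>' \<in> L.S" "smul \<sigma>' (F.dB w) = 0" by auto
  note S = L.S_carrier[OF w(1)] L.S_carrier[OF s'(1)]
  have "smul \<sigma>' w \<in> F.Z n"
    using keys_smul[OF S(2) w(2)] dB_smul[OF S(2) w(2)] s'(2) by (simp add: F.Z_def)
  moreover have "\<Psi> (smul \<sigma>' w) = scale (inc (\<sigma>' \<otimes>\<^bsub>R\<^esub> \<sigma>)) z"
    using Psi_smul_scale[OF S(2) w(2)] scale_scale[OF inc_closed[OF S(2)] inc_closed[OF S(1)] zc] w(3)
    by (simp add: inc_mult S)
  ultimately show ?thesis using that[OF L.S_mult[OF s'(1) w(1)]] by blast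
qed

lemma smul_Z: "c \<in> carrier R \<Longrightarrow> w \<in> F.Z n \<Longrightarrow> smul c w \<in> F.Z n"
  using keys_smul[of c w n] dB_smul[of c w n] by (auto simp: F.Z_def smul_def frag_extend_eq_0)

text \<open>A denominator is a power of s, and each factor s changes a cycle only by a
  boundary.\<close>

lemma smul_S_homologous:
  assumes "\<And>z. z \<in> F.Z n \<Longrightarrow> smul s z - z \<in> F.Bd n" and "\<sigma> \<in> L.S" "w \<in> F.Z n"
  shows "smul \<sigma> w - w \<in> F.Bd n"
  using assms(2)
proof (induction rule: mult_closure.induct)
  case one
  have "smul \<one>\<^bsub>R\<^esub> w = w" by (rule smul_one[of w n]) (use assms in \<open>simp add: F.Z_def\<close>)
  then show ?case using F.Bd_0 by simp
next
  case (mult s' u)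
  have s': "s' = s" and u: "u \<in> carrier R" using mult L.S_carrier by auto
  have "smul (s \<otimes>\<^bsub>R\<^esub> u) w = smul s (smul u w)"
    by (rule smul_mult[OF s_carrier u, of w n]) (use assms in \<open>simp add: F.Z_def\<close>)
  moreover have "smul s (smul u w) - smul u w \<in> F.Bd n"
    by (rule assms(1)[OF smul_Z[OF u assms(3)]])
  ultimately show ?case using F.Bd_add[of "smul s (smul u w) - smul u w" n "smul u w - w"] mult.IH s' by simp
qed

end

section \<open>Comparison of the three complexes\<close>

text \<open>A section of \<delta> shows that H acts transitively on U through \<delta>, with the
  kernel as the stabiliser of the unit. So Z[U] is induced from the trivial module of the kernel,
  the situation of Shapiro's lemma.\<close>

locale det_shapiro = det_group +
  fixes sect :: "'c \<Rightarrow> 'a"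
  assumes sect_closed: "x \<in> carrier U \<Longrightarrow> sect x \<in> carrier H"
    and det_sect: "x \<in> carrier U \<Longrightarrow> \<delta> (sect x) = x" and sect_one: "sect \<one>\<^bsub>U\<^esub> = \<one>"
    and s_homologous: "z \<in> F.Z n \<Longrightarrow> smul s z - z \<in> F.Bd n"
begin

abbreviation "Ker \<equiv> kernel H U \<delta>"
abbreviation "HK \<equiv> H\<lparr>carrier := Ker\<rparr>"

lemma Ker_subgroup: "subgroup Ker H"
  using group_hom.subgroup_kernel[of H U \<delta>] det_hom U.is_group is_group
  by (simp add: group_hom_def group_hom_axioms_def)

sublocale Sh: shapiro H "carrier U" uact Ker "\<one>\<^bsub>U\<^esub>" sect
  by (intro shapiro.intro shapiro_axioms.intro F.gset_axioms Ker_subgroup)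
    (simp_all add: uact_def kernel_def sect_closed det_sect sect_one det_closed)

definition i2L :: "int \<Rightarrow> (('c \<Rightarrow>\<^sub>0 int) \<times> ('c \<Rightarrow>\<^sub>0 int)) set" where
  "i2L k = [k] \<cdot>\<^bsub>Lam\<^esub> \<one>\<^bsub>Lam\<^esub>"

lemma bar_module_int: "bar_module HK \<Z> (\<lambda>a _. a)"
proof -
  have "group HK" by (rule subgroup_imp_group[OF Ker_subgroup])
  moreover have "abelian_group \<Z>" by (rule int.abelian_group_axioms)
  ultimately show ?thesis by (simp add: bar_module_def bar_module_axioms_def)
qed

sublocale BK: bar_module "H\<lparr>carrier := kernel H U \<delta>\<rparr>" "\<Z>" "\<lambda>a _. a"
  by (rule bar_module_int)

lemma i2L_one: "i2L 1 = \<one>\<^bsub>Lam\<^esub>"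
  using Lam.add.int_pow_1[of "\<one>\<^bsub>Lam\<^esub>"] by (simp add: i2L_def)

lemma i2L_closed: "i2L k \<in> carrier Lam"
  unfolding i2L_def by (rule Lam.add.int_pow_closed) simp

sublocale Mp: bar_module_map "H\<lparr>carrier := kernel H U \<delta>\<rparr>" "\<Z>" "\<lambda>a _. a" H
    "localization (group_ring U) {s}" lact i2L "\<lambda>T. T"
proof unfold_locales
  fix a b :: int
  show "i2L a \<in> carrier Lam" by (rule i2L_closed)
  show "i2L (a \<oplus>\<^bsub>\<Z>\<^esub> b) = i2L a \<oplus>\<^bsub>Lam\<^esub> i2L b"
    unfolding i2L_def using Lam.add.int_pow_mult[of "\<one>\<^bsub>Lam\<^esub>" a b] by simp
next
  show "(\<lambda>T. T) \<in> hom HK H" by (auto simp: hom_def kernel_def)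
next
  fix a g assume "g \<in> carrier HK"
  then have "lact (i2L a) g = i2L a \<otimes>\<^bsub>Lam\<^esub> \<beta> \<one>\<^bsub>U\<^esub>" by (simp add: lact_beta kernel_def)
  then show "i2L a = lact (i2L a) g" using i2L_closed by (simp add: beta_one)
qed

text \<open>Shapiro's lemma speaks of bars over a point, the theorem of chains with coefficients in
  the ring of integers. The point becomes the coefficient 1; \<open>Theta_One\<close> and
  \<open>int_chain_surj\<close> identify the two complexes.\<close>

definition One :: "(unit \<times> 'a list \<Rightarrow>\<^sub>0 int) \<Rightarrow> (int \<times> 'a list \<Rightarrow>\<^sub>0 int)" where
  "One w = frag_extend (\<lambda>b. frag_of (1, snd b)) w"

lemma Theta_One: "BK.\<Theta> (One w) l = Poly_Mapping.lookup w ((), l)"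
proof (rule frag_additive_eq[of w UNIV])
  fix a b :: "unit \<times> 'a list \<Rightarrow>\<^sub>0 int"
  show "BK.\<Theta> (One (a - b)) l = BK.\<Theta> (One a) l - BK.\<Theta> (One b) l"
    using BK.Theta_add[of "One (a - b)" "One b"] by (simp add: One_def frag_extend_diff)
next
  fix b :: "unit \<times> 'a list"
  show "BK.\<Theta> (One (frag_of b)) l = Poly_Mapping.lookup (frag_of b) ((), l)"
    using BK.Theta_of[of 1 "snd b"] by (cases b) (simp add: single_chain_def One_def)
qed (auto simp: lookup_minus)

lemma gset_int: "gset HK (UNIV :: int set) (\<lambda>a _. a)"
  by (simp add: gset_def gset_axioms_def subgroup_imp_group[OF Ker_subgroup])

lemma keys_One:
  "Poly_Mapping.keys w \<subseteq> Sh.K.bars n \<Longrightarrow> Poly_Mapping.keys (One w) \<subseteq> gset.bars HK UNIV n"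
  unfolding One_def
  by (erule keys_frag_extend_subset) (auto simp: Sh.K.bars_def gset.bars_def[OF gset_int])

lemma int_chain_surj:
  assumes "c \<in> carrier (bar_chains HK \<Z> n)"
  obtains w where "Poly_Mapping.keys w \<subseteq> Sh.K.bars n" "BK.\<Theta> (One w) = c"
proof -
  define w where "w = Abs_poly_mapping (\<lambda>b::unit \<times> 'a list. c (snd b))"
  have "finite {l. c l \<noteq> 0}" using assms by (simp add: bar_chains_def)
  moreover have "{b::unit \<times> 'a list. c (snd b) \<noteq> 0} = Pair () ` {l. c l \<noteq> 0}" by auto
  ultimately have lw: "Poly_Mapping.lookup w b = c (snd b)" for b
    by (simp add: w_def Abs_poly_mapping_inverse)
  have "Poly_Mapping.keys w \<subseteq> Sh.K.bars n"
    using assms by (auto simp: in_keys_iff lw Sh.K.bars_def bar_chains_def)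
  moreover have "BK.\<Theta> (One w) = c" by (auto simp: Theta_One lw)
  ultimately show ?thesis by (rule that)
qed

lemma One_dB:
  assumes "Poly_Mapping.keys w \<subseteq> Sh.K.bars (Suc n)"
  shows "BK.\<Theta> (One (Sh.K.dB w)) = bar_d HK \<Z> (\<lambda>a _. a) n (BK.\<Theta> (One w))"
proof -
  have id: "(\<lambda>g. g) \<in> hom HK HK" by (rule homI) (auto simp: subgroup.m_closed[OF Ker_subgroup])
  have m: "map_prod (\<lambda>_::unit. 1::int) (map (\<lambda>g. g)) b = (1, snd b)" for b :: "unit \<times> 'a list"
    by (cases b) simp
  have "One (Sh.K.dB w) = BK.dB (One w)"
    unfolding One_def
    by (rule bar_map_dB[where \<alpha> = "\<lambda>_::unit. 1::int" and \<beta> = "\<lambda>g. g", OF Sh.gset_K gset_int id _ assms, unfolded m]) simp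
  then show ?thesis by (simp only: BK.Theta_dB[OF keys_One[OF assms]])
qed

lemma tensor_map_One:
  assumes "Poly_Mapping.keys w \<subseteq> Sh.K.bars n"
  shows "tensor_map \<Z> Lam i2L (\<lambda>T. T) (BK.\<Theta> (One w)) = \<Psi> (Sh.Incl w)"
proof -
  have "Mp.Map (One w) = Beta (Sh.Incl w)"
    by (simp add: One_def frag_extend_extend Sh.incl_def i2L_one beta_one)
  then show ?thesis unfolding Mp.tensor_map_Theta[OF keys_One[OF assms]] \<Psi>_def by (simp only:)
qed

lemma One_eq_zero:
  assumes "\<And>l. BK.\<Theta> (One w) l = 0"
  shows "w = 0"
  by (rule poly_mapping_eqI) (use assms in \<open>auto simp: Theta_One\<close>)

lemma int_cycle:
  assumes "c \<in> cycles (derived_tensor_Z \<Z> (\<lambda>a _. a) HK) n"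
  obtains w where "w \<in> Sh.K.Z n" "BK.\<Theta> (One w) = c"
proof -
  have "c \<in> carrier (bar_chains HK \<Z> n)"
    using assms subgroup.subset[OF subgroup_cycles[OF BK.chain_complex_bar, of n]]
    by (auto simp: derived_tensor_Z_def)
  then obtain w where w: "Poly_Mapping.keys w \<subseteq> Sh.K.bars n" "BK.\<Theta> (One w) = c" by (rule int_chain_surj)
  have "Sh.K.dB w = 0"
  proof (cases n)
    case 0
    show ?thesis
      by (rule frag_extend_eq_0) (use w(1) 0 in \<open>auto simp: Sh.K.bars_def Sh.K.dgen_def\<close>)
  next
    case (Suc k)
    then have "bar_d HK \<Z> (\<lambda>a _. a) k c = \<one>\<^bsub>bar_chains HK \<Z> k\<^esub>"
      using assms by (simp add: cycles_def kernel_def derived_tensor_Z_def)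
    then have "BK.\<Theta> (One (Sh.K.dB w)) l = 0" for l
      using w Suc by (simp only: One_dB) (simp add: bar_chains_def)
    then show ?thesis by (rule One_eq_zero)
  qed
  then show ?thesis using w that by (auto simp: Sh.K.Z_def)
qed

text \<open>Denominators act as the identity on homology over Z[U]. So if a multiple of a class by a
  denominator bounds, the class itself does, and a class divided by a denominator has a
  representative without one. The rest is Shapiro's lemma.\<close>

theorem kernel_homology_iso:
  "homology_iso (derived_tensor_Z \<Z> (\<lambda>a _. a) HK) Cpx (tensor_map \<Z> Lam i2L (\<lambda>T. T)) n"
proof (rule homology_isoI[OF Mp.chain_map_bar])
  let ?f = "tensor_map \<Z> Lam i2L (\<lambda>T. T)"
  fix c assume c: "c \<in> cycles (derived_tensor_Z \<Z> (\<lambda>a _. a) HK) n" and fc: "?f c \<in> boundaries Cpx n"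
  obtain u where u: "u \<in> Sh.K.Z n" "BK.\<Theta> (One u) = c" using c by (rule int_cycle)
  have ku: "Poly_Mapping.keys u \<subseteq> Sh.K.bars n" using u(1) by (simp add: Sh.K.Z_def)
  have kI: "Poly_Mapping.keys (Sh.Incl u) \<subseteq> F.bars n" by (rule Sh.keys_Incl[OF ku])
  have IZ: "Sh.Incl u \<in> F.Z n"
    using kI Sh.dB_Incl[OF ku] u(1) by (simp add: F.Z_def Sh.K.Z_def)
  obtain e where e: "e \<in> carrier (bar_chains H Lam (Suc n))" "\<Psi> (Sh.Incl u) = bar_d H Lam lact n e"
    using fc tensor_map_One[OF ku] u(2) by (auto simp: boundaries_def derived_tensor_Z_def)
  obtain \<sigma> v where v: "\<sigma> \<in> L.S" "Poly_Mapping.keys v \<subseteq> F.bars (Suc n)" "\<Psi> v = scale (inc \<sigma>) e"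
    using clear_denominators[OF e(1)] .
  note S = L.S_carrier[OF v(1)]
  have k1: "Poly_Mapping.keys (smul \<sigma> (Sh.Incl u)) \<subseteq> F.bars n" by (rule keys_smul[OF S kI])
  have kd: "Poly_Mapping.keys (smul \<sigma> (Sh.Incl u) - F.dB v) \<subseteq> F.bars n"
    by (rule keys_diff_subset[OF k1 F.keys_dB[OF v(2)]])
  have eq: "\<Psi> (smul \<sigma> (Sh.Incl u)) = \<Psi> (F.dB v)"
    unfolding Psi_smul_scale[OF S kI] Psi_dB[OF v(2)] v(3) e(2) scale_bar_d[OF inc_closed[OF S] e(1)] ..
  have "\<Psi> (smul \<sigma> (Sh.Incl u) - F.dB v) y = \<zero>\<^bsub>Lam\<^esub>" for y
  proof -
    have "\<Psi> (smul \<sigma> (Sh.Incl u) - F.dB v) y \<oplus>\<^bsub>Lam\<^esub> \<Psi> (F.dB v) y = \<Psi> (F.dB v) y"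
      using B.Theta_add[of "Beta (smul \<sigma> (Sh.Incl u) - F.dB v)" "Beta (F.dB v)"] eq
      by (simp add: \<Psi>_def frag_extend_diff fun_eq_iff)
    then show ?thesis
      using Psi_closed[OF kd] Psi_closed[OF F.keys_dB[OF v(2)]] Lam.add.r_cancel_one
      by (simp add: bar_chains_def)
  qed
  \<comment> \<open>An equality over the localization holds over Z[U] after one more
    denominator.\<close>
  then obtain \<sigma>' where s': "\<sigma>' \<in> L.S" "smul \<sigma>' (smul \<sigma> (Sh.Incl u) - F.dB v) = 0"
    using Psi_eq_zero[OF kd] by blast
  note S' = L.S_carrier[OF s'(1)]
  have "smul (\<sigma>' \<otimes>\<^bsub>R\<^esub> \<sigma>) (Sh.Incl u) = F.dB (smul \<sigma>' v)"
    using s'(2) smul_mult[OF S' S kI] dB_smul[OF S' v(2)] by (simp add: smul_diff)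
  then have b1: "smul (\<sigma>' \<otimes>\<^bsub>R\<^esub> \<sigma>) (Sh.Incl u) \<in> F.Bd n"
    using keys_smul[OF S' v(2)] by (auto simp: F.Bd_def)
  \<comment> \<open>The included cycle is homologous to this multiple of itself, which has just been
    seen to bound.\<close>
  have "smul (\<sigma>' \<otimes>\<^bsub>R\<^esub> \<sigma>) (Sh.Incl u) - Sh.Incl u \<in> F.Bd n"
    by (rule smul_S_homologous[OF s_homologous L.S_mult[OF s'(1) v(1)] IZ])
  from F.Bd_diff[OF b1 this] have "Sh.Incl u \<in> F.Bd n" by simp
  then have "u \<in> Sh.K.Bd n" by (rule Sh.shapiro_inj[OF ku])
  then obtain b where b: "Poly_Mapping.keys b \<subseteq> Sh.K.bars (Suc n)" "u = Sh.K.dB b" by (auto simp: Sh.K.Bd_def)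
  have "c = bar_d HK \<Z> (\<lambda>a _. a) n (BK.\<Theta> (One b))" using u(2) b(2) One_dB[OF b(1)] by simp
  then show "c \<in> boundaries (derived_tensor_Z \<Z> (\<lambda>a _. a) HK) n"
    using BK.Theta_closed[OF keys_One[OF b(1)]] by (simp add: boundaries_def derived_tensor_Z_def)
next
  let ?f = "tensor_map \<Z> Lam i2L (\<lambda>T. T)"
  fix z assume z: "z \<in> cycles Cpx n"
  have zc: "z \<in> carrier (bar_chains H Lam n)"
    using z subgroup.subset[OF subgroup_cycles[OF B.chain_complex_bar, of n]] by (auto simp: derived_tensor_Z_def)
  obtain \<sigma> w where w: "\<sigma> \<in> L.S" "w \<in> F.Z n" "\<Psi> w = scale (inc \<sigma>) z" using z by (rule cycle_clear_denominators)
  note S = L.S_carrier[OF w(1)] and U = unscale_closed[OF w(1)]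
  have kw: "Poly_Mapping.keys w \<subseteq> F.bars n" using w(2) by (simp add: F.Z_def)
  obtain u where u: "u \<in> Sh.K.Z n" "Sh.Incl u - w \<in> F.Bd n" using Sh.shapiro_surj[OF w(2)] .
  have ku: "Poly_Mapping.keys u \<subseteq> Sh.K.bars n" using u(1) by (simp add: Sh.K.Z_def)
  have kI: "Poly_Mapping.keys (Sh.Incl u) \<subseteq> F.bars n" by (rule Sh.keys_Incl[OF ku])
  have IZ: "Sh.Incl u \<in> F.Z n"
    using kI Sh.dB_Incl[OF ku] u(1) by (simp add: F.Z_def Sh.K.Z_def)
  have "smul \<sigma> (Sh.Incl u) - Sh.Incl u \<in> F.Bd n"
    by (rule smul_S_homologous[OF s_homologous w(1) IZ])
  \<comment> \<open>w is homologous to the included cycle and so to its multiple by \<sigma>;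
    dividing by \<sigma> makes z homologous to the image of the included cycle.\<close>
  from F.Bd_add[OF this u(2)] have b: "w - smul \<sigma> (Sh.Incl u) \<in> F.Bd n"
    using F.Bd_uminus by fastforce
  let ?b = "scale (unscale \<sigma>) (\<Psi> (w - smul \<sigma> (Sh.Incl u)))"
  have kb: "Poly_Mapping.keys (w - smul \<sigma> (Sh.Incl u)) \<subseteq> F.bars n"
    by (rule keys_diff_subset[OF kw keys_smul[OF S kI]])
  have "\<Psi> w = \<Psi> (w - smul \<sigma> (Sh.Incl u)) \<otimes>\<^bsub>bar_chains H Lam n\<^esub> \<Psi> (smul \<sigma> (Sh.Incl u))"
    using Psi_add[of "w - smul \<sigma> (Sh.Incl u)" "smul \<sigma> (Sh.Incl u)"] by simp
  then have "scale (unscale \<sigma>) (\<Psi> w) = ?b \<otimes>\<^bsub>bar_chains H Lam n\<^esub> scale (unscale \<sigma>) (\<Psi> (smul \<sigma> (Sh.Incl u)))"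
    using hom_mult[OF scale_hom[OF U] Psi_closed[OF kb] Psi_closed[OF keys_smul[OF S kI]]] by simp
  then have "z = ?b \<otimes>\<^bsub>bar_chains H Lam n\<^esub> \<Psi> (Sh.Incl u)"
    unfolding w(3) scale_unscale[OF w(1) zc] Psi_smul_scale[OF S kI] scale_unscale[OF w(1) Psi_closed[OF kI]] .
  moreover have "?b \<in> boundaries Cpx n" by (rule scale_boundaries[OF U Psi_boundary[OF b]])
  moreover have "?f (BK.\<Theta> (One u)) = \<Psi> (Sh.Incl u)" by (rule tensor_map_One[OF ku])
  moreover have "BK.\<Theta> (One u) \<in> cycles (derived_tensor_Z \<Z> (\<lambda>a _. a) HK) n"
  proof (cases n)
    case 0
    then show ?thesis
      using BK.Theta_closed[OF keys_One[OF ku]] by (simp add: cycles_def derived_tensor_Z_def)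
  next
    case (Suc k)
    then have "bar_d HK \<Z> (\<lambda>a _. a) k (BK.\<Theta> (One u)) = BK.\<Theta> (One 0)"
      using One_dB[of u k] ku u(1) by (simp add: Sh.K.Z_def)
    also have "\<dots> = \<one>\<^bsub>bar_chains HK \<Z> k\<^esub>" by (simp add: bar_chains_def Theta_One fun_eq_iff del: frag_extend_0)
    finally show ?thesis
      using BK.Theta_closed[OF keys_One[OF ku]] Suc by (simp add: cycles_def kernel_def derived_tensor_Z_def)
  qed
  ultimately show "\<exists>u\<in>cycles (derived_tensor_Z \<Z> (\<lambda>a _. a) HK) n. \<exists>b\<in>boundaries Cpx n.
      z = b \<otimes>\<^bsub>fst Cpx n\<^esub> ?f u"
    by (intro bexI[of _ "BK.\<Theta> (One u)"] bexI[of _ ?b]) (simp_all only: derived_tensor_Z_def fst_conv)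
qed

end

text \<open>Both groups share U and s and hence the coefficient ring, so that \<iota> and \<rho> are
  accompanied by the identity on coefficients.\<close>

locale det_retract = G: det_group G U \<delta> s + E: det_group E U \<delta>' s
  for G :: "('g, 'x) monoid_scheme" and U :: "('u, 'y) monoid_scheme" and \<delta> and s
    and E :: "('e, 'z) monoid_scheme" and \<delta>' +
  fixes \<iota> :: "'g \<Rightarrow> 'e" and \<rho> :: "'e \<Rightarrow> 'g"
  assumes iota_hom: "\<iota> \<in> hom G E" and rho_hom: "\<rho> \<in> hom E G"
    and rho_iota: "g \<in> carrier G \<Longrightarrow> \<rho> (\<iota> g) = g"
    and det_iota: "g \<in> carrier G \<Longrightarrow> \<delta>' (\<iota> g) = \<delta> g"
    and det_rho: "e \<in> carrier E \<Longrightarrow> \<delta> (\<rho> e) = \<delta>' e"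
begin

sublocale I: bar_module_map G "localization (group_ring U) {s}" G.lact E "localization (group_ring U) {s}"
    E.lact "\<lambda>x. x" \<iota>
  by unfold_locales (auto simp: iota_hom G.lact_beta E.lact_beta det_iota G.\<beta>_def E.\<beta>_def)

sublocale P: bar_module_map E "localization (group_ring U) {s}" E.lact G "localization (group_ring U) {s}"
    G.lact "\<lambda>x. x" \<rho>
  by unfold_locales (auto simp: rho_hom G.lact_beta E.lact_beta det_rho G.\<beta>_def E.\<beta>_def)

abbreviation "Inj \<equiv> frag_extend (\<lambda>b. frag_of (map_prod (\<lambda>x. x) (map \<iota>) b))"
abbreviation "Prj \<equiv> frag_extend (\<lambda>b. frag_of (map_prod (\<lambda>x. x) (map \<rho>) b))"

lemma dB_Prj: "Poly_Mapping.keys w \<subseteq> E.F.bars n \<Longrightarrow> Prj (E.F.dB w) = G.F.dB (Prj w)"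
  by (rule bar_map_dB[where \<alpha> = "\<lambda>x. x" and \<beta> = \<rho>, OF E.F.gset_axioms G.F.gset_axioms rho_hom])
    (auto simp: E.uact_def G.uact_def det_rho)

lemma keys_Prj: "Poly_Mapping.keys w \<subseteq> E.F.bars n \<Longrightarrow> Poly_Mapping.keys (Prj w) \<subseteq> G.F.bars n"
  by (erule keys_frag_extend_subset) (use hom_in_carrier[OF rho_hom] in \<open>auto simp: E.F.bars_def G.F.bars_def subset_iff\<close>)

lemma keys_Inj: "Poly_Mapping.keys w \<subseteq> G.F.bars n \<Longrightarrow> Poly_Mapping.keys (Inj w) \<subseteq> E.F.bars n"
  by (erule keys_frag_extend_subset) (use hom_in_carrier[OF iota_hom] in \<open>auto simp: E.F.bars_def G.F.bars_def subset_iff\<close>)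

lemma tensor_map_Psi:
  assumes "Poly_Mapping.keys w \<subseteq> G.F.bars n"
  shows "tensor_map G.Lam G.Lam (\<lambda>x. x) \<iota> (G.\<Psi> w) = E.\<Psi> (Inj w)"
proof -
  have "I.Map (G.Beta w) = E.Beta (Inj w)"
    by (simp add: frag_extend_extend G.\<beta>_def[abs_def] E.\<beta>_def[abs_def] map_prod.compositionality comp_def)
  then show ?thesis
    unfolding G.\<Psi>_def E.\<Psi>_def I.tensor_map_Theta[OF G.keys_Beta[OF assms]] by simp
qed

text \<open>Injectivity: \<rho> after \<iota> is the identity already on chains. Surjectivity: by
  \<open>s_proj\<close> multiplication by s agrees on homology with \<iota> after \<rho>, and s is
  invertible in the localization, so that a class is the image of its projection divided by
  s.\<close>

theorem retract_homology_iso: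
  assumes s_proj: "\<And>w. w \<in> E.F.Z n \<Longrightarrow> E.smul s w - Inj (Prj w) \<in> E.F.Bd n"
  shows "homology_iso G.Cpx E.Cpx (tensor_map G.Lam G.Lam (\<lambda>x. x) \<iota>) n"
proof (rule homology_isoI[OF I.chain_map_bar])
  let ?f = "tensor_map G.Lam G.Lam (\<lambda>x. x) \<iota>" and ?g = "tensor_map G.Lam G.Lam (\<lambda>x. x) \<rho>"
  fix z assume z: "z \<in> cycles G.Cpx n" and fz: "?f z \<in> boundaries E.Cpx n"
  have "z \<in> carrier (bar_chains G G.Lam n)"
    using z subgroup.subset[OF subgroup_cycles[OF G.B.chain_complex_bar, of n]] by (auto simp: derived_tensor_Z_def)
  then obtain w where w: "Poly_Mapping.keys w \<subseteq> G.B.bars n" "G.B.\<Theta> w = z" by (rule G.B.Theta_surj)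
  have "P.Map (I.Map w) = w"
  proof -
    have "map_prod (\<lambda>x. x) (map \<rho>) (map_prod (\<lambda>x. x) (map \<iota>) b) = b" if "b \<in> G.B.bars n" for b
      using that by (auto simp: G.B.bars_def rho_iota subset_iff intro!: map_idI)
    then have "P.Map (I.Map w) = frag_extend frag_of w"
      unfolding frag_extend_extend frag_extend_of by (intro frag_extend_eq) (use w(1) in auto)
    then show ?thesis by (simp add: frag_expansion[symmetric])
  qed
  then have "?g (?f z) = z"
    using I.tensor_map_Theta[OF w(1)] P.tensor_map_Theta[OF I.keys_Map[OF w(1)]] w(2) by simp
  then show "z \<in> boundaries G.Cpx n"
    using chain_map_boundaries[OF P.chain_map_bar fz] by simp
next
  let ?f = "tensor_map G.Lam G.Lam (\<lambda>x. x) \<iota>"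
  fix z assume z: "z \<in> cycles E.Cpx n"
  have zc: "z \<in> carrier (bar_chains E G.Lam n)"
    using z subgroup.subset[OF subgroup_cycles[OF E.B.chain_complex_bar, of n]] by (auto simp: derived_tensor_Z_def)
  obtain \<sigma> w where w: "\<sigma> \<in> G.L.S" "w \<in> E.F.Z n" "E.\<Psi> w = E.scale (E.inc \<sigma>) z"
    using z by (rule E.cycle_clear_denominators)
  have kw: "Poly_Mapping.keys w \<subseteq> E.F.bars n" using w(2) by (simp add: E.F.Z_def)
  \<comment> \<open>One division by \<tau> undoes both the clearing of denominators by \<sigma> and
    the factor s of \<open>s_proj\<close>.\<close>
  define \<tau> where "\<tau> = s \<otimes>\<^bsub>E.R\<^esub> \<sigma>"
  have sS: "s \<in> G.L.S" by (rule G.L.Sigma_S) simp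
  have \<tau>: "\<tau> \<in> G.L.S" unfolding \<tau>_def by (rule G.L.S_mult[OF sS w(1)])
  note S = G.L.S_carrier[OF w(1)] and Us = E.unscale_closed[OF \<tau>]
  have PZ: "Prj w \<in> G.F.Z n"
    using keys_Prj[OF kw] dB_Prj[OF kw] w(2) by (simp add: G.F.Z_def E.F.Z_def)
  have kP: "Poly_Mapping.keys (Prj w) \<subseteq> G.F.bars n" by (rule keys_Prj[OF kw])
  let ?d = "E.smul s w - Inj (Prj w)"
  have kd: "Poly_Mapping.keys ?d \<subseteq> E.F.bars n"
    by (rule keys_diff_subset[OF E.keys_smul[OF E.s_carrier kw] keys_Inj[OF kP]])
  have "E.scale (E.inc \<tau>) z = E.\<Psi> (E.smul s w)"
    unfolding E.Psi_smul_scale[OF E.s_carrier kw] w(3) \<tau>_def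
    by (simp add: E.inc_mult[OF E.s_carrier S] E.scale_scale[OF E.inc_closed[OF E.s_carrier] E.inc_closed[OF S] zc])
  also have "\<dots> = E.\<Psi> ?d \<otimes>\<^bsub>bar_chains E G.Lam n\<^esub> E.\<Psi> (Inj (Prj w))"
    using E.Psi_add[of ?d "Inj (Prj w)"] by simp
  finally have "E.scale (E.unscale \<tau>) (E.scale (E.inc \<tau>) z)
      = E.scale (E.unscale \<tau>) (E.\<Psi> ?d) \<otimes>\<^bsub>bar_chains E G.Lam n\<^esub> E.scale (E.unscale \<tau>) (E.\<Psi> (Inj (Prj w)))"
    using hom_mult[OF E.scale_hom[OF Us] E.Psi_closed[OF kd] E.Psi_closed[OF keys_Inj[OF kP]]] by simp
  then have zeq: "z = E.scale (E.unscale \<tau>) (E.\<Psi> ?d) \<otimes>\<^bsub>bar_chains E G.Lam n\<^esub>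
      E.scale (E.unscale \<tau>) (E.\<Psi> (Inj (Prj w)))"
    unfolding E.scale_unscale[OF \<tau> zc] .
  have "E.scale (E.unscale \<tau>) (E.\<Psi> ?d) \<in> boundaries E.Cpx n"
    by (rule E.scale_boundaries[OF Us E.Psi_boundary[OF s_proj[OF w(2)]]])
  \<comment> \<open>Division by \<tau> commutes with the map induced by \<iota>, coefficient by
    coefficient; this moves it to the preimage.\<close>
  moreover have "E.scale (E.unscale \<tau>) (E.\<Psi> (Inj (Prj w))) = ?f (G.scale (E.unscale \<tau>) (G.\<Psi> (Prj w)))"
  proof
    fix y
    interpret p: push G.Lam G.Lam "\<lambda>_ x. x" "{l. length l = n \<and> set l \<subseteq> carrier G}" by (rule I.push_map)
    have pc: "G.\<Psi> (Prj w) \<in> carrier (bar_chains G G.Lam n)" by (rule G.Psi_closed[OF kP])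
    have c1: "\<And>x. G.\<Psi> (Prj w) x \<in> carrier G.Lam" "finite {x. G.\<Psi> (Prj w) x \<noteq> \<zero>\<^bsub>G.Lam\<^esub>}"
      "{x. G.\<Psi> (Prj w) x \<noteq> \<zero>\<^bsub>G.Lam\<^esub>} \<subseteq> {l. length l = n \<and> set l \<subseteq> carrier G}"
      using pc by (auto simp: bar_chains_def)
    let ?S = "{x. G.\<Psi> (Prj w) x \<noteq> \<zero>\<^bsub>G.Lam\<^esub>}" and ?a = "E.unscale \<tau>"
    have "?f (G.scale ?a (G.\<Psi> (Prj w))) y
      = (\<Oplus>\<^bsub>G.Lam\<^esub>x\<in>?S. if map \<iota> x = y then ?a \<otimes>\<^bsub>G.Lam\<^esub> G.\<Psi> (Prj w) x else \<zero>\<^bsub>G.Lam\<^esub>)"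
      unfolding tensor_map_def G.scale_def
      by (rule p.push_chain_superset) (use c1 Us in auto)
    also have "\<dots> = (\<Oplus>\<^bsub>G.Lam\<^esub>x\<in>?S. ?a \<otimes>\<^bsub>G.Lam\<^esub> (if map \<iota> x = y then G.\<Psi> (Prj w) x else \<zero>\<^bsub>G.Lam\<^esub>))"
      by (rule G.Lam.add.finprod_cong') (use c1 Us in auto)
    also have "\<dots> = ?a \<otimes>\<^bsub>G.Lam\<^esub> (\<Oplus>\<^bsub>G.Lam\<^esub>x\<in>?S. if map \<iota> x = y then G.\<Psi> (Prj w) x else \<zero>\<^bsub>G.Lam\<^esub>)"
      by (rule G.Lam.finsum_rdistr[symmetric]) (use c1 Us in auto)
    also have "(\<Oplus>\<^bsub>G.Lam\<^esub>x\<in>?S. if map \<iota> x = y then G.\<Psi> (Prj w) x else \<zero>\<^bsub>G.Lam\<^esub>) = ?f (G.\<Psi> (Prj w)) y"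
      unfolding tensor_map_def by (rule p.push_chain_superset[symmetric]) (use c1 in auto)
    finally show "E.scale (E.unscale \<tau>) (E.\<Psi> (Inj (Prj w))) y = ?f (G.scale (E.unscale \<tau>) (G.\<Psi> (Prj w))) y"
      by (simp add: tensor_map_Psi[OF kP] E.scale_def)
  qed
  moreover have "G.scale (E.unscale \<tau>) (G.\<Psi> (Prj w)) \<in> cycles G.Cpx n"
    by (rule G.scale_cycles[OF Us G.Psi_cycle[OF PZ]])
  ultimately show "\<exists>u\<in>cycles G.Cpx n. \<exists>b\<in>boundaries E.Cpx n. z = b \<otimes>\<^bsub>fst E.Cpx n\<^esub> ?f u"
    using zeq by (auto simp: derived_tensor_Z_def)
qed

end

section \<open>Inner automorphisms and the action of Z[U]\<close>

context det_group
begin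

lemma smul_Bd:
  assumes "c \<in> carrier R" "w \<in> F.Bd n"
  shows "smul c w \<in> F.Bd n"
proof -
  obtain b where b: "Poly_Mapping.keys b \<subseteq> F.bars (Suc n)" "w = F.dB b" using assms(2) by (auto simp: F.Bd_def)
  show ?thesis
    unfolding F.Bd_def b(2) using dB_smul[OF assms(1) b(1)] keys_smul[OF assms(1) b(1)]
    by (intro image_eqI[of _ _ "smul c b"]) simp_all
qed

abbreviation inner :: "'h \<Rightarrow> ('u \<times> 'h list \<Rightarrow>\<^sub>0 int) \<Rightarrow> ('u \<times> 'h list \<Rightarrow>\<^sub>0 int)" where
  "inner h \<equiv> frag_extend (\<lambda>b. frag_of (map_prod (\<lambda>x. x) (map (\<lambda>g. inv h \<otimes> g \<otimes> h)) b))"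

text \<open>Conjugation of chains by h is the inner automorphism on the group part together with
  multiplication by \<open>\<delta> h\<close> on the coefficients, and it is homologous to the
  identity. So the inner automorphism alone acts as the inverse of \<open>\<delta> h\<close>, which
  explains the sign of the exponent in s_{m,-t}.\<close>

lemma inner_homologous:
  assumes h: "h \<in> carrier H" and z: "z \<in> F.Z n"
  shows "inner h z - smul (frag_of (inv\<^bsub>U\<^esub> \<delta> h)) z \<in> F.Bd n"
proof -
  have kz: "Poly_Mapping.keys z \<subseteq> F.bars n" using z by (simp add: F.Z_def)
  have ki: "Poly_Mapping.keys (inner h z) \<subseteq> F.bars n"
  proof (rule keys_frag_extend_subset[OF kz])
    fix b assume "b \<in> F.bars n"
    then show "Poly_Mapping.keys (frag_of (map_prod (\<lambda>x. x) (map (\<lambda>g. inv h \<otimes> g \<otimes> h)) b)) \<subseteq> F.bars n"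
      using h subsetD[of "set (snd b)" "carrier H"] by (cases b) (auto simp: F.bars_def)
  qed
  have d: "\<delta> h \<in> carrier U" by (rule det_closed[OF h])
  have R: "frag_of (\<delta> h) \<in> carrier R" "frag_of (inv\<^bsub>U\<^esub> \<delta> h) \<in> carrier R"
    using d by (auto intro: frag_of_R)
  have "frag_extend (\<lambda>b. frag_of (F.conj h b)) z = smul (frag_of (\<delta> h)) (inner h z)"
    unfolding smul_def frag_extend_of frag_extend_extend
  proof (rule frag_extend_eq)
    fix b assume "b \<in> Poly_Mapping.keys z"
    then have "fst b \<in> carrier U" using kz by (auto simp: F.bars_def)
    then show "frag_of (F.conj h b) = frag_of (map_prod (\<lambda>x. \<delta> h \<otimes>\<^bsub>U\<^esub> x) (map (\<lambda>g. g))
        (map_prod (\<lambda>x. x) (map (\<lambda>g. inv h \<otimes> g \<otimes> h)) b))"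
      using d by (cases b) (simp add: F.conj_def uact_def U.m_comm)
  qed
  then have "smul (frag_of (inv\<^bsub>U\<^esub> \<delta> h)) (smul (frag_of (\<delta> h)) (inner h z) - z) \<in> F.Bd n"
    using smul_Bd[OF R(2) F.conj_homologous[OF h z]] by simp
  moreover have "smul (frag_of (inv\<^bsub>U\<^esub> \<delta> h)) (smul (frag_of (\<delta> h)) (inner h z)) = inner h z"
  proof -
    have "frag_of (inv\<^bsub>U\<^esub> \<delta> h) \<otimes>\<^bsub>R\<^esub> frag_of (\<delta> h) = \<one>\<^bsub>R\<^esub>"
      using d by (simp add: group_ring_simps)
    then show ?thesis using smul_mult[OF R(2,1) ki] smul_one[OF ki] by simp
  qed
  ultimately show ?thesis by (simp add: smul_diff)
qed

end

section \<open>The matrix groups\<close>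

lemma Units_center_D:
  assumes "a \<in> Units center_ring"
  shows "\<forall>c. a * c = c * a" "\<exists>b. (\<forall>c. b * c = c * b) \<and> b * a = 1 \<and> a * b = 1"
proof -
  have "a \<in> carrier center_ring \<and> (\<exists>b \<in> carrier center_ring. b \<otimes>\<^bsub>center_ring\<^esub> a = \<one>\<^bsub>center_ring\<^esub> \<and> a \<otimes>\<^bsub>center_ring\<^esub> b = \<one>\<^bsub>center_ring\<^esub>)"
    using assms unfolding Units_def by (rule CollectD)
  then have "(\<forall>c. a * c = c * a) \<and> (\<exists>b. (\<forall>c. b * c = c * b) \<and> b * a = 1 \<and> a * b = 1)"
    unfolding center_ring_def Bex_def monoid.simps partial_object.simps mem_Collect_eq .
  then show "\<forall>c. a * c = c * a" "\<exists>b. (\<forall>c. b * c = c * b) \<and> b * a = 1 \<and> a * b = 1"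
    by (rule conjunct1, rule conjunct2)
qed

lemma Units_center_I:
  assumes "\<And>c. a * c = c * a" "\<And>c. b * c = c * b" "b * a = 1" "a * b = 1"
  shows "a \<in> Units center_ring"
proof -
  have "a \<in> carrier center_ring" unfolding center_ring_def partial_object.simps
    by (intro CollectI allI) (rule assms(1))
  moreover have "b \<in> carrier center_ring" unfolding center_ring_def partial_object.simps
    by (intro CollectI allI) (rule assms(2))
  moreover have "b \<otimes>\<^bsub>center_ring\<^esub> a = \<one>\<^bsub>center_ring\<^esub>" "a \<otimes>\<^bsub>center_ring\<^esub> b = \<one>\<^bsub>center_ring\<^esub>"
    unfolding center_ring_def monoid.simps by (rule assms(3), rule assms(4))
  ultimately show ?thesis unfolding Units_def by blast
qed

lemma center_central: "a \<in> Units center_ring \<Longrightarrow> a * c = c * a"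
  using Units_center_D(1) by (rule spec)

lemma Units_center_ring:
  assumes "(a :: 'a::{ring,monoid_mult}) \<in> Units center_ring"
  obtains b where "b \<in> Units center_ring" "a * b = 1" "b * a = 1"
proof -
  obtain b where b: "(\<forall>c. b * c = c * b) \<and> b * a = 1 \<and> a * b = 1"
    using Units_center_D(2)[OF assms] by (rule exE)
  have "b \<in> Units center_ring"
    by (rule Units_center_I[OF b[THEN conjunct1, THEN spec] center_central[OF assms]
        b[THEN conjunct2, THEN conjunct2] b[THEN conjunct2, THEN conjunct1]])
  then show ?thesis
    by (rule that[OF _ b[THEN conjunct2, THEN conjunct2] b[THEN conjunct2, THEN conjunct1]])
qed

lemma Units_center_mult:
  assumes "(a :: 'a::{ring,monoid_mult}) \<in> Units center_ring" "b \<in> Units center_ring"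
  shows "a * b \<in> Units center_ring"
proof -
  obtain a' where a': "a' \<in> Units center_ring" "a * a' = 1" "a' * a = 1" using assms(1) by (rule Units_center_ring)
  obtain b' where b': "b' \<in> Units center_ring" "b * b' = 1" "b' * b = 1" using assms(2) by (rule Units_center_ring)
  have "(a * b) * (b' * a') = a * (b * b') * a'" "(b' * a') * (a * b) = b' * (a' * a) * b"
    by (simp_all only: mult.assoc)
  then have "(a * b) * (b' * a') = 1" "(b' * a') * (a * b) = 1" using a' b' by simp_all
  note inv = this
  have cc: "(x * y) * c = c * (x * y)"
    if "x \<in> Units center_ring" "y \<in> Units center_ring" for x y c :: 'a
  proof -
    have "(x * y) * c = x * (y * c)" by (rule mult.assoc)
    also have "\<dots> = x * (c * y)" by (rule arg_cong[OF center_central[OF that(2)]])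
    also have "\<dots> = (x * c) * y" by (rule mult.assoc[symmetric])
    also have "\<dots> = (c * x) * y" by (rule arg_cong[OF center_central[OF that(1)]])
    also have "\<dots> = c * (x * y)" by (rule mult.assoc)
    finally show ?thesis .
  qed
  have "(a * b) * c = c * (a * b)" "(b' * a') * c = c * (b' * a')" for c
    by (rule cc[OF assms], rule cc[OF b'(1) a'(1)])
  then show ?thesis by (rule Units_center_I[OF _ _ inv(2,1)])
qed

lemma scal_Units:
  assumes "a \<in> Units center_ring"
  shows "scal n a \<in> carrier (GL n)"
proof -
  obtain b where "a * b = 1" "b * a = 1" using assms by (rule Units_center_ring)
  then show ?thesis by (rule scal_GL)
qed

lemma K1_unit_mult:
  fixes a b :: "'a::{ring,monoid_mult}"
  assumes "a \<in> Units center_ring" "b \<in> Units center_ring"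
  shows "K1_unit (a * b) = K1_unit a \<otimes>\<^bsub>K1\<^esub> K1_unit b"
proof -
  show ?thesis
    using K1_det_mult[OF scal_Units[OF assms(1)] scal_Units[OF assms(2)], of 1]
    unfolding K1_unit_scal scal_scal .
qed

lemma K1_unit_one: "K1_unit 1 = \<one>\<^bsub>K1\<^esub>"
  by (simp add: K1_unit_scal scal_one K1_det_one del: One_nat_def)

lemma K1_unit_closed: "a \<in> Units center_ring \<Longrightarrow> K1_unit a \<in> carrier K1"
  unfolding K1_unit_scal by (rule K1_det_closed[OF scal_Units])

lemma one_Units_center: "1 \<in> Units center_ring"
  by (rule Units_center_I[of _ 1]) simp_all

lemma A_bar_subgroup: "subgroup (K1_unit ` Units center_ring) (K1 :: 'a::{ring,monoid_mult} K1_elt monoid)"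
proof -
  interpret K: comm_group "K1 :: 'a K1_elt monoid" by (rule K1_comm_group)
  show ?thesis
  proof
    show "K1_unit ` Units center_ring \<subseteq> (carrier K1 :: 'a K1_elt set)"
      using K1_unit_closed by blast
    show "\<one>\<^bsub>K1\<^esub> \<in> K1_unit ` (Units center_ring :: 'a set)"
      using K1_unit_one one_Units_center by (intro image_eqI[of _ _ 1]) auto
  next
    fix x y :: "'a K1_elt" assume "x \<in> K1_unit ` Units center_ring" "y \<in> K1_unit ` Units center_ring"
    then obtain a b :: 'a where ab: "a \<in> Units center_ring" "b \<in> Units center_ring"
      "x = K1_unit a" "y = K1_unit b" by blast
    show "x \<otimes>\<^bsub>K1\<^esub> y \<in> K1_unit ` Units center_ring"
      unfolding ab(3,4) K1_unit_mult[OF ab(1,2), symmetric] using Units_center_mult[OF ab(1,2)] by (rule imageI)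
  next
    fix x :: "'a K1_elt" assume "x \<in> K1_unit ` Units center_ring"
    then obtain a :: 'a where a: "a \<in> Units center_ring" "x = K1_unit a" by blast
    obtain b where b: "b \<in> Units center_ring" "a * b = 1" "b * a = 1" using a(1) by (rule Units_center_ring)
    have "K1_unit b \<otimes>\<^bsub>K1\<^esub> K1_unit a = \<one>\<^bsub>K1\<^esub>"
      using K1_unit_mult[OF b(1) a(1)] unfolding b(3) K1_unit_one by (rule sym)
    then have "inv\<^bsub>K1\<^esub> x = K1_unit b"
      unfolding a(2) using K1_unit_closed a(1) b(1) by (intro K.inv_equality) auto
    then show "inv\<^bsub>K1\<^esub> x \<in> K1_unit ` Units center_ring" using b(1) by blast
  qed
qed

lemma A_bar_simps:
  "carrier A_bar = K1_unit ` Units center_ring" "x \<otimes>\<^bsub>A_bar\<^esub> y = x \<otimes>\<^bsub>K1\<^esub> y" "\<one>\<^bsub>A_bar\<^esub> = \<one>\<^bsub>K1\<^esub>"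
  by (simp_all add: A_bar_def)

lemma A_bar_comm_group: "comm_group (A_bar :: 'a::{ring,monoid_mult} K1_elt monoid)"
proof -
  interpret K: comm_group "K1 :: 'a K1_elt monoid" by (rule K1_comm_group)
  have "group (A_bar :: 'a K1_elt monoid)"
    unfolding A_bar_def by (rule K.subgroup_imp_group[OF A_bar_subgroup])
  then show ?thesis
  proof (rule group.group_comm_groupI)
    fix x y :: "'a K1_elt" assume "x \<in> carrier A_bar" "y \<in> carrier A_bar"
    then have "x \<in> carrier K1" "y \<in> carrier K1"
      using subgroup.subset[OF A_bar_subgroup] unfolding A_bar_simps by blast+
    then show "x \<otimes>\<^bsub>A_bar\<^esub> y = y \<otimes>\<^bsub>A_bar\<^esub> x" unfolding A_bar_simps by (rule K.m_comm)
  qed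
qed

lemma subgroup_det_preimage:
  fixes P :: "'a::{ring,monoid_mult} mat set"
  assumes "subgroup P (GL n)"
  shows "subgroup {T \<in> P. K1_det T \<in> carrier A_bar} (GL n)"
proof -
  interpret g: group_hom "GL n" "K1 :: 'a K1_elt monoid" K1_det
    by (simp add: group_hom_def group_hom_axioms_def GL_group comm_group.axioms(2)[OF K1_comm_group] K1_det_hom)
  have P: "T \<in> carrier (GL n)" if "T \<in> P" for T using that subgroup.subset[OF assms] by auto
  note A = A_bar_subgroup[where 'a = 'a]
  show ?thesis
    by (rule subgroup.intro)
      (auto simp: A_bar_simps(1) P g.hom_mult g.hom_inv subgroup.m_closed[OF assms] subgroup.m_inv_closed[OF assms]
        subgroup.one_closed[OF assms] subgroup.m_closed[OF A] subgroup.m_inv_closed[OF A] subgroup.one_closed[OF A]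
        simp del: image_iff)
qed

lemma G_subgroup: "subgroup {T \<in> carrier (GL q). K1_det T \<in> carrier A_bar} (GL q)"
  by (rule subgroup_det_preimage[OF group.subgroup_self[OF GL_group]])

lemma G_group: "group (G_grp q)"
  unfolding G_grp_def by (rule group.subgroup_imp_group[OF GL_group G_subgroup])

lemma G_simps: "T \<in> carrier (G_grp q) \<longleftrightarrow> T \<in> carrier (GL q) \<and> K1_det T \<in> carrier A_bar"
  "A \<otimes>\<^bsub>G_grp q\<^esub> B = A * B" "\<one>\<^bsub>G_grp q\<^esub> = 1\<^sub>m q"
  by (auto simp: G_grp_def GL_simps)

lemma det_hom_G: "K1_det \<in> hom (G_grp q) A_bar"
  by (rule homI) (auto simp: G_simps A_bar_simps(2) K1_det_mult)

text \<open>The trivial class lies in \<open>A_bar\<close>, so the kernel of det on GL_q is that of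
  its restriction to G_q; in this form \<open>det_shapiro\<close> applies.\<close>

lemma SG_kernel: "(SG_grp q :: 'a::{ring,monoid_mult} mat monoid) = (G_grp q)\<lparr>carrier := kernel (G_grp q) A_bar K1_det\<rparr>"
proof -
  have "\<one>\<^bsub>K1\<^esub> \<in> (carrier A_bar :: 'a K1_elt set)"
    using subgroup.one_closed[OF A_bar_subgroup] by (simp add: A_bar_simps)
  then have "kernel (GL q :: 'a mat monoid) K1 K1_det = kernel (G_grp q) A_bar K1_det"
    by (auto simp: kernel_def G_simps A_bar_simps(3))
  then show ?thesis unfolding SG_grp_def by (simp only:) (simp add: G_grp_def)
qed

lemma G_carrier_mat: "T \<in> carrier (G_grp q) \<Longrightarrow> T \<in> carrier_mat q q"
  by (simp add: G_simps GL_carrier_mat)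

lemma Aff_carrier:
  "carrier (Aff_grp p q) = {blocks q p T M (1\<^sub>m p) | T M. T \<in> carrier (G_grp q) \<and> M \<in> carrier_mat p q}"
  by (simp add: Aff_grp_def)

lemma Aff_I:
  "T \<in> carrier (G_grp q) \<Longrightarrow> M \<in> carrier_mat p q \<Longrightarrow> blocks q p T M (1\<^sub>m p) \<in> carrier (Aff_grp p q)"
  unfolding Aff_carrier by blast

lemma Aff_E:
  assumes "a \<in> carrier (Aff_grp p q)"
  obtains T M where "T \<in> carrier (G_grp q)" "M \<in> carrier_mat p q" "a = blocks q p T M (1\<^sub>m p)"
  using assms unfolding Aff_carrier by blast

lemma Aff_mult:
  fixes T :: "'a::{ring,monoid_mult} mat"
  assumes "T \<in> carrier_mat q q" "M \<in> carrier_mat p q" "T' \<in> carrier_mat q q" "M' \<in> carrier_mat p q"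
  shows "blocks q p T M (1\<^sub>m p) * blocks q p T' M' (1\<^sub>m p) = blocks q p (T * T') (M * T' + M') (1\<^sub>m p)"
  using assms by (subst blocks_mult) (simp_all add: one_mat_mult[of _ p p] one_mat_mult[of _ p q])

lemma Aff_subgroup: "subgroup (carrier (Aff_grp p q)) (GL (q + p) :: 'a::{ring,monoid_mult} mat monoid)"
proof -
  interpret GG: group "GL (q + p) :: 'a mat monoid" by (rule GL_group)
  interpret G: group "G_grp q :: 'a mat monoid" by (rule G_group)
  have sub: "carrier (Aff_grp p q) \<subseteq> (carrier (GL (q + p)) :: 'a mat set)"
  proof
    fix a :: "'a mat" assume "a \<in> carrier (Aff_grp p q)"
    then obtain T M where t: "T \<in> carrier (G_grp q)" "M \<in> carrier_mat p q" "a = blocks q p T M (1\<^sub>m p)"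
      by (rule Aff_E)
    show "a \<in> carrier (GL (q + p))"
      unfolding t(3) by (rule blocks_GL[OF _ one_GL t(2)]) (use t(1) in \<open>simp add: G_simps\<close>)
  qed
  show ?thesis
  proof (rule GG.subgroupI[OF sub])
    have "blocks q p (1\<^sub>m q) (0\<^sub>m p q) (1\<^sub>m p) \<in> (carrier (Aff_grp p q) :: 'a mat set)"
      using G.one_closed unfolding G_simps(3) by (intro Aff_I zero_carrier_mat)
    then show "(carrier (Aff_grp p q) :: 'a mat set) \<noteq> {}" by blast
  next
    fix a b :: "'a mat" assume "a \<in> carrier (Aff_grp p q)" "b \<in> carrier (Aff_grp p q)"
    then obtain T M T' M' where t: "T \<in> carrier (G_grp q)" "M \<in> carrier_mat p q" "a = blocks q p T M (1\<^sub>m p)"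
      "T' \<in> carrier (G_grp q)" "M' \<in> carrier_mat p q" "b = blocks q p T' M' (1\<^sub>m p)"
      by (metis Aff_E)
    have "a \<otimes>\<^bsub>GL (q + p)\<^esub> b = blocks q p (T * T') (M * T' + M') (1\<^sub>m p)"
      unfolding t(3,6) GL_simps by (rule Aff_mult) (use t G_carrier_mat in auto)
    moreover have "T * T' \<in> carrier (G_grp q)" using G.m_closed[OF t(1,4)] by (simp add: G_simps(2))
    moreover have "M * T' + M' \<in> carrier_mat p q" using t(2,5) G_carrier_mat[OF t(4)] by auto
    ultimately show "a \<otimes>\<^bsub>GL (q + p)\<^esub> b \<in> carrier (Aff_grp p q)" by (simp only: Aff_I)
  next
    fix a :: "'a mat" assume a: "a \<in> carrier (Aff_grp p q)"
    then obtain T M where t: "T \<in> carrier (G_grp q)" "M \<in> carrier_mat p q" "a = blocks q p T M (1\<^sub>m p)"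
      by (rule Aff_E)
    have c: "T \<in> carrier_mat q q" by (rule G_carrier_mat[OF t(1)])
    define T' where "T' = inv\<^bsub>G_grp q\<^esub> T"
    have T': "T' \<in> carrier (G_grp q)" "T' * T = 1\<^sub>m q"
      using G.inv_closed[OF t(1)] G.l_inv[OF t(1)] by (simp_all add: T'_def G_simps(2,3))
    have c': "T' \<in> carrier_mat q q" by (rule G_carrier_mat[OF T'(1)])
    \<comment> \<open>The inverse of the affine matrix with blocks T and M has the blocks T' = T^-1
      and - M T'.\<close>
    have M': "- (M * T') \<in> carrier_mat p q" using t(2) c' by auto
    have "- (M * T') * T = - (M * T' * T)"
      using t(2) c c' by (intro uminus_mult_left_mat) auto
    also have "M * T' * T = M" using t c c' T'(2) by (simp add: assoc_mult_mat[of _ p q _ q _ q] one_mat_mult[of _ p q])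
    finally have "- (M * T') * T + M = 0\<^sub>m p q" using t(2) by (auto intro!: eq_matI)
    then have "blocks q p T' (- (M * T')) (1\<^sub>m p) * a = 1\<^sub>m (q + p)"
      unfolding t(3) Aff_mult[OF c' M' c t(2)] T'(2) by simp
    moreover have m: "blocks q p T' (- (M * T')) (1\<^sub>m p) \<in> carrier (Aff_grp p q)"
      by (rule Aff_I[OF T'(1) M'])
    ultimately have "inv\<^bsub>GL (q + p)\<^esub> a = blocks q p T' (- (M * T')) (1\<^sub>m p)"
      by (intro GG.inv_equality subsetD[OF sub] a) (simp_all only: GL_simps)
    then show "inv\<^bsub>GL (q + p)\<^esub> a \<in> carrier (Aff_grp p q)" using m by simp
  qed
qed

lemma Aff_group: "group (Aff_grp p q)"
proof -
  have "Aff_grp p q = (GL (q + p))\<lparr>carrier := carrier (Aff_grp p q)\<rparr>" by (simp add: Aff_grp_def)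
  then show ?thesis using group.subgroup_imp_group[OF GL_group Aff_subgroup] by metis
qed

lemma Aff_simps: "A \<otimes>\<^bsub>Aff_grp p q\<^esub> B = A * B" "\<one>\<^bsub>Aff_grp p q\<^esub> = 1\<^sub>m (q + p)"
  by (auto simp: Aff_grp_def GL_simps)

lemma det_Aff:
  assumes "T \<in> carrier (G_grp q)" "M \<in> carrier_mat p q"
  shows "K1_det (blocks q p T M (1\<^sub>m p)) = K1_det T"
  by (rule K1_det_blocks[OF _ assms(2)]) (use assms(1) in \<open>simp add: G_simps\<close>)

lemma Aff_GL: "a \<in> carrier (Aff_grp p q) \<Longrightarrow> a \<in> carrier (GL (q + p))"
  using subgroup.subset[OF Aff_subgroup] by (rule subsetD)

lemma det_hom_Aff: "K1_det \<in> hom (Aff_grp p q) (A_bar :: 'a::{ring,monoid_mult} K1_elt monoid)"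
proof (rule homI)
  fix a :: "'a mat" assume "a \<in> carrier (Aff_grp p q)"
  then obtain T M where t: "T \<in> carrier (G_grp q)" "M \<in> carrier_mat p q" "a = blocks q p T M (1\<^sub>m p)"
    by (rule Aff_E)
  show "K1_det a \<in> carrier A_bar" unfolding t(3) det_Aff[OF t(1,2)] using t(1) by (simp only: G_simps)
next
  fix a b :: "'a mat" assume "a \<in> carrier (Aff_grp p q)" "b \<in> carrier (Aff_grp p q)"
  then show "K1_det (a \<otimes>\<^bsub>Aff_grp p q\<^esub> b) = K1_det a \<otimes>\<^bsub>A_bar\<^esub> K1_det b"
    unfolding Aff_simps A_bar_simps by (intro K1_det_mult[of _ "q + p"] Aff_GL)
qed

section \<open>The element s as a combination of inner automorphisms\<close>

context gset
begin

lemma Bd_cmul: "a \<in> Bd n \<Longrightarrow> frag_cmul k a \<in> Bd n"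
  by (rule frag_closure_minus_cmul[where P = "\<lambda>a. a \<in> Bd n", OF Bd_0 Bd_diff])

lemma Bd_sum: "(\<And>i. i \<in> I \<Longrightarrow> f i \<in> Bd n) \<Longrightarrow> (\<Sum>i\<in>I. f i) \<in> Bd n"
  by (induction I rule: infinite_finite_induct) (simp_all add: Bd_0 Bd_add)

end

lemma (in det_group) smul_neg_sum:
  assumes "finite N"
  shows "smul (- (\<Sum>J\<in>N. frag_cmul (k J) (frag_of (v J)))) z = - (\<Sum>J\<in>N. frag_cmul (k J) (smul (frag_of (v J)) z))"
  using assms by (simp add: smul_def frag_extend_minus frag_extend_sum frag_extend_cmul comp_def)

text \<open>Each basis element occurring in s is the inverse class of some \<open>h J\<close>, and
  by \<open>inner_homologous\<close> it acts as the inner automorphism of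
  \<open>h J\<close>.\<close>

lemma (in det_group) smul_inner_homologous:
  assumes "finite N" and "\<And>J. J \<in> N \<Longrightarrow> h J \<in> carrier H" and z: "z \<in> F.Z n"
    and s: "s = - (\<Sum>J\<in>N. frag_cmul (k J) (frag_of (inv\<^bsub>U\<^esub> \<delta> (h J))))"
  shows "smul s z + (\<Sum>J\<in>N. frag_cmul (k J) (inner (h J) z)) \<in> F.Bd n"
proof -
  have "(\<Sum>J\<in>N. frag_cmul (k J) (inner (h J) z - smul (frag_of (inv\<^bsub>U\<^esub> \<delta> (h J))) z)) \<in> F.Bd n"
    by (intro F.Bd_sum F.Bd_cmul inner_homologous assms(2) z)
  also have "(\<Sum>J\<in>N. frag_cmul (k J) (inner (h J) z - smul (frag_of (inv\<^bsub>U\<^esub> \<delta> (h J))) z))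
      = smul s z + (\<Sum>J\<in>N. frag_cmul (k J) (inner (h J) z))"
    unfolding s smul_neg_sum[OF assms(1)] frag_cmul_diff_right sum_subtractf by (rule diff_conv_add_uminus[THEN trans], rule add.commute)
  finally show ?thesis .
qed

lemma K1_unit_power:
  fixes a :: "'a::{ring,monoid_mult}"
  assumes "a \<in> Units center_ring"
  shows "a ^ n \<in> Units center_ring \<and> K1_unit (a ^ n) = K1_unit a [^]\<^bsub>K1\<^esub> n"
proof (induction n)
  case 0
  then show ?case by (simp add: one_Units_center K1_unit_one)
next
  case (Suc n)
  have c: "a ^ Suc n = a ^ n * a" by (rule power_Suc2)
  show ?case
    unfolding c using Suc Units_center_mult[of "a ^ n" a] K1_unit_mult[of "a ^ n" a] assms by simp
qed

lemma K1_det_scal_unit: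
  fixes a :: "'a::{ring,monoid_mult}"
  assumes "a \<in> Units center_ring"
  shows "K1_det (scal n a) = K1_unit (a ^ n)"
proof -
  obtain b where "a * b = 1" "b * a = 1" using assms by (rule Units_center_ring)
  then show ?thesis using K1_det_scal[of a b n] K1_unit_power[OF assms] by simp
qed

lemma scal_G: "a \<in> Units center_ring \<Longrightarrow> scal q a \<in> carrier (G_grp q)"
  unfolding G_simps mem_Collect_eq K1_det_scal_unit A_bar_simps
  by (intro conjI scal_Units imageI) (use K1_unit_power[of a q] in blast)+

lemma scal_central:
  fixes A :: "'a::{ring,monoid_mult} mat"
  assumes "c \<in> Units center_ring" "A \<in> carrier_mat k n"
  shows "A * scal n c = scal k c * A"
  unfolding scal_mult_left[OF assms(2)] scal_mult_right[OF assms(2)]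
  by (rule eq_matI) (simp_all add: center_central[OF assms(1)])

text \<open>Expanding into words instead of monomials makes every summand occur exactly once: no
  multinomial coefficients appear, and each word is an index of its own for the cross
  effects.\<close>

lemma sum_words:
  fixes x :: "nat \<Rightarrow> 'a::{ring,monoid_mult}"
  assumes "finite J"
  shows "(\<Sum>w\<in>words d J. prod_list (map x w)) = (\<Sum>j\<in>J. x j) ^ d"
proof (induction d)
  case 0
  have "words 0 J = {[]}" by (auto simp: words_def)
  then show ?case by simp
next
  case (Suc d)
  have "words (Suc d) J = (\<lambda>(j, w). j # w) ` (J \<times> words d J)"
    by (force simp: words_def length_Suc_conv image_iff)
  moreover have "inj_on (\<lambda>(j, w). j # w) (J \<times> words d J)" by (auto simp: inj_on_def)
  ultimately have "(\<Sum>w\<in>words (Suc d) J. prod_list (map x w))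
      = sum ((\<lambda>w. prod_list (map x w)) \<circ> (\<lambda>(j, w). j # w)) (J \<times> words d J)"
    by (simp only: sum.reindex)
  also have "\<dots> = (\<Sum>(j, w)\<in>J \<times> words d J. x j * prod_list (map x w))"
    by (rule sum.cong) auto
  also have "\<dots> = (\<Sum>j\<in>J. \<Sum>w\<in>words d J. x j * prod_list (map x w))"
    by (rule sum.cartesian_product[symmetric])
  also have "\<dots> = (\<Sum>j\<in>J. x j) * (\<Sum>w\<in>words d J. prod_list (map x w))"
    by (simp only: sum_distrib_left sum_distrib_right) (rule sum.swap)
  finally show ?case by (simp only: Suc power_Suc)
qed

section \<open>Affine matrices in block coordinates\<close>

definition proj :: "nat \<Rightarrow> 'a mat \<Rightarrow> 'a::{ring,monoid_mult} mat" where
  "proj q e = mat q q (\<lambda>(i, j). e $$ (i, j))"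

definition low :: "nat \<Rightarrow> nat \<Rightarrow> 'a mat \<Rightarrow> 'a::{ring,monoid_mult} mat" where
  "low p q e = mat p q (\<lambda>(i, j). e $$ (q + i, j))"

lemma proj_blocks: "T \<in> carrier_mat q q \<Longrightarrow> proj q (blocks q p T M (1\<^sub>m p)) = T"
  by (rule eq_matI) (auto simp: proj_def)

lemma low_blocks: "T \<in> carrier_mat q q \<Longrightarrow> M \<in> carrier_mat p q \<Longrightarrow> low p q (blocks q p T M (1\<^sub>m p)) = M"
  by (rule eq_matI) (auto simp: low_def)

text \<open>\<open>affine_ext\<close> takes the abelian normal subgroup as a type of class
  \<open>ab_group_add\<close>. Matrices of size p by q do not make up such a type, functions of two
  indices do; entries beyond the size are ignored by \<open>toM\<close> and set to zero by
  \<open>ofM\<close>.\<close>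

definition toM :: "nat \<Rightarrow> nat \<Rightarrow> (nat \<Rightarrow> nat \<Rightarrow> 'a) \<Rightarrow> 'a::{ring,monoid_mult} mat" where
  "toM p q n = mat p q (\<lambda>(i, j). n i j)"

definition ofM :: "'a mat \<Rightarrow> nat \<Rightarrow> nat \<Rightarrow> 'a::{ring,monoid_mult}" where
  "ofM A = (\<lambda>i j. if i < dim_row A \<and> j < dim_col A then A $$ (i, j) else 0)"

lemma toM_carrier: "toM p q n \<in> carrier_mat p q"
  by (simp add: toM_def)

lemma toM_ofM: "A \<in> carrier_mat p q \<Longrightarrow> toM p q (ofM A) = A"
  by (rule eq_matI) (auto simp: toM_def ofM_def)

lemma toM_add: "toM p q (a + b) = toM p q a + toM p q b"
  by (rule eq_matI) (auto simp: toM_def)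

lemma ofM_add: "A \<in> carrier_mat p q \<Longrightarrow> B \<in> carrier_mat p q \<Longrightarrow> ofM (A + B) = ofM A + ofM B"
  by (auto simp: ofM_def fun_eq_iff)

lemma toM_scale: "toM p q (\<lambda>i j. c * n i j) = scal p c * toM p q n"
  unfolding scal_mult_left[OF toM_carrier] by (rule eq_matI) (auto simp: toM_def)

lemma ofM_scale: "A \<in> carrier_mat p q \<Longrightarrow> ofM (scal p c * A) = (\<lambda>i j. c * ofM A i j)"
  by (auto simp: scal_mult_left ofM_def fun_eq_iff)

text \<open>The elements \<open>x j\<close> will be the images of the X_j, and d is t / q. The
  algebra structure enters the matrix computation through the central units X_J, as sums of the
  \<open>x j\<close>.\<close>

locale scalar_sums =
  fixes m d q p :: nat and x :: "nat \<Rightarrow> 'a::{ring,monoid_mult}"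
  assumes m_pos: "1 \<le> m" and d_pos: "1 \<le> d" and q_pos: "1 \<le> q"
    and sum_unit: "J \<in> nonempty_subsets m \<Longrightarrow> (\<Sum>j\<in>J. x j) \<in> Units center_ring"
begin

definition c :: "nat set \<Rightarrow> 'a" where
  "c J = (\<Sum>j\<in>J. x j) ^ d"

text \<open>The image of s_{m,-t}, written with the classes that \<open>inner_homologous\<close>
  produces: the scalar X_J^d of size q has class X_J^(q d) = X_J^t.\<close>

definition s :: "'a K1_elt \<Rightarrow>\<^sub>0 int" where
  "s = - (\<Sum>J\<in>nonempty_subsets m. frag_cmul ((-1) ^ card J) (frag_of (inv\<^bsub>A_bar\<^esub> K1_det (scal q (c J)))))"

lemma c_unit: "J \<in> nonempty_subsets m \<Longrightarrow> c J \<in> Units center_ring"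
  using K1_unit_power[OF sum_unit] by (simp add: c_def)

lemma finite_nonempty: "finite (nonempty_subsets m)"
  by (rule finite_subset[of _ "Pow {1..m}"]) (auto simp: nonempty_subsets_def)

lemma Pow_eq: "Pow {1..m} = insert {} (nonempty_subsets m)" "{} \<notin> nonempty_subsets m"
  by (auto simp: nonempty_subsets_def)

lemma s_carrier: "s \<in> carrier (group_ring A_bar)"
proof -
  have "K1_det (scal q (c J)) \<in> carrier A_bar" if "J \<in> nonempty_subsets m" for J
    using scal_G[OF c_unit[OF that], of q] by (simp add: G_simps)
  then have v: "inv\<^bsub>A_bar\<^esub> K1_det (scal q (c J)) \<in> carrier A_bar" if "J \<in> nonempty_subsets m" for J
    using group.inv_closed[OF comm_group.axioms(2)[OF A_bar_comm_group]] that by blast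
  have "Poly_Mapping.keys (\<Sum>J\<in>nonempty_subsets m. frag_cmul ((-1) ^ card J) (frag_of (inv\<^bsub>A_bar\<^esub> K1_det (scal q (c J)))))
     \<subseteq> carrier A_bar"
    by (rule order.trans[OF Poly_Mapping.keys_sum], rule UN_least, rule order.trans[OF keys_cmul]) (simp add: v)
  then show ?thesis by (simp add: s_def group_ring_simps keys_minus)
qed

sublocale G: det_group "G_grp q :: 'a mat monoid" "A_bar" K1_det s
  by (simp add: det_group_def det_group_axioms_def G_group A_bar_comm_group det_hom_G s_carrier)

sublocale E: det_group "Aff_grp p q :: 'a mat monoid" "A_bar" K1_det s
  by (simp add: det_group_def det_group_axioms_def Aff_group A_bar_comm_group det_hom_Aff s_carrier)

lemma alternating_nonempty: "(\<Sum>J\<in>nonempty_subsets m. (-1::int) ^ card J) = - 1"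
proof -
  have "(\<Sum>J\<in>Pow {1..m}. (-1::int) ^ card J) = 0"
    by (rule alternating_sum_Pow) (use m_pos in auto)
  then show ?thesis unfolding Pow_eq(1) using Pow_eq(2) finite_nonempty by simp
qed

text \<open>Central scalars have trivial inner automorphisms, so s acts as minus the sum of the
  signs over the nonempty J. That sum is -1, because the sum over all J vanishes for m
  positive.\<close>

lemma G_homologous:
  assumes z: "z \<in> G.F.Z n"
  shows "G.smul s z - z \<in> G.F.Bd n"
proof -
  have kz: "Poly_Mapping.keys z \<subseteq> G.F.bars n" using z by (simp add: G.F.Z_def)
  have i: "G.inner (scal q (c J)) z = z" if J: "J \<in> nonempty_subsets m" for J
  proof -
    note h = scal_G[OF c_unit[OF J], of q]
    have "inv\<^bsub>G_grp q\<^esub> scal q (c J) \<otimes>\<^bsub>G_grp q\<^esub> g \<otimes>\<^bsub>G_grp q\<^esub> scal q (c J) = g" if g: "g \<in> carrier (G_grp q)" for g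
    proof -
      have "g \<otimes>\<^bsub>G_grp q\<^esub> scal q (c J) = scal q (c J) \<otimes>\<^bsub>G_grp q\<^esub> g"
        unfolding G_simps by (rule scal_central[OF c_unit[OF J] G_carrier_mat[OF g]])
      then show ?thesis using h g by (simp add: G.m_assoc) (simp add: G.m_assoc[symmetric])
    qed
    then have "map_prod (\<lambda>x. x) (map (\<lambda>g. inv\<^bsub>G_grp q\<^esub> scal q (c J) \<otimes>\<^bsub>G_grp q\<^esub> g \<otimes>\<^bsub>G_grp q\<^esub> scal q (c J))) b = b"
      if "b \<in> G.F.bars n" for b
      using that by (cases b) (auto simp: G.F.bars_def subset_iff intro!: map_idI)
    then have "G.inner (scal q (c J)) z = frag_extend frag_of z"
      using kz by (intro frag_extend_eq) auto
    then show ?thesis by (simp only: frag_expansion[symmetric])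
  qed
  have "G.smul s z + (\<Sum>J\<in>nonempty_subsets m. frag_cmul ((-1) ^ card J) (G.inner (scal q (c J)) z)) \<in> G.F.Bd n"
    by (rule G.smul_inner_homologous[OF finite_nonempty scal_G[OF c_unit] z s_def])
  also have "(\<Sum>J\<in>nonempty_subsets m. frag_cmul ((-1) ^ card J) (G.inner (scal q (c J)) z))
      = (\<Sum>J\<in>nonempty_subsets m. frag_cmul ((-1) ^ card J) z)"
    by (rule sum.cong) (simp_all only: i)
  also have "\<dots> = frag_cmul (\<Sum>J\<in>nonempty_subsets m. (-1) ^ card J) z"
    using finite_nonempty by (induction rule: finite_induct) (simp_all add: frag_cmul_distrib)
  finally show ?thesis by (simp add: alternating_nonempty)
qed

text \<open>A unit representing u is placed in the first diagonal entry, for which q has to be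
  positive. At the trivial class the identity matrix is prescribed, since an arbitrary
  representative would not guarantee \<open>sect_one\<close>.\<close>

definition sect :: "'a K1_elt \<Rightarrow> 'a mat" where
  "sect u = (if u = \<one>\<^bsub>A_bar\<^esub> then 1\<^sub>m q else
     blocks 1 (q - 1) (scal 1 (SOME a. a \<in> Units center_ring \<and> K1_unit a = u)) (0\<^sub>m (q - 1) 1) (1\<^sub>m (q - 1)))"

lemma sect_props:
  assumes u: "u \<in> carrier A_bar"
  shows "sect u \<in> carrier (G_grp q) \<and> K1_det (sect u) = u"
proof (cases "u = \<one>\<^bsub>A_bar\<^esub>")
  case True
  then show ?thesis
    using G.one_closed K1_det_one[of q] by (simp add: sect_def G_simps(3) A_bar_simps(3))
next
  case False
  define a where "a = (SOME a. a \<in> Units center_ring \<and> K1_unit a = u)"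
  have "\<exists>a. a \<in> Units center_ring \<and> K1_unit a = u" using u unfolding A_bar_simps by blast
  then have a: "a \<in> Units center_ring \<and> K1_unit a = u" unfolding a_def by (rule someI_ex)
  have e: "sect u = blocks 1 (q - 1) (scal 1 a) (0\<^sub>m (q - 1) 1) (1\<^sub>m (q - 1))"
    using False by (simp add: sect_def a_def)
  have "blocks 1 (q - 1) (scal 1 a) (0\<^sub>m (q - 1) 1) (1\<^sub>m (q - 1)) \<in> carrier (GL (1 + (q - 1)))"
    by (intro blocks_GL scal_Units one_GL zero_carrier_mat) (use a in blast)
  then have "sect u \<in> carrier (GL q)" unfolding e using q_pos by simp
  moreover have "K1_det (sect u) = u"
    unfolding e K1_det_blocks_one[OF scal_carrier] K1_unit_scal[symmetric] using a by blast
  ultimately show ?thesis using u by (simp add: G_simps)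
qed

sublocale Sh: det_shapiro "G_grp q :: 'a mat monoid" "A_bar" K1_det s sect
  by (intro det_shapiro.intro det_shapiro_axioms.intro G.det_group_axioms G_homologous)
    (use sect_props in blast, use sect_props in blast, simp add: sect_def G_simps(3))

definition \<pi> :: "'a mat \<Rightarrow> 'a mat" where "\<pi> e = blocks q p (proj q e) (0\<^sub>m p q) (1\<^sub>m p)"

definition \<mu> :: "(nat \<Rightarrow> nat \<Rightarrow> 'a) \<Rightarrow> 'a mat" where "\<mu> n = blocks q p (1\<^sub>m q) (toM p q n) (1\<^sub>m p)"

definition Ti :: "'a mat \<Rightarrow> 'a mat" where "Ti e = inv\<^bsub>G_grp q\<^esub> proj q e"

text \<open>With pairs for the diagonal and the lower left block, (1, n)(T, 0) = (T, n T) gives n =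
  M T^-1 for the matrix (T, M). Likewise (T, 0)(1, n) = (T, n) = (1, n T^-1)(T, 0) determines
  \<open>L\<close>.\<close>

definition \<nu> :: "'a mat \<Rightarrow> nat \<Rightarrow> nat \<Rightarrow> 'a" where "\<nu> e = ofM (low p q e * Ti e)"

definition L :: "'a mat \<Rightarrow> (nat \<Rightarrow> nat \<Rightarrow> 'a) \<Rightarrow> nat \<Rightarrow> nat \<Rightarrow> 'a" where "L e n = ofM (toM p q n * Ti e)"

text \<open>Multiplication by the monomial of w, on the left; \<open>L\<close> multiplies by a
  matrix on the right, so the two commute.\<close>

definition sc :: "nat list \<Rightarrow> (nat \<Rightarrow> nat \<Rightarrow> 'a) \<Rightarrow> nat \<Rightarrow> nat \<Rightarrow> 'a" where
  "sc w n = (\<lambda>i j. prod_list (map x w) * n i j)"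

lemma Aff_parts:
  assumes "e \<in> carrier (Aff_grp p q)"
  shows "e = blocks q p (proj q e) (low p q e) (1\<^sub>m p)" "proj q e \<in> carrier (G_grp q)"
    "proj q e \<in> carrier_mat q q" "low p q e \<in> carrier_mat p q" "Ti e \<in> carrier_mat q q"
    "proj q e * Ti e = 1\<^sub>m q" "Ti e * proj q e = 1\<^sub>m q"
proof -
  obtain T M where t: "T \<in> carrier (G_grp q)" "M \<in> carrier_mat p q" "e = blocks q p T M (1\<^sub>m p)"
    using assms by (rule Aff_E)
  have T: "T \<in> carrier_mat q q" by (rule G_carrier_mat[OF t(1)])
  have pe: "proj q e = T" unfolding t(3) by (rule proj_blocks[OF T])
  have le: "low p q e = M" unfolding t(3) by (rule low_blocks[OF T t(2)])
  show "e = blocks q p (proj q e) (low p q e) (1\<^sub>m p)" unfolding pe le by (rule t(3))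
  show "proj q e \<in> carrier (G_grp q)" "proj q e \<in> carrier_mat q q" "low p q e \<in> carrier_mat p q"
    unfolding pe le by (rule t(1), rule T, rule t(2))
  show "Ti e \<in> carrier_mat q q" unfolding Ti_def pe by (rule G_carrier_mat[OF G.inv_closed[OF t(1)]])
  show "proj q e * Ti e = 1\<^sub>m q" "Ti e * proj q e = 1\<^sub>m q"
    using G.r_inv[OF t(1)] G.l_inv[OF t(1)] by (simp_all only: Ti_def pe G_simps)
qed

lemma parts_mult:
  assumes e: "e \<in> carrier (Aff_grp p q)" and f: "f \<in> carrier (Aff_grp p q)"
  shows "proj q (e * f) = proj q e * proj q f" "low p q (e * f) = low p q e * proj q f + low p q f"
    "Ti (e * f) = Ti f * Ti e"
proof -
  note ee = Aff_parts[OF e] and ff = Aff_parts[OF f]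
  have m: "e * f = blocks q p (proj q e * proj q f) (low p q e * proj q f + low p q f) (1\<^sub>m p)"
    using Aff_mult[OF ee(3,4) ff(3,4)] ee(1) ff(1) by simp
  have cT: "proj q e * proj q f \<in> carrier_mat q q" and cM: "low p q e * proj q f + low p q f \<in> carrier_mat p q"
    using ee(3,4) ff(3,4) by simp_all
  show pm: "proj q (e * f) = proj q e * proj q f" unfolding m by (rule proj_blocks[OF cT])
  show "low p q (e * f) = low p q e * proj q f + low p q f" unfolding m by (rule low_blocks[OF cT cM])
  show "Ti (e * f) = Ti f * Ti e"
    using G.inv_mult_group[OF ee(2) ff(2)] by (simp only: Ti_def pm G_simps)
qed

lemma one_G: "1\<^sub>m q \<in> carrier (G_grp q :: 'a mat monoid)"
  using G.one_closed by (simp only: G_simps(3))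

lemma mu_pi:
  assumes e: "e \<in> carrier (Aff_grp p q)"
  shows "\<mu> n * \<pi> e = blocks q p (proj q e) (toM p q n * proj q e) (1\<^sub>m p)"
proof -
  note ee = Aff_parts[OF e]
  have "toM p q n * proj q e + 0\<^sub>m p q = toM p q n * proj q e"
    by (rule right_add_zero_mat) (use ee(3) toM_carrier[of p q n] in simp)
  then show ?thesis
    unfolding \<mu>_def \<pi>_def Aff_mult[OF one_carrier_mat toM_carrier ee(3) zero_carrier_mat] one_mat_mult(1)[OF ee(3)]
    by (simp only:)
qed

sublocale A: affine_ext "Aff_grp p q :: 'a mat monoid" "carrier A_bar" E.uact \<pi> \<mu> \<nu> L sc
proof (intro affine_ext.intro affine_ext_axioms.intro E.F.gset_axioms)
  show "\<pi> \<in> hom (Aff_grp p q) (Aff_grp p q)"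
  proof (rule homI)
    fix e :: "'a mat" assume e: "e \<in> carrier (Aff_grp p q)"
    show "\<pi> e \<in> carrier (Aff_grp p q)"
      unfolding \<pi>_def by (rule Aff_I[OF Aff_parts(2)[OF e] zero_carrier_mat])
    fix f :: "'a mat" assume f: "f \<in> carrier (Aff_grp p q)"
    have "0\<^sub>m p q * proj q f + 0\<^sub>m p q = 0\<^sub>m p q" using Aff_parts(3)[OF f] by simp
    then show "\<pi> (e \<otimes>\<^bsub>Aff_grp p q\<^esub> f) = \<pi> e \<otimes>\<^bsub>Aff_grp p q\<^esub> \<pi> f"
      unfolding Aff_simps \<pi>_def parts_mult[OF e f]
        Aff_mult[OF Aff_parts(3)[OF e] zero_carrier_mat Aff_parts(3)[OF f] zero_carrier_mat] by (simp only:)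
  qed
  fix n a b :: "nat \<Rightarrow> nat \<Rightarrow> 'a"
  show "\<mu> n \<in> carrier (Aff_grp p q)"
    unfolding \<mu>_def by (rule Aff_I[OF one_G toM_carrier])
  show "\<mu> (a + b) = \<mu> a \<otimes>\<^bsub>Aff_grp p q\<^esub> \<mu> b"
    unfolding Aff_simps \<mu>_def Aff_mult[OF one_carrier_mat toM_carrier one_carrier_mat toM_carrier] toM_add
      one_mat_mult(2)[OF toM_carrier] one_mat_mult(2)[OF one_carrier_mat] by (rule refl)
  fix w
  show "sc w (a + b) = sc w a + sc w b" by (intro ext) (simp add: sc_def distrib_left)
  { fix u :: "'a K1_elt" assume "u \<in> carrier A_bar"
    \<comment> \<open>Translations are unipotent, hence of trivial class in K1.\<close>
    then show "E.uact u (\<mu> n) = u"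
      unfolding E.uact_def \<mu>_def K1_det_unipotent[OF toM_carrier] A_bar_simps(3)[symmetric] by (rule G.U.r_one) }
  fix e :: "'a mat" assume e: "e \<in> carrier (Aff_grp p q)"
  note ee = Aff_parts[OF e]
  have nT: "toM p q n * Ti e \<in> carrier_mat p q" for n using toM_carrier[of p q n] ee(5) by simp
  have lT: "low p q e * Ti e \<in> carrier_mat p q" using ee(4,5) by simp
  show "\<mu> (\<nu> e) \<otimes>\<^bsub>Aff_grp p q\<^esub> \<pi> e = e"
  proof -
    have "low p q e * Ti e * proj q e = low p q e"
      unfolding assoc_mult_mat[OF ee(4,5,3)] ee(7) by (rule one_mat_mult(2)[OF ee(4)])
    then show ?thesis
      unfolding Aff_simps mu_pi[OF e] \<nu>_def toM_ofM[OF lT] using ee(1) by (simp only:)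
  qed
  show "L e (a + b) = L e a + L e b"
    unfolding L_def toM_add add_mult_distrib_mat[OF toM_carrier toM_carrier ee(5)] by (rule ofM_add[OF nT nT])
  show "\<pi> e \<otimes>\<^bsub>Aff_grp p q\<^esub> \<mu> n = \<mu> (L e n) \<otimes>\<^bsub>Aff_grp p q\<^esub> \<pi> e"
  proof -
    have "toM p q n * Ti e * proj q e = toM p q n"
      unfolding assoc_mult_mat[OF toM_carrier ee(5,3)] ee(7) by (rule one_mat_mult(2)[OF toM_carrier])
    moreover have "\<pi> e * \<mu> n = blocks q p (proj q e) (toM p q n) (1\<^sub>m p)"
    proof -
      have "0\<^sub>m p q * 1\<^sub>m q + toM p q n = toM p q n"
        unfolding one_mat_mult(2)[OF zero_carrier_mat] by (rule left_add_zero_mat[OF toM_carrier])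
      then show ?thesis
        unfolding \<pi>_def \<mu>_def Aff_mult[OF ee(3) zero_carrier_mat one_carrier_mat toM_carrier] one_mat_mult(2)[OF ee(3)]
        by (simp only:)
    qed
    ultimately show ?thesis unfolding Aff_simps mu_pi[OF e] L_def toM_ofM[OF nT] by (simp only:)
  qed
  show "L e (sc w a) = sc w (L e a)"
    unfolding L_def sc_def toM_scale assoc_mult_mat[OF scal_carrier toM_carrier ee(5)] by (rule ofM_scale[OF nT])
  fix f :: "'a mat" assume f: "f \<in> carrier (Aff_grp p q)"
  note ff = Aff_parts[OF f]
  have lf: "low p q f * Ti f \<in> carrier_mat p q" using ff(4,5) by simp
  have TT: "Ti f * Ti e \<in> carrier_mat q q" using ee(5) ff(5) by simp
  have lp: "low p q e * proj q f \<in> carrier_mat p q" using ee(4) ff(3) by simp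
  \<comment> \<open>In the product the linear part of f is undone by \<open>Ti f\<close>: this
    leaves the translation part of e as it was and applies \<open>L e\<close> to that of f.\<close>
  have "low p q e * proj q f * (Ti f * Ti e) = low p q e * (proj q f * (Ti f * Ti e))"
    by (rule assoc_mult_mat[OF ee(4) ff(3) TT])
  also have "proj q f * (Ti f * Ti e) = Ti e"
    unfolding assoc_mult_mat[OF ff(3,5) ee(5), symmetric] ff(6) by (rule one_mat_mult(1)[OF ee(5)])
  finally have 1: "low p q e * proj q f * (Ti f * Ti e) = low p q e * Ti e" .
  have 2: "low p q f * (Ti f * Ti e) = low p q f * Ti f * Ti e"
    by (rule assoc_mult_mat[OF ff(4,5) ee(5), symmetric])
  have lfe: "low p q f * Ti f * Ti e \<in> carrier_mat p q" using lf ee(5) by simp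
  show "\<nu> (e \<otimes>\<^bsub>Aff_grp p q\<^esub> f) = \<nu> e + L e (\<nu> f)"
    unfolding Aff_simps \<nu>_def L_def parts_mult[OF e f] toM_ofM[OF lf]
      add_mult_distrib_mat[OF lp ff(4) TT] 1 2 by (rule ofM_add[OF lT lfe])
qed

lemma sum_sc: "(\<Sum>w\<in>S. sc w n) = (\<lambda>i j. (\<Sum>w\<in>S. prod_list (map x w)) * n i j)"
  by (induction S rule: infinite_finite_induct) (auto simp: sc_def fun_eq_iff distrib_right)

text \<open>By \<open>sum_words\<close> the monomials of the words of length d in J add up to
  \<open>c J\<close>.\<close>

lemma sigma_words:
  assumes J: "finite J" and e: "e \<in> carrier (Aff_grp p q)"
  shows "A.\<sigma> (words d J) e = blocks q p (proj q e) (scal p (c J) * low p q e) (1\<^sub>m p)"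
proof -
  note ee = Aff_parts[OF e]
  have lT: "low p q e * Ti e \<in> carrier_mat p q" using ee(4,5) by simp
  have "toM p q (\<Sum>w\<in>words d J. sc w (\<nu> e)) = scal p (c J) * (low p q e * Ti e)"
    unfolding sum_sc sum_words[OF J] c_def[symmetric] toM_scale \<nu>_def toM_ofM[OF lT] ..
  moreover have "scal p (c J) * (low p q e * Ti e) * proj q e = scal p (c J) * low p q e"
    unfolding assoc_mult_mat[OF scal_carrier lT ee(3)] assoc_mult_mat[OF ee(4,5,3)] ee(7) one_mat_mult(2)[OF ee(4)] ..
  ultimately show ?thesis
    unfolding A.\<sigma>_def Aff_simps mu_pi[OF e] by (simp only:)
qed

text \<open>The scalar occupies the block of G_q only, with 1 in the other diagonal block.
  Conjugation by it therefore leaves T alone and multiplies the lower left block by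
  \<open>c J\<close>.\<close>

definition hs :: "nat set \<Rightarrow> 'a mat" where
  "hs J = blocks q p (scal q (c J)) (0\<^sub>m p q) (1\<^sub>m p)"

lemma hs_Aff: "J \<in> nonempty_subsets m \<Longrightarrow> hs J \<in> carrier (Aff_grp p q)"
  unfolding hs_def by (rule Aff_I[OF scal_G[OF c_unit] zero_carrier_mat])

lemma det_hs: "J \<in> nonempty_subsets m \<Longrightarrow> K1_det (hs J) = K1_det (scal q (c J))"
  unfolding hs_def by (rule det_Aff[OF scal_G[OF c_unit] zero_carrier_mat])

lemma sigma_inner:
  assumes J: "J \<in> nonempty_subsets m" and e: "e \<in> carrier (Aff_grp p q)"
  shows "inv\<^bsub>Aff_grp p q\<^esub> hs J \<otimes>\<^bsub>Aff_grp p q\<^esub> e \<otimes>\<^bsub>Aff_grp p q\<^esub> hs J = A.\<sigma> (words d J) e"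
proof -
  note ee = Aff_parts[OF e] and cJ = c_unit[OF J]
  have fJ: "finite J" using J by (auto simp: nonempty_subsets_def intro: finite_subset)
  have cl: "A.\<sigma> (words d J) e \<in> carrier (Aff_grp p q)" by (rule A.sigma_closed[OF e])
  have lM: "scal p (c J) * low p q e \<in> carrier_mat p q" using scal_carrier[of p "c J"] ee(4) by simp
  have "hs J * A.\<sigma> (words d J) e = blocks q p (scal q (c J) * proj q e) (scal p (c J) * low p q e) (1\<^sub>m p)"
    unfolding hs_def sigma_words[OF fJ e] Aff_mult[OF scal_carrier zero_carrier_mat ee(3) lM]
    using ee(3) left_add_zero_mat[OF lM] by simp
  moreover have "e * hs J = blocks q p (proj q e * scal q (c J)) (low p q e * scal q (c J) + 0\<^sub>m p q) (1\<^sub>m p)"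
    by (subst ee(1), unfold hs_def, rule Aff_mult[OF ee(3,4) scal_carrier zero_carrier_mat])
  moreover have "low p q e * scal q (c J) + 0\<^sub>m p q = scal p (c J) * low p q e"
    unfolding scal_central[OF cJ ee(4)] by (rule right_add_zero_mat[OF lM])
  ultimately have "e * hs J = hs J * A.\<sigma> (words d J) e"
    unfolding scal_central[OF cJ ee(3)] by (simp only:)
  then have "e \<otimes>\<^bsub>Aff_grp p q\<^esub> hs J = hs J \<otimes>\<^bsub>Aff_grp p q\<^esub> A.\<sigma> (words d J) e" by (simp only: Aff_simps)
  then show ?thesis
    using hs_Aff[OF J] e cl by (simp add: E.m_assoc) (simp add: E.m_assoc[symmetric])
qed

lemma embed_hom: "Aff_embed p q \<in> hom (G_grp q) (Aff_grp p q :: 'a mat monoid)"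
proof (rule homI)
  fix T T' :: "'a mat" assume T: "T \<in> carrier (G_grp q)"
  show "Aff_embed p q T \<in> carrier (Aff_grp p q)"
    unfolding Aff_embed_def by (rule Aff_I[OF T zero_carrier_mat])
  assume T': "T' \<in> carrier (G_grp q)"
  have "0\<^sub>m p q * T' + 0\<^sub>m p q = 0\<^sub>m p q" using G_carrier_mat[OF T'] by simp
  then show "Aff_embed p q (T \<otimes>\<^bsub>G_grp q\<^esub> T') = Aff_embed p q T \<otimes>\<^bsub>Aff_grp p q\<^esub> Aff_embed p q T'"
    unfolding Aff_embed_def Aff_simps G_simps
      Aff_mult[OF G_carrier_mat[OF T] zero_carrier_mat G_carrier_mat[OF T'] zero_carrier_mat] by (simp only:)
qed

sublocale Re: det_retract "G_grp q :: 'a mat monoid" "A_bar" K1_det s "Aff_grp p q :: 'a mat monoid" K1_det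
    "Aff_embed p q" "proj q"
proof (intro det_retract.intro det_retract_axioms.intro G.det_group_axioms E.det_group_axioms embed_hom)
  show "proj q \<in> hom (Aff_grp p q) (G_grp q :: 'a mat monoid)"
  proof (rule homI)
    fix e f :: "'a mat" assume e: "e \<in> carrier (Aff_grp p q)"
    show "proj q e \<in> carrier (G_grp q)" by (rule Aff_parts(2)[OF e])
    assume "f \<in> carrier (Aff_grp p q)"
    then show "proj q (e \<otimes>\<^bsub>Aff_grp p q\<^esub> f) = proj q e \<otimes>\<^bsub>G_grp q\<^esub> proj q f"
      unfolding Aff_simps G_simps by (rule parts_mult(1)[OF e])
  qed
  fix g :: "'a mat" assume g: "g \<in> carrier (G_grp q)"
  show "proj q (Aff_embed p q g) = g" unfolding Aff_embed_def by (rule proj_blocks[OF G_carrier_mat[OF g]])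
  show "K1_det (Aff_embed p q g) = K1_det g" unfolding Aff_embed_def by (rule det_Aff[OF g zero_carrier_mat])
next
  fix e :: "'a mat" assume e: "e \<in> carrier (Aff_grp p q)"
  note ee = Aff_parts[OF e]
  show "K1_det (proj q e) = K1_det e" by (subst (2) ee(1)) (rule det_Aff[OF ee(2,4), symmetric])
qed

text \<open>In the alternating sum over all J, which bounds because r d < m, the nonempty J
  contribute inner automorphisms, together -s, and the empty J contributes the projection.\<close>

theorem Aff_homologous:
  assumes z: "z \<in> E.F.Z r" and rd: "r * d < m"
  shows "E.smul s z - Re.Inj (Re.Prj z) \<in> E.F.Bd r"
proof -
  have kz: "Poly_Mapping.keys z \<subseteq> E.F.bars r" using z by (simp add: E.F.Z_def)
  define f where "f S = frag_extend (\<lambda>b. frag_of (map_prod (\<lambda>x. x) (map (A.\<sigma> S)) b)) z" for S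
  have fw: "f (words d J) = E.inner (hs J) z" if J: "J \<in> nonempty_subsets m" for J
    unfolding f_def
  proof (rule frag_extend_eq)
    fix b assume "b \<in> Poly_Mapping.keys z"
    then have "b \<in> E.F.bars r" by (rule subsetD[OF kz])
    then have "set (snd b) \<subseteq> carrier (Aff_grp p q)" by (cases b) (auto simp: E.F.bars_def)
    then have "map (A.\<sigma> (words d J)) (snd b)
        = map (\<lambda>g. inv\<^bsub>Aff_grp p q\<^esub> hs J \<otimes>\<^bsub>Aff_grp p q\<^esub> g \<otimes>\<^bsub>Aff_grp p q\<^esub> hs J) (snd b)"
      using sigma_inner[OF J] by (intro map_cong refl) (auto simp: subset_iff)
    then show "frag_of (map_prod (\<lambda>x. x) (map (A.\<sigma> (words d J))) b) =
      frag_of (map_prod (\<lambda>x. x) (map (\<lambda>g. inv\<^bsub>Aff_grp p q\<^esub> hs J \<otimes>\<^bsub>Aff_grp p q\<^esub> g \<otimes>\<^bsub>Aff_grp p q\<^esub> hs J)) b)"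
      by (simp only: map_prod_def case_prod_beta)
  qed
  have f0: "f (words d {}) = Re.Inj (Re.Prj z)"
    unfolding f_def frag_extend_extend frag_extend_of
  proof (rule frag_extend_eq)
    fix b assume "b \<in> Poly_Mapping.keys z"
    then have "b \<in> E.F.bars r" by (rule subsetD[OF kz])
    then have b: "set (snd b) \<subseteq> carrier (Aff_grp p q)" by (cases b) (auto simp: E.F.bars_def)
    have "A.\<sigma> (words d {}) g = Aff_embed p q (proj q g)" if g: "g \<in> carrier (Aff_grp p q)" for g
    proof -
      \<comment> \<open>The empty sum raised to a positive power is 0; for d = 0 the factor would be
        1.\<close>
      have "scal p (c {}) * low p q g = 0\<^sub>m p q"
        unfolding scal_mult_left[OF Aff_parts(4)[OF g]] c_def using d_pos
        by (cases d) (auto intro!: eq_matI)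
      then show ?thesis unfolding sigma_words[OF finite.emptyI g] Aff_embed_def by (simp only:)
    qed
    then have "map (A.\<sigma> (words d {})) (snd b) = map (\<lambda>g. Aff_embed p q (proj q g)) (snd b)"
      using b by (intro map_cong refl) (auto simp: subset_iff)
    then show "frag_of (map_prod (\<lambda>x. x) (map (A.\<sigma> (words d {}))) b) =
      frag_of (map_prod (\<lambda>x. x) (map (Aff_embed p q)) (map_prod (\<lambda>x. x) (map (proj q)) b))"
      by (simp only: map_prod_def case_prod_beta fst_conv snd_conv map_map comp_def)
  qed
  have "(\<Sum>J\<in>Pow {1..m}. frag_cmul ((-1) ^ card J) (f (words d J))) \<in> E.F.Bd r"
  proof (rule alternating_sum_words[where r = r])
    fix T :: "nat list set" assume "finite T" "r < card T"
    then show "cross_diff_sum f T \<in> E.F.Bd r"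
      unfolding f_def by (rule A.cross_effect_homologous_zero[OF z])
  qed (simp_all add: rd E.F.Bd_0 E.F.Bd_add E.F.Bd_uminus)
  then have 1: "Re.Inj (Re.Prj z) + (\<Sum>J\<in>nonempty_subsets m. frag_cmul ((-1) ^ card J) (f (words d J))) \<in> E.F.Bd r"
    unfolding Pow_eq(1) sum.insert[OF finite_nonempty Pow_eq(2)] f0 by simp
  have s: "s = - (\<Sum>J\<in>nonempty_subsets m. frag_cmul ((-1) ^ card J) (frag_of (inv\<^bsub>A_bar\<^esub> K1_det (hs J))))"
    unfolding s_def by (intro arg_cong[of _ _ uminus] sum.cong refl) (simp only: det_hs)
  have "E.smul s z + (\<Sum>J\<in>nonempty_subsets m. frag_cmul ((-1) ^ card J) (E.inner (hs J) z)) \<in> E.F.Bd r"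
    by (rule E.smul_inner_homologous[OF finite_nonempty hs_Aff z s])
  also have "(\<Sum>J\<in>nonempty_subsets m. frag_cmul ((-1) ^ card J) (E.inner (hs J) z))
      = (\<Sum>J\<in>nonempty_subsets m. frag_cmul ((-1) ^ card J) (f (words d J)))"
    by (rule sum.cong) (simp_all only: fw)
  finally show ?thesis using E.F.Bd_diff[OF _ 1] by fastforce
qed

end

section \<open>The structure map of the algebra on the sums X_J\<close>

lemma X_sum_carrier:
  assumes "J \<subseteq> {1..m}"
  shows "X_sum J \<in> carrier (int_poly_ring m)"
proof -
  interpret cring "int_poly_ring m" by (rule int_poly_ring_cring)
  have "finite J" using assms by (rule finite_subset) simp
  then show ?thesis using assms
  proof (induction J rule: finite_induct)
    case empty
    then show ?case using zero_closed by (simp add: X_sum_def int_poly_ring_def)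
  next
    case (insert j J)
    have "X_var j \<in> carrier (int_poly_ring m)" using insert.prems by (simp add: X_var_def int_poly_ring_def)
    then have "X_var j \<oplus>\<^bsub>int_poly_ring m\<^esub> X_sum J \<in> carrier (int_poly_ring m)"
      using insert by (intro add.m_closed) auto
    then show ?case using insert.hyps by (simp add: X_sum_def int_poly_ring_def)
  qed
qed

locale Rm_algebra =
  fixes m :: nat and \<phi> :: "Rm_elt \<Rightarrow> 'a::{ring,monoid_mult}"
  assumes alg: "R_algebra m \<phi>"
begin

sublocale P: localized "int_poly_ring m" "X_sum ` nonempty_subsets m"
  by (intro localized.intro localized_axioms.intro int_poly_ring_cring image_subsetI X_sum_carrier)
    (simp add: nonempty_subsets_def)

lemma phi_hom: "\<phi> \<in> ring_hom P.LR center_ring"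
  using alg by (simp only: R_algebra_def R_ring_def)

lemma R_X_fr: "R_X m J = P.fr (X_sum J) \<one>\<^bsub>int_poly_ring m\<^esub>"
  by (simp add: R_X_def int_poly_ring_def)

lemma phi_R_X:
  assumes "J \<in> nonempty_subsets m"
  shows "\<phi> (R_X m J) = (\<Sum>j\<in>J. \<phi> (R_X m {j}))"
proof -
  have J: "J \<noteq> {}" "J \<subseteq> {1..m}" using assms by (simp_all add: nonempty_subsets_def)
  then have "finite J" by (meson finite_atLeastAtMost finite_subset)
  then show ?thesis using J
  proof (induction J rule: finite_ne_induct)
    case (insert j J)
    have c: "X_sum {j} \<in> carrier (int_poly_ring m)" "X_sum J \<in> carrier (int_poly_ring m)"
      using insert.prems by (auto intro!: X_sum_carrier)
    have "X_sum (insert j J) = X_sum {j} \<oplus>\<^bsub>int_poly_ring m\<^esub> X_sum J"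
      using insert.hyps by (simp add: X_sum_def int_poly_ring_def)
    then have "R_X m (insert j J) = R_X m {j} \<oplus>\<^bsub>P.LR\<^esub> R_X m J"
      by (simp only: R_X_fr P.fr_add_same[OF c P.S_one])
    then have "\<phi> (R_X m (insert j J)) = \<phi> (R_X m {j}) \<oplus>\<^bsub>center_ring\<^esub> \<phi> (R_X m J)"
      unfolding R_X_fr by (simp only: ring_hom_add[OF phi_hom P.fr_closed[OF c(1) P.S_one] P.fr_closed[OF c(2) P.S_one]])
    then show ?case using insert by (simp add: center_ring_def)
  qed simp
qed

lemma R_X_Units:
  assumes "J \<in> nonempty_subsets m"
  shows "R_X m J \<in> Units P.LR"
proof -
  interpret L: cring P.LR by (rule P.localization_cring)
  have J: "X_sum J \<in> P.S" by (rule P.Sigma_S[OF imageI[OF assms]])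
  have c: "R_X m J \<in> carrier P.LR" "P.fr \<one>\<^bsub>int_poly_ring m\<^esub> (X_sum J) \<in> carrier P.LR"
    unfolding R_X_fr by (rule P.fr_closed[OF P.S_carrier[OF J] P.S_one], rule P.fr_closed[OF P.one_closed J])
  have "R_X m J \<otimes>\<^bsub>P.LR\<^esub> P.fr \<one>\<^bsub>int_poly_ring m\<^esub> (X_sum J) = \<one>\<^bsub>P.LR\<^esub>"
    unfolding R_X_fr by (rule P.fr_inverse[OF J])
  then show ?thesis using c L.m_comm[OF c] unfolding Units_def by auto
qed

lemma phi_Units:
  assumes u: "u \<in> Units P.LR"
  shows "\<phi> u \<in> Units center_ring"
proof -
  interpret L: cring P.LR by (rule P.localization_cring)
  note c = L.Units_closed[OF u] L.Units_closed[OF L.Units_inv_Units[OF u]]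
  have z: "\<phi> a * b = b * \<phi> a" if "a \<in> carrier P.LR" for a b
    using ring_hom_closed[OF phi_hom that] by (simp add: center_ring_def)
  have "\<phi> (inv\<^bsub>P.LR\<^esub> u) * \<phi> u = 1"
    using ring_hom_mult[OF phi_hom c(2,1)] ring_hom_one[OF phi_hom] L.Units_l_inv[OF u] by (simp add: center_ring_def)
  then show ?thesis using z c by (metis Units_center_I)
qed

text \<open>\<open>s_elt\<close> takes powers with exponent -t in the unit group of R_m; in
  \<open>A_bar\<close> they become inverses, which is the form of
  \<open>scalar_sums.s\<close>.\<close>

lemma K1_unit_phi_power:
  assumes u: "u \<in> Units P.LR"
  shows "K1_unit (\<phi> (u [^]\<^bsub>units_of P.LR\<^esub> (- int t))) = inv\<^bsub>A_bar\<^esub> K1_unit (\<phi> u ^ t)"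
proof -
  interpret L: cring P.LR by (rule P.localization_cring)
  interpret U: group "units_of P.LR" by (rule L.units_group)
  interpret A: comm_group "A_bar :: 'a K1_elt monoid" by (rule A_bar_comm_group)
  have u': "u \<in> carrier (units_of P.LR)" using u by (simp add: units_of_carrier)
  have mult: "\<phi> (a \<otimes>\<^bsub>units_of P.LR\<^esub> b) = \<phi> a * \<phi> b" if "a \<in> carrier (units_of P.LR)" "b \<in> carrier (units_of P.LR)" for a b
    using ring_hom_mult[OF phi_hom, of a b] that by (simp add: units_of_carrier units_of_mult L.Units_closed center_ring_def)
  have one: "\<phi> \<one>\<^bsub>units_of P.LR\<^esub> = 1"
    using ring_hom_one[OF phi_hom] by (simp add: units_of_one center_ring_def)
  have pow: "\<phi> (u [^]\<^bsub>units_of P.LR\<^esub> n) = \<phi> u ^ n" for n :: nat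
    by (induction n) (simp_all add: one mult u' power_Suc2 del: power_Suc)
  define v where "v = u [^]\<^bsub>units_of P.LR\<^esub> (- int t)"
  have v: "v \<in> carrier (units_of P.LR)" unfolding v_def using u' by (rule U.int_pow_closed)
  have "v \<otimes>\<^bsub>units_of P.LR\<^esub> u [^]\<^bsub>units_of P.LR\<^esub> t = \<one>\<^bsub>units_of P.LR\<^esub>"
    unfolding v_def U.int_pow_neg_int[OF u'] by (rule U.l_inv) (use u' in simp)
  then have "\<phi> v * \<phi> u ^ t = 1" using mult[OF v, of "u [^]\<^bsub>units_of P.LR\<^esub> t"] u' by (simp add: pow one)
  moreover have "\<phi> v \<in> Units center_ring" using v by (simp add: units_of_carrier phi_Units)
  moreover have "\<phi> u ^ t \<in> Units center_ring" using K1_unit_power[OF phi_Units[OF u]] by blast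
  ultimately have "K1_unit (\<phi> v) \<otimes>\<^bsub>A_bar\<^esub> K1_unit (\<phi> u ^ t) = \<one>\<^bsub>A_bar\<^esub>"
    "K1_unit (\<phi> v) \<in> carrier A_bar" "K1_unit (\<phi> u ^ t) \<in> carrier A_bar"
    by (simp_all add: A_bar_simps K1_unit_mult[symmetric] K1_unit_one)
  then show ?thesis unfolding v_def[symmetric] by (metis A.inv_equality)
qed

lemma s_bar_eq:
  "s_bar \<phi> m (- int t) = - (\<Sum>J\<in>nonempty_subsets m. frag_cmul ((-1) ^ card J) (frag_of (inv\<^bsub>A_bar\<^esub> K1_unit (\<phi> (R_X m J) ^ t))))"
proof -
  have "finite (nonempty_subsets m)"
    by (rule finite_subset[of _ "Pow {1..m}"]) (auto simp: nonempty_subsets_def)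
  then have "s_bar \<phi> m (- int t) = - (\<Sum>J\<in>nonempty_subsets m. frag_cmul ((-1) ^ card J)
      (frag_of (K1_unit (\<phi> (R_X m J [^]\<^bsub>units_of P.LR\<^esub> (- int t))))))"
    by (simp add: s_bar_def s_elt_def R_ring_def frag_extend_minus frag_extend_sum frag_extend_cmul comp_def)
  also have "\<dots> = - (\<Sum>J\<in>nonempty_subsets m. frag_cmul ((-1) ^ card J) (frag_of (inv\<^bsub>A_bar\<^esub> K1_unit (\<phi> (R_X m J) ^ t))))"
    by (intro arg_cong[of _ _ uminus] sum.cong refl) (simp only: K1_unit_phi_power[OF R_X_Units])
  finally show ?thesis .
qed

end

theorem corollary2p5:
  fixes \<phi> :: "Rm_elt \<Rightarrow> 'a::{ring,monoid_mult}" and m t q p :: nat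
  assumes "m \<ge> 1" and "R_algebra m \<phi>"
    and "t \<ge> 1" and "q \<ge> 1" and "q dvd t"
  shows "chain_map (cplx_SG q) (cplx_G \<phi> m (int t) q) (SG_to_G \<phi> m (int t)) \<and>
         chain_map (cplx_G \<phi> m (int t) q) (cplx_Aff \<phi> m (int t) p q) (G_to_Aff \<phi> m (int t) p q) \<and>
         (\<forall>r::nat. real r < real m * real q / real t \<longrightarrow>
            homology_iso (cplx_SG q) (cplx_G \<phi> m (int t) q) (SG_to_G \<phi> m (int t)) r \<and>
            homology_iso (cplx_G \<phi> m (int t) q) (cplx_Aff \<phi> m (int t) p q)
              (G_to_Aff \<phi> m (int t) p q) r)"
proof -
  obtain d where t: "t = q * d" using assms(5) by (rule dvdE)
  have d: "1 \<le> d" using assms(3) t by (cases d) auto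
  interpret Rm: Rm_algebra m \<phi> by (rule Rm_algebra.intro[OF assms(2)])
  define x where "x j = \<phi> (R_X m {j})" for j
  have x: "(\<Sum>j\<in>J. x j) = \<phi> (R_X m J)" if "J \<in> nonempty_subsets m" for J
    unfolding x_def by (rule Rm.phi_R_X[OF that, symmetric])
  interpret S: scalar_sums m d q p x
    by (rule scalar_sums.intro[OF assms(1) d assms(4)]) (simp only: x Rm.phi_Units Rm.R_X_Units)
  have "K1_det (scal q (S.c J)) = K1_unit (\<phi> (R_X m J) ^ t)" if J: "J \<in> nonempty_subsets m" for J
    unfolding K1_det_scal_unit[OF S.c_unit[OF J]] unfolding S.c_def x[OF J] t power_mult[symmetric] mult.commute[of d] ..
  then have s: "s_bar \<phi> m (- int t) = S.s"
    unfolding Rm.s_bar_eq S.s_def by (intro arg_cong[of _ _ uminus] sum.cong refl) (simp only:)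
  have Lam: "Lambda \<phi> m (int t) = localization (group_ring A_bar) {S.s}"
    by (simp only: Lambda_def s)
  \<comment> \<open>The action depends on a matrix through \<open>K1_det\<close> alone, so one
    function serves for G_q and for the affine group.\<close>
  have act: "Lambda_act \<phi> m (int t) = S.G.lact" "Lambda_act \<phi> m (int t) = S.E.lact"
    by (intro ext; simp only: Lambda_act_def Lam S.G.lact_def S.E.lact_def s)+
  have i2L: "int_to_Lambda \<phi> m (int t) = S.Sh.i2L"
    by (intro ext) (simp only: int_to_Lambda_def S.Sh.i2L_def Lam)
  \<comment> \<open>r < m q / t reads r t < m q, and with t = q d the factor q cancels.\<close>
  have rd: "r * d < m" if "real r < real m * real q / real t" for r
  proof -
    have "0 < real t" using assms(3) by simp
    then have "real r * real t < real m * real q" using that by (simp only: pos_less_divide_eq)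
    then have "r * t < m * q" by (simp only: of_nat_mult[symmetric] of_nat_less_iff)
    then have "r * d * q < m * q" by (simp only: t ac_simps)
    then show ?thesis by (simp only: mult_less_cancel2)
  qed
  have SG: "chain_map (cplx_SG q) (cplx_G \<phi> m (int t) q) (SG_to_G \<phi> m (int t))"
    unfolding cplx_SG_def cplx_G_def SG_to_G_def SG_kernel Lam act(1) i2L by (rule S.Sh.Mp.chain_map_bar)
  have Aff: "chain_map (cplx_G \<phi> m (int t) q) (cplx_Aff \<phi> m (int t) p q) (G_to_Aff \<phi> m (int t) p q)"
    using S.Re.I.chain_map_bar
    unfolding cplx_G_def cplx_Aff_def G_to_Aff_def Lam act(1)[symmetric] unfolding act(2) .
  have iso_SG: "homology_iso (cplx_SG q) (cplx_G \<phi> m (int t) q) (SG_to_G \<phi> m (int t)) r" for r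
    unfolding cplx_SG_def cplx_G_def SG_to_G_def SG_kernel Lam act(1) i2L by (rule S.Sh.kernel_homology_iso)
  have iso_Aff: "homology_iso (cplx_G \<phi> m (int t) q) (cplx_Aff \<phi> m (int t) p q) (G_to_Aff \<phi> m (int t) p q) r"
    if "r * d < m" for r
    using S.Re.retract_homology_iso[OF S.Aff_homologous[OF _ that]]
    unfolding cplx_G_def cplx_Aff_def G_to_Aff_def Lam act(1)[symmetric] unfolding act(2) .
  show ?thesis using SG Aff iso_SG iso_Aff rd by blast
qed

end
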